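(* Let $E=\mathbb R^d$ or $\mathbb Z^d$ and let $(X,\mathcal B,P)$ be a translation invariant determinantal random point field in $E$. Then the dynamical system $(X,\mathcal B,P,\{T^t\}_{t\in E})$ is ergodic, has the mixing property of any multiplicity $r\ge1$, and its spectrum is absolutely continuous.
   Context: Random point fields. $X$ is the space of locally finite configurations $\xi=(x_i)$ of particles in $E$; $\#_B(\xi)=\#\{i:x_i\in B\}$; $\mathcal B$ is the $\sigma$-algebra generated by the sets $\{\#_B=n\}$, $B\subset E$ bounded Borel, $n\ge0$; $P$ is a probability measure on $(X,\mathcal B)$. The $k$-point correlation function $\rho_k:E^k\to[0,\infty)$ is the locally integrable function such that for all disjoint bounded Borel $A_1,\dots,A_m$ and non-negative integers $k_i$ with $\sum k_i=k$, $\mathbb E\prod_i\frac{(\#_{A_i})!}{(\#_{A_i}-k_i)!}=\int_{A_1^{k_1}\times\dots\times A_m^{k_m}}\rho_k\,dx_1\cdots dx_k$ (Lebesgue measure on $\mathbb R^d$, counting measure on $\mathbb Z^d$). Determinantal fields. The field is determinantal with kernel $K$ if $\rho_n(x_1,\dots,x_n)=\det(K(x_i,x_j))_{1\le i,j\le n}$ for all $n\ge1$, where $K$ is a self-adjoint operator on $L^2(E)$, $0\le K\le\mathrm{Id}$, locally trace class ($\chi_BK\chi_B$ is trace class for every bounded Borel $B$), with integral kernel chosen (for $E=\mathbb R^d$) so that for every bounded measurable $B$ the function $y\mapsto K(\cdot,\cdot+y)\chi_B(\cdot+y)$ is continuous with values in $L^1(B)$ and $\mathrm{Tr}(\chi_BK\chi_B)=\int_BK(x,x)dx$.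 Dynamics. $T^t:X\to X$, $t\in E$, shifts every particle by $t$: $(T^t\xi)_i=x_i+t$. The field is translation invariant if $P(T^{-t}A)=P(A)$ for all $A\in\mathcal B$, $t\in E$. Ergodic: every $\{T^t\}$-invariant set $A$ has $P(A)\in\{0,1\}$. Mixing property of multiplicity $r\ge1$: for all $f_0,\dots,f_r\in L^{r+1}(X,\mathcal B,P)$, $$\lim_{t_1,\dots,t_r\to\infty}\int_Xf_0(\xi)f_1(T^{t_1}\xi)\cdots f_r(T^{t_1+\dots+t_r}\xi)\,dP=\prod_{i=0}^r\int_Xf_i(\xi)\,dP.$$ Absolutely continuous spectrum: for every $f\in L^2(X,\mathcal B,P)$ orthogonal to constants, $\int_Xf(\xi)\overline{f(T^t\xi)}\,dP=\int e^{i(t\cdot\lambda)}h_f(\lambda)\,d\lambda$ for all $t\in E$, where the integral on the right is over $\mathbb R^d$ if $E=\mathbb R^d$ and over $[0,2\pi]^d$ if $E=\mathbb Z^d$, and $h_f(\lambda)\,d\lambda$ is a finite measure absolutely continuous with respect to Lebesgue measure.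
   Formalization: The limit t_1,…,t_r→∞ in the mixing property is taken with all consecutive sums t_i+…+t_j tending to infinity in norm; if only each |t_i|→∞, the claim fails for r≥2 (Bernoulli field on Z, t_2=−t_1). *)

theory Defs
  imports "HOL-Probability.Probability" "Jordan_Normal_Form.Determinant"
begin

text \<open>
  Throughout, a measure \<open>M\<close> on \<open>real ^ 'd\<close> stands for the one-particle space \<open>E\<close> together with its
  reference measure: \<open>E\<close> is \<open>space M\<close>, and \<open>M\<close> is \<open>lborel\<close> for the Euclidean space and counting
  measure on the integer lattice for the discrete case.
\<close>

definition int_lattice :: "(real ^ 'd) set" where
  "int_lattice = {x. \<forall>i. vec_nth x i \<in> \<int>}"

definition bounded_sets :: "'a::metric_space measure \<Rightarrow> 'a set set" where
  "bounded_sets M = {B \<in> sets M. bounded B}"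


section \<open>Random point fields\<close>

text \<open>
  A configuration is encoded by its multiplicity function: \<open>\<xi> x\<close> is the number of particles located
  at \<open>x\<close>. Multiple particles at one point are allowed.
\<close>

definition configurations :: "'a::metric_space set \<Rightarrow> ('a \<Rightarrow> nat) set" where
  "configurations E =
     {\<xi>. (\<forall>x. x \<notin> E \<longrightarrow> \<xi> x = 0) \<and> (\<forall>B. bounded B \<longrightarrow> finite {x \<in> B. \<xi> x \<noteq> 0})}"

definition num_particles :: "'a set \<Rightarrow> ('a \<Rightarrow> nat) \<Rightarrow> nat" where
  "num_particles B \<xi> = (\<Sum>x | x \<in> B \<and> \<xi> x \<noteq> 0. \<xi> x)"

definition configuration_algebra :: "'a::metric_space measure \<Rightarrow> ('a \<Rightarrow> nat) measure" where
  "configuration_algebra M = sigma (configurations (space M))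
     {{\<xi> \<in> configurations (space M). num_particles B \<xi> = n} | B n. B \<in> bounded_sets M}"

definition random_point_field :: "'a::metric_space measure \<Rightarrow> ('a \<Rightarrow> nat) measure \<Rightarrow> bool" where
  "random_point_field M P \<longleftrightarrow> prob_space P \<and> sets P = sets (configuration_algebra M)"

text \<open>\<open>n! / (n - k)!\<close>, which is \<open>0\<close> for \<open>k > n\<close> (truncated subtraction would give \<open>n!\<close>).\<close>

definition falling :: "nat \<Rightarrow> nat \<Rightarrow> nat" where
  "falling n k = (if k \<le> n then fact n div fact (n - k) else 0)"

text \<open>\<open>A\<^sub>0\<^bsup>k\<^sub>0\<^esup> \<times> A\<^sub>1\<^bsup>k\<^sub>1\<^esup> \<times> \<dots> \<times> A\<^bsub>m-1\<^esub>\<^bsup>k\<^bsub>m-1\<^esub>\<^esup>\<close>; \<open>n\<close> is meant to be the sum of the exponents.\<close>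

definition power_box :: "nat \<Rightarrow> nat \<Rightarrow> (nat \<Rightarrow> 'a set) \<Rightarrow> (nat \<Rightarrow> nat) \<Rightarrow> (nat \<Rightarrow> 'a) set" where
  "power_box n m A k =
     (\<Pi>\<^sub>E j\<in>{..<n}. concat (map (\<lambda>i. replicate (k i) (A i)) [0..<m]) ! j)"

definition correlation_function ::
    "'a::metric_space measure \<Rightarrow> ('a \<Rightarrow> nat) measure \<Rightarrow> nat \<Rightarrow> ((nat \<Rightarrow> 'a) \<Rightarrow> real) \<Rightarrow> bool" where
  "correlation_function M P n \<rho> \<longleftrightarrow>
     \<rho> \<in> borel_measurable (PiM {..<n} (\<lambda>_. M)) \<and>
     (\<forall>x \<in> space (PiM {..<n} (\<lambda>_. M)). 0 \<le> \<rho> x) \<and>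
     (\<forall>B \<in> bounded_sets M. set_integrable (PiM {..<n} (\<lambda>_. M)) (\<Pi>\<^sub>E j\<in>{..<n}. B) \<rho>) \<and>
     (\<forall>m A k. (\<forall>i<m. A i \<in> bounded_sets M) \<and> disjoint_family_on A {..<m} \<and> (\<Sum>i<m. k i) = n \<longrightarrow>
        (\<integral>\<^sup>+\<xi>. of_nat (\<Prod>i<m. falling (num_particles (A i) \<xi>) (k i)) \<partial>P) =
        (\<integral>\<^sup>+x\<in>power_box n m A k. ennreal (\<rho> x) \<partial>PiM {..<n} (\<lambda>_. M)))"


section \<open>Operators on the complex Hilbert space of square integrable functions\<close>

text \<open>Elements of the Hilbert space are represented by functions, up to equality almost everywhere.\<close>

definition L2 :: "'b measure \<Rightarrow> ('b \<Rightarrow> complex) set" where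
  "L2 M = {f \<in> borel_measurable M. integrable M (\<lambda>x. (cmod (f x))\<^sup>2)}"

definition L2_inner :: "'b measure \<Rightarrow> ('b \<Rightarrow> complex) \<Rightarrow> ('b \<Rightarrow> complex) \<Rightarrow> complex" where
  "L2_inner M f g = (\<integral>x. f x * cnj (g x) \<partial>M)"

type_synonym 'b op = "('b \<Rightarrow> complex) \<Rightarrow> ('b \<Rightarrow> complex)"

text \<open>
  Bounded linear operators. Linearity and boundedness together imply that equivalence of functions
  modulo null sets is respected.
\<close>

definition L2_operator :: "'b measure \<Rightarrow> 'b op \<Rightarrow> bool" where
  "L2_operator M T \<longleftrightarrow>
     (\<forall>f \<in> L2 M. T f \<in> L2 M) \<and>
     (\<forall>f \<in> L2 M. \<forall>g \<in> L2 M. \<forall>a b.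
        AE x in M. T (\<lambda>y. a * f y + b * g y) x = a * T f x + b * T g x) \<and>
     (\<exists>C. \<forall>f \<in> L2 M. (\<integral>x. (cmod (T f x))\<^sup>2 \<partial>M) \<le> C * (\<integral>x. (cmod (f x))\<^sup>2 \<partial>M))"

definition L2_self_adjoint :: "'b measure \<Rightarrow> 'b op \<Rightarrow> bool" where
  "L2_self_adjoint M T \<longleftrightarrow> (\<forall>f \<in> L2 M. \<forall>g \<in> L2 M. L2_inner M (T f) g = L2_inner M f (T g))"

text \<open>The order \<open>S \<le> T\<close> of self-adjoint operators, whose quadratic forms are real.\<close>

definition L2_le :: "'b measure \<Rightarrow> 'b op \<Rightarrow> 'b op \<Rightarrow> bool" where
  "L2_le M S T \<longleftrightarrow> (\<forall>f \<in> L2 M. Re (L2_inner M (S f) f) \<le> Re (L2_inner M (T f) f))"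

definition zero_op :: "'b op" where "zero_op f = (\<lambda>_. 0)"

definition id_op :: "'b op" where "id_op f = f"

text \<open>
  Orthonormal bases are indexed by the natural numbers: all Hilbert spaces to which this is applied
  are separable and of infinite dimension.
\<close>

definition orthonormal_basis :: "'b measure \<Rightarrow> (nat \<Rightarrow> 'b \<Rightarrow> complex) \<Rightarrow> bool" where
  "orthonormal_basis M e \<longleftrightarrow>
     (\<forall>n. e n \<in> L2 M) \<and>
     (\<forall>m n. L2_inner M (e m) (e n) = (if m = n then 1 else 0)) \<and>
     (\<forall>f \<in> L2 M. (\<forall>n. L2_inner M f (e n) = 0) \<longrightarrow> (AE x in M. f x = 0))"

text \<open>
  \<open>A\<close> is the absolute value of \<open>T\<close>, that is, the positive square root of \<open>T\<^sup>* T\<close>: the last conjunct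
  says \<open>A\<^sup>2 = T\<^sup>* T\<close>.
\<close>

definition L2_absolute_value :: "'b measure \<Rightarrow> 'b op \<Rightarrow> 'b op \<Rightarrow> bool" where
  "L2_absolute_value M T A \<longleftrightarrow>
     L2_operator M A \<and> L2_self_adjoint M A \<and> L2_le M zero_op A \<and>
     (\<forall>f \<in> L2 M. \<forall>g \<in> L2 M. L2_inner M (A f) (A g) = L2_inner M (T f) (T g))"

definition trace_class :: "'b measure \<Rightarrow> 'b op \<Rightarrow> bool" where
  "trace_class M T \<longleftrightarrow> L2_operator M T \<and>
     (\<exists>A e. L2_absolute_value M T A \<and> orthonormal_basis M e \<and>
            summable (\<lambda>n. Re (L2_inner M (A (e n)) (e n))))"

definition has_trace :: "'b measure \<Rightarrow> 'b op \<Rightarrow> complex \<Rightarrow> bool" where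
  "has_trace M T c \<longleftrightarrow> trace_class M T \<and>
     (\<forall>e. orthonormal_basis M e \<longrightarrow> (\<lambda>n. L2_inner M (T (e n)) (e n)) sums c)"

text \<open>The operator \<open>\<chi>\<^sub>B T \<chi>\<^sub>B\<close>.\<close>

definition compression :: "'b set \<Rightarrow> 'b op \<Rightarrow> 'b op" where
  "compression B T f = (\<lambda>x. indicator B x * T (\<lambda>y. indicator B y * f y) x)"

definition locally_trace_class :: "'a::metric_space measure \<Rightarrow> 'a op \<Rightarrow> bool" where
  "locally_trace_class M T \<longleftrightarrow> (\<forall>B \<in> bounded_sets M. trace_class M (compression B T))"

definition integral_kernel :: "'b measure \<Rightarrow> 'b op \<Rightarrow> ('b \<Rightarrow> 'b \<Rightarrow> complex) \<Rightarrow> bool" where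
  "integral_kernel M T K \<longleftrightarrow>
     case_prod K \<in> borel_measurable (M \<Otimes>\<^sub>M M) \<and>
     (\<forall>f \<in> L2 M. AE x in M. integrable M (\<lambda>y. K x y * f y) \<and> T f x = (\<integral>y. K x y * f y \<partial>M))"


section \<open>Determinantal fields\<close>

text \<open>
  The choice of the integral kernel in the Euclidean case: \<open>y \<mapsto> K(\<cdot>,\<cdot>+y) \<chi>\<^sub>B(\<cdot>+y)\<close> is a continuous
  map into \<open>L\<^sup>1(B)\<close>, and \<open>Tr(\<chi>\<^sub>B T \<chi>\<^sub>B)\<close> is the integral of \<open>K\<close> over the diagonal of \<open>B\<close>.
\<close>

definition regular_kernel ::
    "(real ^ 'd) op \<Rightarrow> (real ^ 'd \<Rightarrow> real ^ 'd \<Rightarrow> complex) \<Rightarrow> bool" where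
  "regular_kernel T K \<longleftrightarrow>
     (\<forall>B \<in> bounded_sets lborel.
        (let F = (\<lambda>y x. K x (x + y) * indicator B (x + y)) in
           (\<forall>y. set_integrable lborel B (F y)) \<and>
           (\<forall>y. ((\<lambda>z. LINT x:B|lborel. cmod (F z x - F y x)) \<longlongrightarrow> 0) (at y))) \<and>
        has_trace lborel (compression B T) (LINT x:B|lborel. K x x))"

definition determinantal_kernel ::
    "(real ^ 'd) measure \<Rightarrow> (real ^ 'd \<Rightarrow> real ^ 'd \<Rightarrow> complex) \<Rightarrow> bool" where
  "determinantal_kernel M K \<longleftrightarrow>
     (\<exists>T. L2_operator M T \<and> L2_self_adjoint M T \<and> L2_le M zero_op T \<and> L2_le M T id_op \<and>
          locally_trace_class M T \<and> integral_kernel M T K \<and>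
          (M = lborel \<longrightarrow> regular_kernel T K))"

text \<open>
  Correlation functions are determined only up to null sets, so the determinantal formula is
  required almost everywhere; on the lattice this means everywhere.
\<close>

definition determinantal_field ::
    "(real ^ 'd) measure \<Rightarrow> (real ^ 'd \<Rightarrow> nat) measure \<Rightarrow> (real ^ 'd \<Rightarrow> real ^ 'd \<Rightarrow> complex) \<Rightarrow> bool"
  where
  "determinantal_field M P K \<longleftrightarrow>
     random_point_field M P \<and> determinantal_kernel M K \<and>
     (\<forall>n\<ge>1. \<exists>\<rho>. correlation_function M P n \<rho> \<and>
        (AE x in PiM {..<n} (\<lambda>_. M).
           complex_of_real (\<rho> x) = Determinant.det (Matrix.mat n n (\<lambda>(i, j). K (x i) (x j)))))"


section \<open>The dynamical system of translations\<close>

definition shift :: "'a::ab_group_add \<Rightarrow> ('a \<Rightarrow> nat) \<Rightarrow> ('a \<Rightarrow> nat)" where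
  "shift t \<xi> = (\<lambda>x. \<xi> (x - t))"

definition translation_invariant ::
    "'a::ab_group_add measure \<Rightarrow> ('a \<Rightarrow> nat) measure \<Rightarrow> bool" where
  "translation_invariant M P \<longleftrightarrow>
     (\<forall>A \<in> sets P. \<forall>t \<in> space M. measure P (shift (- t) ` A) = measure P A)"

definition ergodic_field :: "'a::ab_group_add measure \<Rightarrow> ('a \<Rightarrow> nat) measure \<Rightarrow> bool" where
  "ergodic_field M P \<longleftrightarrow>
     (\<forall>A \<in> sets P. (\<forall>t \<in> space M. shift t ` A = A) \<longrightarrow> measure P A \<in> {0, 1})"

text \<open>
  The filter for the limit \<open>t\<^sub>1, \<dots>, t\<^sub>r \<rightarrow> \<infinity>\<close> in \<open>E\<close>. The observables are evaluated at the times
  \<open>0, t\<^sub>1, t\<^sub>1 + t\<^sub>2, \<dots>, t\<^sub>1 + \<dots> + t\<^sub>r\<close>, and the limit means that all mutual distances of these times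
  tend to infinity. If only the norm of each \<open>t\<^sub>i\<close> went to infinity, increments could cancel
  (\<open>t\<^sub>2 = - t\<^sub>1\<close>) and no nontrivial system would be mixing of multiplicity 2. The limit along
  increments all of whose coordinates tend to \<open>+\<infinity>\<close> is a special case, see below.
\<close>

definition increments_to_infinity ::
    "'a::real_normed_vector set \<Rightarrow> nat \<Rightarrow> (nat \<Rightarrow> 'a) filter" where
  "increments_to_infinity E r =
     (INF R::real. principal {t. (\<forall>i\<in>{1..r}. t i \<in> E) \<and>
        (\<forall>i\<in>{1..r}. \<forall>j\<in>{i..r}. R \<le> norm (\<Sum>l=i..j. t l))})"

lemma filterlim_increments_to_infinity:
  fixes t :: "'b \<Rightarrow> nat \<Rightarrow> real ^ 'd"
  assumes E: "\<And>i. i \<in> {1..r} \<Longrightarrow> \<forall>\<^sub>F b in F. t b i \<in> E"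
    and top: "\<And>i c. i \<in> {1..r} \<Longrightarrow> filterlim (\<lambda>b. vec_nth (t b i) c) at_top F"
  shows "filterlim t (increments_to_infinity E r) F"
  unfolding increments_to_infinity_def filterlim_INF filterlim_principal
proof
  fix R :: real
  obtain c :: 'd where True by simp
  have 1: "\<forall>\<^sub>F b in F. \<forall>i\<in>{1..r}. t b i \<in> E"
    by (intro eventually_ball_finite) (use E in auto)
  have 2: "\<forall>\<^sub>F b in F. \<forall>i\<in>{1..r}. max 0 R \<le> vec_nth (t b i) c"
    by (intro eventually_ball_finite)
      (use top in \<open>auto simp: filterlim_at_top simp del: max.bounded_iff\<close>)
  show "\<forall>\<^sub>F b in F. t b \<in> {t. (\<forall>i\<in>{1..r}. t i \<in> E) \<and>
        (\<forall>i\<in>{1..r}. \<forall>j\<in>{i..r}. R \<le> norm (\<Sum>l=i..j. t l))}"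
    using 1 2
  proof eventually_elim
    case (elim b)
    have "R \<le> norm (\<Sum>l=i..j. t b l)" if "i \<in> {1..r}" "j \<in> {i..r}" for i j
    proof -
      have "R \<le> vec_nth (t b i) c" using elim that by auto
      also have "\<dots> \<le> (\<Sum>l=i..j. vec_nth (t b l) c)"
        by (rule member_le_sum) (use elim that in auto)
      also have "\<dots> = vec_nth (\<Sum>l=i..j. t b l) c" by simp
      also have "\<dots> \<le> norm (\<Sum>l=i..j. t b l)"
        using component_le_norm_cart[of "\<Sum>l=i..j. t b l" c] by linarith
      finally show ?thesis .
    qed
    with elim show ?case by auto
  qed
qed

definition mixing_of_multiplicity ::
    "'a::real_normed_vector measure \<Rightarrow> ('a \<Rightarrow> nat) measure \<Rightarrow> nat \<Rightarrow> bool" where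
  "mixing_of_multiplicity M P r \<longleftrightarrow>
     (\<forall>f :: nat \<Rightarrow> ('a \<Rightarrow> nat) \<Rightarrow> complex.
        (\<forall>i\<le>r. f i \<in> borel_measurable P \<and> integrable P (\<lambda>\<xi>. cmod (f i \<xi>) ^ (r + 1))) \<longrightarrow>
        ((\<lambda>t. \<integral>\<xi>. (\<Prod>i\<le>r. f i (shift (\<Sum>l=1..i. t l) \<xi>)) \<partial>P)
           \<longlongrightarrow> (\<Prod>i\<le>r. \<integral>\<xi>. f i \<xi> \<partial>P)) (increments_to_infinity (space M) r))"

text \<open>\<open>\<Lambda>\<close> is the domain of the spectral variable.\<close>

definition absolutely_continuous_spectrum ::
    "'a::euclidean_space measure \<Rightarrow> 'a set \<Rightarrow> ('a \<Rightarrow> nat) measure \<Rightarrow> bool" where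
  "absolutely_continuous_spectrum M \<Lambda> P \<longleftrightarrow>
     (\<forall>f \<in> L2 P. (\<integral>\<xi>. f \<xi> \<partial>P) = 0 \<longrightarrow>
        (\<exists>h :: 'a \<Rightarrow> real. (\<forall>l\<in>\<Lambda>. 0 \<le> h l) \<and> set_integrable lborel \<Lambda> h \<and>
           (\<forall>t \<in> space M. (\<integral>\<xi>. f \<xi> * cnj (f (shift t \<xi>)) \<partial>P) =
              (LINT l:\<Lambda>|lborel. exp (\<i> * complex_of_real (inner t l)) * complex_of_real (h l)))))"

end

theory Submission
  imports Defs
begin

text \<open>
  Products of falling factorials of the counts of disjoint sets (factorial monomials) have expectations
  given by the determinants. The off-block terms of a determinant bound the covariance of two factorial
  monomials with disjoint supports \<open>S\<close> and \<open>S'\<close> by a constant times the integral \<open>W S S'\<close> of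
  \<open>|K x y|\<^sup>2\<close> over \<open>S \<times> S'\<close>. That the number of particles in large boxes has non-negative variance
  forces \<open>W S E\<close> to be finite, hence \<open>W S (S' - t)\<close> tends to \<open>0\<close> as \<open>t \<rightarrow> \<infinity>\<close> and is integrable in
  \<open>t\<close>. The first fact is mixing for factorial monomials, whose span is dense in every \<open>L\<^sup>p\<close> because the
  counts have exponential moments; ergodicity follows by mixing an invariant event with itself. The
  second fact makes the autocovariance of an element of the span an integrable positive definite
  function, so Fourier inversion gives it a non-negative spectral density. These densities depend on
  the observable continuously from \<open>L\<^sup>2\<close> to \<open>L\<^sup>1\<close>, and density of the span gives the general case.
\<close>

text \<open>The field is invariant, but \<open>K\<close> need not be: multiplying
  \<open>K x y\<close> by \<open>u x * cnj (u y)\<close> with \<open>cmod (u x) = 1\<close> changes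
  no determinant. Invariance is therefore read off from moments. First and second factorial moments
  give it for \<open>mu\<close>, and for \<open>W\<close> on two disjoint sets or on a set paired
  with itself; unit cells at lattice points are always in one of these two positions, which is why
  the sums run over cells. Sign information comes from the correlation functions: a principal minor
  of the matrix \<open>K (x i) (x j)\<close> is a lower correlation function at a selection of the
  points, hence non-negative almost everywhere. With Hermitian symmetry this gives the
  Cauchy-Schwarz bound for \<open>K\<close> behind the covariance estimate, and Hadamard's
  inequality, the source of the exponential moments. Each such fact holds off a null set of some
  power of the space and has to be carried to larger powers. In the Euclidean case inversion must
  hold at each \<open>t\<close>, so autocovariances have to be continuous; integrability of the
  density is extracted from its sign.\<close>

no_notation Matrix.vec_index (infixl "$" 100)

abbreviation (input) lborel2 :: "('a::euclidean_space \<times> 'a) measure" where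
  "lborel2 \<equiv> lborel \<Otimes>\<^sub>M lborel"

type_synonym 'd config = "real ^ 'd \<Rightarrow> nat"

abbreviation (input) mdet :: "nat \<Rightarrow> (nat \<Rightarrow> nat \<Rightarrow> 'a::comm_ring_1) \<Rightarrow> 'a" where
  "mdet n B \<equiv> Determinant.det (Matrix.mat n n (\<lambda>(i, j). B i j))"

section \<open>Determinants: Hadamard's inequality and the off-block terms\<close>

lemma det_block_lower:
  fixes B :: "nat \<Rightarrow> nat \<Rightarrow> 'a::idom"
  assumes zero: "\<And>i j. i < n1 \<Longrightarrow> n1 \<le> j \<Longrightarrow> j < n1 + n2 \<Longrightarrow> B i j = 0"
  shows "mdet (n1 + n2) (\<lambda>i j. B i j) =
    mdet n1 (\<lambda>i j. B i j) *
    mdet n2 (\<lambda>i j. B (i + n1) (j + n1))"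
proof -
  have "Matrix.mat (n1 + n2) (n1 + n2) (\<lambda>(i, j). B i j) =
    four_block_mat (Matrix.mat n1 n1 (\<lambda>(i, j). B i j)) (0\<^sub>m n1 n2)
      (Matrix.mat n2 n1 (\<lambda>(i, j). B (i + n1) j)) (Matrix.mat n2 n2 (\<lambda>(i, j). B (i + n1) (j + n1)))"
    using zero by (intro eq_matI) auto
  then show ?thesis
    by (simp add: det_four_block_mat_upper_right_zero[OF mat_carrier refl mat_carrier mat_carrier])
qed

text \<open>One elimination step with the last diagonal entry as pivot. Taking the last entry rather
  than the first leaves the remaining indices unshifted.\<close>

lemma det_schur_complement:
  fixes B :: "nat \<Rightarrow> nat \<Rightarrow> 'a::field"
  assumes a: "B m m \<noteq> 0"
  shows "mdet (Suc m) (\<lambda>i j. B i j) =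
    B m m * mdet m (\<lambda>i j. B i j - B i m * B m j / B m m)"
proof -
  \<comment> \<open>\<open>?U\<close> is unit upper triangular and records the multipliers of the
    elimination; \<open>?L\<close> is what remains, with a last column that vanishes above the
    pivot.\<close>
  let ?U = "\<lambda>i j. if i = j then 1 else if j = m then B i m / B m m else 0"
  let ?L = "\<lambda>i j. if j = m then (if i = m then B m m else 0)
    else if i = m then B m j else B i j - B i m * B m j / B m m"
  have "Matrix.mat (Suc m) (Suc m) (\<lambda>(i, j). B i j) =
    Matrix.mat (Suc m) (Suc m) (\<lambda>(i, j). ?U i j) * Matrix.mat (Suc m) (Suc m) (\<lambda>(i, j). ?L i j)"
  proof (intro eq_matI)
    fix i j assume "i < dim_row (Matrix.mat (Suc m) (Suc m) (\<lambda>(i, j). ?U i j) * Matrix.mat (Suc m) (Suc m) (\<lambda>(i, j). ?L i j))"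
      "j < dim_col (Matrix.mat (Suc m) (Suc m) (\<lambda>(i, j). ?U i j) * Matrix.mat (Suc m) (Suc m) (\<lambda>(i, j). ?L i j))"
    then have ij: "i < Suc m" "j < Suc m" by auto
    have "(Matrix.mat (Suc m) (Suc m) (\<lambda>(i, j). ?U i j) * Matrix.mat (Suc m) (Suc m) (\<lambda>(i, j). ?L i j)) $$ (i, j)
      = (\<Sum>k<Suc m. ?U i k * ?L k j)"
      using ij by (simp add: times_mat_def scalar_prod_def atLeast0LessThan)
    also have "\<dots> = B i j"
    proof (cases "i = m")
      case True
      have "(\<Sum>k<Suc m. ?U i k * ?L k j) = (\<Sum>k<Suc m. if k = m then ?L m j else 0)"
        using True by (intro sum.cong) auto
      then show ?thesis using True by simp
    next
      case False
      have "(\<Sum>k<Suc m. ?U i k * ?L k j) =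
        (\<Sum>k<Suc m. (if k = i then ?L i j else 0) + (if k = m then B i m / B m m * ?L m j else 0))"
        using False by (intro sum.cong) auto
      also have "\<dots> = ?L i j + B i m / B m m * ?L m j"
        using ij by (simp add: sum.distrib)
      also have "\<dots> = B i j" using a False by (cases "j = m") auto
      finally show ?thesis .
    qed
    finally show "Matrix.mat (Suc m) (Suc m) (\<lambda>(i, j). B i j) $$ (i, j) =
      (Matrix.mat (Suc m) (Suc m) (\<lambda>(i, j). ?U i j) * Matrix.mat (Suc m) (Suc m) (\<lambda>(i, j). ?L i j)) $$ (i, j)"
      using ij by simp
  qed auto
  then have "mdet (Suc m) (\<lambda>i j. B i j) =
    mdet (Suc m) (\<lambda>i j. ?U i j) *
    mdet (Suc m) (\<lambda>i j. ?L i j)"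
    by (simp add: Determinant.det_mult[of _ "Suc m"])
  also have "mdet (Suc m) (\<lambda>i j. ?U i j) = 1"
    by (subst Determinant.det_upper_triangular[of _ "Suc m"])
      (auto intro!: upper_triangularI simp: prod_list_diag_prod)
  also have "mdet (Suc m) (\<lambda>i j. ?L i j) =
    mdet m (\<lambda>i j. ?L i j) *
    mdet 1 (\<lambda>i j. ?L (i + m) (j + m))"
    using det_block_lower[of m 1 ?L] by simp
  also have "mdet 1 (\<lambda>i j. ?L (i + m) (j + m)) = B m m"
    by (subst Determinant.det_single[of _]) auto
  also have "Matrix.mat m m (\<lambda>(i, j). ?L i j) = Matrix.mat m m (\<lambda>(i, j). B i j - B i m * B m j / B m m)"
    by (intro eq_matI) auto
  finally show ?thesis by simp
qed

text \<open>Rows are selected by a map instead of an index set, so that bordering a minor by one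
  more row and column is a function update.\<close>

definition minor :: "(nat \<Rightarrow> nat \<Rightarrow> complex) \<Rightarrow> nat \<Rightarrow> (nat \<Rightarrow> nat) \<Rightarrow> complex" where
  "minor B m s = mdet m (\<lambda>i j. B (s i) (s j))"

lemma det_mat_1:
  "Determinant.det (Matrix.mat (Suc 0) (Suc 0) f) = f (0, 0 :: nat)"
  by (subst Determinant.det_single) auto

lemma det_mat_2:
  "mdet 2 (\<lambda>i j. B i j) = (B 0 0 * B 1 1 - B 0 1 * B 1 0 :: 'a::comm_ring_1)"
proof -
  let ?U = "\<lambda>i j. B i j"
  have perms: "{p. p permutes {0..<2::nat}} = {id, Transposition.transpose 0 1}"
    by (auto simp: atLeastLessThan_nat_numeral atLeast0_lessThan_Suc numeral_2_eq_2 permutes_doubleton_iff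
        insert_commute[of "Suc 0"])
  have ne: "id \<noteq> Transposition.transpose 0 (1::nat)"
    by (metis id_apply transpose_apply_first zero_neq_one)
  show ?thesis
    unfolding det_def'[OF mat_carrier] perms
    by (use ne in \<open>auto simp: perms sign_swap_id atLeast0_lessThan_Suc numeral_2_eq_2\<close>)
qed

text \<open>Non-negative principal minors are assumed instead of a positive quadratic form because
  minors are what correlation functions provide. The induction passes to the Schur complement of the
  last entry: its minors are bordered minors of \<open>B\<close> divided by the pivot, and its
  diagonal entries are no larger than those of \<open>B\<close>.\<close>

lemma hadamard_of_minors:
  assumes herm: "\<And>i j. i < n \<Longrightarrow> j < n \<Longrightarrow> B j i = cnj (B i j)"
    and minors: "\<And>m s. inj_on s {..<m} \<Longrightarrow> s ` {..<m} \<subseteq> {..<n} \<Longrightarrow> \<exists>r\<ge>0. minor B m s = complex_of_real r"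
  shows "Re (mdet n (\<lambda>i j. B i j)) \<le> (\<Prod>i<n. Re (B i i))"
  using assms
proof (induction n arbitrary: B)
  case 0
  then show ?case by simp
next
  case (Suc n)
  note herm = Suc.prems(1) and minors = Suc.prems(2)
  have diag: "\<exists>r\<ge>0. B i i = complex_of_real r" if "i < Suc n" for i
    using minors[of "\<lambda>_. i" 1] that by (auto simp: minor_def det_mat_1 inj_on_def)
  have diag': "Re (B i i) \<ge> 0" "B i i = complex_of_real (Re (B i i))" if "i < Suc n" for i
    using diag[OF that] by auto
  show ?case
  proof (cases "B n n = 0")
    case True
    \<comment> \<open>With pivot \<open>0\<close> the 2 by 2 minor on \<open>i\<close>,
      \<open>n\<close> equals minus the squared modulus of \<open>B i n\<close>, and its sign forces
      the last row and column to vanish. The determinant is then \<open>0\<close>.\<close>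
    have zero: "B n i = 0" "B i n = 0" if "i \<le> n" for i
    proof -
      have "B i n = 0"
      proof (cases "i = n")
        case False
        have "\<exists>r\<ge>0. minor B 2 (\<lambda>k. if k = 0 then i else n) = complex_of_real r"
          using that False by (intro minors) (auto simp: inj_on_def less_2_cases_iff)
        then obtain r where r: "r \<ge> 0" "- (B i n * B n i) = complex_of_real r"
          by (auto simp: minor_def det_mat_2 True cong: if_cong)
        have "B i n * B n i = complex_of_real ((cmod (B i n))\<^sup>2)"
          unfolding complex_norm_square using herm[of i n] that by simp
        then have "complex_of_real r = complex_of_real (- ((cmod (B i n))\<^sup>2))"
          using r(2) by (metis of_real_minus)
        then have "r = - ((cmod (B i n))\<^sup>2)"
          by (simp only: of_real_eq_iff)
        with r(1) have "(cmod (B i n))\<^sup>2 \<le> 0" by linarith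
        then show ?thesis by simp
      qed (use True in auto)
      with herm[of i n] that show "B n i = 0" "B i n = 0" by auto
    qed
    have "mdet (n + 1) (\<lambda>i j. B i j) =
      mdet n (\<lambda>i j. B i j) *
      mdet 1 (\<lambda>i j. B (i + n) (j + n))"
      by (rule det_block_lower) (use zero le_less_Suc_eq in \<open>auto simp: le_less_Suc_eq\<close>)
    then have "mdet (Suc n) (\<lambda>i j. B i j) = 0"
      using True by (simp add: det_mat_1)
    then show ?thesis using True by simp
  next
    case False
    define a where "a = Re (B n n)"
    have a: "B n n = complex_of_real a" "a > 0"
      using diag'[of n] False by (auto simp: a_def order_less_le)
    let ?C = "\<lambda>i j. B i j - B i n * B n j / B n n"
    \<comment> \<open>A minor of the Schur complement on \<open>s\<close>, multiplied by the pivot,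
      is the minor of \<open>B\<close> on \<open>s\<close> bordered by \<open>n\<close>.\<close>
    have minC: "\<exists>r\<ge>0. minor ?C m s = complex_of_real r"
      if s: "inj_on s {..<m}" "s ` {..<m} \<subseteq> {..<n}" for m s
    proof -
      let ?s = "s(m := n)"
      have inj: "inj_on ?s {..<Suc m}"
        using s by (force simp: inj_on_def less_Suc_eq image_subset_iff)
      have sub: "?s ` {..<Suc m} \<subseteq> {..<Suc n}"
        using s(2) by (auto simp: less_Suc_eq image_subset_iff)
      obtain r where r: "r \<ge> 0" "minor B (Suc m) ?s = complex_of_real r"
        using minors[OF inj sub] by blast
      have "minor B (Suc m) ?s = B n n * minor ?C m s"
      proof -
        have "Matrix.mat m m (\<lambda>(i, j). B (?s i) (?s j) - B (?s i) (?s m) * B (?s m) (?s j) / B (?s m) (?s m))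
          = Matrix.mat m m (\<lambda>(i, j). ?C (s i) (s j))"
          by (intro eq_matI) auto
        then show ?thesis
          unfolding minor_def using det_schur_complement[of "\<lambda>i j. B (?s i) (?s j)" m] False by simp
      qed
      then have "minor ?C m s = complex_of_real (r / a)"
        using r a by (simp add: field_simps)
      with r a show ?thesis by (intro exI[of _ "r / a"]) auto
    qed
    have hermC: "?C j i = cnj (?C i j)" if "i < n" "j < n" for i j
      using herm[of i j] herm[of n i] herm[of n j] that a by simp
    \<comment> \<open>Elimination subtracts the squared modulus of \<open>B i n\<close> over the
      pivot from the diagonal entry.\<close>
    have le: "Re (?C i i) \<le> Re (B i i)" if "i < n" for i
    proof -
      have "B i n * B n i / B n n = complex_of_real ((cmod (B i n))\<^sup>2 / a)"
        unfolding of_real_divide complex_norm_square using herm[of i n] that a by simp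
      then show ?thesis using a by simp
    qed
    have nn: "Re (?C i i) \<ge> 0" if "i < n" for i
    proof -
      have "\<exists>r\<ge>0. minor ?C 1 (\<lambda>_. i) = complex_of_real r"
        using that by (intro minC) (auto simp: inj_on_def)
      then show ?thesis
        unfolding minor_def One_nat_def det_mat_1 by (auto simp del: minus_complex.sel)
    qed
    have "Re (mdet n (\<lambda>i j. ?C i j)) \<le> (\<Prod>i<n. Re (?C i i))"
      using Suc.IH[of ?C] hermC minC by blast
    also have "\<dots> \<le> (\<Prod>i<n. Re (B i i))"
      using le nn by (intro prod_mono) auto
    finally have "a * Re (mdet n (\<lambda>i j. ?C i j)) \<le> a * (\<Prod>i<n. Re (B i i))"
      using a by simp
    moreover have "mdet (Suc n) (\<lambda>i j. B i j) =
        complex_of_real a * mdet n (\<lambda>i j. ?C i j)"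
      using det_schur_complement[of B n] False a by simp
    ultimately show ?thesis
      by (simp add: a_def mult.commute)
  qed
qed

text \<open>Otherwise the second block would be mapped injectively into itself, hence onto itself,
  and could not receive an index of the first block.\<close>

lemma permutes_off_block:
  fixes p :: "nat \<Rightarrow> nat"
  assumes p: "p permutes {..<n}" and n1: "n1 \<le> n" and i: "i < n1" "n1 \<le> p i"
  shows "\<exists>j. n1 \<le> j \<and> j < n \<and> p j < n1"
proof (rule ccontr)
  assume "\<not> ?thesis"
  then have *: "p ` {n1..<n} \<subseteq> {n1..<n}"
    using permutes_in_image[OF p] by force
  have inj: "inj p" using p by (rule permutes_inj)
  have "p ` {n1..<n} = {n1..<n}"
    using * inj by (intro card_subset_eq) (auto simp: card_image inj_on_subset[OF inj])
  moreover have "p i \<in> {n1..<n}"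
    using i permutes_in_image[OF p, of i] n1 by auto
  ultimately have "p i \<in> p ` {n1..<n}" by (simp only:)
  then have "i \<in> {n1..<n}"
    unfolding inj_image_mem_iff[OF inj] .
  with i show False by simp
qed

text \<open>Normalised by the square roots of \<open>g\<close>, all entries have modulus at most
  \<open>1\<close>. A permutation that leaves the first block also returns to it, so the product
  contains two normalised entries from the off-diagonal blocks. All other normalised factors are
  bounded by \<open>1\<close>, and the arithmetic-geometric inequality turns the two into squares.
  Two crossing factors are essential: squares of entries are what is integrable later.\<close>

lemma prod_entries_off_block_le:
  fixes B :: "nat \<Rightarrow> nat \<Rightarrow> complex" and g :: "nat \<Rightarrow> real"
  assumes g: "\<And>i. i < n \<Longrightarrow> g i \<ge> 0"
    and bound: "\<And>i j. i < n \<Longrightarrow> j < n \<Longrightarrow> (cmod (B i j))\<^sup>2 \<le> g i * g j"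
    and sym: "\<And>i j. i < n \<Longrightarrow> j < n \<Longrightarrow> cmod (B i j) = cmod (B j i)"
    and p: "p permutes {..<n}" and n1: "n1 \<le> n" and i: "i < n1" "n1 \<le> p i"
  shows "(\<Prod>l<n. cmod (B l (p l))) \<le>
    (\<Sum>a<n1. \<Sum>b=n1..<n. (cmod (B a b))\<^sup>2 * (\<Prod>l\<in>{..<n} - {a, b}. g l))"
proof -
  obtain j where j: "n1 \<le> j" "j < n" "p j < n1"
    using permutes_off_block[OF p n1 i] by auto
  have pi: "p i < n" using permutes_in_image[OF p, of i] i n1 by auto
  \<comment> \<open>If \<open>g a\<close> or \<open>g b\<close> is \<open>0\<close>, the bound
    forces the entry to be \<open>0\<close>, and division by zero gives \<open>0\<close> as well, so
    the normalisation loses nothing.\<close>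
  define \<kappa> where "\<kappa> a b = cmod (B a b) / (sqrt (g a) * sqrt (g b))" for a b
  have \<kappa>: "cmod (B a b) = sqrt (g a) * sqrt (g b) * \<kappa> a b" if "a < n" "b < n" for a b
    using bound[OF that] by (auto simp: \<kappa>_def)
  have \<kappa>0: "\<kappa> a b \<ge> 0" if "a < n" "b < n" for a b
    using g that by (simp add: \<kappa>_def)
  have \<kappa>1: "\<kappa> a b \<le> 1" if "a < n" "b < n" for a b
  proof -
    have "cmod (B a b) \<le> sqrt (g a) * sqrt (g b)"
      using real_le_rsqrt[OF bound[OF that]] by (simp add: real_sqrt_mult)
    then show ?thesis
      unfolding \<kappa>_def using g that by (intro divide_le_eq_1[THEN iffD2]) (auto simp: order_less_le)
  qed
  have \<kappa>_sym: "\<kappa> a b = \<kappa> b a" if "a < n" "b < n" for a b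
    using sym[OF that] by (simp add: \<kappa>_def mult.commute)
  have pin: "p l < n" if "l < n" for l using permutes_in_image[OF p, of l] that by auto
  \<comment> \<open>Every index occurs once as a row and once as a column, so the square roots
    combine to the full product of \<open>g\<close>.\<close>
  have "(\<Prod>l<n. cmod (B l (p l))) = (\<Prod>l<n. sqrt (g l)) * (\<Prod>l<n. sqrt (g (p l))) * (\<Prod>l<n. \<kappa> l (p l))"
    using \<kappa> pin by (simp add: prod.distrib)
  also have "(\<Prod>l<n. sqrt (g (p l))) = (\<Prod>l<n. sqrt (g l))"
    using prod.permute[OF p, of "\<lambda>l. sqrt (g l)"] by (simp add: o_def)
  also have "(\<Prod>l<n. sqrt (g l)) * (\<Prod>l<n. sqrt (g l)) = (\<Prod>l<n. g l)"
    using g by (simp add: prod.distrib[symmetric])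
  finally have 1: "(\<Prod>l<n. cmod (B l (p l))) = (\<Prod>l<n. g l) * (\<Prod>l<n. \<kappa> l (p l))" .
  have "(\<Prod>l<n. \<kappa> l (p l)) \<le> \<kappa> i (p i) * \<kappa> j (p j)"
  proof -
    have ij: "i \<noteq> j" "i < n" using i j n1 by auto
    have "(\<Prod>l<n. \<kappa> l (p l)) = \<kappa> i (p i) * (\<kappa> j (p j) * (\<Prod>l\<in>{..<n} - {i} - {j}. \<kappa> l (p l)))"
      using ij j by (subst prod.remove[of _ i], simp, simp, subst prod.remove[of _ j]) auto
    also have "(\<Prod>l\<in>{..<n} - {i} - {j}. \<kappa> l (p l)) \<le> 1"
      using \<kappa>0 \<kappa>1 pin by (intro prod_le_1) auto
    finally show ?thesis using \<kappa>0[of i "p i"] \<kappa>0[of j "p j"] ij j pin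
      by (simp add: mult_left_mono mult_left_le)
  qed
  \<comment> \<open>The entry at \<open>(j, p j)\<close> lies in the lower left block; symmetry of
    the modulus moves it to the upper right one, over which the sum runs.\<close>
  also have "\<kappa> i (p i) * \<kappa> j (p j) \<le> (\<Sum>a<n1. \<Sum>b=n1..<n. (\<kappa> a b)\<^sup>2)"
  proof -
    have mem: "(\<kappa> a b)\<^sup>2 \<le> (\<Sum>a<n1. \<Sum>b=n1..<n. (\<kappa> a b)\<^sup>2)" if "a < n1" "n1 \<le> b" "b < n" for a b
    proof -
      have "(\<kappa> a b)\<^sup>2 \<le> (\<Sum>b=n1..<n. (\<kappa> a b)\<^sup>2)" using that by (intro member_le_sum) auto
      also have "\<dots> \<le> (\<Sum>a<n1. \<Sum>b=n1..<n. (\<kappa> a b)\<^sup>2)"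
        using that by (intro member_le_sum[where f="\<lambda>a. \<Sum>b=n1..<n. (\<kappa> a b)\<^sup>2"]) (auto intro: sum_nonneg)
      finally show ?thesis .
    qed
    have eq: "\<kappa> j (p j) = \<kappa> (p j) j" using \<kappa>_sym[of j "p j"] j n1 by simp
    have "2 * \<kappa> i (p i) * \<kappa> (p j) j \<le> (\<kappa> i (p i))\<^sup>2 + (\<kappa> (p j) j)\<^sup>2"
      by (rule sum_squares_bound)
    with mem[of i "p i"] mem[of "p j" j] i j pi show ?thesis
      unfolding eq by simp
  qed
  finally have "(\<Prod>l<n. cmod (B l (p l))) \<le> (\<Prod>l<n. g l) * (\<Sum>a<n1. \<Sum>b=n1..<n. (\<kappa> a b)\<^sup>2)"
    unfolding 1 using g by (intro mult_left_mono prod_nonneg) auto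
  also have "(\<Prod>l<n. g l) * (\<Sum>a<n1. \<Sum>b=n1..<n. (\<kappa> a b)\<^sup>2) =
      (\<Sum>a<n1. \<Sum>b=n1..<n. (cmod (B a b))\<^sup>2 * (\<Prod>l\<in>{..<n} - {a, b}. g l))"
  proof -
    have "(\<Prod>l<n. g l) * (\<kappa> a b)\<^sup>2 = (cmod (B a b))\<^sup>2 * (\<Prod>l\<in>{..<n} - {a, b}. g l)"
      if ab: "a < n1" "n1 \<le> b" "b < n" for a b
    proof -
      have "(\<Prod>l<n. g l) = g a * (g b * (\<Prod>l\<in>{..<n} - {a} - {b}. g l))"
        using ab n1 by (subst prod.remove[of _ a], simp, simp, subst prod.remove[of _ b]) auto
      also have "{..<n} - {a} - {b} = {..<n} - {a, b}" by auto
      finally have 1: "(\<Prod>l<n. g l) = g a * g b * (\<Prod>l\<in>{..<n} - {a, b}. g l)" by simp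
      have "(cmod (B a b))\<^sup>2 = g a * g b * (\<kappa> a b)\<^sup>2"
        using \<kappa>[of a b] g ab n1 by (simp add: power_mult_distrib)
      with 1 show ?thesis by simp
    qed
    then show ?thesis by (simp add: sum_distrib_left)
  qed
  finally show ?thesis .
qed

text \<open>The product of the two block determinants is the determinant of the matrix whose upper
  right block is replaced by zeros. In the difference of the two expansions only permutations that
  cross between the blocks survive, at most \<open>fact (n1 + n2)\<close> of them.\<close>

lemma det_off_block_le:
  fixes B :: "nat \<Rightarrow> nat \<Rightarrow> complex" and g :: "nat \<Rightarrow> real"
  assumes g: "\<And>i. i < n1 + n2 \<Longrightarrow> g i \<ge> 0"
    and bound: "\<And>i j. i < n1 + n2 \<Longrightarrow> j < n1 + n2 \<Longrightarrow> (cmod (B i j))\<^sup>2 \<le> g i * g j"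
    and sym: "\<And>i j. i < n1 + n2 \<Longrightarrow> j < n1 + n2 \<Longrightarrow> cmod (B i j) = cmod (B j i)"
  shows "cmod (mdet (n1 + n2) (\<lambda>i j. B i j) -
      mdet n1 (\<lambda>i j. B i j) *
      mdet n2 (\<lambda>i j. B (i + n1) (j + n1))) \<le>
    fact (n1 + n2) * (\<Sum>a<n1. \<Sum>b=n1..<n1 + n2. (cmod (B a b))\<^sup>2 * (\<Prod>l\<in>{..<n1 + n2} - {a, b}. g l))"
    (is "cmod (?D - ?E) \<le> fact ?n * ?S")
proof -
  \<comment> \<open>One zero block suffices: a permutation that uses the lower left block also uses
    the upper right one.\<close>
  let ?Z = "\<lambda>i j. if i < n1 \<and> n1 \<le> j then 0 else B i j"
  have E: "?E = mdet ?n (\<lambda>i j. ?Z i j)"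
  proof -
    have "Matrix.mat n1 n1 (\<lambda>(i, j). ?Z i j) = Matrix.mat n1 n1 (\<lambda>(i, j). B i j)"
      "Matrix.mat n2 n2 (\<lambda>(i, j). ?Z (i + n1) (j + n1)) = Matrix.mat n2 n2 (\<lambda>(i, j). B (i + n1) (j + n1))"
      by (auto intro!: eq_matI)
    then show ?thesis using det_block_lower[of n1 n2 ?Z] by simp
  qed
  have det: "mdet ?n (\<lambda>i j. C i j) =
    (\<Sum>p | p permutes {..<?n}. signof p * (\<Prod>i<?n. C i (p i)))" for C :: "nat \<Rightarrow> nat \<Rightarrow> complex"
  proof -
    have "C i (p i) = Matrix.mat ?n ?n (\<lambda>(i, j). C i j) $$ (i, p i)" if "p permutes {..<?n}" "i < ?n" for i p
      using permutes_in_image[OF that(1), of i] that(2) by simp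
    then show ?thesis
      by (subst det_def'[of _ ?n]) (auto simp: atLeast0LessThan intro!: sum.cong prod.cong)
  qed
  have S0: "?S \<ge> 0"
    using g by (intro sum_nonneg mult_nonneg_nonneg prod_nonneg) auto
  have summand: "cmod (signof p * (\<Prod>i<?n. B i (p i)) - signof p * (\<Prod>i<?n. ?Z i (p i))) \<le> ?S"
    if p: "p permutes {..<?n}" for p
  proof (cases "\<exists>i<n1. n1 \<le> p i")
    case True
    then obtain i where i: "i < n1" "n1 \<le> p i" by auto
    then have "(\<Prod>i<?n. ?Z i (p i)) = 0"
      by (intro prod_zero) auto
    moreover have "cmod (signof p * (\<Prod>i<?n. B i (p i))) = (\<Prod>l<?n. cmod (B l (p l)))"
      by (simp add: norm_mult prod_norm sign_def)
    ultimately show ?thesis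
      using prod_entries_off_block_le[where B=B and g=g, OF g bound sym p _ i]
      by (simp only: mult_zero_right diff_0_right le_add1)
  next
    case False
    then have "(\<Prod>i<?n. ?Z i (p i)) = (\<Prod>i<?n. B i (p i))"
      by (intro prod.cong) auto
    then show ?thesis using S0 by simp
  qed
  have "cmod (?D - ?E) = cmod (\<Sum>p | p permutes {..<?n}.
      signof p * (\<Prod>i<?n. B i (p i)) - signof p * (\<Prod>i<?n. ?Z i (p i)))"
    unfolding E det by (simp only: sum_subtractf)
  also have "\<dots> \<le> (\<Sum>p | p permutes {..<?n}. ?S)"
    using summand by (intro sum_norm_le) auto
  also have "\<dots> = fact ?n * ?S"
    by (simp add: card_permutations)
  finally show ?thesis .
qed

subsection \<open>Powers of a sigma-finite measure\<close>

context sigma_finite_measure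
begin

sublocale power: product_sigma_finite "\<lambda>_. M"
  by unfold_locales

abbreviation (input) powM :: "'i set \<Rightarrow> ('i \<Rightarrow> 'a) measure" where
  "powM J \<equiv> PiM J (\<lambda>_. M)"

lemma distr_PiM_reindex_inj:
  assumes J: "finite J" and s: "inj_on s J"
  shows "distr (powM (s ` J)) (powM J) (\<lambda>x. \<lambda>j\<in>J. x (s j)) = powM J"
proof (rule power.PiM_eqI[OF J])
  have f: "(\<lambda>x. \<lambda>j\<in>J. x (s j)) \<in> measurable (powM (s ` J)) (powM J)"
    by (intro measurable_restrict measurable_component_singleton) auto
  fix A assume A: "\<And>i. i \<in> J \<Longrightarrow> A i \<in> sets M"
  have "(\<lambda>x. \<lambda>j\<in>J. x (s j)) -` (Pi\<^sub>E J A) \<inter> space (powM (s ` J)) =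
    (\<Pi>\<^sub>E i\<in>s ` J. A (the_inv_into J s i))"
    using A[THEN sets.sets_into_space] s
    by (auto simp: space_PiM PiE_iff the_inv_into_f_f subset_eq)
  then have "emeasure (distr (powM (s ` J)) (powM J) (\<lambda>x. \<lambda>j\<in>J. x (s j))) (Pi\<^sub>E J A) =
      emeasure (powM (s ` J)) (\<Pi>\<^sub>E i\<in>s ` J. A (the_inv_into J s i))"
    using A J by (subst emeasure_distr[OF f]) (auto intro!: sets_PiM_I_finite)
  also have "\<dots> = (\<Prod>i\<in>s ` J. emeasure M (A (the_inv_into J s i)))"
    using A J s by (intro power.emeasure_PiM) (auto simp: the_inv_into_f_f)
  also have "\<dots> = (\<Prod>i\<in>J. emeasure M (A i))"
    using s by (simp add: prod.reindex the_inv_into_f_f)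
  finally show "emeasure (distr (powM (s ` J)) (powM J) (\<lambda>x. \<lambda>j\<in>J. x (s j))) (Pi\<^sub>E J A) =
    (\<Prod>i\<in>J. emeasure M (A i))" .
qed simp

lemma nn_integral_PiM_reindex_inj:
  assumes J: "finite J" and s: "inj_on s J" and f: "f \<in> borel_measurable (powM J)"
  shows "(\<integral>\<^sup>+x. f (\<lambda>j\<in>J. x (s j)) \<partial>powM (s ` J)) = (\<integral>\<^sup>+x. f x \<partial>powM J)"
proof -
  have m: "(\<lambda>x. \<lambda>j\<in>J. x (s j)) \<in> measurable (powM (s ` J)) (powM J)"
    by (intro measurable_restrict measurable_component_singleton) auto
  show ?thesis
    using nn_integral_distr[OF m, of f] f by (simp add: distr_PiM_reindex_inj[OF J s])
qed

text \<open>The means of carrying almost-everywhere facts about few points to configurations of many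
  points. The preimage of a null set is null by Fubini; the mass of the remaining coordinates may be
  infinite, but it is multiplied by \<open>0\<close>.\<close>

lemma AE_PiM_reindex:
  fixes s :: "'b \<Rightarrow> 'c"
  assumes I: "finite I" and s: "inj_on s J" "s ` J \<subseteq> I"
    and AE: "AE y in powM J. Q y"
  shows "AE x in powM I. Q (\<lambda>j\<in>J. x (s j))"
proof -
  have J: "finite J" using finite_imageD[OF finite_subset[OF s(2) I] s(1)] .
  define R where "R = I - s ` J"
  have R: "s ` J \<inter> R = {}" "finite (s ` J)" "finite R" "s ` J \<union> R = I"
    using s I J by (auto simp: R_def)
  obtain N where N: "N \<in> null_sets (powM J)" "{y \<in> space (powM J). \<not> Q y} \<subseteq> N"
    using AE by (auto simp: eventually_ae_filter)
  have N': "N \<in> sets (powM J)" using N(1) by auto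
  have m: "(\<lambda>x. \<lambda>j\<in>J. x (s j)) \<in> measurable (powM I) (powM J)"
    using s by (intro measurable_restrict measurable_component_singleton) auto
  have m': "(\<lambda>x. \<lambda>j\<in>J. x (s j)) \<in> measurable (powM (s ` J)) (powM J)"
    by (intro measurable_restrict measurable_component_singleton) auto
  have f: "(\<lambda>x. indicator N (\<lambda>j\<in>J. x (s j)) :: ennreal) \<in> borel_measurable (powM I)"
    using measurable_compose[OF m borel_measurable_indicator[OF N']] .
  have f': "(\<lambda>x. indicator N (\<lambda>j\<in>J. x (s j)) :: ennreal) \<in> borel_measurable (powM (s ` J))"
    using measurable_compose[OF m' borel_measurable_indicator[OF N']] .
  have "(\<integral>\<^sup>+x. indicator N (\<lambda>j\<in>J. x (s j)) \<partial>powM I) =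
    (\<integral>\<^sup>+x. \<integral>\<^sup>+y. indicator N (\<lambda>j\<in>J. merge (s ` J) R (x, y) (s j)) \<partial>powM R \<partial>powM (s ` J))"
    using power.product_nn_integral_fold[OF R(1-3), of "\<lambda>x. indicator N (\<lambda>j\<in>J. x (s j))"] f R(4) by simp
  also have "\<dots> = (\<integral>\<^sup>+x. indicator N (\<lambda>j\<in>J. x (s j)) * emeasure (powM R) (space (powM R)) \<partial>powM (s ` J))"
  proof (intro nn_integral_cong)
    fix x :: "'c \<Rightarrow> 'a"
    have "(\<lambda>j\<in>J. merge (s ` J) R (x, y) (s j)) = (\<lambda>j\<in>J. x (s j))" for y
      by (auto simp: merge_def)
    then show "(\<integral>\<^sup>+y. indicator N (\<lambda>j\<in>J. merge (s ` J) R (x, y) (s j)) \<partial>powM R) =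
      indicator N (\<lambda>j\<in>J. x (s j)) * emeasure (powM R) (space (powM R))"
      by simp
  qed
  also have "\<dots> = (\<integral>\<^sup>+x. indicator N (\<lambda>j\<in>J. x (s j)) \<partial>powM (s ` J)) * emeasure (powM R) (space (powM R))"
    by (rule nn_integral_multc[OF f'])
  also have "(\<integral>\<^sup>+x. indicator N (\<lambda>j\<in>J. x (s j)) \<partial>powM (s ` J)) = 0"
    using N(1) N' by (subst nn_integral_PiM_reindex_inj[OF J s(1) borel_measurable_indicator[OF N']]) auto
  finally have "(\<integral>\<^sup>+x. indicator N (\<lambda>j\<in>J. x (s j)) \<partial>powM I) = 0"
    by (simp only: mult_zero_left)
  then have "AE x in powM I. indicator N (\<lambda>j\<in>J. x (s j)) = (0::ennreal)"
    using nn_integral_0_iff_AE[OF f] by blast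
  then show ?thesis
  proof (rule AE_mp, intro AE_I2 impI)
    fix x assume x: "x \<in> space (powM I)" "indicator N (\<lambda>j\<in>J. x (s j)) = (0::ennreal)"
    with measurable_space[OF m x(1)] N(2) show "Q (\<lambda>j\<in>J. x (s j))"
      by (auto simp: indicator_def split: if_splits)
  qed
qed

lemma AE_PiM_component_sigma_finite:
  assumes I: "finite I" "a \<in> I" and AE: "AE y in powM {..<1::nat}. Q (y 0)"
  shows "AE x in powM I. Q (x a)"
  using AE_PiM_reindex[OF I(1), of "\<lambda>_. a" "{..<1::nat}" "\<lambda>y. Q (y 0)"] I AE
  by (simp add: inj_on_def image_subset_iff)

lemma AE_PiM_two_components:
  assumes I: "finite I" "a \<in> I" "b \<in> I" "a \<noteq> b" and AE: "AE y in powM {..<2::nat}. Q (y 0) (y 1)"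
  shows "AE x in powM I. Q (x a) (x b)"
proof -
  have "AE x in powM I. (\<lambda>y. Q (y 0) (y 1)) (\<lambda>j\<in>{..<2::nat}. x ((\<lambda>k. if k = 0 then a else b) j))"
    using I by (intro AE_PiM_reindex[OF I(1) _ _ AE]) (auto simp: inj_on_def less_2_cases_iff)
  then show ?thesis by simp
qed

lemma AE_PiM_pair_of_AE_pair:
  assumes AE: "AE z in M \<Otimes>\<^sub>M M. Q (fst z) (snd z)"
  shows "AE y in powM {..<2::nat}. Q (y 0) (y 1)"
proof -
  obtain N where N: "N \<in> null_sets (M \<Otimes>\<^sub>M M)" "{z \<in> space (M \<Otimes>\<^sub>M M). \<not> Q (fst z) (snd z)} \<subseteq> N"
    using AE by (auto simp: eventually_ae_filter)
  have N': "N \<in> sets (M \<Otimes>\<^sub>M M)" using N(1) by auto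
  have two: "{..<2::nat} = {0, 1}" by auto
  have m: "(\<lambda>x. (x 0, x 1)) \<in> measurable (powM {0, 1::nat}) (M \<Otimes>\<^sub>M M)"
    by (intro measurable_Pair measurable_component_singleton) auto
  have f: "(\<lambda>x. indicator N (x 0, x 1) :: ennreal) \<in> borel_measurable (powM {0, 1::nat})"
    using measurable_compose[OF m borel_measurable_indicator[OF N']] .
  have "(\<integral>\<^sup>+x. indicator N (x 0, x 1) \<partial>powM {0, 1::nat}) = (\<integral>\<^sup>+z. indicator N (fst z, snd z) \<partial>(M \<Otimes>\<^sub>M M))"
    by (rule power.product_nn_integral_pair[of "\<lambda>x y. indicator N (x, y)"]) (use N' in auto)
  also have "\<dots> = emeasure (M \<Otimes>\<^sub>M M) N" using N' by simp
  also have "\<dots> = 0" using N(1) by auto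
  finally have "AE x in powM {0, 1::nat}. indicator N (x 0, x 1) = (0::ennreal)"
    using nn_integral_0_iff_AE[OF f] by blast
  then show ?thesis unfolding two
  proof (rule AE_mp, intro AE_I2 impI)
    fix x assume x: "x \<in> space (powM {0, 1::nat})" "indicator N (x 0, x 1) = (0::ennreal)"
    with measurable_space[OF m x(1)] N(2) show "Q (x 0) (x 1)"
      by (auto simp: indicator_def split: if_splits)
  qed
qed

text \<open>This is the shape of one off-block term: a factor that couples two points, and one-point
  factors for all the others.\<close>

lemma nn_integral_PiM_pair_prod:
  assumes I: "finite I" "a \<in> I" "b \<in> I" "a \<noteq> b"
    and f: "case_prod f \<in> borel_measurable (M \<Otimes>\<^sub>M M)"
    and h: "\<And>l. l \<in> I \<Longrightarrow> h l \<in> borel_measurable M"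
  shows "(\<integral>\<^sup>+x. f (x a) (x b) * (\<Prod>l\<in>I - {a, b}. h l (x l)) \<partial>powM I) =
    (\<integral>\<^sup>+z. f (fst z) (snd z) \<partial>(M \<Otimes>\<^sub>M M)) * (\<Prod>l\<in>I - {a, b}. \<integral>\<^sup>+x. h l x \<partial>M)"
proof -
  define R where "R = I - {a, b}"
  have R: "{a, b} \<inter> R = {}" "finite {a, b}" "finite R" "{a, b} \<union> R = I"
    using I by (auto simp: R_def)
  have hm: "(\<lambda>x. \<Prod>l\<in>R. h l (x l)) \<in> borel_measurable (powM J)" if "R \<subseteq> J" "J \<subseteq> I" for J
    using that by (intro borel_measurable_prod_ennreal measurable_compose[OF measurable_component_singleton[of _ J] h]) auto
  have fm: "(\<lambda>x. f (x a) (x b)) \<in> borel_measurable (powM J)" if "a \<in> J" "b \<in> J" for J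
  proof -
    have "(\<lambda>x. (x a, x b)) \<in> measurable (powM J) (M \<Otimes>\<^sub>M M)"
      using that by (intro measurable_Pair measurable_component_singleton) auto
    from measurable_compose[OF this f] show ?thesis by simp
  qed
  have "(\<integral>\<^sup>+x. f (x a) (x b) * (\<Prod>l\<in>R. h l (x l)) \<partial>powM I) =
    (\<integral>\<^sup>+x. \<integral>\<^sup>+y. f (merge {a, b} R (x, y) a) (merge {a, b} R (x, y) b) * (\<Prod>l\<in>R. h l (merge {a, b} R (x, y) l))
      \<partial>powM R \<partial>powM {a, b})"
  proof -
    have "(\<lambda>x. f (x a) (x b) * (\<Prod>l\<in>R. h l (x l))) \<in> borel_measurable (powM ({a, b} \<union> R))"
      using fm[of I] hm[of I] R I by (intro borel_measurable_times_ennreal) auto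
    from power.product_nn_integral_fold[OF R(1-3) this] show ?thesis
      using R(4) by simp
  qed
  also have "\<dots> = (\<integral>\<^sup>+x. \<integral>\<^sup>+y. f (x a) (x b) * (\<Prod>l\<in>R. h l (y l)) \<partial>powM R \<partial>powM {a, b})"
    using R by (intro nn_integral_cong arg_cong2[where f="(*)"] arg_cong2[where f=f] prod.cong) (auto simp: merge_def)
  also have "\<dots> = (\<integral>\<^sup>+x. f (x a) (x b) * (\<Prod>l\<in>R. \<integral>\<^sup>+x. h l x \<partial>M) \<partial>powM {a, b})"
  proof (intro nn_integral_cong)
    fix x
    show "(\<integral>\<^sup>+y. f (x a) (x b) * (\<Prod>l\<in>R. h l (y l)) \<partial>powM R) = f (x a) (x b) * (\<Prod>l\<in>R. \<integral>\<^sup>+x. h l x \<partial>M)"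
      using hm[of R] R h power.product_nn_integral_prod[of R h] by (simp add: nn_integral_cmult subset_iff R_def)
  qed
  also have "\<dots> = (\<integral>\<^sup>+x. f (x a) (x b) \<partial>powM {a, b}) * (\<Prod>l\<in>R. \<integral>\<^sup>+x. h l x \<partial>M)"
    using fm[of "{a, b}"] by (intro nn_integral_multc) auto
  also have "(\<integral>\<^sup>+x. f (x a) (x b) \<partial>powM {a, b}) = (\<integral>\<^sup>+z. f (fst z) (snd z) \<partial>(M \<Otimes>\<^sub>M M))"
    by (rule power.product_nn_integral_pair[OF f I(4)])
  finally show ?thesis by (simp add: R_def)
qed

text \<open>Writes a product of two expectations as one integral over \<open>n1 + n2\<close> points,
  where it can be compared pointwise with the joint expectation.\<close>

lemma nn_integral_PiM_blocks:
  fixes n1 n2 :: nat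
  assumes u: "u \<in> borel_measurable (powM {..<n1})"
    and v: "v \<in> borel_measurable (powM {..<n2})"
  shows "(\<integral>\<^sup>+x. u (\<lambda>j\<in>{..<n1}. x j) * v (\<lambda>j\<in>{..<n2}. x (n1 + j)) \<partial>powM {..<n1 + n2}) =
    (\<integral>\<^sup>+x. u x \<partial>powM {..<n1}) * (\<integral>\<^sup>+x. v x \<partial>powM {..<n2})"
proof -
  define s where "s j = n1 + j" for j :: nat
  have inj: "inj_on s {..<n2}" by (auto simp: s_def inj_on_def)
  have R: "{..<n1} \<inter> s ` {..<n2} = {}" "finite {..<n1}" "finite (s ` {..<n2})" by (auto simp: s_def)
  have un: "{..<n1} \<union> s ` {..<n2} = {..<n1 + n2}"
  proof -
    have "s ` {..<n2} = {n1..<n1 + n2}"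
      unfolding s_def using image_add_atLeastLessThan[of n1 0 n2] by (simp add: atLeast0LessThan add.commute)
    then show ?thesis by auto
  qed
  then have sub: "s ` {..<n2} \<subseteq> {..<n1 + n2}" by blast
  have m1: "(\<lambda>x. \<lambda>j\<in>{..<n1}. x j) \<in> measurable (powM {..<n1 + n2}) (powM {..<n1})"
    by (intro measurable_restrict measurable_component_singleton) auto
  have m2: "(\<lambda>x. \<lambda>j\<in>{..<n2}. x (s j)) \<in> measurable (powM J) (powM {..<n2})"
    if "s ` {..<n2} \<subseteq> J" for J
    using that by (intro measurable_restrict measurable_component_singleton) auto
  have vm: "(\<lambda>x. v (\<lambda>j\<in>{..<n2}. x (s j))) \<in> borel_measurable (powM J)" if "s ` {..<n2} \<subseteq> J" for J
    using measurable_compose[OF m2[OF that] v] .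
  have um: "(\<lambda>x. u (\<lambda>j\<in>{..<n1}. x j)) \<in> borel_measurable (powM {..<n1 + n2})"
    using measurable_compose[OF m1 u] .
  have "(\<integral>\<^sup>+x. u (\<lambda>j\<in>{..<n1}. x j) * v (\<lambda>j\<in>{..<n2}. x (s j)) \<partial>powM {..<n1 + n2}) =
    (\<integral>\<^sup>+x. \<integral>\<^sup>+y. u (\<lambda>j\<in>{..<n1}. merge {..<n1} (s ` {..<n2}) (x, y) j) *
       v (\<lambda>j\<in>{..<n2}. merge {..<n1} (s ` {..<n2}) (x, y) (s j)) \<partial>powM (s ` {..<n2}) \<partial>powM {..<n1})"
    using power.product_nn_integral_fold[OF R, of "\<lambda>x. u (\<lambda>j\<in>{..<n1}. x j) * v (\<lambda>j\<in>{..<n2}. x (s j))"]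
      borel_measurable_times_ennreal[OF um vm[OF sub]] by (simp add: un)
  also have "\<dots> = (\<integral>\<^sup>+x. \<integral>\<^sup>+y. u x * v (\<lambda>j\<in>{..<n2}. y (s j)) \<partial>powM (s ` {..<n2}) \<partial>powM {..<n1})"
  proof (intro nn_integral_cong arg_cong2[where f="(*)"] arg_cong[where f=u] arg_cong[where f=v])
    fix x y assume x: "x \<in> space (powM {..<n1})"
    show "(\<lambda>j\<in>{..<n1}. merge {..<n1} (s ` {..<n2}) (x, y) j) = x"
      using x by (auto simp: merge_def space_PiM PiE_iff extensional_def)
    show "(\<lambda>j\<in>{..<n2}. merge {..<n1} (s ` {..<n2}) (x, y) (s j)) = (\<lambda>j\<in>{..<n2}. y (s j))"
      by (auto simp: merge_def s_def)
  qed
  also have "\<dots> = (\<integral>\<^sup>+x. u x * (\<integral>\<^sup>+y. v y \<partial>powM {..<n2}) \<partial>powM {..<n1})"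
    using vm[of "s ` {..<n2}"] by (simp add: nn_integral_cmult nn_integral_PiM_reindex_inj[OF _ inj v])
  also have "\<dots> = (\<integral>\<^sup>+x. u x \<partial>powM {..<n1}) * (\<integral>\<^sup>+x. v x \<partial>powM {..<n2})"
    by (rule nn_integral_multc[OF u])
  finally show ?thesis by (simp add: s_def)
qed

end

subsection \<open>The one-particle space\<close>

lemma countable_int_lattice: "countable (int_lattice :: (real ^ 'd) set)"
proof -
  have "(int_lattice :: (real ^ 'd) set) \<subseteq> range (\<lambda>f :: 'd \<Rightarrow> int. \<chi> i. of_int (f i))"
  proof
    fix x :: "real ^ 'd" assume "x \<in> int_lattice"
    then have "\<forall>i. \<exists>k :: int. x $ i = of_int k" by (auto simp: int_lattice_def elim!: Ints_cases)
    then obtain f where "\<And>i. x $ i = of_int (f i :: int)" by metis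
    then have "x = (\<chi> i. of_int (f i))" by (simp add: Finite_Cartesian_Product.vec_eq_iff)
    then show "x \<in> range (\<lambda>f :: 'd \<Rightarrow> int. \<chi> i. of_int (f i))" by blast
  qed
  then show ?thesis by (rule countable_subset) auto
qed

lemma int_lattice_closed:
  "0 \<in> int_lattice" "x \<in> int_lattice \<Longrightarrow> y \<in> int_lattice \<Longrightarrow> x + y \<in> int_lattice"
  "x \<in> int_lattice \<Longrightarrow> - x \<in> int_lattice"
  by (auto simp: int_lattice_def)

lemma finite_int_lattice_bounded:
  assumes "bounded (B :: (real ^ 'd) set)" "B \<subseteq> int_lattice"
  shows "finite B"
proof -
  obtain b where b: "\<And>x. x \<in> B \<Longrightarrow> norm x \<le> b" using assms(1) by (auto simp: bounded_iff)
  have "B \<subseteq> (\<lambda>f. \<chi> i. of_int (f i)) ` (UNIV \<rightarrow>\<^sub>E {- \<lceil>b\<rceil>..\<lceil>b\<rceil>})"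
  proof
    fix x assume x: "x \<in> B"
    then have "\<forall>i. \<exists>k :: int. x $ i = of_int k" using assms(2) by (auto simp: int_lattice_def elim!: Ints_cases)
    then obtain f where f: "\<And>i. x $ i = of_int (f i :: int)" by metis
    have "\<bar>of_int (f i)\<bar> \<le> b" for i
      using component_le_norm_cart[of x i] b[OF x] by (simp add: f)
    then have "\<bar>f i\<bar> \<le> \<lceil>b\<rceil>" for i
      by (metis le_of_int_ceiling of_int_abs of_int_le_iff order_trans)
    then have "f i \<in> {- \<lceil>b\<rceil>..\<lceil>b\<rceil>}" for i
      by (simp add: abs_le_iff minus_le_iff)
    then have "f \<in> (UNIV \<rightarrow>\<^sub>E {- \<lceil>b\<rceil>..\<lceil>b\<rceil>})" by (auto simp: PiE_UNIV_domain)
    moreover have "x = (\<chi> i. of_int (f i))" by (simp add: Finite_Cartesian_Product.vec_eq_iff f)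
    ultimately show "x \<in> (\<lambda>f. \<chi> i. of_int (f i)) ` (UNIV \<rightarrow>\<^sub>E {- \<lceil>b\<rceil>..\<lceil>b\<rceil>})" by blast
  qed
  then show ?thesis by (rule finite_subset) (intro finite_imageI finite_PiE, auto)
qed

text \<open>Both cases are treated together as far as possible through a few common facts: shifts by
  elements of the space preserve \<open>M\<close>, bounded sets have finite measure, and the integer
  lattice lies in the space.\<close>

locale one_particle_space =
  fixes M :: "(real ^ 'd) measure"
  assumes M_cases: "M = lborel \<or> M = count_space int_lattice"
begin

lemma M_cases': obtains "M = lborel" | "M = count_space int_lattice"
  using M_cases by auto

sublocale sigma_finite_measure M
  by (rule M_cases')
    (simp_all add: sigma_finite_lborel sigma_finite_measure_count_space_countable countable_int_lattice)

lemma space_closed: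
  "0 \<in> space M" "x \<in> space M \<Longrightarrow> y \<in> space M \<Longrightarrow> x + y \<in> space M" "x \<in> space M \<Longrightarrow> - x \<in> space M"
  using M_cases int_lattice_closed by auto

lemma space_diff: "x \<in> space M \<Longrightarrow> y \<in> space M \<Longrightarrow> x - y \<in> space M"
  using space_closed(2)[of x "- y"] space_closed(3)[of y] by simp

lemma int_lattice_subset: "int_lattice \<subseteq> space M"
  using M_cases by auto

lemma borel_sets_M: "A \<in> sets M \<Longrightarrow> A \<in> sets borel"
  by (rule M_cases') (auto intro: sets.countable countable_subset[OF _ countable_int_lattice])

lemma sets_M_borel: "A \<in> sets borel \<Longrightarrow> A \<inter> space M \<in> sets M"
  by (rule M_cases') auto

lemma id_measurable [measurable]: "(\<lambda>x. x) \<in> measurable M borel"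
  by (rule M_cases') auto

lemma measurable_into_M:
  assumes "f \<in> measurable N borel" "\<And>x. x \<in> space N \<Longrightarrow> f x \<in> space M"
  shows "f \<in> measurable N M"
proof (rule measurableI)
  fix A assume A: "A \<in> sets M"
  show "f -` A \<inter> space N \<in> sets N"
    by (rule measurable_sets[OF assms(1) borel_sets_M[OF A]])
qed (use assms in auto)

lemma measurable_shift: "t \<in> space M \<Longrightarrow> (\<lambda>x. x + t) \<in> measurable M M"
  by (rule measurable_into_M) (auto intro: space_closed)

lemma measurable_add_pair: "(\<lambda>z. fst z + snd z) \<in> measurable (M \<Otimes>\<^sub>M M) M"
  by (rule measurable_into_M) (auto intro!: space_closed borel_measurable_add
      measurable_compose[OF measurable_fst id_measurable] measurable_compose[OF measurable_snd id_measurable]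
      simp: space_pair_measure)

lemma measurable_diff_pair: "(\<lambda>z. fst z - snd z) \<in> measurable (M \<Otimes>\<^sub>M M) M"
  by (rule measurable_into_M) (auto intro!: space_diff borel_measurable_diff
      measurable_compose[OF measurable_fst id_measurable] measurable_compose[OF measurable_snd id_measurable]
      simp: space_pair_measure)

lemma distr_shift:
  assumes t: "t \<in> space M"
  shows "distr M M (\<lambda>x. x + t) = M"
proof (rule M_cases')
  assume M: "M = lborel"
  have "distr lborel lborel (\<lambda>x. x + t) = distr lborel borel ((+) t)"
    by (intro distr_cong) (auto simp: add.commute)
  then show ?thesis unfolding M by (simp add: lborel_distr_plus)
next
  assume M: "M = count_space int_lattice"
  have "bij_betw (\<lambda>x. x + t) int_lattice int_lattice"
    by (rule bij_betwI[of _ _ _ "\<lambda>x. x - t"])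
      (use t M int_lattice_closed(2) int_lattice_closed(2)[of _ "- t"] int_lattice_closed(3)[of t] in auto)
  then show ?thesis unfolding M by (rule distr_bij_count_space)
qed

lemma nn_integral_shift:
  assumes "t \<in> space M" "f \<in> borel_measurable M"
  shows "(\<integral>\<^sup>+x. f (x + t) \<partial>M) = (\<integral>\<^sup>+x. f x \<partial>M)"
  using nn_integral_distr[OF measurable_shift[OF assms(1)], of f] assms by (simp add: distr_shift)

lemma bounded_sets_sets: "B \<in> bounded_sets M \<Longrightarrow> B \<in> sets M"
  by (simp add: bounded_sets_def)

lemma emeasure_bounded_sets: "B \<in> bounded_sets M \<Longrightarrow> emeasure M B < \<infinity>"
  by (rule M_cases')
    (auto simp: bounded_sets_def finite_int_lattice_bounded of_nat_less_top dest: emeasure_bounded_finite)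

lemma bounded_sets_ops:
  assumes "A \<in> bounded_sets M" "B \<in> bounded_sets M"
  shows "A \<union> B \<in> bounded_sets M" "A \<inter> B \<in> bounded_sets M" "A - B \<in> bounded_sets M"
  using assms by (auto simp: bounded_sets_def intro: bounded_subset)

lemma bounded_sets_UN:
  "finite I \<Longrightarrow> (\<And>i. i \<in> I \<Longrightarrow> A i \<in> bounded_sets M) \<Longrightarrow> (\<Union>i\<in>I. A i) \<in> bounded_sets M"
  by (auto simp: bounded_sets_def intro!: sets.finite_UN)

lemma bounded_sets_translate:
  assumes B: "B \<in> bounded_sets M" and t: "t \<in> space M"
  shows "(\<lambda>x. x - t) ` B \<in> bounded_sets M"
proof -
  have "(\<lambda>x. x - t) ` B = (\<lambda>x. x + t) -` B \<inter> space M"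
    using sets.sets_into_space[OF bounded_sets_sets[OF B]] space_diff[OF _ t]
    by (auto simp: image_iff algebra_simps intro!: bexI[of _ "_ + t"])
  moreover have "(\<lambda>x. x + t) -` B \<inter> space M \<in> sets M"
    using measurable_shift[OF t] bounded_sets_sets[OF B] by (rule measurable_sets)
  moreover have "bounded ((\<lambda>x. x - t) ` B)"
    using B bounded_translation_minus[of B t] by (simp add: bounded_sets_def)
  ultimately show ?thesis by (simp add: bounded_sets_def)
qed

end

subsection \<open>Hermitian symmetry of the kernel\<close>

text \<open>Local integrability is what Fubini needs in the proof of Hermitian symmetry. In the
  coordinates \<open>x\<close> and \<open>y = u - x\<close> the integral over a square becomes the
  integral over \<open>y\<close> of the \<open>L1\<close> norm of \<open>F y\<close>, which is a
  continuous function of bounded support.\<close>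

lemma regular_kernel_locally_integrable:
  fixes K :: "real ^ 'd \<Rightarrow> real ^ 'd \<Rightarrow> complex"
  assumes K [measurable]: "case_prod K \<in> borel_measurable lborel2"
    and reg: "regular_kernel T K" and B: "B \<in> bounded_sets lborel"
  shows "integrable lborel2 (\<lambda>(x, y). indicator (B \<times> B) (x, y) *\<^sub>R K x y)"
proof -
  define F where "F = (\<lambda>y x. K x (x + y) * indicator B (x + y))"
  define N where "N y = (LINT x:B|lborel. cmod (F y x))" for y
  have Bs [measurable]: "B \<in> sets borel" using B by (simp add: bounded_sets_def)
  have F: "set_integrable lborel B (F y)" "((\<lambda>z. LINT x:B|lborel. cmod (F z x - F y x)) \<longlongrightarrow> 0) (at y)" for y
    using reg B by (simp_all add: regular_kernel_def Let_def F_def)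
  have F': "set_integrable lborel B (\<lambda>x. cmod (F y x))" for y
    using F(1)[of y] by (rule set_integrable_norm)
  have cont: "continuous_on UNIV N"
  proof (rule continuous_at_imp_continuous_on, intro ballI)
    fix y
    have "\<bar>N z - N y\<bar> \<le> (LINT x:B|lborel. cmod (F z x - F y x))" for z
    proof -
      have "\<bar>N z - N y\<bar> = \<bar>LINT x:B|lborel. cmod (F z x) - cmod (F y x)\<bar>"
        unfolding N_def by (simp add: set_integral_diff F')
      also have "\<dots> \<le> (LINT x:B|lborel. \<bar>cmod (F z x) - cmod (F y x)\<bar>)"
        unfolding set_lebesgue_integral_def
        by (rule order_trans[OF integral_abs_bound]) (simp add: abs_mult)
      also have "\<dots> \<le> (LINT x:B|lborel. cmod (F z x - F y x))"
        by (intro set_integral_mono set_integrable_norm set_integral_diff F set_integrable_abs F'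
            norm_triangle_ineq3)
      finally show ?thesis .
    qed
    then have "(N \<longlongrightarrow> N y) (at y)"
      by (intro Lim_transform_bound[OF _ F(2)[of y], of "\<lambda>z. N z - N y", THEN LIM_zero_cancel])
        (auto intro!: always_eventually order_trans[OF _ abs_ge_self])
    then show "isCont N y" by (simp add: isCont_def)
  qed
  obtain r where r: "\<And>x. x \<in> B \<Longrightarrow> norm x \<le> r" using B by (auto simp: bounded_sets_def bounded_iff)
  \<comment> \<open>Two points of \<open>B\<close> differ by at most twice the radius of a ball
    around the origin that contains \<open>B\<close>.\<close>
  have vanish: "F y x = 0" if "x \<in> B" "y \<notin> cball 0 (2 * r)" for x y
  proof -
    have "x + y \<notin> B"
      using r[of "x + y"] r[OF that(1)] that(2) norm_triangle_ineq4[of "x + y" x] by (auto simp: dist_norm)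
    then show ?thesis by (simp add: F_def)
  qed
  have [measurable]: "(\<lambda>z. F (snd z) (fst z)) \<in> borel_measurable lborel2"
  proof -
    have "(\<lambda>z. (fst z, fst z + snd z)) \<in> measurable lborel2 (lborel \<Otimes>\<^sub>M (lborel :: (real^'d) measure))"
      by simp
    from measurable_compose[OF this K] show ?thesis unfolding F_def by (simp add: case_prod_beta)
  qed
  have [measurable]: "(\<lambda>z. indicator B (fst z) * ennreal (cmod (F (snd z) (fst z)))) \<in> borel_measurable lborel2"
    by measurable
  have "(\<integral>\<^sup>+z. ennreal (norm (case z of (x, y) \<Rightarrow> indicator (B \<times> B) (x, y) *\<^sub>R K x y)) \<partial>lborel2) =
    (\<integral>\<^sup>+x. \<integral>\<^sup>+u. indicator B x * (indicator B u * ennreal (cmod (K x u))) \<partial>lborel \<partial>lborel)"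
    by (subst lborel.nn_integral_fst[symmetric])
      (auto intro!: nn_integral_cong simp: indicator_def split: if_splits)
  also have "\<dots> = (\<integral>\<^sup>+x. \<integral>\<^sup>+y. indicator B x * ennreal (cmod (F y x)) \<partial>lborel \<partial>lborel)"
  proof (rule nn_integral_cong)
    fix x :: "real ^ 'd"
    have "(\<integral>\<^sup>+u. indicator B x * (indicator B u * ennreal (cmod (K x u))) \<partial>lborel) =
      (\<integral>\<^sup>+u. indicator B x * (indicator B u * ennreal (cmod (K x u))) \<partial>distr lborel borel ((+) x))"
      by (simp add: lborel_distr_plus)
    also have "\<dots> = (\<integral>\<^sup>+y. indicator B x * (indicator B (x + y) * ennreal (cmod (K x (x + y)))) \<partial>lborel)"
      by (subst nn_integral_distr) auto
    also have "\<dots> = (\<integral>\<^sup>+y. indicator B x * ennreal (cmod (F y x)) \<partial>lborel)"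
      by (intro nn_integral_cong) (auto simp: F_def indicator_def)
    finally show "(\<integral>\<^sup>+u. indicator B x * (indicator B u * ennreal (cmod (K x u))) \<partial>lborel) =
      (\<integral>\<^sup>+y. indicator B x * ennreal (cmod (F y x)) \<partial>lborel)" .
  qed
  also have "\<dots> = (\<integral>\<^sup>+y. \<integral>\<^sup>+x. indicator B x * ennreal (cmod (F y x)) \<partial>lborel \<partial>lborel)"
    by (rule lborel_pair.Fubini'[symmetric]) (simp add: case_prod_beta)
  also have "\<dots> = (\<integral>\<^sup>+y. ennreal (indicator (cball 0 (2 * r)) y *\<^sub>R N y) \<partial>lborel)"
  proof (intro nn_integral_cong)
    fix y :: "real ^ 'd"
    have N: "(\<integral>\<^sup>+x. indicator B x * ennreal (cmod (F y x)) \<partial>lborel) = ennreal (N y)"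
    proof -
      have "(\<integral>\<^sup>+x. indicator B x * ennreal (cmod (F y x)) \<partial>lborel) = (\<integral>\<^sup>+x. ennreal (indicator B x *\<^sub>R cmod (F y x)) \<partial>lborel)"
        by (intro nn_integral_cong) (auto simp: indicator_def)
      also have "\<dots> = ennreal (N y)"
        unfolding N_def set_lebesgue_integral_def
        by (rule nn_integral_eq_integral) (use F'[of y] in \<open>auto simp: set_integrable_def\<close>)
      finally show ?thesis .
    qed
    show "(\<integral>\<^sup>+x. indicator B x * ennreal (cmod (F y x)) \<partial>lborel) = ennreal (indicator (cball 0 (2 * r)) y *\<^sub>R N y)"
    proof (cases "y \<in> cball 0 (2 * r)")
      case False
      have "(\<integral>\<^sup>+x. indicator B x * ennreal (cmod (F y x)) \<partial>lborel) = (\<integral>\<^sup>+x. 0 \<partial>(lborel :: (real^'d) measure))"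
        using vanish[OF _ False] by (intro nn_integral_cong) (auto simp: indicator_def)
      then show ?thesis using False by simp
    qed (use N in simp)
  qed
  also have "\<dots> < \<infinity>"
  proof -
    have "integrable lborel (\<lambda>y. indicator (cball 0 (2 * r)) y *\<^sub>R N y)"
      by (intro borel_integrable_compact continuous_on_subset[OF cont]) auto
    then have "(\<integral>\<^sup>+y. ennreal (norm (indicator (cball 0 (2 * r)) y *\<^sub>R N y)) \<partial>lborel) < \<infinity>"
      by (simp add: integrable_iff_bounded)
    moreover have "(\<integral>\<^sup>+y. ennreal (indicator (cball 0 (2 * r)) y *\<^sub>R N y) \<partial>lborel) \<le>
      (\<integral>\<^sup>+y. ennreal (norm (indicator (cball 0 (2 * r)) y *\<^sub>R N y)) \<partial>lborel)"
      by (intro nn_integral_mono ennreal_leI) auto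
    ultimately show ?thesis by (rule order_le_less_trans[rotated])
  qed
  finally show ?thesis
    by (intro integrableI_bounded) (auto simp: case_prod_beta)
qed

context sigma_finite_measure
begin

text \<open>Rectangles form an intersection-stable generator, and vanishing integrals pass to
  complements and disjoint unions. Self-adjointness, tested on indicators, speaks of rectangles
  only.\<close>

lemma AE_zero_of_rectangles:
  fixes D :: "'a \<times> 'a \<Rightarrow> complex"
  assumes D: "integrable (M \<Otimes>\<^sub>M M) D"
    and rect: "\<And>A C. A \<in> sets M \<Longrightarrow> C \<in> sets M \<Longrightarrow> (LINT z:A \<times> C|(M \<Otimes>\<^sub>M M). D z) = 0"
  shows "AE z in M \<Otimes>\<^sub>M M. D z = 0"
proof -
  interpret pair: pair_sigma_finite M M ..
  show ?thesis
proof (rule pair.density_zero[OF D])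
  fix Z assume "Z \<in> sets (M \<Otimes>\<^sub>M M)"
  then have Z: "Z \<in> sigma_sets (space M \<times> space M) {a \<times> b |a b. a \<in> sets M \<and> b \<in> sets M}"
    by (simp add: sets_pair_measure)
  have "{a \<times> b |a b. a \<in> sets M \<and> b \<in> sets M} \<subseteq> Pow (space M \<times> space M)"
    by (auto dest: sets.sets_into_space)
  from Int_stable_pair_measure_generator this Z
  show "(LINT z:Z|(M \<Otimes>\<^sub>M M). D z) = 0"
  proof (induction rule: sigma_sets_induct_disjoint)
    case (basic A)
    then show ?case using rect by auto
  next
    case empty
    then show ?case by (simp add: set_lebesgue_integral_def)
  next
    case (compl A)
    then have A: "A \<in> sets (M \<Otimes>\<^sub>M M)" by (simp add: sets_pair_measure)
    have sp: "space M \<times> space M \<in> sets (M \<Otimes>\<^sub>M M)" by auto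
    have si: "set_integrable (M \<Otimes>\<^sub>M M) B D" if "B \<in> sets (M \<Otimes>\<^sub>M M)" for B
      using D that unfolding set_integrable_def by (rule integrable_mult_indicator[rotated])
    have "A \<subseteq> space M \<times> space M" using sets.sets_into_space[OF A] by (simp add: space_pair_measure)
    then have "(LINT z:space M \<times> space M|(M \<Otimes>\<^sub>M M). D z) =
      (LINT z:A|(M \<Otimes>\<^sub>M M). D z) + (LINT z:space M \<times> space M - A|(M \<Otimes>\<^sub>M M). D z)"
      using A sp si by (subst set_integral_Un[symmetric]) (auto simp: Un_absorb1)
    then show ?case using compl rect[of "space M" "space M"] by simp
  next
    case (union A)
    then have A: "A i \<in> sets (M \<Otimes>\<^sub>M M)" for i by (auto simp: sets_pair_measure)
    have si: "set_integrable (M \<Otimes>\<^sub>M M) (\<Union>i. A i) D"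
      using D A unfolding set_integrable_def by (intro integrable_mult_indicator sets.countable_UN) auto
    have "(LINT z:(\<Union>i. A i)|(M \<Otimes>\<^sub>M M). D z) = (\<Sum>i. LINT z:A i|(M \<Otimes>\<^sub>M M). D z)"
      by (rule lebesgue_integral_countable_add[OF A _ si])
        (use union(1) in \<open>auto simp: disjoint_family_on_def\<close>)
    then show ?case using union by simp
  qed
qed
qed

end

lemma indicator_L2:
  assumes "A \<in> sets N" "emeasure N A < \<infinity>"
  shows "(\<lambda>x. indicator A x :: complex) \<in> L2 N"
proof -
  have "(\<lambda>x. (cmod (indicator A x))\<^sup>2) = (indicator A :: _ \<Rightarrow> real)"
    by (auto simp: indicator_def)
  then show ?thesis
    using assms by (auto simp: L2_def intro!: integrable_real_indicator)
qed

lemma cnj_indicator [simp]: "cnj (indicator A x) = indicator A x"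
  by (simp add: indicator_def)

text \<open>Testing self-adjointness on indicators of two bounded sets equates the integrals of
  \<open>K\<close> and of its conjugate transpose over every bounded rectangle; local integrability
  allows the iterated integrals to be read as double ones.\<close>

lemma kernel_hermitian_lborel:
  fixes K :: "real ^ 'd \<Rightarrow> real ^ 'd \<Rightarrow> complex"
  assumes op: "L2_operator lborel T" and ker: "integral_kernel lborel T K" and sa: "L2_self_adjoint lborel T" and reg: "regular_kernel T K"
  shows "AE z in lborel2. K (snd z) (fst z) = cnj (K (fst z) (snd z))"
proof -
  have K [measurable]: "case_prod K \<in> borel_measurable lborel2"
    using ker by (simp add: integral_kernel_def)
  have K' [measurable]: "(\<lambda>z. K (snd z) (fst z)) \<in> borel_measurable lborel2"
    using measurable_compose[OF measurable_Pair[OF measurable_snd measurable_fst] K] by simp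
  have T: "AE x in lborel. T f x = (\<integral>y. K x y * f y \<partial>lborel)" if "f \<in> L2 lborel" for f
    using ker that by (force simp: integral_kernel_def)
  have main: "AE z in lborel2. indicator (B \<times> B) z *\<^sub>R (K (fst z) (snd z) - cnj (K (snd z) (fst z))) = 0"
    if B: "B \<in> bounded_sets lborel" for B
  proof (rule lborel.AE_zero_of_rectangles)
    have Bs [measurable]: "B \<in> sets borel" and Bb: "bounded B" using B by (auto simp: bounded_sets_def)
    have int: "integrable lborel2 (\<lambda>z. indicator (B \<times> B) z *\<^sub>R K (fst z) (snd z))"
      using regular_kernel_locally_integrable[OF K reg B] unfolding case_prod_unfold prod.collapse .
    have int': "integrable lborel2 (\<lambda>z. indicator (B \<times> B) z *\<^sub>R cnj (K (snd z) (fst z)))"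
    proof -
      have "integrable lborel2 (\<lambda>(x, y). (\<lambda>z. indicator (B \<times> B) z *\<^sub>R K (fst z) (snd z)) (y, x))"
        by (rule lborel_pair.integrable_product_swap[OF int])
      then have "integrable lborel2 (\<lambda>z. cnj (indicator (B \<times> B) (snd z, fst z) *\<^sub>R K (snd z) (fst z)))"
        unfolding case_prod_unfold fst_conv snd_conv by (rule integrable_cnj)
      then show ?thesis
        by (rule Bochner_Integration.integrable_cong[THEN iffD1, rotated 2]) (auto simp: indicator_def)
    qed
    show "integrable lborel2 (\<lambda>z. indicator (B \<times> B) z *\<^sub>R (K (fst z) (snd z) - cnj (K (snd z) (fst z))))"
      using Bochner_Integration.integrable_diff[OF int int'] by (simp add: scaleR_diff_right)
    fix C A :: "(real ^ 'd) set" assume CA: "C \<in> sets lborel" "A \<in> sets lborel"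
    \<comment> \<open>Cutting with \<open>B\<close> gives the sides finite measure, so that their
      indicators belong to \<open>L2\<close>.\<close>
    define C' A' where "C' = C \<inter> B" and "A' = A \<inter> B"
    have [measurable]: "C' \<in> sets borel" "A' \<in> sets borel" using CA by (auto simp: C'_def A'_def)
    have fin: "emeasure lborel C' < \<infinity>" "emeasure lborel A' < \<infinity>"
      using emeasure_bounded_finite[OF bounded_subset[OF Bb], of C'] emeasure_bounded_finite[OF bounded_subset[OF Bb], of A']
      by (auto simp: C'_def A'_def)
    have L: "(\<lambda>x. indicator C' x :: complex) \<in> L2 lborel" "(\<lambda>x. indicator A' x :: complex) \<in> L2 lborel"
      using fin by (auto intro!: indicator_L2)
    have iter: "integrable lborel2 (\<lambda>z. indicator (U \<times> V) z *\<^sub>R K (fst z) (snd z))"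
        "L2_inner lborel (T (\<lambda>x. indicator V x)) (\<lambda>x. indicator U x) =
          (\<integral>z. indicator (U \<times> V) z *\<^sub>R K (fst z) (snd z) \<partial>lborel2)"
      if U: "U \<in> sets borel" "U \<subseteq> B" and V: "V \<in> sets borel" "V \<subseteq> B" "(\<lambda>x. indicator V x :: complex) \<in> L2 lborel"
        for U V
    proof -
      have "integrable lborel2 (\<lambda>z. indicator (U \<times> V) z *\<^sub>R (indicator (B \<times> B) z *\<^sub>R K (fst z) (snd z)))"
        using U V by (intro integrable_mult_indicator int) auto
      moreover have "(\<lambda>z. indicator (U \<times> V) z *\<^sub>R (indicator (B \<times> B) z *\<^sub>R K (fst z) (snd z))) =
        (\<lambda>z. indicator (U \<times> V) z *\<^sub>R K (fst z) (snd z))"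
        using U V by (auto simp: indicator_def fun_eq_iff)
      ultimately show i: "integrable lborel2 (\<lambda>z. indicator (U \<times> V) z *\<^sub>R K (fst z) (snd z))"
        by simp
      have "L2_inner lborel (T (\<lambda>x. indicator V x)) (\<lambda>x. indicator U x) =
        (\<integral>x. (\<integral>y. K x y * indicator V y \<partial>lborel) * cnj (indicator U x) \<partial>lborel)"
        unfolding L2_inner_def
      proof (rule integral_cong_AE)
        have "T (\<lambda>x. indicator V x) \<in> borel_measurable lborel"
          using op V(3) by (auto simp: L2_operator_def L2_def)
        then show "(\<lambda>x. T (\<lambda>x. indicator V x) x * cnj (indicator U x)) \<in> borel_measurable lborel"
          unfolding cnj_indicator using U by measurable
        show "(\<lambda>x. (\<integral>y. K x y * indicator V y \<partial>lborel) * cnj (indicator U x)) \<in> borel_measurable lborel"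
          unfolding cnj_indicator using U V by measurable
      qed (use T[OF V(3)] in auto)
      also have "\<dots> = (\<integral>x. (\<integral>y. indicator (U \<times> V) (x, y) *\<^sub>R K x y \<partial>lborel) \<partial>lborel)"
      proof (rule Bochner_Integration.integral_cong[OF refl])
        fix x
        show "(\<integral>y. K x y * indicator V y \<partial>lborel) * cnj (indicator U x) = (\<integral>y. indicator (U \<times> V) (x, y) *\<^sub>R K x y \<partial>lborel)"
        proof (cases "x \<in> U")
          case True
          then show ?thesis by (auto intro!: Bochner_Integration.integral_cong simp: indicator_def)
        qed (simp add: indicator_def)
      qed
      also have "\<dots> = (\<integral>z. indicator (U \<times> V) z *\<^sub>R K (fst z) (snd z) \<partial>lborel2)"
        using lborel_pair.integral_fst'[OF i] by simp
      finally show "L2_inner lborel (T (\<lambda>x. indicator V x)) (\<lambda>x. indicator U x) =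
          (\<integral>z. indicator (U \<times> V) z *\<^sub>R K (fst z) (snd z) \<partial>lborel2)" .
    qed
    have sub: "C' \<subseteq> B" "A' \<subseteq> B" by (auto simp: C'_def A'_def)
    note i1 = iter[of C' A', OF _ sub(1) _ sub(2) L(2), simplified]
    note i2 = iter[of A' C', OF _ sub(2) _ sub(1) L(1), simplified]
    have "(\<integral>z. indicator (C' \<times> A') z *\<^sub>R K (fst z) (snd z) \<partial>lborel2) =
      L2_inner lborel (\<lambda>x. indicator A' x) (T (\<lambda>x. indicator C' x))"
      using sa L i1(2) by (simp add: L2_self_adjoint_def)
    also have "\<dots> = cnj (L2_inner lborel (T (\<lambda>x. indicator C' x)) (\<lambda>x. indicator A' x))"
      unfolding L2_inner_def
      by (rule trans[OF _ Bochner_Integration.integral_cnj]) (auto intro!: Bochner_Integration.integral_cong simp: mult.commute)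
    also have "\<dots> = cnj (\<integral>z. indicator (A' \<times> C') z *\<^sub>R K (fst z) (snd z) \<partial>lborel2)"
      using i2(2) by simp
    also have "\<dots> = cnj (\<integral>(x, y). indicator (A' \<times> C') (y, x) *\<^sub>R K y x \<partial>lborel2)"
      using lborel_pair.integral_product_swap[of "\<lambda>z. indicator (A' \<times> C') z *\<^sub>R K (fst z) (snd z)"] i2(1)
      by (simp add: borel_measurable_integrable)
    also have "\<dots> = (\<integral>z. indicator (C' \<times> A') z *\<^sub>R cnj (K (snd z) (fst z)) \<partial>lborel2)"
      unfolding case_prod_unfold
      by (rule trans[OF Bochner_Integration.integral_cnj[symmetric]], rule Bochner_Integration.integral_cong) (auto simp: indicator_def)
    finally have eq: "(\<integral>z. indicator (C' \<times> A') z *\<^sub>R K (fst z) (snd z) \<partial>lborel2) =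
      (\<integral>z. indicator (C' \<times> A') z *\<^sub>R cnj (K (snd z) (fst z)) \<partial>lborel2)" .
    have j: "integrable lborel2 (\<lambda>z. indicator (C' \<times> A') z *\<^sub>R cnj (K (snd z) (fst z)))"
    proof -
      have "integrable lborel2 (\<lambda>z. indicator (C' \<times> A') z *\<^sub>R (indicator (B \<times> B) z *\<^sub>R cnj (K (snd z) (fst z))))"
        by (intro integrable_mult_indicator int') auto
      moreover have "(\<lambda>z. indicator (C' \<times> A') z *\<^sub>R (indicator (B \<times> B) z *\<^sub>R cnj (K (snd z) (fst z)))) =
        (\<lambda>z. indicator (C' \<times> A') z *\<^sub>R cnj (K (snd z) (fst z)))"
        by (auto simp: indicator_def fun_eq_iff C'_def A'_def)
      ultimately show ?thesis by simp
    qed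
    have "(LINT z:C \<times> A|lborel2. indicator (B \<times> B) z *\<^sub>R (K (fst z) (snd z) - cnj (K (snd z) (fst z)))) =
      (\<integral>z. indicator (C' \<times> A') z *\<^sub>R K (fst z) (snd z) - indicator (C' \<times> A') z *\<^sub>R cnj (K (snd z) (fst z)) \<partial>lborel2)"
      unfolding set_lebesgue_integral_def
      by (intro Bochner_Integration.integral_cong) (auto simp: indicator_def C'_def A'_def)
    also have "\<dots> = 0"
      using i1(1) j eq by simp
    finally show "(LINT z:C \<times> A|lborel2. indicator (B \<times> B) z *\<^sub>R (K (fst z) (snd z) - cnj (K (snd z) (fst z)))) = 0" .
  qed
  have "AE z in lborel2. \<forall>n::nat. indicator (cball 0 (real n) \<times> cball 0 (real n)) z *\<^sub>R
      (K (fst z) (snd z) - cnj (K (snd z) (fst z))) = 0"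
    unfolding AE_all_countable by (intro allI main) (simp add: bounded_sets_def)
  then show ?thesis
  proof eventually_elim
    case (elim z)
    obtain n :: nat where "max (norm (fst z)) (norm (snd z)) \<le> real n" using real_arch_simple by blast
    then have "z \<in> cball 0 (real n) \<times> cball 0 (real n)" by (cases z) auto
    with elim[rule_format, of n] have "K (fst z) (snd z) = cnj (K (snd z) (fst z))" by simp
    then show ?case by simp
  qed
qed

text \<open>On the lattice the indicators of single points are test functions that recover every
  value of \<open>K\<close>, and almost everywhere means everywhere.\<close>

lemma (in one_particle_space) kernel_hermitian:
  assumes "determinantal_kernel M K"
  shows "AE z in M \<Otimes>\<^sub>M M. K (snd z) (fst z) = cnj (K (fst z) (snd z))"
proof -
  obtain T where T: "L2_operator M T" "L2_self_adjoint M T" "integral_kernel M T K" "M = lborel \<longrightarrow> regular_kernel T K"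
    using assms by (auto simp: determinantal_kernel_def)
  show ?thesis
  proof (rule M_cases')
    assume "M = lborel"
    with T show ?thesis using kernel_hermitian_lborel[of T K] by metis
  next
    assume M: "M = count_space int_lattice"
    have MM: "M \<Otimes>\<^sub>M M = count_space (int_lattice \<times> int_lattice)"
      unfolding M by (rule pair_measure_countable) (rule countable_int_lattice)+
    have ind: "(\<lambda>u. indicator {y} u :: complex) \<in> L2 M" if "y \<in> int_lattice" for y
      using that by (intro indicator_L2) (auto simp: M)
    have sum: "(\<integral>u. f u * indicator {y} u \<partial>M) = f y" if "y \<in> int_lattice" for f :: "_ \<Rightarrow> complex" and y
    proof -
      have "{u \<in> int_lattice. f u * indicator {y} u \<noteq> 0} = (if f y = 0 then {} else {y})"
        using that by (auto simp: indicator_def split: if_splits)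
      then have "(\<integral>u. f u * indicator {y} u \<partial>M) = (\<Sum>u\<in>(if f y = 0 then {} else {y}). f u * indicator {y} u)"
        unfolding M by (subst lebesgue_integral_count_space_finite_support) simp_all
      then show ?thesis by simp
    qed
    have Tv: "T (\<lambda>u. indicator {y} u) x = K x y" if "x \<in> int_lattice" "y \<in> int_lattice" for x y
    proof -
      have "AE x in M. T (\<lambda>u. indicator {y} u) x = (\<integral>u. K x u * indicator {y} u \<partial>M)"
        using T(3) ind[OF that(2)] by (force simp: integral_kernel_def)
      then have "AE x in M. T (\<lambda>u. indicator {y} u) x = K x y"
        by (simp only: sum[OF that(2)])
      with that(1) show ?thesis unfolding M AE_count_space by blast
    qed
    have "K y x = cnj (K x y)" if xy: "x \<in> int_lattice" "y \<in> int_lattice" for x y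
    proof -
      have "L2_inner M (T (\<lambda>u. indicator {y} u)) (\<lambda>u. indicator {x} u) = L2_inner M (\<lambda>u. indicator {y} u) (T (\<lambda>u. indicator {x} u))"
        using T(2) ind xy by (simp add: L2_self_adjoint_def)
      moreover have "L2_inner M (T (\<lambda>u. indicator {y} u)) (\<lambda>u. indicator {x} u) = K x y"
        unfolding L2_inner_def using sum[of x "T (\<lambda>u. indicator {y} u)"] xy Tv by simp
      moreover have "L2_inner M (\<lambda>u. indicator {y} u) (T (\<lambda>u. indicator {x} u)) = cnj (K y x)"
        unfolding L2_inner_def using sum[of y "\<lambda>u. cnj (T (\<lambda>u. indicator {x} u) u)"] xy Tv
        by (simp add: mult.commute)
      ultimately show ?thesis by simp
    qed
    then show ?thesis unfolding MM AE_count_space by (metis mem_Times_iff)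
  qed
qed

subsection \<open>Counting particles\<close>

lemma falling_binomial: "falling n k = fact k * (n choose k)"
proof (cases "k \<le> n")
  case True
  have "fact n = fact (n - k) * (fact k * (n choose k))"
    using binomial_fact_lemma[OF True] by (simp add: mult_ac)
  then show ?thesis using True by (simp add: falling_def)
qed (simp add: falling_def binomial_eq_0)

lemma falling_0 [simp]: "falling n 0 = 1" and falling_1: "falling n (Suc 0) = n"
  by (simp_all add: falling_binomial)

lemma falling_2: "falling n 2 = n * (n - 1)"
proof -
  have "even (n * (n - 1))" by (cases n) auto
  then show ?thesis by (simp add: falling_binomial choose_two)
qed

lemma configurations_finite:
  "\<xi> \<in> configurations E \<Longrightarrow> bounded B \<Longrightarrow> finite {x. x \<in> B \<and> \<xi> x \<noteq> 0}"
  by (auto simp: configurations_def)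

lemma num_particles_Un:
  assumes "\<xi> \<in> configurations E" "bounded A" "bounded B" "A \<inter> B = {}"
  shows "num_particles (A \<union> B) \<xi> = num_particles A \<xi> + num_particles B \<xi>"
proof -
  have "{x. x \<in> A \<union> B \<and> \<xi> x \<noteq> 0} = {x. x \<in> A \<and> \<xi> x \<noteq> 0} \<union> {x. x \<in> B \<and> \<xi> x \<noteq> 0}" by auto
  then show ?thesis
    unfolding num_particles_def using configurations_finite[OF assms(1)] assms
    by (simp only:, intro sum.union_disjoint) auto
qed

lemma num_particles_empty [simp]: "num_particles {} \<xi> = 0"
  by (simp add: num_particles_def)

lemma num_particles_UN:
  assumes "\<xi> \<in> configurations E" "finite I" "\<And>i. i \<in> I \<Longrightarrow> bounded (A i)" "disjoint_family_on A I"
  shows "num_particles (\<Union>i\<in>I. A i) \<xi> = (\<Sum>i\<in>I. num_particles (A i) \<xi>)"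
  using assms(2-4)
proof (induction I)
  case (insert i I)
  have "num_particles (A i \<union> (\<Union>i\<in>I. A i)) \<xi> = num_particles (A i) \<xi> + num_particles (\<Union>i\<in>I. A i) \<xi>"
    using insert by (intro num_particles_Un[OF assms(1)]) (auto simp: disjoint_family_on_def)
  then show ?case using insert by (simp add: disjoint_family_on_def)
qed simp

lemma num_particles_mono:
  assumes "\<xi> \<in> configurations E" "bounded B" "A \<subseteq> B"
  shows "num_particles A \<xi> \<le> num_particles B \<xi>"
  unfolding num_particles_def using configurations_finite[OF assms(1,2)] assms(3)
  by (intro sum_mono2) auto

lemma num_particles_shift:
  "num_particles B (shift t \<xi>) = num_particles ((\<lambda>x. x - t) ` B) \<xi>"
proof -
  have "{x. x \<in> (\<lambda>x. x - t) ` B \<and> \<xi> x \<noteq> 0} = (\<lambda>x. x - t) ` {x. x \<in> B \<and> \<xi> (x - t) \<noteq> 0}" by auto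
  then show ?thesis
    unfolding num_particles_def shift_def by (simp add: sum.reindex inj_on_def)
qed

lemma shift_configurations:
  fixes t :: "'a::real_normed_vector"
  assumes "\<And>x. x \<in> E \<Longrightarrow> x + t \<in> E" "\<xi> \<in> configurations E"
  shows "shift t \<xi> \<in> configurations E"
proof -
  have "finite {x \<in> B. \<xi> (x - t) \<noteq> 0}" if "bounded B" for B
  proof -
    have "finite {x. x \<in> (\<lambda>x. x - t) ` B \<and> \<xi> x \<noteq> 0}"
      using assms(2) bounded_translation_minus[OF that, of t] by (rule configurations_finite)
    moreover have "{x \<in> B. \<xi> (x - t) \<noteq> 0} \<subseteq> (\<lambda>x. x + t) ` {x. x \<in> (\<lambda>x. x - t) ` B \<and> \<xi> x \<noteq> 0}"
      by (auto simp: image_iff intro!: exI[of _ "_ - t"])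
    ultimately show ?thesis by (meson finite_imageI finite_subset)
  qed
  moreover have "\<xi> (x - t) = 0" if "x \<notin> E" for x
  proof -
    have "x - t \<notin> E" using assms(1)[of "x - t"] that by auto
    then show ?thesis using assms(2) by (simp add: configurations_def)
  qed
  ultimately show ?thesis using assms(2) by (auto simp: configurations_def shift_def)
qed

lemma shift_0 [simp]: "shift 0 \<xi> = \<xi>" and shift_shift: "shift s (shift t \<xi>) = shift (s + t) \<xi>"
  by (auto simp: shift_def algebra_simps)

locale invariant_determinantal_field = one_particle_space M
  for M :: "(real ^ 'd) measure" +
  fixes P :: "'d config measure" and K :: "real ^ 'd \<Rightarrow> real ^ 'd \<Rightarrow> complex"
  assumes field: "determinantal_field M P K"
    and invariant: "translation_invariant M P"
begin

sublocale P: prob_space P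
  using field by (simp add: determinantal_field_def random_point_field_def)

lemma sets_P: "sets P = sets (configuration_algebra M)"
  using field by (simp add: determinantal_field_def random_point_field_def)

lemma space_P: "space P = configurations (space M)"
  using sets_eq_imp_space_eq[OF sets_P] by (simp add: configuration_algebra_def space_measure_of_conv)

abbreviation cylinders :: "'d config set set" where
  "cylinders \<equiv> {{\<xi> \<in> configurations (space M). num_particles B \<xi> = n} | B n. B \<in> bounded_sets M}"

lemma sets_P_sigma: "sets P = sigma_sets (configurations (space M)) cylinders"
  unfolding sets_P configuration_algebra_def by (rule sets_measure_of) auto

lemma num_particles_measurable [measurable]:
  assumes "B \<in> bounded_sets M"
  shows "num_particles B \<in> measurable P (count_space UNIV)"
proof (rule measurableI)
  fix N :: "nat set"
  have "num_particles B -` N \<inter> space P = (\<Union>n\<in>N. {\<xi> \<in> configurations (space M). num_particles B \<xi> = n})"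
    by (auto simp: space_P)
  also have "\<dots> \<in> sets P"
    using assms by (intro sets.countable_UN'') (auto simp: sets_P_sigma intro!: sigma_sets.Basic)
  finally show "num_particles B -` N \<inter> space P \<in> sets P" .
qed simp

lemma shift_space: "t \<in> space M \<Longrightarrow> \<xi> \<in> space P \<Longrightarrow> shift t \<xi> \<in> space P"
  unfolding space_P by (rule shift_configurations) (auto intro: space_closed)

lemma shift_measurable [measurable]:
  assumes t: "t \<in> space M"
  shows "shift t \<in> measurable P P"
proof -
  have "shift t \<in> measurable P (sigma (configurations (space M)) cylinders)"
  proof (rule measurable_measure_of)
    show "shift t \<in> space P \<rightarrow> configurations (space M)"
      using shift_space[OF t] by (auto simp: space_P)
    fix Y assume "Y \<in> cylinders"
    then obtain B n where B: "B \<in> bounded_sets M"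
      and Y: "Y = {\<xi> \<in> configurations (space M). num_particles B \<xi> = n}" by auto
    have "shift t -` Y \<inter> space P = num_particles ((\<lambda>x. x - t) ` B) -` {n} \<inter> space P"
      using shift_space[OF t] by (auto simp: Y num_particles_shift space_P)
    also have "\<dots> \<in> sets P"
      by (intro measurable_sets[OF num_particles_measurable] bounded_sets_translate B t) auto
    finally show "shift t -` Y \<inter> space P \<in> sets P" .
  qed auto
  moreover have "measurable P (sigma (configurations (space M)) cylinders) = measurable P P"
    by (rule measurable_cong_sets) (auto simp: sets_P configuration_algebra_def)
  ultimately show ?thesis by simp
qed

text \<open>Invariance is stated for images under \<open>shift (- t)\<close>; on
  \<open>space P\<close> these are the preimages under \<open>shift t\<close>.\<close>

lemma distr_shift_P:
  assumes t: "t \<in> space M"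
  shows "distr P P (shift t) = P"
proof (rule measure_eqI)
  fix A assume "A \<in> sets (distr P P (shift t))"
  then have A: "A \<in> sets P" by simp
  have "shift t -` A \<inter> space P = shift (- t) ` A"
  proof (intro equalityI subsetI)
    fix \<xi> assume "\<xi> \<in> shift t -` A \<inter> space P"
    then show "\<xi> \<in> shift (- t) ` A"
      by (intro image_eqI[of _ _ "shift t \<xi>"]) (auto simp: shift_shift)
  next
    fix \<xi> assume "\<xi> \<in> shift (- t) ` A"
    then show "\<xi> \<in> shift t -` A \<inter> space P"
      using shift_space[OF space_closed(3)[OF t]] sets.sets_into_space[OF A] by (auto simp: shift_shift)
  qed
  then have "emeasure (distr P P (shift t)) A = ennreal (measure P (shift (- t) ` A))"
    using A t by (simp add: emeasure_distr P.emeasure_eq_measure)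
  also have "\<dots> = emeasure P A"
    using invariant A t by (simp add: translation_invariant_def P.emeasure_eq_measure)
  finally show "emeasure (distr P P (shift t)) A = emeasure P A" .
qed simp

lemma nn_integral_shift_P:
  "t \<in> space M \<Longrightarrow> f \<in> borel_measurable P \<Longrightarrow> (\<integral>\<^sup>+\<xi>. f (shift t \<xi>) \<partial>P) = (\<integral>\<^sup>+\<xi>. f \<xi> \<partial>P)"
  using nn_integral_distr[of "shift t" P P f] by (simp add: distr_shift_P)

lemma integral_shift_P:
  fixes f :: "_ \<Rightarrow> 'c::{banach, second_countable_topology}"
  shows "t \<in> space M \<Longrightarrow> f \<in> borel_measurable P \<Longrightarrow> (\<integral>\<xi>. f (shift t \<xi>) \<partial>P) = (\<integral>\<xi>. f \<xi> \<partial>P)"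
  using integral_distr[of "shift t" P P f] by (simp add: distr_shift_P)

lemma integrable_shift_P:
  fixes f :: "_ \<Rightarrow> 'c::{banach, second_countable_topology}"
  shows "t \<in> space M \<Longrightarrow> integrable P f \<Longrightarrow> integrable P (\<lambda>\<xi>. f (shift t \<xi>))"
  using integrable_distr[of "shift t" P P f] by (simp add: distr_shift_P)

subsection \<open>Factorial monomials and their expectations\<close>

text \<open>\<open>L\<close> lists one set for each point argument of the correlation function that
  computes the expectation, so its length is the degree. \<open>S\<close> also covers sets with
  exponent \<open>0\<close>.\<close>

definition falling_monomial ::
    "(real ^ 'd) set \<Rightarrow> (real ^ 'd) set list \<Rightarrow> ('d config \<Rightarrow> nat) \<Rightarrow> bool" where
  "falling_monomial S L F \<longleftrightarrow> (\<exists>m A k. (\<forall>i<m. A i \<in> bounded_sets M) \<and> disjoint_family_on A {..<m} \<and>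
     (\<Union>i<m. A i) = S \<and> L = concat (map (\<lambda>i. replicate (k i) (A i)) [0..<m]) \<and>
     F = (\<lambda>\<xi>. \<Prod>i<m. falling (num_particles (A i) \<xi>) (k i)))"

lemma falling_monomialI:
  assumes "\<And>i. i < m \<Longrightarrow> A i \<in> bounded_sets M" "disjoint_family_on A {..<m}"
  shows "falling_monomial (\<Union>i<m. A i) (concat (map (\<lambda>i. replicate (k i) (A i)) [0..<m]))
    (\<lambda>\<xi>. \<Prod>i<m. falling (num_particles (A i) \<xi>) (k i))"
  unfolding falling_monomial_def using assms by blast

lemma falling_monomial_support:
  assumes "falling_monomial S L F"
  shows "S \<in> bounded_sets M" "\<And>B. B \<in> set L \<Longrightarrow> B \<in> bounded_sets M \<and> B \<subseteq> S"
proof -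
  obtain m A k where A: "\<forall>i<m. A i \<in> bounded_sets M" "(\<Union>i<m. A i) = S"
    "L = concat (map (\<lambda>i. replicate (k i) (A i)) [0..<m])"
    using assms unfolding falling_monomial_def by blast
  show "S \<in> bounded_sets M" using A(1) unfolding A(2)[symmetric] by (intro bounded_sets_UN) auto
  fix B assume "B \<in> set L"
  then obtain i where "i < m" "B = A i" by (auto simp: A(3) split: if_splits)
  then show "B \<in> bounded_sets M \<and> B \<subseteq> S" using A(1,2) by blast
qed

lemma falling_monomial_measurable:
  assumes "falling_monomial S L F"
  shows "F \<in> measurable P (count_space UNIV)"
proof -
  obtain m :: nat and A k where A: "\<forall>i<m. A i \<in> bounded_sets M"
    and F: "F = (\<lambda>\<xi>. \<Prod>i<m. falling (num_particles (A i) \<xi>) (k i))"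
    using assms unfolding falling_monomial_def by blast
  have "(\<lambda>\<xi>. falling (num_particles (A i) \<xi>) (k i)) \<in> measurable P (count_space UNIV)" if "i < m" for i
    using A that by (intro measurable_compose[OF num_particles_measurable]) auto
  then have "(\<lambda>\<xi>. \<Prod>i<j. falling (num_particles (A i) \<xi>) (k i)) \<in> measurable P (count_space UNIV)" if "j \<le> m" for j
    using that by (induction j) auto
  then show ?thesis unfolding F by simp
qed

text \<open>Factorial moments are prescribed for disjoint families only, so disjoint supports are
  what makes a product again a single monomial.\<close>

lemma falling_monomial_mult:
  assumes F: "falling_monomial S L F" and G: "falling_monomial S' L' G" and disj: "S \<inter> S' = {}"
  shows "falling_monomial (S \<union> S') (L @ L') (\<lambda>\<xi>. F \<xi> * G \<xi>)"
proof -
  obtain m A k where A: "\<forall>i<m. A i \<in> bounded_sets M" "disjoint_family_on A {..<m}" "(\<Union>i<m. A i) = S"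
    "L = concat (map (\<lambda>i. replicate (k i) (A i)) [0..<m])"
    "F = (\<lambda>\<xi>. \<Prod>i<m. falling (num_particles (A i) \<xi>) (k i))"
    using F unfolding falling_monomial_def by blast
  obtain m' A' k' where A': "\<forall>i<m'. A' i \<in> bounded_sets M" "disjoint_family_on A' {..<m'}" "(\<Union>i<m'. A' i) = S'"
    "L' = concat (map (\<lambda>i. replicate (k' i) (A' i)) [0..<m'])"
    "G = (\<lambda>\<xi>. \<Prod>i<m'. falling (num_particles (A' i) \<xi>) (k' i))"
    using G unfolding falling_monomial_def by blast
  define C where "C i = (if i < m then A i else A' (i - m))" for i
  define c where "c i = (if i < m then k i else k' (i - m))" for i
  have split: "{..<m + m'} = {..<m} \<union> (\<lambda>i. i + m) ` {..<m'}"
  proof (intro equalityI subsetI)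
    fix x assume x: "x \<in> {..<m + m'}"
    show "x \<in> {..<m} \<union> (\<lambda>i. i + m) ` {..<m'}"
    proof (cases "x < m")
      case False
      then have "x = (x - m) + m" "x - m < m'" using x by auto
      then show ?thesis by blast
    qed simp
  qed auto
  have "C i \<in> bounded_sets M" if "i < m + m'" for i
    using A(1) A'(1) that by (auto simp: C_def)
  moreover have "disjoint_family_on C {..<m + m'}"
    unfolding disjoint_family_on_def
  proof (intro ballI impI)
    fix i j assume ij: "i \<in> {..<m + m'}" "j \<in> {..<m + m'}" "i \<noteq> j"
    have S: "A i \<subseteq> S" if "i < m" for i using A(3) that by auto
    have S': "A' (i - m) \<subseteq> S'" if "i < m + m'" "\<not> i < m" for i
    proof -
      have "i - m < m'" using that by auto
      then show ?thesis using A'(3) by auto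
    qed
    consider "i < m" "j < m" | "\<not> i < m" "\<not> j < m" | "i < m" "\<not> j < m" | "\<not> i < m" "j < m" by blast
    then show "C i \<inter> C j = {}"
    proof cases
      case 1
      then show ?thesis using A(2) ij by (simp add: C_def disjoint_family_on_def)
    next
      case 2
      then have "i - m < m'" "j - m < m'" "i - m \<noteq> j - m" using ij by auto
      with 2 show ?thesis using A'(2) by (simp add: C_def disjoint_family_on_def)
    next
      case 3
      then show ?thesis using S[of i] S'[of j] ij disj by (simp add: C_def) blast
    next
      case 4
      then show ?thesis using S[of j] S'[of i] ij disj by (simp add: C_def) blast
    qed
  qed
  moreover have "(\<Union>i<m + m'. C i) = S \<union> S'"
  proof -
    have "C (i + m) = A' i" for i by (simp add: C_def)
    then have "(\<Union>i\<in>{..<m}. C i) = S" "(\<Union>i\<in>(\<lambda>i. i + m) ` {..<m'}. C i) = S'"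
      by (simp_all only: image_image A'(3)) (simp add: C_def A(3)[symmetric])
    then show ?thesis unfolding split UN_Un by (simp only:)
  qed
  moreover have "L @ L' = concat (map (\<lambda>i. replicate (c i) (C i)) [0..<m + m'])"
  proof -
    have eq1: "[0..<m + m'] = [0..<m] @ map (\<lambda>i. i + m) [0..<m']"
      using upt_add_eq_append[of 0 m m'] map_add_upt[of m m'] by (simp add: add.commute)
    have eq2: "map (\<lambda>i. replicate (c i) (C i)) [0..<m] = map (\<lambda>i. replicate (k i) (A i)) [0..<m]"
      "map ((\<lambda>i. replicate (c i) (C i)) \<circ> (\<lambda>i. i + m)) [0..<m'] = map (\<lambda>i. replicate (k' i) (A' i)) [0..<m']"
      by (auto simp: C_def c_def)
    show ?thesis unfolding A(4) A'(4) eq1 map_append map_map concat_append eq2 ..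
  qed
  moreover have "(\<lambda>\<xi>. F \<xi> * G \<xi>) = (\<lambda>\<xi>. \<Prod>i<m + m'. falling (num_particles (C i) \<xi>) (c i))"
  proof
    fix \<xi>
    have "(\<Prod>i<m + m'. falling (num_particles (C i) \<xi>) (c i)) =
      (\<Prod>i<m. falling (num_particles (C i) \<xi>) (c i)) * (\<Prod>i\<in>(\<lambda>i. i + m) ` {..<m'}. falling (num_particles (C i) \<xi>) (c i))"
      unfolding split by (intro prod.union_disjoint) auto
    also have "\<dots> = F \<xi> * G \<xi>"
      unfolding A(5) A'(5) by (simp add: prod.reindex inj_on_def C_def c_def)
    finally show "F \<xi> * G \<xi> = (\<Prod>i<m + m'. falling (num_particles (C i) \<xi>) (c i))" by simp
  qed
  ultimately show ?thesis unfolding falling_monomial_def by blast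
qed

lemma falling_monomial_single:
  assumes "A \<in> bounded_sets M"
  shows "falling_monomial A (replicate k A) (\<lambda>\<xi>. falling (num_particles A \<xi>) k)"
  using falling_monomialI[of 1 "\<lambda>_. A" "\<lambda>_. k"] assms by (simp add: disjoint_family_on_def lessThan_Suc)

lemma falling_monomial_one: "falling_monomial {} [] (\<lambda>_. 1)"
  using falling_monomialI[of 0 "\<lambda>_. {}" "\<lambda>_. 0"] by (simp add: disjoint_family_on_def)

lemma falling_monomial_shift:
  assumes F: "falling_monomial S L F" and t: "t \<in> space M"
  shows "falling_monomial ((\<lambda>x. x - t) ` S) (map ((`) (\<lambda>x. x - t)) L) (\<lambda>\<xi>. F (shift t \<xi>))"
proof -
  obtain m A k where A: "\<forall>i<m. A i \<in> bounded_sets M" "disjoint_family_on A {..<m}" "(\<Union>i<m. A i) = S"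
    "L = concat (map (\<lambda>i. replicate (k i) (A i)) [0..<m])"
    "F = (\<lambda>\<xi>. \<Prod>i<m. falling (num_particles (A i) \<xi>) (k i))"
    using F unfolding falling_monomial_def by blast
  have "disjoint_family_on (\<lambda>i. (\<lambda>x. x - t) ` A i) {..<m}"
    using A(2) by (simp add: disjoint_family_on_def image_Int[symmetric] inj_on_def)
  moreover have "(\<lambda>x. x - t) ` A i \<in> bounded_sets M" if "i < m" for i
    using A(1) that t by (intro bounded_sets_translate) auto
  ultimately have "falling_monomial (\<Union>i<m. (\<lambda>x. x - t) ` A i)
      (concat (map (\<lambda>i. replicate (k i) ((\<lambda>x. x - t) ` A i)) [0..<m]))
      (\<lambda>\<xi>. \<Prod>i<m. falling (num_particles ((\<lambda>x. x - t) ` A i) \<xi>) (k i))"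
    by (intro falling_monomialI) auto
  then show ?thesis
    unfolding A(3)[symmetric] A(4,5) by (simp add: image_UN map_concat o_def num_particles_shift)
qed

section \<open>Correlation functions and almost-everywhere properties of the kernel\<close>

definition detK :: "nat \<Rightarrow> (nat \<Rightarrow> real ^ 'd) \<Rightarrow> complex" where
  "detK n x = mdet n (\<lambda>i j. K (x i) (x j))"

text \<open>Integrals are taken in the extended non-negative reals, so no integrability has to be
  carried along. Degree \<open>0\<close> is included, with the constant \<open>1\<close> and the
  empty determinant, so that constant monomials are no exception.\<close>

definition is_correlation :: "nat \<Rightarrow> ((nat \<Rightarrow> real ^ 'd) \<Rightarrow> real) \<Rightarrow> bool" where
  "is_correlation n \<rho> \<longleftrightarrow> \<rho> \<in> borel_measurable (powM {..<n}) \<and>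
     (\<forall>x \<in> space (powM {..<n}). 0 \<le> \<rho> x) \<and>
     (\<forall>B \<in> bounded_sets M. (\<integral>\<^sup>+x\<in>(\<Pi>\<^sub>E j\<in>{..<n}. B). ennreal (\<rho> x) \<partial>powM {..<n}) < \<infinity>) \<and>
     (AE x in powM {..<n}. complex_of_real (\<rho> x) = detK n x) \<and>
     (\<forall>S L F. falling_monomial S L F \<and> length L = n \<longrightarrow>
        (\<integral>\<^sup>+\<xi>. of_nat (F \<xi>) \<partial>P) = (\<integral>\<^sup>+x\<in>(\<Pi>\<^sub>E j\<in>{..<n}. L ! j). ennreal (\<rho> x) \<partial>powM {..<n}))"

lemma falling_monomialE:
  assumes "falling_monomial S L F"
  obtains m A k where "\<And>i. i < m \<Longrightarrow> A i \<in> bounded_sets M" "disjoint_family_on A {..<m}" "(\<Union>i<m. A i) = S"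
    "L = concat (map (\<lambda>i. replicate (k i) (A i)) [0..<m])" "length L = (\<Sum>i<m. k i)"
    "F = (\<lambda>\<xi>. \<Prod>i<m. falling (num_particles (A i) \<xi>) (k i))"
proof -
  obtain m A k where *: "\<forall>i<m. A i \<in> bounded_sets M" "disjoint_family_on A {..<m}" "(\<Union>i<m. A i) = S"
    "L = concat (map (\<lambda>i. replicate (k i) (A i)) [0..<m])"
    "F = (\<lambda>\<xi>. \<Prod>i<m. falling (num_particles (A i) \<xi>) (k i))"
    using assms unfolding falling_monomial_def by blast
  have "length L = (\<Sum>i<m. k i)"
    unfolding *(4) using sum_set_upt_conv_sum_list_nat[of k 0 m]
    by (simp add: length_concat o_def lessThan_atLeast0)
  with * show ?thesis by (intro that) auto
qed

lemma ex_correlation: "\<exists>\<rho>. is_correlation n \<rho>"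
proof (cases "n = 0")
  case True
  have "is_correlation 0 (\<lambda>_. 1)"
  proof -
    have "(\<integral>\<^sup>+\<xi>. of_nat (F \<xi>) \<partial>P) = 1" if "falling_monomial S [] F" for S F
    proof -
      from that have "F = (\<lambda>_. 1)"
        by (rule falling_monomialE) (auto intro!: prod.neutral)
      then show ?thesis by (simp add: P.emeasure_space_1)
    qed
    then show ?thesis
      by (auto simp: is_correlation_def detK_def power.nn_integral_empty)
  qed
  with True show ?thesis by blast
next
  case False
  then obtain \<rho> where \<rho>: "correlation_function M P n \<rho>"
      "AE x in powM {..<n}. complex_of_real (\<rho> x) = detK n x"
    using field by (auto simp: determinantal_field_def detK_def Suc_le_eq)
  have nn: "\<forall>x \<in> space (powM {..<n}). 0 \<le> \<rho> x"
    using \<rho>(1) by (simp add: correlation_function_def)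
  have "(\<integral>\<^sup>+x\<in>(\<Pi>\<^sub>E j\<in>{..<n}. B). ennreal (\<rho> x) \<partial>powM {..<n}) < \<infinity>" if "B \<in> bounded_sets M" for B
  proof -
    have "set_integrable (powM {..<n}) (\<Pi>\<^sub>E j\<in>{..<n}. B) \<rho>"
      using \<rho>(1) that by (simp add: correlation_function_def)
    then have "(\<integral>\<^sup>+x. ennreal (norm (indicator (\<Pi>\<^sub>E j\<in>{..<n}. B) x *\<^sub>R \<rho> x)) \<partial>powM {..<n}) < \<infinity>"
      unfolding set_integrable_def by (simp add: integrable_iff_bounded)
    also have "(\<integral>\<^sup>+x. ennreal (norm (indicator (\<Pi>\<^sub>E j\<in>{..<n}. B) x *\<^sub>R \<rho> x)) \<partial>powM {..<n}) =
      (\<integral>\<^sup>+x\<in>(\<Pi>\<^sub>E j\<in>{..<n}. B). ennreal (\<rho> x) \<partial>powM {..<n})"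
      using nn by (intro nn_integral_cong) (auto simp: indicator_def)
    finally show ?thesis .
  qed
  moreover have "(\<integral>\<^sup>+\<xi>. of_nat (F \<xi>) \<partial>P) = (\<integral>\<^sup>+x\<in>(\<Pi>\<^sub>E j\<in>{..<n}. L ! j). ennreal (\<rho> x) \<partial>powM {..<n})"
    if F: "falling_monomial S L F" and L: "length L = n" for S L F
    using F
  proof (rule falling_monomialE)
    fix m A k
    assume *: "\<And>i. i < m \<Longrightarrow> A i \<in> bounded_sets M" "disjoint_family_on A {..<m}"
      "L = concat (map (\<lambda>i. replicate (k i) (A i)) [0..<m])" "length L = (\<Sum>i<m. k i)"
      "F = (\<lambda>\<xi>. \<Prod>i<m. falling (num_particles (A i) \<xi>) (k i))"
    have "\<forall>m A k. (\<forall>i<m. A i \<in> bounded_sets M) \<and> disjoint_family_on A {..<m} \<and> (\<Sum>i<m. k i) = n \<longrightarrow>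
        (\<integral>\<^sup>+\<xi>. of_nat (\<Prod>i<m. falling (num_particles (A i) \<xi>) (k i)) \<partial>P) =
        (\<integral>\<^sup>+x\<in>power_box n m A k. ennreal (\<rho> x) \<partial>powM {..<n})"
      using \<rho>(1) unfolding correlation_function_def by blast
    from this[rule_format, of m A k] show ?thesis
      using * L by (simp add: power_box_def)
  qed
  ultimately have "is_correlation n \<rho>"
    using \<rho> nn unfolding is_correlation_def correlation_function_def by blast
  then show ?thesis by blast
qed

definition rho :: "nat \<Rightarrow> (nat \<Rightarrow> real ^ 'd) \<Rightarrow> real" where
  "rho n = (SOME \<rho>. is_correlation n \<rho>)"

lemma rho: "is_correlation n (rho n)"
  unfolding rho_def by (rule someI_ex[OF ex_correlation])

lemma rho_measurable [measurable]: "rho n \<in> borel_measurable (powM {..<n})"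
  and rho_nonneg: "x \<in> space (powM {..<n}) \<Longrightarrow> 0 \<le> rho n x"
  and rho_det: "AE x in powM {..<n}. complex_of_real (rho n x) = detK n x"
  and rho_finite: "B \<in> bounded_sets M \<Longrightarrow> (\<integral>\<^sup>+x\<in>(\<Pi>\<^sub>E j\<in>{..<n}. B). ennreal (rho n x) \<partial>powM {..<n}) < \<infinity>"
  using rho[of n] by (auto simp: is_correlation_def)

lemma nn_expectation_monomial:
  assumes "falling_monomial S L F" "length L = n"
  shows "(\<integral>\<^sup>+\<xi>. of_nat (F \<xi>) \<partial>P) = (\<integral>\<^sup>+x\<in>(\<Pi>\<^sub>E j\<in>{..<n}. L ! j). ennreal (rho n x) \<partial>powM {..<n})"
  using rho[of n] assms unfolding is_correlation_def by blast

definition gK :: "real ^ 'd \<Rightarrow> real" where "gK x = Re (K x x)"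

lemma K_measurable [measurable]: "case_prod K \<in> borel_measurable (M \<Otimes>\<^sub>M M)"
  using field by (auto simp: determinantal_field_def determinantal_kernel_def integral_kernel_def)

lemma gK_measurable [measurable]: "gK \<in> borel_measurable M"
proof -
  have "(\<lambda>x. (x, x)) \<in> measurable M (M \<Otimes>\<^sub>M M)" by simp
  from measurable_compose[OF this K_measurable] show ?thesis
    unfolding gK_def by simp
qed

text \<open>The correlation function of one point is \<open>K x x\<close> almost everywhere, and it
  is real and non-negative.\<close>

lemma AE_diagonal:
  fixes n :: nat
  shows
  "AE x in powM {..<n}. \<forall>i<n. K (x i) (x i) = complex_of_real (gK (x i)) \<and> 0 \<le> gK (x i)"
proof -
  have 1: "AE y in powM {..<1::nat}. K (y 0) (y 0) = complex_of_real (gK (y 0)) \<and> 0 \<le> gK (y 0)"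
    using rho_det[of 1]
  proof (rule AE_mp, intro AE_I2 impI)
    fix y assume "y \<in> space (powM {..<1})" "complex_of_real (rho 1 y) = detK 1 y"
    then have "complex_of_real (rho 1 y) = K (y 0) (y 0)" "0 \<le> rho 1 y"
      by (auto simp: detK_def det_mat_1 rho_nonneg)
    then show "K (y 0) (y 0) = complex_of_real (gK (y 0)) \<and> 0 \<le> gK (y 0)"
      unfolding gK_def by (metis Re_complex_of_real)
  qed
  have "AE x in powM {..<n}. K (x i) (x i) = complex_of_real (gK (x i)) \<and> 0 \<le> gK (x i)" if "i \<in> {..<n}" for i
    using AE_PiM_component_sigma_finite[OF _ that 1] by simp
  then have "AE x in powM {..<n}. \<forall>i\<in>{..<n}. K (x i) (x i) = complex_of_real (gK (x i)) \<and> 0 \<le> gK (x i)"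
    by (intro AE_finite_allI) auto
  then show ?thesis unfolding Ball_def lessThan_iff .
qed

lemma AE_hermitian:
  fixes n :: nat
  shows
  "AE x in powM {..<n}. \<forall>i<n. \<forall>j<n. K (x j) (x i) = cnj (K (x i) (x j))"
proof -
  have "AE x in powM {..<n}. K (x j) (x i) = cnj (K (x i) (x j))" if "i \<in> {..<n}" "j \<in> {..<n}" for i j
  proof (cases "i = j")
    \<comment> \<open>In the Euclidean case the diagonal is a null set of pairs, so the symmetry of
      \<open>K\<close> on pairs says nothing here; the one-point correlation function does.\<close>
    case True
    then show ?thesis using AE_diagonal[of n] that by (auto elim!: eventually_mono)
  next
    case False
    have "AE z in M \<Otimes>\<^sub>M M. (\<lambda>x y. K y x = cnj (K x y)) (fst z) (snd z)"
      using kernel_hermitian[of K] field by (simp add: determinantal_field_def)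
    from AE_PiM_two_components[OF _ that False AE_PiM_pair_of_AE_pair[OF this]]
    show ?thesis by simp
  qed
  then have "AE x in powM {..<n}. \<forall>i\<in>{..<n}. \<forall>j\<in>{..<n}. K (x j) (x i) = cnj (K (x i) (x j))"
    by (intro AE_finite_allI) auto
  then show ?thesis unfolding Ball_def lessThan_iff .
qed

lemma AE_rho_2:
  "AE y in powM {..<2::nat}. rho 2 y + (cmod (K (y 0) (y 1)))\<^sup>2 = gK (y 0) * gK (y 1)"
  using rho_det[of 2] AE_hermitian[of 2] AE_diagonal[of 2]
proof eventually_elim
  case (elim y)
  have "complex_of_real (rho 2 y) = K (y 0) (y 0) * K (y 1) (y 1) - K (y 0) (y 1) * K (y 1) (y 0)"
    using elim(1) by (simp add: detK_def det_mat_2)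
  also have "\<dots> = complex_of_real (gK (y 0)) * complex_of_real (gK (y 1)) - K (y 0) (y 1) * cnj (K (y 0) (y 1))"
    using elim(2)[rule_format, of 0 1] elim(3)[rule_format, of 0] elim(3)[rule_format, of 1] by simp
  also have "\<dots> = complex_of_real (gK (y 0) * gK (y 1) - (cmod (K (y 0) (y 1)))\<^sup>2)"
    unfolding of_real_diff of_real_mult complex_norm_square ..
  finally show ?case by (simp only: of_real_eq_iff)
qed

text \<open>A Cauchy-Schwarz inequality for the kernel; for distinct indices it is the
  non-negativity of the two-point correlation function, for equal ones an equality.\<close>

lemma AE_kernel_bound:
  fixes n :: nat
  shows
  "AE x in powM {..<n}. \<forall>i<n. \<forall>j<n. (cmod (K (x i) (x j)))\<^sup>2 \<le> gK (x i) * gK (x j)"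
proof -
  have 2: "AE y in powM {..<2::nat}. (\<lambda>x y. (cmod (K x y))\<^sup>2 \<le> gK x * gK y) (y 0) (y 1)"
    using AE_rho_2
    by (rule AE_mp, intro AE_I2 impI) (use rho_nonneg[of _ 2] in fastforce)
  have "AE x in powM {..<n}. (cmod (K (x i) (x j)))\<^sup>2 \<le> gK (x i) * gK (x j)" if "i \<in> {..<n}" "j \<in> {..<n}" for i j
  proof (cases "i = j")
    case True
    show ?thesis using AE_diagonal[of n]
    proof eventually_elim
      case (elim x)
      then have "K (x i) (x i) = complex_of_real (gK (x i))" "0 \<le> gK (x i)" using that by auto
      then show ?case using True by (simp add: power2_eq_square)
    qed
  next
    case False
    from AE_PiM_two_components[OF _ that False 2] show ?thesis by simp
  qed
  then have "AE x in powM {..<n}. \<forall>i\<in>{..<n}. \<forall>j\<in>{..<n}. (cmod (K (x i) (x j)))\<^sup>2 \<le> gK (x i) * gK (x j)"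
    by (intro AE_finite_allI) auto
  then show ?thesis unfolding Ball_def lessThan_iff .
qed

lemma detK_reindex: "detK m (\<lambda>j\<in>{..<m}. x (s j)) = minor (\<lambda>i j. K (x i) (x j)) m s"
  unfolding detK_def minor_def by (intro arg_cong[where f=Determinant.det] eq_matI) auto

text \<open>A minor selected by an injective \<open>s\<close> is the determinant at the points
  \<open>x (s j)\<close>, hence almost everywhere a value of the correlation function of
  \<open>m\<close> points.\<close>

lemma AE_minors:
  fixes n :: nat
  shows
  "AE x in powM {..<n}. \<forall>m s. inj_on s {..<m} \<longrightarrow> s ` {..<m} \<subseteq> {..<n} \<longrightarrow>
     (\<exists>r\<ge>0. minor (\<lambda>i j. K (x i) (x j)) m s = complex_of_real r)"
proof -
  let ?Q = "\<lambda>x m s. \<exists>r\<ge>0. minor (\<lambda>i j. K (x i) (x j)) m s = complex_of_real r"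
  have "AE x in powM {..<n}. ?Q x m s" if s: "inj_on s {..<m}" "s ` {..<m} \<subseteq> {..<n}" for m :: nat and s
  proof -
    have "AE y in powM {..<m}. \<exists>r\<ge>0. detK m y = complex_of_real r"
      using rho_det[of m] by (rule AE_mp, intro AE_I2 impI) (use rho_nonneg[of _ m] in metis)
    from AE_PiM_reindex[OF _ s this] show ?thesis by (simp add: detK_reindex)
  qed
  \<comment> \<open>A minor depends only on the restriction of \<open>s\<close>, and there are
    finitely many restricted maps, so the exceptional null sets can be united.\<close>
  then have "AE x in powM {..<n}. \<forall>m\<in>{..n}. \<forall>s\<in>({..<m} \<rightarrow>\<^sub>E {..<n}). inj_on s {..<m} \<longrightarrow> ?Q x m s"
    by (intro AE_finite_allI finite_PiE) (auto simp: PiE_iff image_subset_iff)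
  then show ?thesis
  proof eventually_elim
    case (elim x)
    show ?case
    proof (intro allI impI)
      fix m :: nat and s assume s: "inj_on s {..<m}" "s ` {..<m} \<subseteq> {..<n}"
      have "m \<le> n" using card_inj_on_le[OF s] by simp
      moreover have "restrict s {..<m} \<in> {..<m} \<rightarrow>\<^sub>E {..<n}" using s(2) by auto
      moreover have "inj_on (restrict s {..<m}) {..<m}" using s(1) by (simp add: inj_on_def)
      moreover have "minor (\<lambda>i j. K (x i) (x j)) m (restrict s {..<m}) = minor (\<lambda>i j. K (x i) (x j)) m s"
        unfolding minor_def by (intro arg_cong[where f=Determinant.det] eq_matI) auto
      ultimately show "?Q x m s" using elim by (metis atMost_iff)
    qed
  qed
qed

text \<open>Hadamard's inequality for the kernel matrix; all moment bounds rest on it.\<close>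

lemma AE_rho_le: "AE x in powM {..<n}. rho n x \<le> (\<Prod>i<n. gK (x i))"
  using rho_det[of n] AE_hermitian[of n] AE_minors[of n]
proof eventually_elim
  case (elim x)
  have "Re (detK n x) \<le> (\<Prod>i<n. Re (K (x i) (x i)))"
    unfolding detK_def using elim(2,3) by (intro hadamard_of_minors) blast+
  then show ?case using elim(1) by (metis (no_types, lifting) Re_complex_of_real gK_def prod.cong)
qed

text \<open>The pointwise form of decoupling: two groups of points interact only through squares of
  kernel values between the groups.\<close>

lemma AE_rho_blocks:
  "AE x in powM {..<n1 + n2}.
     \<bar>rho (n1 + n2) x - rho n1 (\<lambda>j\<in>{..<n1}. x j) * rho n2 (\<lambda>j\<in>{..<n2}. x (n1 + j))\<bar> \<le>
     fact (n1 + n2) * (\<Sum>a<n1. \<Sum>b=n1..<n1 + n2. (cmod (K (x a) (x b)))\<^sup>2 * (\<Prod>l\<in>{..<n1 + n2} - {a, b}. gK (x l)))"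
proof -
  have 1: "AE x in powM {..<n1 + n2}. complex_of_real (rho n1 (\<lambda>j\<in>{..<n1}. x j)) = detK n1 (\<lambda>j\<in>{..<n1}. x j)"
    using AE_PiM_reindex[of "{..<n1 + n2}" "\<lambda>j. j" "{..<n1}", OF _ _ _ rho_det[of n1]] by auto
  have 2: "AE x in powM {..<n1 + n2}.
      complex_of_real (rho n2 (\<lambda>j\<in>{..<n2}. x (n1 + j))) = detK n2 (\<lambda>j\<in>{..<n2}. x (n1 + j))"
    using AE_PiM_reindex[of "{..<n1 + n2}" "\<lambda>j. n1 + j" "{..<n2}", OF _ _ _ rho_det[of n2]] by (auto simp: image_subset_iff)
  show ?thesis
    using rho_det[of "n1 + n2"] 1 2 AE_hermitian[of "n1 + n2"] AE_kernel_bound[of "n1 + n2"] AE_diagonal[of "n1 + n2"]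
  proof eventually_elim
    case (elim x)
    have d1: "detK n1 (\<lambda>j\<in>{..<n1}. x j) = mdet n1 (\<lambda>i j. K (x i) (x j))"
      using detK_reindex[of n1 x "\<lambda>j. j"] by (simp add: minor_def)
    have d2: "detK n2 (\<lambda>j\<in>{..<n2}. x (n1 + j)) = mdet n2 (\<lambda>i j. K (x (i + n1)) (x (j + n1)))"
      using detK_reindex[of n2 x "\<lambda>j. n1 + j"] by (simp add: minor_def add.commute)
    have "cmod (detK (n1 + n2) x - detK n1 (\<lambda>j\<in>{..<n1}. x j) * detK n2 (\<lambda>j\<in>{..<n2}. x (n1 + j))) \<le>
      fact (n1 + n2) * (\<Sum>a<n1. \<Sum>b=n1..<n1 + n2. (cmod (K (x a) (x b)))\<^sup>2 * (\<Prod>l\<in>{..<n1 + n2} - {a, b}. gK (x l)))"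
      unfolding d1 d2 unfolding detK_def
    proof (rule det_off_block_le[where B="\<lambda>i j. K (x i) (x j)" and g="\<lambda>i. gK (x i)"])
      show "cmod (K (x i) (x j)) = cmod (K (x j) (x i))" if "i < n1 + n2" "j < n1 + n2" for i j
        using elim(4) that by (metis complex_mod_cnj)
    qed (use elim(5,6) in auto)
    also have "detK (n1 + n2) x - detK n1 (\<lambda>j\<in>{..<n1}. x j) * detK n2 (\<lambda>j\<in>{..<n2}. x (n1 + j)) =
      complex_of_real (rho (n1 + n2) x - rho n1 (\<lambda>j\<in>{..<n1}. x j) * rho n2 (\<lambda>j\<in>{..<n2}. x (n1 + j)))"
      using elim(1-3) by simp
    finally show ?case by (simp only: norm_of_real)
  qed
qed

section \<open>The intensity measure and the mass of the squared kernel\<close>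

text \<open>The intensity measure: on bounded sets it is the expected number of particles, by
  \<open>nn_expectation_num_particles\<close>.\<close>

definition mu :: "(real ^ 'd) set \<Rightarrow> ennreal" where
  "mu B = (\<integral>\<^sup>+x. ennreal (gK x) * indicator B x \<partial>M)"

text \<open>By \<open>W_disjoint\<close> this is minus the covariance of the counts of two disjoint
  sets; by \<open>W_self\<close>, for one set paired with itself, it is the amount by which the
  second factorial moment falls short of the squared mean.\<close>

definition W :: "(real ^ 'd) set \<Rightarrow> (real ^ 'd) set \<Rightarrow> ennreal" where
  "W A B = (\<integral>\<^sup>+z. ennreal ((cmod (K (fst z) (snd z)))\<^sup>2) * indicator A (fst z) * indicator B (snd z) \<partial>(M \<Otimes>\<^sub>M M))"

lemma mu_mono: "A \<subseteq> B \<Longrightarrow> mu A \<le> mu B"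
  unfolding mu_def by (intro nn_integral_mono mult_left_mono) (auto simp: indicator_def)

lemma W_mono: "A \<subseteq> A' \<Longrightarrow> B \<subseteq> B' \<Longrightarrow> W A B \<le> W A' B'"
  unfolding W_def by (intro nn_integral_mono mult_mono) (auto simp: indicator_def)

lemma box_indicator:
  fixes x :: "nat \<Rightarrow> real ^ 'd"
  assumes "x \<in> space (powM {..<n})"
  shows "indicator (\<Pi>\<^sub>E j\<in>{..<n}. A j) x = (\<Prod>j<n. indicator (A j) (x j) :: ennreal)"
proof (cases "x \<in> (\<Pi>\<^sub>E j\<in>{..<n}. A j)")
  case True
  then have "x j \<in> A j" if "j < n" for j using that by (auto simp: PiE_iff)
  then have "(\<Prod>j<n. indicator (A j) (x j) :: ennreal) = 1" by (intro prod.neutral) simp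
  with True show ?thesis by simp
next
  case False
  then obtain j where "j < n" "x j \<notin> A j" using assms by (auto simp: space_PiM PiE_iff)
  then have "(\<Prod>j<n. indicator (A j) (x j) :: ennreal) = 0" by (intro prod_zero bexI[of _ j]) auto
  with False show ?thesis by simp
qed

lemma box_measurable:
  fixes n :: nat
  assumes "\<And>j. j < n \<Longrightarrow> A j \<in> sets M"
  shows "(\<Pi>\<^sub>E j\<in>{..<n}. A j) \<in> sets (powM {..<n})"
  using assms by (intro sets_PiM_I_finite) auto

lemma nn_integral_prod_gK:
  assumes "finite I" "\<And>j. j \<in> I \<Longrightarrow> A j \<in> sets M"
  shows "(\<integral>\<^sup>+x. (\<Prod>j\<in>I. ennreal (gK (x j)) * indicator (A j) (x j)) \<partial>powM I) = (\<Prod>j\<in>I. mu (A j))"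
  unfolding mu_def using assms
  by (intro power.product_nn_integral_prod) auto

lemma nn_expectation_num_particles:
  assumes B: "B \<in> bounded_sets M"
  shows "(\<integral>\<^sup>+\<xi>. of_nat (num_particles B \<xi>) \<partial>P) = mu B"
proof -
  have "falling_monomial B (replicate 1 B) (\<lambda>\<xi>. num_particles B \<xi>)"
    using falling_monomial_single[OF B, of 1] by (simp add: falling_1)
  then have "(\<integral>\<^sup>+\<xi>. of_nat (num_particles B \<xi>) \<partial>P) =
    (\<integral>\<^sup>+x\<in>(\<Pi>\<^sub>E j\<in>{..<1}. replicate 1 B ! j). ennreal (rho 1 x) \<partial>powM {..<1})"
    by (rule nn_expectation_monomial) simp
  also have "\<dots> = (\<integral>\<^sup>+x. (\<Prod>j\<in>{..<1}. ennreal (gK (x j)) * indicator B (x j)) \<partial>powM {..<1::nat})"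
  proof (rule nn_integral_cong_AE, use rho_det[of 1] in \<open>rule AE_mp\<close>, intro AE_I2 impI)
    fix x assume x: "x \<in> space (powM {..<1})" "complex_of_real (rho 1 x) = detK 1 x"
    then have "rho 1 x = gK (x 0)"
      by (simp add: detK_def det_mat_1 gK_def) (metis Re_complex_of_real)
    then show "ennreal (rho 1 x) * indicator (\<Pi>\<^sub>E j\<in>{..<1}. replicate 1 B ! j) x =
      (\<Prod>j\<in>{..<1}. ennreal (gK (x j)) * indicator B (x j))"
      using box_indicator[OF x(1), of "\<lambda>j. replicate 1 B ! j"] by (simp add: lessThan_Suc)
  qed
  also have "\<dots> = mu B"
    using nn_integral_prod_gK[of "{..<1::nat}" "\<lambda>_. B"] bounded_sets_sets[OF B] by simp
  finally show ?thesis .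
qed

lemma mu_finite:
  assumes B: "B \<in> bounded_sets M"
  shows "mu B < \<infinity>"
proof -
  have "falling_monomial B (replicate 1 B) (\<lambda>\<xi>. num_particles B \<xi>)"
    using falling_monomial_single[OF B, of 1] by (simp add: falling_1)
  then have "mu B = (\<integral>\<^sup>+x\<in>(\<Pi>\<^sub>E j\<in>{..<1}. replicate 1 B ! j). ennreal (rho 1 x) \<partial>powM {..<1})"
    unfolding nn_expectation_num_particles[OF B, symmetric] by (rule nn_expectation_monomial) simp
  also have "(\<Pi>\<^sub>E j\<in>{..<1}. replicate 1 B ! j) = (\<Pi>\<^sub>E j\<in>{..<1}. B)"
    by (intro PiE_cong) auto
  finally show ?thesis using rho_finite[OF B, of 1] by simp
qed

lemma mu_translate:
  assumes B: "B \<in> bounded_sets M" and t: "t \<in> space M"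
  shows "mu ((\<lambda>x. x - t) ` B) = mu B"
proof -
  have [measurable]: "num_particles B \<in> measurable P (count_space UNIV)" by (rule num_particles_measurable[OF B])
  have "mu ((\<lambda>x. x - t) ` B) = (\<integral>\<^sup>+\<xi>. of_nat (num_particles B (shift t \<xi>)) \<partial>P)"
    using nn_expectation_num_particles[OF bounded_sets_translate[OF B t]] by (simp add: num_particles_shift)
  also have "\<dots> = mu B"
    using nn_integral_shift_P[OF t, of "\<lambda>\<xi>. of_nat (num_particles B \<xi>)"]
    by (simp add: nn_expectation_num_particles[OF B])
  finally show ?thesis .
qed

text \<open>Hadamard's inequality in expectation: factorial moments do not exceed those of a Poisson
  field with the same intensity.\<close>

lemma nn_expectation_monomial_le:
  assumes F: "falling_monomial S L F"
  shows "(\<integral>\<^sup>+\<xi>. of_nat (F \<xi>) \<partial>P) \<le> (\<Prod>j<length L. mu (L ! j))"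
proof -
  have "(\<integral>\<^sup>+\<xi>. of_nat (F \<xi>) \<partial>P) =
      (\<integral>\<^sup>+x\<in>(\<Pi>\<^sub>E j\<in>{..<length L}. L ! j). ennreal (rho (length L) x) \<partial>powM {..<length L})"
    by (rule nn_expectation_monomial[OF F refl])
  also have "\<dots> \<le> (\<integral>\<^sup>+x. (\<Prod>j<length L. ennreal (gK (x j)) * indicator (L ! j) (x j)) \<partial>powM {..<length L})"
  proof (rule nn_integral_mono_AE)
    show "AE x in powM {..<length L}. ennreal (rho (length L) x) * indicator (\<Pi>\<^sub>E j\<in>{..<length L}. L ! j) x \<le>
      (\<Prod>j<length L. ennreal (gK (x j)) * indicator (L ! j) (x j))"
      using AE_rho_le[of "length L"] AE_diagonal[of "length L"] AE_space
    proof eventually_elim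
      case (elim x)
      have "ennreal (rho (length L) x) \<le> ennreal (\<Prod>i<length L. gK (x i))" using elim(1) by (rule ennreal_leI)
      also have "\<dots> = (\<Prod>i<length L. ennreal (gK (x i)))" using elim(2) by (intro prod_ennreal[symmetric]) auto
      finally show ?case
        unfolding box_indicator[OF elim(3)] prod.distrib by (rule mult_right_mono) simp
    qed
  qed
  also have "\<dots> = (\<Prod>j<length L. mu (L ! j))"
    using falling_monomial_support(2)[OF F] by (intro nn_integral_prod_gK) (auto simp: bounded_sets_def)
  finally show ?thesis .
qed

lemma nn_expectation_monomial_finite:
  assumes F: "falling_monomial S L F"
  shows "(\<integral>\<^sup>+\<xi>. of_nat (F \<xi>) \<partial>P) < \<infinity>"
proof -
  have "mu (L ! j) \<noteq> \<infinity>" if "j < length L" for j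
    using mu_finite[of "L ! j"] falling_monomial_support(2)[OF F nth_mem[OF that]] by (simp add: less_top)
  then have "(\<Prod>j<length L. mu (L ! j)) < \<infinity>"
    by (simp add: less_top[symmetric] ennreal_prod_eq_top)
  then show ?thesis using nn_expectation_monomial_le[OF F] by (rule le_less_trans[rotated])
qed

lemma W_integrand_measurable:
  assumes "A \<in> sets M" "B \<in> sets M"
  shows "case_prod (\<lambda>x y. ennreal ((cmod (K x y))\<^sup>2) * indicator A x * indicator B y) \<in> borel_measurable (M \<Otimes>\<^sub>M M)"
proof -
  have [measurable]: "(\<lambda>z. K (fst z) (snd z)) \<in> borel_measurable (M \<Otimes>\<^sub>M M)"
    using K_measurable by (simp add: case_prod_beta)
  note assms [measurable]
  show ?thesis unfolding case_prod_beta by measurable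
qed

text \<open>The 2 by 2 determinant integrated over \<open>A\<close> times \<open>B\<close>. A
  monomial of degree two with list \<open>[A, B]\<close> is either a product of two counts of
  disjoint sets or, when \<open>A = B\<close>, the second factorial power of one count.\<close>

lemma W_pair_identity:
  assumes A: "A \<in> bounded_sets M" and B: "B \<in> bounded_sets M"
    and F: "falling_monomial S [A, B] F"
  shows "(\<integral>\<^sup>+\<xi>. of_nat (F \<xi>) \<partial>P) + W A B = mu A * mu B"
proof -
  let ?P = "powM {..<2::nat}"
  let ?L = "\<lambda>j. [A, B] ! j"
  let ?W = "\<lambda>x y. ennreal ((cmod (K x y))\<^sup>2) * indicator A x * indicator B y"
  note W = W_integrand_measurable[OF bounded_sets_sets[OF A] bounded_sets_sets[OF B]]
  have m: "(\<lambda>x. (x 0, x 1)) \<in> measurable ?P (M \<Otimes>\<^sub>M M)"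
    by (intro measurable_Pair measurable_component_singleton) auto
  have Wm: "(\<lambda>x. ?W (x 0) (x 1)) \<in> borel_measurable ?P"
    using measurable_compose[OF m W] by simp
  have L: "?L j \<in> sets M" if "j < 2" for j
    using that A B by (auto simp: less_2_cases_iff bounded_sets_def)
  have bm: "(\<lambda>x. ennreal (rho 2 x) * indicator (\<Pi>\<^sub>E j\<in>{..<2}. ?L j) x) \<in> borel_measurable ?P"
    using box_measurable[of 2 ?L, OF L] by measurable
  have two: "{..<2::nat} = {0, 1}" by auto
  have "W A B = (\<integral>\<^sup>+x. ?W (x 0) (x 1) \<partial>?P)"
    unfolding two W_def by (rule power.product_nn_integral_pair[OF W, symmetric]) simp
  then have "(\<integral>\<^sup>+\<xi>. of_nat (F \<xi>) \<partial>P) + W A B =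
    (\<integral>\<^sup>+x. ennreal (rho 2 x) * indicator (\<Pi>\<^sub>E j\<in>{..<2}. ?L j) x + ?W (x 0) (x 1) \<partial>?P)"
    using nn_integral_add[OF bm Wm] nn_expectation_monomial[OF F, of 2] by simp
  also have "\<dots> = (\<integral>\<^sup>+x. (\<Prod>j\<in>{..<2}. ennreal (gK (x j)) * indicator (?L j) (x j)) \<partial>?P)"
  proof (rule nn_integral_cong_AE)
    show "AE x in ?P. ennreal (rho 2 x) * indicator (\<Pi>\<^sub>E j\<in>{..<2}. ?L j) x + ?W (x 0) (x 1) =
      (\<Prod>j\<in>{..<2}. ennreal (gK (x j)) * indicator (?L j) (x j))"
      using AE_rho_2 AE_diagonal[of 2] AE_space
    proof eventually_elim
      case (elim x)
      have g: "0 \<le> gK (x 0)" "0 \<le> gK (x 1)" using elim(2) by auto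
      have e: "ennreal (rho 2 x) + ennreal ((cmod (K (x 0) (x 1)))\<^sup>2) = ennreal (gK (x 0)) * ennreal (gK (x 1))"
        using elim(1) rho_nonneg[OF elim(3)] g by (simp add: ennreal_plus[symmetric] ennreal_mult[symmetric] del: ennreal_plus)
      have "ennreal (gK (x 0)) * ennreal (gK (x 1)) * (indicator A (x 0) * indicator B (x 1)) =
        ennreal (rho 2 x) * (indicator A (x 0) * indicator B (x 1)) + ?W (x 0) (x 1)"
        unfolding e[symmetric] by (simp add: distrib_right mult.assoc)
      then show ?case
        unfolding box_indicator[OF elim(3)] by (simp add: two mult_ac)
    qed
  qed
  also have "\<dots> = mu A * mu B"
    using A B by (subst nn_integral_prod_gK) (auto simp: two bounded_sets_def)
  finally show ?thesis .
qed

lemma W_disjoint: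
  assumes A: "A \<in> bounded_sets M" and B: "B \<in> bounded_sets M" and disj: "A \<inter> B = {}"
  shows "(\<integral>\<^sup>+\<xi>. of_nat (num_particles A \<xi> * num_particles B \<xi>) \<partial>P) + W A B = mu A * mu B"
proof -
  have 1: "falling_monomial C [C] (\<lambda>\<xi>. num_particles C \<xi>)" if "C \<in> bounded_sets M" for C
    using falling_monomial_single[OF that, of 1] by (simp add: falling_1)
  show ?thesis
    using W_pair_identity[OF A B falling_monomial_mult[OF 1[OF A] 1[OF B] disj, simplified]] by simp
qed

lemma W_self:
  assumes A: "A \<in> bounded_sets M"
  shows "(\<integral>\<^sup>+\<xi>. of_nat (falling (num_particles A \<xi>) 2) \<partial>P) + W A A = mu A * mu A"
  using falling_monomial_single[OF A, of 2] by (intro W_pair_identity[OF A A]) (simp add: numeral_2_eq_2)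

lemma W_finite:
  assumes A: "A \<in> bounded_sets M" and B: "B \<in> bounded_sets M"
  shows "W A B < \<infinity>"
proof -
  \<comment> \<open>Second factorial moments reach only disjoint or equal pairs, so both sets are
    enlarged to their union.\<close>
  have "W A B \<le> W (A \<union> B) (A \<union> B)" by (intro W_mono) auto
  also have "\<dots> \<le> mu (A \<union> B) * mu (A \<union> B)"
    unfolding W_self[OF bounded_sets_ops(1)[OF A B], symmetric] by (rule le_iff_add[THEN iffD2]) (auto simp: add.commute)
  also have "\<dots> < \<infinity>"
    using mu_finite[OF bounded_sets_ops(1)[OF A B]] by (simp add: ennreal_mult_less_top)
  finally show ?thesis .
qed

text \<open>\<open>K\<close> may change under a translation, but the mean counts and the mean
  product of counts do not, and these finite moments determine \<open>W A B\<close>.\<close>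

lemma W_translate_disjoint:
  assumes A: "A \<in> bounded_sets M" and B: "B \<in> bounded_sets M" and disj: "A \<inter> B = {}" and t: "t \<in> space M"
  shows "W ((\<lambda>x. x - t) ` A) ((\<lambda>x. x - t) ` B) = W A B"
proof -
  let ?T = "(`) (\<lambda>x. x - t)"
  have [measurable]: "num_particles A \<in> measurable P (count_space UNIV)" "num_particles B \<in> measurable P (count_space UNIV)"
    by (rule num_particles_measurable, fact)+
  have TA: "?T A \<in> bounded_sets M" and TB: "?T B \<in> bounded_sets M"
    using A B t by (auto intro: bounded_sets_translate)
  have disj': "?T A \<inter> ?T B = {}" using disj by auto
  let ?e = "\<integral>\<^sup>+\<xi>. of_nat (num_particles A \<xi> * num_particles B \<xi>) \<partial>P"
  have e: "(\<integral>\<^sup>+\<xi>. of_nat (num_particles (?T A) \<xi> * num_particles (?T B) \<xi>) \<partial>P) = ?e"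
    using nn_integral_shift_P[OF t, of "\<lambda>\<xi>. of_nat (num_particles A \<xi> * num_particles B \<xi>)"]
    by (simp add: num_particles_shift)
  have eq: "?e + W (?T A) (?T B) = ?e + W A B"
    using W_disjoint[OF TA TB disj'] W_disjoint[OF A B disj] unfolding e mu_translate[OF A t] mu_translate[OF B t] by simp
  have "?e \<le> mu A * mu B" unfolding W_disjoint[OF A B disj, symmetric] by simp
  also have "\<dots> < \<top>" using mu_finite[OF A] mu_finite[OF B] by (simp add: ennreal_mult_less_top)
  finally show ?thesis using eq by (auto simp: ennreal_add_left_cancel)
qed

lemma W_translate_self:
  assumes A: "A \<in> bounded_sets M" and t: "t \<in> space M"
  shows "W ((\<lambda>x. x - t) ` A) ((\<lambda>x. x - t) ` A) = W A A"
proof -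
  let ?T = "(`) (\<lambda>x. x - t)"
  have [measurable]: "num_particles A \<in> measurable P (count_space UNIV)"
    by (rule num_particles_measurable, fact)
  have TA: "?T A \<in> bounded_sets M" using A t by (auto intro: bounded_sets_translate)
  let ?e = "\<integral>\<^sup>+\<xi>. of_nat (falling (num_particles A \<xi>) 2) \<partial>P"
  have e: "(\<integral>\<^sup>+\<xi>. of_nat (falling (num_particles (?T A) \<xi>) 2) \<partial>P) = ?e"
    using nn_integral_shift_P[OF t, of "\<lambda>\<xi>. of_nat (falling (num_particles A \<xi>) 2)"]
    by (simp add: num_particles_shift)
  have eq: "?e + W (?T A) (?T A) = ?e + W A A"
    using W_self[OF TA] W_self[OF A] unfolding e mu_translate[OF A t] by simp
  have "?e \<le> mu A * mu A" unfolding W_self[OF A, symmetric] by simp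
  also have "\<dots> < \<top>" using mu_finite[OF A] by (simp add: ennreal_mult_less_top)
  finally show ?thesis using eq by (auto simp: ennreal_add_left_cancel)
qed

text \<open>The coupled pair contributes to \<open>W S S'\<close>, every other point at most
  \<open>mu U\<close>. The base \<open>1 + mu U\<close> is at least \<open>1\<close>, so the
  exponent \<open>n\<close> can stand for the actual number of uncoupled points.\<close>

lemma nn_integral_off_block_term:
  assumes L: "\<And>B. B \<in> set LL \<Longrightarrow> B \<in> bounded_sets M \<and> B \<subseteq> U"
    and n: "length LL = n" and ab: "a < n" "b < n" "a \<noteq> b" and S: "LL ! a \<subseteq> S" "LL ! b \<subseteq> S'"
  shows "(\<integral>\<^sup>+x. ennreal ((cmod (K (x a) (x b)))\<^sup>2) * (\<Prod>l\<in>{..<n} - {a, b}. ennreal (gK (x l))) *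
      indicator (\<Pi>\<^sub>E j\<in>{..<n}. LL ! j) x \<partial>powM {..<n}) \<le> W S S' * (1 + mu U) ^ n"
proof -
  have LM: "LL ! l \<in> sets M" "LL ! l \<subseteq> U" if "l < n" for l
    using L[OF nth_mem[of l LL]] that n by (auto simp: bounded_sets_def)
  have "(\<integral>\<^sup>+x. ennreal ((cmod (K (x a) (x b)))\<^sup>2) * (\<Prod>l\<in>{..<n} - {a, b}. ennreal (gK (x l))) *
      indicator (\<Pi>\<^sub>E j\<in>{..<n}. LL ! j) x \<partial>powM {..<n}) =
    (\<integral>\<^sup>+x. (ennreal ((cmod (K (x a) (x b)))\<^sup>2) * indicator (LL ! a) (x a) * indicator (LL ! b) (x b)) *
      (\<Prod>l\<in>{..<n} - {a, b}. ennreal (gK (x l)) * indicator (LL ! l) (x l)) \<partial>powM {..<n})"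
  proof (rule nn_integral_cong)
    fix x assume x: "x \<in> space (powM {..<n})"
    have "(\<Prod>j<n. indicator (LL ! j) (x j) :: ennreal) =
      indicator (LL ! a) (x a) * (indicator (LL ! b) (x b) * (\<Prod>l\<in>{..<n} - {a} - {b}. indicator (LL ! l) (x l)))"
      using ab by (subst prod.remove[of _ a], simp, simp, subst prod.remove[of _ b]) auto
    also have "{..<n} - {a} - {b} = {..<n} - {a, b}" by auto
    finally show "ennreal ((cmod (K (x a) (x b)))\<^sup>2) * (\<Prod>l\<in>{..<n} - {a, b}. ennreal (gK (x l))) *
      indicator (\<Pi>\<^sub>E j\<in>{..<n}. LL ! j) x =
      (ennreal ((cmod (K (x a) (x b)))\<^sup>2) * indicator (LL ! a) (x a) * indicator (LL ! b) (x b)) *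
      (\<Prod>l\<in>{..<n} - {a, b}. ennreal (gK (x l)) * indicator (LL ! l) (x l))"
      unfolding box_indicator[OF x] by (simp add: prod.distrib mult_ac)
  qed
  also have "\<dots> = W (LL ! a) (LL ! b) * (\<Prod>l\<in>{..<n} - {a, b}. mu (LL ! l))"
    unfolding W_def mu_def
    by (rule nn_integral_PiM_pair_prod[OF _ _ _ ab(3) W_integrand_measurable]) (use ab LM in auto)
  also have "\<dots> \<le> W S S' * (1 + mu U) ^ n"
  proof (rule mult_mono)
    have "mu (LL ! l) \<le> 1 + mu U" if "l < n" for l
      using mu_mono[OF LM(2)[OF that]] by (rule order_trans) simp
    then have "(\<Prod>l\<in>{..<n} - {a, b}. mu (LL ! l)) \<le> (\<Prod>l\<in>{..<n} - {a, b}. 1 + mu U)"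
      by (intro prod_mono_ennreal) auto
    also have "\<dots> = (1 + mu U) ^ card ({..<n} - {a, b})" by simp
    also have "\<dots> \<le> (1 + mu U) ^ n"
      using card_mono[of "{..<n}" "{..<n} - {a, b}"] by (intro power_increasing) auto
    finally show "(\<Prod>l\<in>{..<n} - {a, b}. mu (LL ! l)) \<le> (1 + mu U) ^ n" .
  qed (use W_mono[OF S] in auto)
  finally show ?thesis .
qed

text \<open>The expectation of the product and the product of the expectations become integrals over
  the same \<open>n\<close> points, and \<open>AE_rho_blocks\<close> bounds the difference of the
  integrands. In \<open>C\<close>, \<open>length L * length L'\<close> counts the pairs of points
  from different groups. Two one-sided inequalities take the place of an absolute difference, since
  subtraction of extended non-negative reals truncates.\<close>

lemma nn_expectation_mult_monomials:
  assumes F: "falling_monomial S L F" and G: "falling_monomial S' L' G" and disj: "S \<inter> S' = {}"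
  defines "n \<equiv> length L + length L'"
  defines "C \<equiv> fact n * of_nat (length L * length L') * (1 + mu (S \<union> S')) ^ n * W S S'"
  shows "(\<integral>\<^sup>+\<xi>. of_nat (F \<xi> * G \<xi>) \<partial>P) \<le> (\<integral>\<^sup>+\<xi>. of_nat (F \<xi>) \<partial>P) * (\<integral>\<^sup>+\<xi>. of_nat (G \<xi>) \<partial>P) + C"
    "(\<integral>\<^sup>+\<xi>. of_nat (F \<xi>) \<partial>P) * (\<integral>\<^sup>+\<xi>. of_nat (G \<xi>) \<partial>P) \<le> (\<integral>\<^sup>+\<xi>. of_nat (F \<xi> * G \<xi>) \<partial>P) + C"
proof -
  define n1 n2 where "n1 = length L" and "n2 = length L'"
  define LL where "LL = L @ L'"
  have n: "n = n1 + n2" and LLn: "length LL = n" by (auto simp: n_def n1_def n2_def LL_def)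
  have FG: "falling_monomial (S \<union> S') LL (\<lambda>\<xi>. F \<xi> * G \<xi>)"
    unfolding LL_def by (rule falling_monomial_mult[OF F G disj])
  let ?P = "powM {..<n}"
  let ?box = "\<Pi>\<^sub>E j\<in>{..<n}. LL ! j"
  let ?box1 = "\<Pi>\<^sub>E j\<in>{..<n1}. L ! j" and ?box2 = "\<Pi>\<^sub>E j\<in>{..<n2}. L' ! j"
  let ?x1 = "\<lambda>x. \<lambda>j\<in>{..<n1}. x j :: real ^ 'd" and ?x2 = "\<lambda>x. \<lambda>j\<in>{..<n2}. x (n1 + j) :: real ^ 'd"
  define \<delta> where "\<delta> x = fact n * (\<Sum>a<n1. \<Sum>b=n1..<n. ennreal ((cmod (K (x a) (x b)))\<^sup>2) *
      (\<Prod>l\<in>{..<n} - {a, b}. ennreal (gK (x l))))" for x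
  have Ls: "L ! j \<in> sets M" if "j < n1" for j
    using that falling_monomial_support(2)[OF F nth_mem[of j L]] by (auto simp: n1_def bounded_sets_def)
  have L's: "L' ! j \<in> sets M" if "j < n2" for j
    using that falling_monomial_support(2)[OF G nth_mem[of j L']] by (auto simp: n2_def bounded_sets_def)
  have LLs: "LL ! j \<in> sets M" if "j < n" for j
    using that falling_monomial_support(2)[OF FG nth_mem[of j LL]] by (auto simp: LLn bounded_sets_def)
  have m1: "?x1 \<in> measurable ?P (powM {..<n1})" and m2: "?x2 \<in> measurable ?P (powM {..<n2})"
    by (auto intro!: measurable_restrict measurable_component_singleton simp: n)
  have fg: "(\<integral>\<^sup>+\<xi>. of_nat (F \<xi> * G \<xi>) \<partial>P) = (\<integral>\<^sup>+x\<in>?box. ennreal (rho n x) \<partial>?P)"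
    by (rule nn_expectation_monomial[OF FG LLn])
  let ?u = "\<lambda>x. ennreal (rho n1 x) * indicator ?box1 x" and ?v = "\<lambda>x. ennreal (rho n2 x) * indicator ?box2 x"
  have um: "?u \<in> borel_measurable (powM {..<n1})" and vm: "?v \<in> borel_measurable (powM {..<n2})"
    using box_measurable[of n1 "\<lambda>j. L ! j", OF Ls] box_measurable[of n2 "\<lambda>j. L' ! j", OF L's] by measurable
  have box_split: "indicator ?box x = (indicator ?box1 (?x1 x) * indicator ?box2 (?x2 x) :: ennreal)"
    if "x \<in> space ?P" for x
  proof -
    have "x \<in> ?box \<longleftrightarrow> ?x1 x \<in> ?box1 \<and> ?x2 x \<in> ?box2"
    proof -
      have "x \<in> ?box \<longleftrightarrow> (\<forall>j<n. x j \<in> LL ! j)"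
        using that by (auto simp: space_PiM PiE_iff)
      also have "\<dots> \<longleftrightarrow> (\<forall>j<n1. x j \<in> L ! j) \<and> (\<forall>j<n2. x (n1 + j) \<in> L' ! j)"
      proof -
        have "(\<forall>j<n. x j \<in> LL ! j) \<longleftrightarrow> (\<forall>j<n1. x j \<in> LL ! j) \<and> (\<forall>j<n2. x (n1 + j) \<in> LL ! (n1 + j))"
        proof (intro iffI conjI allI impI)
          fix j assume *: "(\<forall>j<n1. x j \<in> LL ! j) \<and> (\<forall>j<n2. x (n1 + j) \<in> LL ! (n1 + j))" "j < n"
          show "x j \<in> LL ! j"
          proof (cases "j < n1")
            case False
            then have "j = n1 + (j - n1)" "j - n1 < n2" using *(2) n by auto
            then show ?thesis using *(1) by metis
          qed (use * in auto)
        qed (auto simp: n)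
        then show ?thesis by (auto simp: LL_def nth_append n1_def)
      qed
      finally show ?thesis by (auto simp: PiE_iff)
    qed
    then show ?thesis by (auto simp: indicator_def)
  qed
  have "(\<integral>\<^sup>+\<xi>. of_nat (F \<xi>) \<partial>P) * (\<integral>\<^sup>+\<xi>. of_nat (G \<xi>) \<partial>P) =
    (\<integral>\<^sup>+x. ?u x \<partial>powM {..<n1}) * (\<integral>\<^sup>+x. ?v x \<partial>powM {..<n2})"
    using nn_expectation_monomial[OF F n1_def[symmetric]] nn_expectation_monomial[OF G n2_def[symmetric]] by simp
  also have "\<dots> = (\<integral>\<^sup>+x. ?u (?x1 x) * ?v (?x2 x) \<partial>?P)"
    unfolding n by (rule nn_integral_PiM_blocks[OF um vm, symmetric])
  finally have prod: "(\<integral>\<^sup>+\<xi>. of_nat (F \<xi>) \<partial>P) * (\<integral>\<^sup>+\<xi>. of_nat (G \<xi>) \<partial>P) =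
    (\<integral>\<^sup>+x. ?u (?x1 x) * ?v (?x2 x) \<partial>?P)" .
  have uvm: "(\<lambda>x. ?u (?x1 x) * ?v (?x2 x)) \<in> borel_measurable ?P"
    using measurable_compose[OF m1 um] measurable_compose[OF m2 vm] by (rule borel_measurable_times_ennreal)
  have Km: "(\<lambda>x. ennreal ((cmod (K (x a) (x b)))\<^sup>2)) \<in> borel_measurable ?P" if "a < n" "b < n" for a b
  proof -
    have "(\<lambda>x. (x a, x b)) \<in> measurable ?P (M \<Otimes>\<^sub>M M)"
      using measurable_component_singleton[of a "{..<n}" "\<lambda>_. M"] measurable_component_singleton[of b "{..<n}" "\<lambda>_. M"] that
      by (intro measurable_Pair) (simp_all only: lessThan_iff)
    from measurable_compose[OF this K_measurable] have "(\<lambda>x. K (x a) (x b)) \<in> borel_measurable ?P" by simp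
    from measurable_compose[OF this, of "\<lambda>c. ennreal ((cmod c)\<^sup>2)" borel] show ?thesis by simp
  qed
  have gm: "(\<lambda>x. \<Prod>l\<in>{..<n} - {a, b}. ennreal (gK (x l))) \<in> borel_measurable ?P" for a b
  proof (intro borel_measurable_prod_ennreal)
    fix l assume "l \<in> {..<n} - {a, b}"
    then have "(\<lambda>x. x l) \<in> measurable ?P M" by (intro measurable_component_singleton) auto
    from measurable_compose[OF this gK_measurable] show "(\<lambda>x. ennreal (gK (x l))) \<in> borel_measurable ?P"
      by measurable
  qed
  have tm: "(\<lambda>x. ennreal ((cmod (K (x a) (x b)))\<^sup>2) * (\<Prod>l\<in>{..<n} - {a, b}. ennreal (gK (x l))) * indicator ?box x)
      \<in> borel_measurable ?P" if "a < n" "b < n" for a b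
    using Km[OF that] gm[of a b] box_measurable[of n "\<lambda>j. LL ! j", OF LLs] by measurable
  have \<delta>m: "(\<lambda>x. \<delta> x * indicator ?box x) \<in> borel_measurable ?P"
    unfolding \<delta>_def using Km gm box_measurable[of n "\<lambda>j. LL ! j", OF LLs]
    by (intro borel_measurable_times_ennreal borel_measurable_sum borel_measurable_const) (auto simp: n)
  have bound: "(\<integral>\<^sup>+x. \<delta> x * indicator ?box x \<partial>?P) \<le> C"
  proof -
    define t where "t a b x = ennreal ((cmod (K (x a) (x b)))\<^sup>2) *
      (\<Prod>l\<in>{..<n} - {a, b}. ennreal (gK (x l))) * indicator ?box x" for a b x
    have tm': "t a b \<in> borel_measurable ?P" if "a < n" "b < n" for a b
      unfolding t_def by (rule tm[OF that])
    have "(\<integral>\<^sup>+x. \<delta> x * indicator ?box x \<partial>?P) = (\<integral>\<^sup>+x. fact n * (\<Sum>a<n1. \<Sum>b=n1..<n. t a b x) \<partial>?P)"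
      unfolding \<delta>_def t_def by (simp only: sum_distrib_right mult.assoc)
    also have "\<dots> = fact n * (\<integral>\<^sup>+x. (\<Sum>a<n1. \<Sum>b=n1..<n. t a b x) \<partial>?P)"
      using tm' by (intro nn_integral_cmult borel_measurable_sum) (auto simp: n)
    also have "(\<integral>\<^sup>+x. (\<Sum>a<n1. \<Sum>b=n1..<n. t a b x) \<partial>?P) = (\<Sum>a<n1. \<integral>\<^sup>+x. (\<Sum>b=n1..<n. t a b x) \<partial>?P)"
      using tm' by (intro nn_integral_sum borel_measurable_sum) (auto simp: n)
    also have "\<dots> = (\<Sum>a<n1. \<Sum>b=n1..<n. \<integral>\<^sup>+x. t a b x \<partial>?P)"
      using tm' by (intro sum.cong refl nn_integral_sum) (auto simp: n)
    finally have "(\<integral>\<^sup>+x. \<delta> x * indicator ?box x \<partial>?P) = fact n * (\<Sum>a<n1. \<Sum>b=n1..<n. \<integral>\<^sup>+x.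
      ennreal ((cmod (K (x a) (x b)))\<^sup>2) * (\<Prod>l\<in>{..<n} - {a, b}. ennreal (gK (x l))) * indicator ?box x \<partial>?P)"
      unfolding t_def .
    also have "\<dots> \<le> fact n * (\<Sum>a<n1. \<Sum>b=n1..<n. W S S' * (1 + mu (S \<union> S')) ^ n)"
    proof (intro mult_left_mono sum_mono)
      fix a b assume ab: "a \<in> {..<n1}" "b \<in> {n1..<n}"
      have "LL ! a \<in> set L" "LL ! b \<in> set L'"
        using ab by (auto simp: LL_def nth_append n1_def n2_def n)
      then have "LL ! a \<subseteq> S" "LL ! b \<subseteq> S'"
        using falling_monomial_support(2)[OF F] falling_monomial_support(2)[OF G] by auto
      then show "(\<integral>\<^sup>+x. ennreal ((cmod (K (x a) (x b)))\<^sup>2) * (\<Prod>l\<in>{..<n} - {a, b}. ennreal (gK (x l))) *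
          indicator ?box x \<partial>?P) \<le> W S S' * (1 + mu (S \<union> S')) ^ n"
        using ab n by (intro nn_integral_off_block_term[OF falling_monomial_support(2)[OF FG] LLn]) auto
    qed simp
    also have "\<dots> = C"
      unfolding C_def n1_def[symmetric] n2_def[symmetric] by (simp add: n mult_ac)
    finally show ?thesis .
  qed
  have AE: "AE x in ?P. ennreal (rho n x) * indicator ?box x \<le> ?u (?x1 x) * ?v (?x2 x) + \<delta> x * indicator ?box x \<and>
     ?u (?x1 x) * ?v (?x2 x) \<le> ennreal (rho n x) * indicator ?box x + \<delta> x * indicator ?box x"
    using AE_rho_blocks[of n1 n2, folded n] AE_diagonal[of n] AE_space
  proof eventually_elim
    case (elim x)
    let ?r = "rho n1 (?x1 x) * rho n2 (?x2 x)"
    have r: "0 \<le> rho n1 (?x1 x)" "0 \<le> rho n2 (?x2 x)" "0 \<le> rho n x"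
      using measurable_space[OF m1 elim(3)] measurable_space[OF m2 elim(3)] elim(3) by (auto intro: rho_nonneg)
    let ?d = "fact n * (\<Sum>a<n1. \<Sum>b=n1..<n. (cmod (K (x a) (x b)))\<^sup>2 * (\<Prod>l\<in>{..<n} - {a, b}. gK (x l)))"
    have g: "0 \<le> gK (x l)" if "l < n" for l using elim(2) that by auto
    have pg: "0 \<le> (\<Prod>l\<in>{..<n} - {a, b}. gK (x l))" for a b using g by (intro prod_nonneg) auto
    have pe: "(\<Prod>l\<in>{..<n} - {a, b}. ennreal (gK (x l))) = ennreal (\<Prod>l\<in>{..<n} - {a, b}. gK (x l))" for a b
      using g by (intro prod_ennreal) auto
    have \<delta>: "\<delta> x = ennreal ?d"
      unfolding \<delta>_def pe using pg
      by (simp add: ennreal_mult sum_nonneg flip: sum_ennreal ennreal_fact)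
    have d0: "0 \<le> ?d" using pg by (intro mult_nonneg_nonneg sum_nonneg) auto
    have uv: "?u (?x1 x) * ?v (?x2 x) = ennreal ?r * indicator ?box x"
      using r by (simp add: box_split[OF elim(3)] ennreal_mult mult_ac)
    have "rho n x \<le> ?r + ?d" "?r \<le> rho n x + ?d" using elim(1) by (auto simp: abs_le_iff)
    then have "ennreal (rho n x) \<le> ennreal ?r + ennreal ?d" "ennreal ?r \<le> ennreal (rho n x) + ennreal ?d"
      using r d0 by (auto simp: ennreal_plus[symmetric] simp del: ennreal_plus intro!: ennreal_leI)
    then show ?case
      unfolding uv \<delta> distrib_right[symmetric] by (auto intro!: mult_right_mono)
  qed
  have rm: "(\<lambda>x. ennreal (rho n x) * indicator ?box x) \<in> borel_measurable ?P"
    using box_measurable[of n "\<lambda>j. LL ! j", OF LLs] by measurable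
  show "(\<integral>\<^sup>+\<xi>. of_nat (F \<xi> * G \<xi>) \<partial>P) \<le> (\<integral>\<^sup>+\<xi>. of_nat (F \<xi>) \<partial>P) * (\<integral>\<^sup>+\<xi>. of_nat (G \<xi>) \<partial>P) + C"
  proof -
    have "(\<integral>\<^sup>+\<xi>. of_nat (F \<xi> * G \<xi>) \<partial>P) \<le> (\<integral>\<^sup>+x. ?u (?x1 x) * ?v (?x2 x) + \<delta> x * indicator ?box x \<partial>?P)"
      unfolding fg by (rule nn_integral_mono_AE) (use AE in auto)
    also have "\<dots> = (\<integral>\<^sup>+\<xi>. of_nat (F \<xi>) \<partial>P) * (\<integral>\<^sup>+\<xi>. of_nat (G \<xi>) \<partial>P) + (\<integral>\<^sup>+x. \<delta> x * indicator ?box x \<partial>?P)"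
      unfolding prod by (rule nn_integral_add[OF uvm \<delta>m])
    finally show ?thesis using bound by (meson add_left_mono order_trans)
  qed
  show "(\<integral>\<^sup>+\<xi>. of_nat (F \<xi>) \<partial>P) * (\<integral>\<^sup>+\<xi>. of_nat (G \<xi>) \<partial>P) \<le> (\<integral>\<^sup>+\<xi>. of_nat (F \<xi> * G \<xi>) \<partial>P) + C"
  proof -
    have "(\<integral>\<^sup>+\<xi>. of_nat (F \<xi>) \<partial>P) * (\<integral>\<^sup>+\<xi>. of_nat (G \<xi>) \<partial>P) \<le>
      (\<integral>\<^sup>+x. ennreal (rho n x) * indicator ?box x + \<delta> x * indicator ?box x \<partial>?P)"
      unfolding prod by (rule nn_integral_mono_AE) (use AE in auto)
    also have "\<dots> = (\<integral>\<^sup>+\<xi>. of_nat (F \<xi> * G \<xi>) \<partial>P) + (\<integral>\<^sup>+x. \<delta> x * indicator ?box x \<partial>?P)"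
      unfolding fg by (rule nn_integral_add[OF rm \<delta>m])
    finally show ?thesis using bound by (meson add_left_mono order_trans)
  qed
qed

text \<open>The count of \<open>B\<close> has second moment
  \<open>mu B * mu B - W B B + mu B\<close>, so its variance is \<open>mu B - W B B\<close>.
  Non-negativity of the variance enters as the Cauchy-Schwarz inequality against the constant
  \<open>1\<close>; the finite second factorial moment is then cancelled.\<close>

lemma W_le_mu:
  assumes B: "B \<in> bounded_sets M"
  shows "W B B \<le> mu B"
proof -
  have [measurable]: "num_particles B \<in> measurable P (count_space UNIV)" by (rule num_particles_measurable[OF B])
  let ?N = "\<lambda>\<xi>. num_particles B \<xi>"
  let ?f = "\<integral>\<^sup>+\<xi>. of_nat (falling (?N \<xi>) 2) \<partial>P"
  have f: "?f + W B B = mu B * mu B" by (rule W_self[OF B])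
  have "mu B * mu B = (\<integral>\<^sup>+\<xi>. of_nat (?N \<xi>) * 1 \<partial>P)\<^sup>2"
    unfolding nn_expectation_num_particles[OF B, symmetric] by (simp add: power2_eq_square)
  also have "\<dots> \<le> (\<integral>\<^sup>+\<xi>. (of_nat (?N \<xi>))\<^sup>2 \<partial>P) * (\<integral>\<^sup>+\<xi>. 1\<^sup>2 \<partial>P)"
    by (rule Cauchy_Schwarz_nn_integral) auto
  also have "\<dots> = (\<integral>\<^sup>+\<xi>. of_nat (falling (?N \<xi>) 2) + of_nat (?N \<xi>) \<partial>P)"
  proof -
    have "falling n 2 + n = n\<^sup>2" for n :: nat
      by (cases n) (simp_all add: falling_2 power2_eq_square)
    then have "of_nat (falling n 2) + of_nat n = (of_nat n :: ennreal)\<^sup>2" for n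
      by (metis of_nat_add of_nat_power)
    then show ?thesis by (simp add: P.emeasure_space_1)
  qed
  also have "\<dots> = ?f + mu B"
    by (subst nn_integral_add) (auto simp: nn_expectation_num_particles[OF B])
  finally have "?f + W B B \<le> ?f + mu B" unfolding f .
  moreover have "?f < \<top>"
  proof -
    have "?f \<le> mu B * mu B" unfolding f[symmetric] by simp
    also have "\<dots> < \<top>" using mu_finite[OF B] by (simp add: ennreal_mult_less_top)
    finally show ?thesis .
  qed
  ultimately show ?thesis by (auto simp: ennreal_add_left_cancel_le)
qed

lemma W_UN:
  assumes I: "finite I" "disjoint_family_on A I" "\<And>i. i \<in> I \<Longrightarrow> A i \<in> sets M"
    and J: "finite J" "disjoint_family_on B J" "\<And>j. j \<in> J \<Longrightarrow> B j \<in> sets M"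
  shows "W (\<Union>i\<in>I. A i) (\<Union>j\<in>J. B j) = (\<Sum>i\<in>I. \<Sum>j\<in>J. W (A i) (B j))"
proof -
  have m: "(\<lambda>z. ennreal ((cmod (K (fst z) (snd z)))\<^sup>2) * indicator (A i) (fst z) * indicator (B j) (snd z)) \<in> borel_measurable (M \<Otimes>\<^sub>M M)"
    if "i \<in> I" "j \<in> J" for i j
    using W_integrand_measurable[OF I(3)[OF that(1)] J(3)[OF that(2)]] by (simp add: case_prod_beta)
  have "W (\<Union>i\<in>I. A i) (\<Union>j\<in>J. B j) =
    (\<integral>\<^sup>+z. (\<Sum>i\<in>I. \<Sum>j\<in>J. ennreal ((cmod (K (fst z) (snd z)))\<^sup>2) * indicator (A i) (fst z) * indicator (B j) (snd z)) \<partial>(M \<Otimes>\<^sub>M M))"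
    unfolding W_def indicator_UN_disjoint[OF I(1,2)] indicator_UN_disjoint[OF J(1,2)]
    by (rule nn_integral_cong, simp only: sum_distrib_left sum_distrib_right mult.assoc, rule sum.swap)
  also have "\<dots> = (\<Sum>i\<in>I. \<integral>\<^sup>+z. (\<Sum>j\<in>J. ennreal ((cmod (K (fst z) (snd z)))\<^sup>2) * indicator (A i) (fst z) * indicator (B j) (snd z)) \<partial>(M \<Otimes>\<^sub>M M))"
    using m by (intro nn_integral_sum borel_measurable_sum) auto
  also have "\<dots> = (\<Sum>i\<in>I. \<Sum>j\<in>J. W (A i) (B j))"
    unfolding W_def using m by (intro sum.cong refl nn_integral_sum) auto
  finally show ?thesis .
qed

lemma mu_UN:
  assumes I: "finite I" "disjoint_family_on A I" "\<And>i. i \<in> I \<Longrightarrow> A i \<in> sets M"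
  shows "mu (\<Union>i\<in>I. A i) = (\<Sum>i\<in>I. mu (A i))"
proof -
  have "mu (\<Union>i\<in>I. A i) = (\<integral>\<^sup>+x. (\<Sum>i\<in>I. ennreal (gK x) * indicator (A i) x) \<partial>M)"
    unfolding mu_def indicator_UN_disjoint[OF I(1,2)] by (simp only: sum_distrib_left)
  also have "\<dots> = (\<Sum>i\<in>I. mu (A i))"
    unfolding mu_def using I(3) by (intro nn_integral_sum) auto
  finally show ?thesis .
qed

section \<open>Lattice cells\<close>

text \<open>Half-open, so that the cells at lattice points are disjoint and cover the space. In the
  discrete case such a cell is a single point.\<close>

definition cell :: "real ^ 'd \<Rightarrow> (real ^ 'd) set" where
  "cell z = {x \<in> space M. \<forall>i. z $ i \<le> x $ i \<and> x $ i < z $ i + 1}"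

lemma cell_bounded_sets: "cell z \<in> bounded_sets M"
proof -
  let ?C = "{x. \<forall>i. z $ i \<le> x $ i \<and> x $ i < z $ i + 1}"
  have "?C \<in> sets borel" by measurable
  moreover have "cell z = ?C \<inter> space M" by (auto simp: cell_def)
  moreover have "bounded (cell z)"
    by (rule bounded_subset[OF bounded_cbox[of z "z + 1"]]) (auto simp: cell_def mem_box_cart less_imp_le)
  ultimately show ?thesis using sets_M_borel by (simp add: bounded_sets_def)
qed

lemma disjoint_cells: "disjoint_family_on cell int_lattice"
  unfolding disjoint_family_on_def
proof (intro ballI impI)
  fix z w :: "real ^ 'd" assume zw: "z \<in> int_lattice" "w \<in> int_lattice" "z \<noteq> w"
  then obtain i where i: "z $ i \<noteq> w $ i" by (auto simp: Finite_Cartesian_Product.vec_eq_iff)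
  obtain a b :: int where ab: "z $ i = of_int a" "w $ i = of_int b"
    using zw by (auto simp: int_lattice_def elim!: Ints_cases) (metis Ints_cases)
  show "cell z \<inter> cell w = {}"
  proof (rule ccontr)
    assume "cell z \<inter> cell w \<noteq> {}"
    then obtain x where "x \<in> cell z" "x \<in> cell w" by auto
    then have "of_int a \<le> x $ i" "x $ i < of_int a + 1" "of_int b \<le> x $ i" "x $ i < of_int b + 1"
      using ab by (auto simp: cell_def dest!: spec[of _ i])
    then have "a = \<lfloor>x $ i\<rfloor>" "b = \<lfloor>x $ i\<rfloor>" by (auto simp: floor_unique[symmetric] intro: floor_unique[symmetric])
    with i ab show False by simp
  qed
qed

lemma cell_translate:
  assumes "z \<in> space M"
  shows "(\<lambda>x. x - z) ` cell w = cell (w - z)"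
proof (intro equalityI subsetI)
  fix x assume "x \<in> cell (w - z)"
  then have "x + z \<in> cell w" using assms by (auto simp: cell_def space_closed algebra_simps)
  then show "x \<in> (\<lambda>x. x - z) ` cell w" by (intro image_eqI[of _ _ "x + z"]) auto
qed (use assms in \<open>auto simp: cell_def space_diff algebra_simps\<close>)

text \<open>Two cells at lattice points coincide or are disjoint, so the two invariance rules for
  \<open>W\<close> cover every pair.\<close>

lemma W_cells:
  assumes z: "z \<in> int_lattice" and w: "w \<in> int_lattice"
  shows "W (cell z) (cell w) = W (cell 0) (cell (w - z))"
proof -
  have zM: "z \<in> space M" using z int_lattice_subset by auto
  show ?thesis
  proof (cases "z = w")
    case True
    then show ?thesis using W_translate_self[OF cell_bounded_sets zM, of z, unfolded cell_translate[OF zM]] by simp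
  next
    case False
    then have "cell z \<inter> cell w = {}" using disjoint_cells z w by (auto simp: disjoint_family_on_def)
    from W_translate_disjoint[OF cell_bounded_sets cell_bounded_sets this zM]
    show ?thesis by (simp add: cell_translate[OF zM])
  qed
qed

lemma mu_cell: "z \<in> int_lattice \<Longrightarrow> mu (cell z) = mu (cell 0)"
  using mu_translate[OF cell_bounded_sets, of z z] cell_translate[of z z] int_lattice_subset by auto

text \<open>\<open>W_le_mu\<close> for a union of cells: its left side is quadratic in the number of
  cells, its right side only linear. This gap forces the terms to be summable.\<close>

lemma sum_W_cells_le:
  assumes F: "finite F" "F \<subseteq> int_lattice"
  shows "(\<Sum>z\<in>F. \<Sum>w\<in>F. W (cell 0) (cell (w - z))) \<le> of_nat (card F) * mu (cell 0)"
proof -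
  have d: "disjoint_family_on cell F" by (rule disjoint_family_on_mono[OF F(2) disjoint_cells])
  have s: "cell z \<in> sets M" for z using cell_bounded_sets by (rule bounded_sets_sets)
  have "(\<Sum>z\<in>F. \<Sum>w\<in>F. W (cell 0) (cell (w - z))) = (\<Sum>z\<in>F. \<Sum>w\<in>F. W (cell z) (cell w))"
    using F by (intro sum.cong refl W_cells[symmetric]) auto
  also have "\<dots> = W (\<Union>z\<in>F. cell z) (\<Union>z\<in>F. cell z)"
    by (rule W_UN[OF F(1) d s F(1) d s, symmetric])
  also have "\<dots> \<le> mu (\<Union>z\<in>F. cell z)"
    by (intro W_le_mu bounded_sets_UN F cell_bounded_sets)
  also have "\<dots> = (\<Sum>z\<in>F. mu (cell 0))"
    using F unfolding mu_UN[OF F(1) d s] by (intro sum.cong refl mu_cell) auto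
  finally show ?thesis by simp
qed

end

subsection \<open>Folner boxes\<close>

context one_particle_space
begin

definition fbox :: "nat \<Rightarrow> (real ^ 'd) set" where
  "fbox n = {x \<in> space M. \<forall>i. 0 \<le> x $ i \<and> x $ i < real n}"

lemma fbox_bounded_sets: "fbox n \<in> bounded_sets M"
proof -
  let ?C = "{x. \<forall>i. 0 \<le> x $ i \<and> x $ i < real n} :: (real ^ 'd) set"
  have "?C \<in> sets borel" by measurable
  moreover have "fbox n = ?C \<inter> space M" by (auto simp: fbox_def)
  moreover have "bounded (fbox n)"
    by (rule bounded_subset[OF bounded_cbox[of 0 "\<chi> i. real n"]]) (auto simp: fbox_def mem_box_cart less_imp_le)
  ultimately show ?thesis using sets_M_borel by (simp add: bounded_sets_def)
qed

lemma measure_fbox: "measure M (fbox n) = real n ^ CARD('d)"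
proof (rule M_cases')
  assume M: "M = lborel"
  let ?b = "\<chi> i. real n :: real ^ 'd"
  have fb: "fbox n = {x. \<forall>i. 0 \<le> x $ i \<and> x $ i < real n}"
    unfolding fbox_def by (simp add: M)
  have sub: "box 0 ?b \<subseteq> fbox n" "fbox n \<subseteq> cbox 0 ?b"
    by (auto simp: fb mem_box_cart less_imp_le)
  have eq: "emeasure lborel (box 0 ?b) = emeasure lborel (cbox 0 ?b)"
    by (simp add: emeasure_lborel_box_eq emeasure_lborel_cbox_eq)
  have fs: "fbox n \<in> sets lborel" using fbox_bounded_sets[of n] M by (simp add: bounded_sets_def)
  have "emeasure lborel (fbox n) = emeasure lborel (cbox 0 ?b)"
    using emeasure_mono[OF sub(1) fs] emeasure_mono[OF sub(2), of lborel] eq by (intro antisym) auto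
  then have "measure M (fbox n) = measure lborel (cbox 0 ?b)" by (simp add: M measure_def)
  also have "\<dots> = (\<Prod>i\<in>(UNIV :: 'd set). real n)"
  proof -
    have "cbox 0 ?b \<noteq> {}" by (auto simp: interval_ne_empty_cart)
    then show ?thesis by (simp add: content_cbox_cart)
  qed
  finally show ?thesis by simp
next
  assume M: "M = count_space int_lattice"
  let ?F = "\<lambda>f :: 'd \<Rightarrow> int. \<chi> i. real_of_int (f i)"
  have fb: "fbox n = {x \<in> int_lattice. \<forall>i. 0 \<le> x $ i \<and> x $ i < real n}"
    unfolding fbox_def by (simp add: M)
  have "fbox n = ?F ` (UNIV \<rightarrow>\<^sub>E {0..<int n})"
  proof (intro equalityI subsetI)
    fix x assume x: "x \<in> fbox n"
    then have "\<forall>i. \<exists>k :: int. x $ i = of_int k" by (auto simp: fb int_lattice_def elim!: Ints_cases)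
    then obtain f where f: "\<And>i. x $ i = of_int (f i :: int)" by metis
    have "f i \<in> {0..<int n}" for i using x f[of i] by (auto simp: fb dest!: spec[of _ i])
    moreover have "x = ?F f" by (simp add: Finite_Cartesian_Product.vec_eq_iff f)
    ultimately show "x \<in> ?F ` (UNIV \<rightarrow>\<^sub>E {0..<int n})" by (intro image_eqI[of _ _ f]) (auto simp: PiE_UNIV_domain)
  qed (auto simp: fb int_lattice_def PiE_UNIV_domain Pi_iff, metis of_int_less_iff of_int_of_nat_eq)
  moreover have "inj ?F" by (auto simp: inj_on_def Finite_Cartesian_Product.vec_eq_iff)
  ultimately have "card (fbox n) = card (UNIV \<rightarrow>\<^sub>E {0..<int n} :: ('d \<Rightarrow> int) set)"
    by (simp add: card_image inj_on_subset)
  also have "\<dots> = n ^ CARD('d)" by (simp add: card_PiE)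
  finally have c: "card (fbox n) = n ^ CARD('d)" .
  have "finite (fbox n)" "fbox n \<subseteq> int_lattice"
    using finite_int_lattice_bounded[of "fbox n"] fbox_bounded_sets[of n] by (auto simp: bounded_sets_def M)
  then show ?thesis using c by (simp add: M measure_count_space)
qed

text \<open>The box of side \<open>n - 2 * m\<close>, moved by \<open>m\<close> in every coordinate,
  lies in the overlap. For \<open>2 * m > n\<close> the truncated difference is \<open>0\<close> and
  that box is empty, so the bound still holds.\<close>

lemma measure_fbox_overlap_ge:
  fixes u :: "real ^ 'd"
  assumes u: "u \<in> space M" and m: "\<And>i. \<bar>u $ i\<bar> \<le> real m"
  shows "real (n - 2 * m) ^ CARD('d) \<le> measure M {x \<in> fbox n. x + u \<in> fbox n}"
proof -
  define v where "v = (\<chi> i. real m :: real ^ 'd)"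
  have v: "v \<in> space M" using int_lattice_subset by (auto simp: v_def int_lattice_def)
  let ?S = "{x \<in> fbox n. x + u \<in> fbox n}"
  have Seq: "?S = fbox n \<inter> ((\<lambda>x. x + u) -` fbox n \<inter> space M)" by (auto simp: fbox_def)
  have S: "?S \<in> sets M"
    unfolding Seq using fbox_bounded_sets[of n]
    by (intro sets.Int measurable_sets[OF measurable_shift[OF u]]) (auto simp: bounded_sets_def)
  have "measure M (fbox (n - 2 * m)) = measure (distr M M (\<lambda>x. x + v)) ((\<lambda>x. x + v) ` fbox (n - 2 * m))"
  proof -
    have im: "(\<lambda>x. x + v) ` fbox (n - 2 * m) \<in> sets M"
      using bounded_sets_translate[OF fbox_bounded_sets space_closed(3)[OF v], of "n - 2 * m"] by (simp add: bounded_sets_def)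
    have "(\<lambda>x. x + v) -` ((\<lambda>x. x + v) ` fbox (n - 2 * m)) \<inter> space M = fbox (n - 2 * m)"
      by (auto simp: fbox_def)
    then show ?thesis using measure_distr[OF measurable_shift[OF v] im] by simp
  qed
  also have "\<dots> = measure M ((\<lambda>x. x + v) ` fbox (n - 2 * m))" by (simp only: distr_shift[OF v])
  also have "\<dots> \<le> measure M ?S"
  proof (rule measure_mono_fmeasurable)
    show "(\<lambda>x. x + v) ` fbox (n - 2 * m) \<subseteq> ?S"
    proof (intro subsetI, elim imageE)
      fix x y assume xy: "x = y + v" "y \<in> fbox (n - 2 * m)"
      show "x \<in> ?S"
      proof (cases "2 * m \<le> n")
        case True
        have y: "0 \<le> y $ i" "y $ i < real n - 2 * real m" for i using xy(2) True by (auto simp: fbox_def of_nat_diff)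
        have "x \<in> space M" "x + u \<in> space M"
          using xy u v by (auto simp: fbox_def intro!: space_closed)
        moreover have "0 \<le> x $ i" "x $ i < real n" "0 \<le> (x + u) $ i" "(x + u) $ i < real n" for i
          using y[of i] m[of i] by (auto simp: xy(1) v_def abs_le_iff)
        ultimately show ?thesis by (simp add: fbox_def)
      next
        case False
        then show ?thesis using xy(2) by (auto simp: fbox_def)
      qed
    qed
    show "(\<lambda>x. x + v) ` fbox (n - 2 * m) \<in> sets M"
      using bounded_sets_translate[OF fbox_bounded_sets space_closed(3)[OF v], of "n - 2 * m"] by (simp add: bounded_sets_def)
    have "emeasure M ?S \<le> emeasure M (fbox n)"
      using fbox_bounded_sets[of n] by (intro emeasure_mono) (auto simp: bounded_sets_def)
    then show "?S \<in> fmeasurable M"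
      using S emeasure_bounded_sets[OF fbox_bounded_sets, of n] by (auto simp: fmeasurable_def intro: le_less_trans)
  qed
  finally show ?thesis by (simp add: measure_fbox)
qed

lemma folner_ratio:
  assumes u: "u \<in> space M"
  shows "(\<lambda>n. measure M {x \<in> fbox n. x + u \<in> fbox n} / measure M (fbox n)) \<longlonglongrightarrow> 1"
proof -
  obtain m :: nat where m: "norm u \<le> real m" using real_arch_simple by blast
  have m': "\<bar>u $ i\<bar> \<le> real m" for i using component_le_norm_cart[of u i] m by linarith
  have lim: "(\<lambda>n. ((real n - 2 * real m) / real n) ^ CARD('d)) \<longlonglongrightarrow> 1"
  proof -
    have "(\<lambda>n. 1 - (2 * real m) * inverse (real n)) \<longlonglongrightarrow> 1 - (2 * real m) * 0"
      by (intro tendsto_intros lim_inverse_n)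
    moreover have "\<forall>\<^sub>F n in sequentially. 1 - (2 * real m) * inverse (real n) = (real n - 2 * real m) / real n"
      using eventually_gt_at_top[of 0] by eventually_elim (simp add: field_simps)
    ultimately have "(\<lambda>n. (real n - 2 * real m) / real n) \<longlonglongrightarrow> 1"
      by (simp add: tendsto_cong)
    from tendsto_power[OF this, of "CARD('d)"] show ?thesis by simp
  qed
  show ?thesis
  proof (rule tendsto_sandwich[OF _ _ lim tendsto_const])
    show "\<forall>\<^sub>F n in sequentially. ((real n - 2 * real m) / real n) ^ CARD('d) \<le>
      measure M {x \<in> fbox n. x + u \<in> fbox n} / measure M (fbox n)"
      using eventually_ge_at_top[of "2 * m + 1"]
    proof eventually_elim
      case (elim n)
      then have "(real n - 2 * real m) ^ CARD('d) \<le> measure M {x \<in> fbox n. x + u \<in> fbox n}"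
        using measure_fbox_overlap_ge[OF u m', of n] by (simp add: of_nat_diff)
      then show ?case unfolding measure_fbox power_divide by (intro divide_right_mono) auto
    qed
    show "\<forall>\<^sub>F n in sequentially. measure M {x \<in> fbox n. x + u \<in> fbox n} / measure M (fbox n) \<le> 1"
    proof (intro always_eventually allI)
      fix n
      have "measure M {x \<in> fbox n. x + u \<in> fbox n} \<le> measure M (fbox n)"
      proof (cases "{x \<in> fbox n. x + u \<in> fbox n} \<in> sets M")
        case True
        then show ?thesis using fbox_bounded_sets[of n] emeasure_bounded_sets[OF fbox_bounded_sets, of n]
          by (intro measure_mono_fmeasurable) (auto simp: fmeasurable_def bounded_sets_def)
      qed (simp add: measure_notin_sets)
      then show "measure M {x \<in> fbox n. x + u \<in> fbox n} / measure M (fbox n) \<le> 1"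
        by (simp add: divide_le_eq_1 less_le)
    qed
  qed
qed

end

context invariant_determinantal_field
begin

section \<open>Integrability of the squared kernel in one variable\<close>

text \<open>In \<open>sum_W_cells_le\<close> for a lattice box, a displacement \<open>u\<close> is
  counted once for every \<open>z\<close> such that \<open>z\<close> and \<open>z + u\<close> both
  lie in the box. Relative to the size of the box these weights tend to \<open>1\<close>, which
  leaves the sum over \<open>u\<close> with a bound independent of \<open>G\<close>.\<close>

lemma sum_W_cell_le:
  assumes G: "finite G" "G \<subseteq> int_lattice"
  shows "(\<Sum>u\<in>G. W (cell 0) (cell u)) \<le> mu (cell 0)"
proof -
  \<comment> \<open>Cells are indexed by lattice points in both cases, so the averaging boxes are
    lattice boxes even when \<open>M\<close> is Lebesgue measure.\<close>
  interpret L: one_particle_space "count_space int_lattice :: (real ^ 'd) measure"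
    by unfold_locales simp
  define w where "w u = enn2real (W (cell 0) (cell u))" for u
  have w: "W (cell 0) (cell u) = ennreal (w u)" for u
    unfolding w_def using W_finite[OF cell_bounded_sets cell_bounded_sets] by (simp add: ennreal_enn2real_if less_top[symmetric])
  have w0: "w u \<ge> 0" for u by (simp add: w_def)
  define c where "c = enn2real (mu (cell 0))"
  have c: "mu (cell 0) = ennreal c"
    unfolding c_def using mu_finite[OF cell_bounded_sets] by (simp add: ennreal_enn2real_if less_top[symmetric])
  have c0: "c \<ge> 0" by (simp add: c_def)
  have fin: "finite (L.fbox n)" and sub: "L.fbox n \<subseteq> int_lattice" for n
    using L.fbox_bounded_sets[of n] finite_int_lattice_bounded[of "L.fbox n"] by (auto simp: bounded_sets_def)
  have card: "measure (count_space int_lattice) A = real (card A)" if "A \<subseteq> L.fbox n" for A n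
    using that sub[of n] fin[of n] by (subst measure_count_space) (auto intro: finite_subset)
  have le: "(\<Sum>u\<in>G. w u * (measure (count_space int_lattice) {x \<in> L.fbox n. x + u \<in> L.fbox n} / measure (count_space int_lattice) (L.fbox n))) \<le> c"
    if n: "n > 0" for n
  proof -
    let ?F = "L.fbox n"
    have pos: "real (card ?F) > 0"
      using L.measure_fbox[of n] n card[of ?F n] by simp
    have "(\<Sum>u\<in>G. w u * real (card {x \<in> ?F. x + u \<in> ?F})) = (\<Sum>u\<in>G. \<Sum>z\<in>{x \<in> ?F. x + u \<in> ?F}. w u)"
      by (simp add: mult.commute)
    also have "\<dots> = (\<Sum>u\<in>G. \<Sum>z\<in>?F. if z + u \<in> ?F then w u else 0)"
      using fin by (simp add: sum.If_cases Int_def)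
    also have "\<dots> = (\<Sum>z\<in>?F. \<Sum>u\<in>G. if z + u \<in> ?F then w u else 0)"
      by (rule sum.swap)
    also have "\<dots> = (\<Sum>z\<in>?F. \<Sum>u\<in>{u \<in> G. z + u \<in> ?F}. w u)"
      using G by (simp add: sum.If_cases Int_def)
    also have "\<dots> = (\<Sum>z\<in>?F. \<Sum>v\<in>(\<lambda>u. z + u) ` {u \<in> G. z + u \<in> ?F}. w (v - z))"
      by (simp add: sum.reindex)
    also have "\<dots> \<le> (\<Sum>z\<in>?F. \<Sum>v\<in>?F. w (v - z))"
      using fin w0 by (intro sum_mono sum_mono2) auto
    also have "\<dots> \<le> real (card ?F) * c"
    proof -
      have "ennreal (\<Sum>z\<in>?F. \<Sum>v\<in>?F. w (v - z)) = (\<Sum>z\<in>?F. \<Sum>v\<in>?F. W (cell 0) (cell (v - z)))"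
        unfolding w using w0 by (simp add: sum_ennreal sum_nonneg)
      also have "\<dots> \<le> ennreal (real (card ?F) * c)"
        using sum_W_cells_le[of ?F, OF fin sub] c0 by (simp add: c ennreal_mult ennreal_of_nat_eq_real_of_nat)
      finally show ?thesis using c0 by (simp add: ennreal_le_iff)
    qed
    finally show ?thesis
      using pos card[of "{x \<in> ?F. x + u \<in> ?F}" n for u] card[of ?F n]
      by (simp add: sum_divide_distrib[symmetric] times_divide_eq_right divide_le_eq mult.commute)
  qed
  have "(\<lambda>n. \<Sum>u\<in>G. w u * (measure (count_space int_lattice) {x \<in> L.fbox n. x + u \<in> L.fbox n} / measure (count_space int_lattice) (L.fbox n)))
      \<longlonglongrightarrow> (\<Sum>u\<in>G. w u * 1)"
    using G by (intro tendsto_intros L.folner_ratio) auto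
  then have "(\<Sum>u\<in>G. w u * 1) \<le> c"
    by (rule tendsto_upperbound[OF _ eventually_mono[OF eventually_gt_at_top[of 0] le]]) simp_all
  then have "ennreal (\<Sum>u\<in>G. w u) \<le> ennreal c" by (intro ennreal_leI) simp
  then show ?thesis using w0 by (simp add: w c)
qed

definition cube :: "nat \<Rightarrow> (real ^ 'd) set" where
  "cube N = {x \<in> space M. \<forall>i. - real N \<le> x $ i \<and> x $ i < real N}"

definition cube_cells :: "nat \<Rightarrow> (real ^ 'd) set" where
  "cube_cells N = {z \<in> int_lattice. \<forall>i. - real N \<le> z $ i \<and> z $ i < real N}"

lemma cube_cells: "finite (cube_cells N)" "cube_cells N \<subseteq> int_lattice"
proof -
  have "bounded (cube_cells N)"
    by (rule bounded_subset[OF bounded_cbox[of "\<chi> i. - real N" "\<chi> i. real N"]])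
      (auto simp: cube_cells_def mem_box_cart less_imp_le)
  then show "finite (cube_cells N)" by (rule finite_int_lattice_bounded) (auto simp: cube_cells_def)
qed (auto simp: cube_cells_def)

lemma cube_eq: "cube N = (\<Union>z\<in>cube_cells N. cell z)"
proof (intro equalityI subsetI)
  fix x assume x: "x \<in> cube N"
  define z :: "real ^ 'd" where "z = (\<chi> i. of_int \<lfloor>x $ i\<rfloor>)"
  have "z \<in> cube_cells N"
  proof -
    have "- real N \<le> of_int \<lfloor>x $ i\<rfloor>" "of_int \<lfloor>x $ i\<rfloor> < real N" for i
    proof -
      have "- real N \<le> x $ i" "x $ i < real N" using x by (auto simp: cube_def)
      then have "- int N \<le> \<lfloor>x $ i\<rfloor>" "\<lfloor>x $ i\<rfloor> < int N" by (auto simp: le_floor_iff floor_less_iff)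
      then show "- real N \<le> of_int \<lfloor>x $ i\<rfloor>" "of_int \<lfloor>x $ i\<rfloor> < real N" by linarith+
    qed
    then show ?thesis by (simp add: cube_cells_def z_def int_lattice_def)
  qed
  moreover have "x \<in> cell z" using x by (auto simp: cell_def z_def cube_def intro: less_imp_le)
  ultimately show "x \<in> (\<Union>z\<in>cube_cells N. cell z)" by blast
next
  fix x assume "x \<in> (\<Union>z\<in>cube_cells N. cell z)"
  then obtain z where z: "z \<in> int_lattice" "\<And>i. - real N \<le> z $ i" "\<And>i. z $ i < real N" "x \<in> cell z"
    by (auto simp: cube_cells_def)
  have "- real N \<le> x $ i" "x $ i < real N" for i
  proof -
    obtain k :: int where k: "z $ i = of_int k" using z(1) by (auto simp: int_lattice_def elim!: Ints_cases)
    have "k < int N" using z(3)[of i] k by simp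
    then have "real_of_int k + 1 \<le> real N" by linarith
    moreover have "z $ i \<le> x $ i" "x $ i < z $ i + 1" using z(4) by (auto simp: cell_def)
    ultimately show "- real N \<le> x $ i" "x $ i < real N" using z(2)[of i] k by auto
  qed
  then show "x \<in> cube N" using z(4) by (auto simp: cube_def cell_def)
qed

lemma cube_bounded_sets: "cube N \<in> bounded_sets M"
  unfolding cube_eq by (intro bounded_sets_UN cube_cells cell_bounded_sets)

lemma bounded_subset_cube:
  assumes "bounded A" "A \<subseteq> space M"
  shows "\<exists>N. A \<subseteq> cube N"
proof -
  obtain b where b: "\<And>x. x \<in> A \<Longrightarrow> norm x \<le> b" using assms(1) by (auto simp: bounded_iff)
  obtain N :: nat where N: "b < real N" using reals_Archimedean2 by blast
  have "- real N \<le> x $ i" "x $ i < real N" if "x \<in> A" for x i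
    using component_le_norm_cart[of x i] b[OF that] N by auto
  then have "A \<subseteq> cube N" using assms(2) by (auto simp: cube_def)
  then show ?thesis by blast
qed

lemma incseq_cube: "incseq cube"
proof (intro monoI subsetI)
  fix N N' :: nat and x :: "real ^ 'd" assume "N \<le> N'" "x \<in> cube N"
  then have "- real N' \<le> x $ i" "x $ i < real N'" for i
    using of_nat_mono[of N N', where ?'a=real] by (auto simp: cube_def dest!: spec[of _ i])
  then show "x \<in> cube N'" using \<open>x \<in> cube N\<close> by (simp add: cube_def)
qed

lemma UN_cube: "(\<Union>N. cube N) = space M"
proof
  show "space M \<subseteq> (\<Union>N. cube N)"
    using bounded_subset_cube[of "{x}" for x] by auto
qed (auto simp: cube_def)

lemma W_cube_le: "W (cube N) (cube N') \<le> of_nat (card (cube_cells N)) * mu (cell 0)"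
proof -
  have d: "disjoint_family_on cell (cube_cells N)" for N
    by (rule disjoint_family_on_mono[OF cube_cells(2) disjoint_cells])
  have s: "cell z \<in> sets M" for z using cell_bounded_sets by (rule bounded_sets_sets)
  have "W (cube N) (cube N') = (\<Sum>z\<in>cube_cells N. \<Sum>v\<in>cube_cells N'. W (cell z) (cell v))"
    unfolding cube_eq by (rule W_UN[OF cube_cells(1) d s cube_cells(1) d s])
  also have "\<dots> \<le> (\<Sum>z\<in>cube_cells N. mu (cell 0))"
  proof (intro sum_mono)
    fix z assume z: "z \<in> cube_cells N"
    then have zl: "z \<in> int_lattice" using cube_cells(2) by auto
    have "(\<Sum>v\<in>cube_cells N'. W (cell z) (cell v)) = (\<Sum>v\<in>cube_cells N'. W (cell 0) (cell (v - z)))"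
      using cube_cells(2) zl by (intro sum.cong refl W_cells) auto
    also have "\<dots> = (\<Sum>u\<in>(\<lambda>v. v - z) ` cube_cells N'. W (cell 0) (cell u))"
      by (simp add: sum.reindex inj_on_def)
    also have "\<dots> \<le> mu (cell 0)"
    proof (rule sum_W_cell_le)
      show "(\<lambda>v. v - z) ` cube_cells N' \<subseteq> int_lattice"
        using cube_cells(2)[of N'] int_lattice_closed(2)[OF _ int_lattice_closed(3)[OF zl]] by auto
    qed (intro finite_imageI cube_cells)
    finally show "(\<Sum>v\<in>cube_cells N'. W (cell z) (cell v)) \<le> mu (cell 0)" .
  qed
  finally show ?thesis by simp
qed

text \<open>The bound of \<open>W_cube_le\<close> does not depend on the second cube, so monotone
  convergence lets that cube exhaust the space.\<close>

lemma W_space_finite: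
  assumes A: "A \<in> bounded_sets M"
  shows "W A (space M) < \<infinity>"
proof -
  obtain N where N: "A \<subseteq> cube N"
    using bounded_subset_cube[of A] A sets.sets_into_space[of A M] by (auto simp: bounded_sets_def)
  have m: "(\<lambda>z. ennreal ((cmod (K (fst z) (snd z)))\<^sup>2) * indicator (cube N) (fst z) * indicator (cube N') (snd z)) \<in> borel_measurable (M \<Otimes>\<^sub>M M)" for N'
    using W_integrand_measurable[OF bounded_sets_sets[OF cube_bounded_sets] bounded_sets_sets[OF cube_bounded_sets], of N N']
    by (simp add: case_prod_beta)
  have "W (cube N) (space M) = (\<integral>\<^sup>+z. (SUP N'. ennreal ((cmod (K (fst z) (snd z)))\<^sup>2) * indicator (cube N) (fst z) * indicator (cube N') (snd z)) \<partial>(M \<Otimes>\<^sub>M M))"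
    unfolding W_def
  proof (rule nn_integral_cong)
    fix z :: "(real ^ 'd) \<times> (real ^ 'd)"
    have "indicator (space M) y = (SUP N'. indicator (cube N') y :: ennreal)" for y
    proof (cases "\<exists>N'. y \<in> cube N'")
      case True
      then obtain N' where N': "y \<in> cube N'" by auto
      have "indicator (space M) y \<le> (SUP N'. indicator (cube N') y :: ennreal)"
        by (rule SUP_upper2[of N']) (use N' in \<open>auto simp: indicator_def\<close>)
      moreover have "(SUP N'. indicator (cube N') y :: ennreal) \<le> indicator (space M) y"
        by (rule SUP_least) (auto simp: indicator_def cube_def)
      ultimately show ?thesis by (rule antisym)
    next
      case False
      then have "y \<notin> space M" unfolding UN_cube[symmetric] by auto
      with False show ?thesis by simp
    qed
    then show "ennreal ((cmod (K (fst z) (snd z)))\<^sup>2) * indicator (cube N) (fst z) * indicator (space M) (snd z) =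
      (SUP N'. ennreal ((cmod (K (fst z) (snd z)))\<^sup>2) * indicator (cube N) (fst z) * indicator (cube N') (snd z))"
      by (simp add: SUP_mult_left_ennreal)
  qed
  also have "\<dots> = (SUP N'. W (cube N) (cube N'))"
    unfolding W_def
  proof (rule nn_integral_monotone_convergence_SUP[OF _ m])
    show "incseq (\<lambda>N' z. ennreal ((cmod (K (fst z) (snd z)))\<^sup>2) * indicator (cube N) (fst z) * indicator (cube N') (snd z))"
      using incseq_cube by (intro monoI le_funI mult_left_mono) (auto simp: indicator_def mono_def)
  qed
  also have "\<dots> \<le> of_nat (card (cube_cells N)) * mu (cell 0)"
    by (intro SUP_least W_cube_le)
  also have "\<dots> < \<infinity>" using mu_finite[OF cell_bounded_sets, of 0] by (simp add: ennreal_mult_less_top of_nat_less_top)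
  finally show ?thesis using W_mono[OF N order_refl, of "space M"] by (rule le_less_trans[rotated])
qed

text \<open>A translate by a long vector lies outside a large ball, and the part of the finite
  quantity \<open>W A (space M)\<close> outside that ball decreases to \<open>0\<close>.\<close>

lemma W_translate_tendsto_0:
  assumes A: "A \<in> bounded_sets M" and B: "B \<in> bounded_sets M" and e: "e > 0"
  shows "\<exists>R. \<forall>t\<in>space M. R \<le> norm t \<longrightarrow> W A ((\<lambda>x. x - t) ` B) < e"
proof -
  define T where "T n = space M - ball 0 (real n)" for n
  have Ts: "T n \<in> sets M" for n
  proof -
    have "T n = (- ball 0 (real n)) \<inter> space M" by (auto simp: T_def)
    then show ?thesis using sets_M_borel[of "- ball 0 (real n)"] by simp
  qed
  let ?f = "\<lambda>n z. ennreal ((cmod (K (fst z) (snd z)))\<^sup>2) * indicator A (fst z) * indicator (T n) (snd z)"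
  have m: "?f n \<in> borel_measurable (M \<Otimes>\<^sub>M M)" for n
    using W_integrand_measurable[OF bounded_sets_sets[OF A] Ts] by (simp add: case_prod_beta)
  have "(INF n. W A (T n)) = (\<integral>\<^sup>+z. (INF n. ?f n z) \<partial>(M \<Otimes>\<^sub>M M))"
    unfolding W_def
  proof (rule nn_integral_monotone_convergence_INF_decseq[symmetric, of _ _ 0])
    show "decseq ?f"
      by (intro antimonoI le_funI mult_left_mono) (auto simp: indicator_def T_def)
    show "?f n \<in> borel_measurable (M \<Otimes>\<^sub>M M)" for n by (rule m)
    have "(\<integral>\<^sup>+z. ?f 0 z \<partial>(M \<Otimes>\<^sub>M M)) \<le> W A (space M)"
      unfolding W_def[symmetric] by (rule W_mono) (auto simp: T_def)
    then show "(\<integral>\<^sup>+z. ?f 0 z \<partial>(M \<Otimes>\<^sub>M M)) < \<infinity>"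
      using W_space_finite[OF A] by (rule le_less_trans)
  qed
  also have "\<dots> = (\<integral>\<^sup>+z. 0 \<partial>(M \<Otimes>\<^sub>M M))"
  proof (rule nn_integral_cong)
    fix z :: "(real ^ 'd) \<times> (real ^ 'd)"
    obtain n :: nat where "norm (snd z) < real n" using reals_Archimedean2 by blast
    then have "?f n z = 0" by (simp add: T_def)
    then have "(INF n. ?f n z) \<le> 0" by (intro INF_lower2[of n]) simp_all
    then show "(INF n. ?f n z) = 0" by simp
  qed
  finally have "(INF n. W A (T n)) = 0" by simp
  then obtain n where n: "W A (T n) < e" using e by (metis INF_less_iff)
  obtain b where b: "\<And>x. x \<in> B \<Longrightarrow> norm x \<le> b" using B by (auto simp: bounded_sets_def bounded_iff)
  show ?thesis
  proof (intro exI[of _ "real n + b"] ballI impI)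
    fix t assume t: "t \<in> space M" "real n + b \<le> norm t"
    have "(\<lambda>x. x - t) ` B \<subseteq> T n"
    proof (intro subsetI, elim imageE)
      fix x y assume x: "x = y - t" "y \<in> B"
      have "norm t \<le> norm y + norm x" using norm_triangle_ineq4[of y x] by (simp add: x(1))
      then have "real n \<le> norm x" using b[OF x(2)] t(2) by linarith
      moreover have "x \<in> space M"
        using x t sets.sets_into_space[OF bounded_sets_sets[OF B]] space_diff by auto
      ultimately show "x \<in> T n" by (simp add: T_def)
    qed
    then have "W A ((\<lambda>x. x - t) ` B) \<le> W A (T n)" by (intro W_mono) auto
    with n show "W A ((\<lambda>x. x - t) ` B) < e" by simp
  qed
qed

text \<open>By Tonelli and the invariance of \<open>M\<close> the integral equals
  \<open>W A (space M)\<close> times the measure of \<open>B\<close>.\<close>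

lemma nn_integral_W_translate:
  assumes A: "A \<in> bounded_sets M" and B: "B \<in> bounded_sets M"
  shows "(\<integral>\<^sup>+t. W A ((\<lambda>x. x - t) ` B) \<partial>M) < \<infinity>"
proof -
  interpret MM: pair_sigma_finite M M ..
  have As [measurable]: "A \<in> sets M" and Bs [measurable]: "B \<in> sets M" using A B by (auto simp: bounded_sets_def)
  let ?k = "\<lambda>z. ennreal ((cmod (K (fst z) (snd z)))\<^sup>2) * indicator A (fst z)"
  have km: "?k \<in> borel_measurable (M \<Otimes>\<^sub>M M)"
  proof -
    have "(\<lambda>z. K (fst z) (snd z)) \<in> borel_measurable (M \<Otimes>\<^sub>M M)" using K_measurable by (simp add: case_prod_beta)
    then show ?thesis by measurable
  qed
  have Bm: "(\<lambda>p. indicator B (snd (fst p) + snd p) :: ennreal) \<in> borel_measurable ((M \<Otimes>\<^sub>M M) \<Otimes>\<^sub>M M)"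
  proof -
    have "(\<lambda>p. (snd (fst p), snd p)) \<in> measurable ((M \<Otimes>\<^sub>M M) \<Otimes>\<^sub>M M) (M \<Otimes>\<^sub>M M)" by measurable
    from measurable_compose[OF measurable_compose[OF this measurable_add_pair] borel_measurable_indicator[OF Bs]]
    show ?thesis by simp
  qed
  have "(\<integral>\<^sup>+t. W A ((\<lambda>x. x - t) ` B) \<partial>M) = (\<integral>\<^sup>+t. \<integral>\<^sup>+z. ?k z * indicator B (snd z + t) \<partial>(M \<Otimes>\<^sub>M M) \<partial>M)"
    unfolding W_def
  proof (intro nn_integral_cong arg_cong2[where f="(*)"] refl)
    fix t and z :: "(real ^ 'd) \<times> (real ^ 'd)"
    have "y \<in> (\<lambda>x. x - t) ` B \<longleftrightarrow> y + t \<in> B" for y by (force simp: image_iff)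
    then show "indicator ((\<lambda>x. x - t) ` B) (snd z) = (indicator B (snd z + t) :: ennreal)"
      by (simp add: indicator_def)
  qed
  also have "\<dots> = (\<integral>\<^sup>+z. \<integral>\<^sup>+t. ?k z * indicator B (snd z + t) \<partial>M \<partial>(M \<Otimes>\<^sub>M M))"
  proof -
    interpret p: pair_sigma_finite "M \<Otimes>\<^sub>M M" M ..
    show ?thesis
      by (rule p.Fubini') (use measurable_compose[OF measurable_fst km] Bm in \<open>simp add: case_prod_beta\<close>)
  qed
  also have "\<dots> = (\<integral>\<^sup>+z. ?k z * indicator (space M) (snd z) * emeasure M B \<partial>(M \<Otimes>\<^sub>M M))"
  proof (rule nn_integral_cong)
    fix z assume "z \<in> space (M \<Otimes>\<^sub>M M)"
    then have z: "snd z \<in> space M" by (auto simp: space_pair_measure)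
    have "(\<integral>\<^sup>+t. ?k z * indicator B (t + snd z) \<partial>M) = (\<integral>\<^sup>+t. ?k z * indicator B t \<partial>M)"
      by (rule nn_integral_shift[OF z, of "\<lambda>t. ?k z * indicator B t"]) simp
    also have "\<dots> = ?k z * emeasure M B" by (simp add: nn_integral_cmult_indicator)
    finally show "(\<integral>\<^sup>+t. ?k z * indicator B (snd z + t) \<partial>M) = ?k z * indicator (space M) (snd z) * emeasure M B"
      using z by (simp add: add.commute)
  qed
  also have "\<dots> = W A (space M) * emeasure M B"
    unfolding W_def using W_integrand_measurable[OF As sets.top]
    by (intro nn_integral_multc) (simp add: case_prod_beta)
  also have "\<dots> < \<infinity>"
    using W_space_finite[OF A] emeasure_bounded_sets[OF B] by (simp add: ennreal_mult_less_top)
  finally show ?thesis .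
qed

end

subsection \<open>Density of factorial polynomials\<close>

text \<open>Expresses the indicator of the event that a count equals \<open>n\<close> by binomial
  coefficients of the count, that is, by factorial powers. The sum may be cut at any
  \<open>L\<close> not below the count.\<close>

lemma binomial_inversion:
  assumes "N \<le> L"
  shows "(\<Sum>k\<le>L. (- 1) ^ (k + n) * of_nat (k choose n) * of_nat (N choose k)) =
    (if N = n then 1 else 0 :: 'a::comm_ring_1)"
proof -
  have "(\<Sum>k\<le>L. (- 1) ^ (k + n) * of_nat (k choose n) * of_nat (N choose k)) =
    (\<Sum>k\<in>{n..N}. (- 1) ^ (k + n) * of_nat (k choose n) * of_nat (N choose k) :: 'a)"
    using assms by (intro sum.mono_neutral_right) (auto simp: not_le binomial_eq_0)
  also have "\<dots> = (if N = n then 1 else 0)"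
  proof (cases "n \<le> N")
    case True
    have "(\<Sum>k\<in>{n..N}. (- 1) ^ (k + n) * of_nat (k choose n) * of_nat (N choose k)) =
      (\<Sum>j\<le>N - n. (- 1) ^ (j + n + n) * of_nat ((j + n) choose n) * of_nat (N choose (j + n)) :: 'a)"
      using True by (intro sum.reindex_bij_witness[of _ "\<lambda>j. j + n" "\<lambda>k. k - n"]) auto
    also have "\<dots> = (\<Sum>j\<le>N - n. of_nat (N choose n) * ((- 1) ^ j * of_nat ((N - n) choose j)))"
    proof (intro sum.cong refl)
      fix j assume "j \<in> {..N - n}"
      then have "(N choose (j + n)) * ((j + n) choose n) = (N choose n) * ((N - n) choose j)"
        using choose_mult[of n "j + n" N] True by simp
      then have "of_nat (N choose (j + n)) * of_nat ((j + n) choose n) = (of_nat (N choose n) * of_nat ((N - n) choose j) :: 'a)"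
        by (metis of_nat_mult)
      moreover have "(- 1) ^ (j + n + n) = ((- 1) ^ j :: 'a)"
        by (simp add: power_add mult.assoc flip: power_mult_distrib)
      ultimately show "(- 1) ^ (j + n + n) * of_nat ((j + n) choose n) * of_nat (N choose (j + n)) =
        of_nat (N choose n) * ((- 1) ^ j * of_nat ((N - n) choose j) :: 'a)"
        by (simp add: mult_ac)
    qed
    also have "\<dots> = of_nat (N choose n) * (\<Sum>j\<le>N - n. (- 1) ^ j * of_nat ((N - n) choose j))"
      by (simp add: sum_distrib_left)
    also have "\<dots> = (if N = n then 1 else 0)"
      using choose_alternating_sum[of "N - n", where ?'a='a] True by auto
    finally show ?thesis .
  qed auto
  finally show ?thesis .
qed

text \<open>Cut too early, the inversion sum is wrong but stays under a bound independent of
  \<open>L\<close>: one factor \<open>2 ^ N\<close> bounds \<open>k choose n\<close>, the other the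
  sum of the \<open>N choose k\<close>. This is the dominating function when \<open>L\<close>
  grows.\<close>

lemma binomial_inversion_bound:
  "cmod (\<Sum>k\<le>L. (- 1) ^ (k + n) * of_nat (k choose n) * of_nat (N choose k)) \<le> 4 ^ N"
proof -
  have "cmod (\<Sum>k\<le>L. (- 1) ^ (k + n) * of_nat (k choose n) * of_nat (N choose k)) \<le>
    (\<Sum>k\<le>L. real (k choose n) * real (N choose k))"
    by (rule order_trans[OF norm_sum]) (simp add: norm_mult norm_power)
  also have "\<dots> \<le> (\<Sum>k\<le>L. 2 ^ N * real (N choose k))"
  proof (intro sum_mono)
    fix k
    show "real (k choose n) * real (N choose k) \<le> 2 ^ N * real (N choose k)"
    proof (cases "k \<le> N")
      case True
      have "(k choose n) \<le> 2 ^ k" by (rule binomial_le_pow2)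
      also have "\<dots> \<le> 2 ^ N" using True by (simp add: power_increasing)
      finally have "real (k choose n) \<le> 2 ^ N" by (metis of_nat_le_iff of_nat_numeral of_nat_power)
      then show ?thesis by (intro mult_right_mono) auto
    qed (simp add: not_le binomial_eq_0)
  qed
  also have "\<dots> = 2 ^ N * real (\<Sum>k\<le>L. N choose k)" by (simp add: sum_distrib_left)
  also have "real (\<Sum>k\<le>L. N choose k) \<le> real (2 ^ N)"
  proof (intro of_nat_mono)
    have "(\<Sum>k\<le>L. N choose k) \<le> (\<Sum>k\<le>max L N. N choose k)" by (intro sum_mono2) auto
    also have "\<dots> = (\<Sum>k\<le>N. N choose k)" by (intro sum.mono_neutral_right) auto
    finally show "(\<Sum>k\<le>L. N choose k) \<le> 2 ^ N" by (simp add: choose_row_sum)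
  qed
  also have "2 ^ N * real (2 ^ N) = (4 :: real) ^ N"
    by (simp flip: power_mult_distrib)
  finally show ?thesis by simp
qed

lemma norm_add_power_le:
  fixes a b :: "'a::real_normed_vector"
  shows "norm (a + b) ^ p \<le> 2 ^ p * (norm a ^ p + norm b ^ p)"
proof -
  have "norm (a + b) \<le> 2 * max (norm a) (norm b)" using norm_triangle_ineq[of a b] by linarith
  then have "norm (a + b) ^ p \<le> (2 * max (norm a) (norm b)) ^ p" by (intro power_mono) auto
  also have "\<dots> = 2 ^ p * (max (norm a) (norm b)) ^ p" by (simp add: power_mult_distrib)
  also have "(max (norm a) (norm b)) ^ p \<le> norm a ^ p + norm b ^ p" by (simp add: max_def)
  finally show ?thesis by simp
qed

context invariant_determinantal_field
begin

lemma nn_expectation_binomial_le: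
  assumes B: "B \<in> bounded_sets M"
  shows "(\<integral>\<^sup>+\<xi>. of_nat (num_particles B \<xi> choose k) \<partial>P) \<le> ennreal (enn2real (mu B) ^ k / fact k)"
proof -
  have [measurable]: "num_particles B \<in> measurable P (count_space UNIV)" by (rule num_particles_measurable[OF B])
  define c where "c = enn2real (mu B)"
  have c: "mu B = ennreal c" "c \<ge> 0"
    unfolding c_def using mu_finite[OF B] by (simp_all add: ennreal_enn2real_if less_top[symmetric])
  have e: "of_nat (N choose k) = of_nat (falling N k) * ennreal (1 / fact k)" for N
    by (simp add: falling_binomial ennreal_of_nat_eq_real_of_nat ennreal_mult[symmetric])
  have "(\<integral>\<^sup>+\<xi>. of_nat (num_particles B \<xi> choose k) \<partial>P) =
    (\<integral>\<^sup>+\<xi>. of_nat (falling (num_particles B \<xi>) k) \<partial>P) * ennreal (1 / fact k)"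
    unfolding e by (rule nn_integral_multc) simp
  also have "\<dots> \<le> (\<Prod>j<length (replicate k B). mu (replicate k B ! j)) * ennreal (1 / fact k)"
    by (intro mult_right_mono nn_expectation_monomial_le[OF falling_monomial_single[OF B]]) simp
  also have "(\<Prod>j<length (replicate k B). mu (replicate k B ! j)) = mu B ^ k" by simp
  also have "mu B ^ k * ennreal (1 / fact k) = ennreal (c ^ k / fact k)"
    using c by (simp add: ennreal_power ennreal_mult[symmetric])
  finally show ?thesis by (simp add: c_def)
qed

text \<open>By the binomial theorem \<open>(1 + R) ^ N\<close> is the sum of
  \<open>R ^ k * (N choose k)\<close>, and the Poisson bound on binomial moments sums to an
  exponential. Enlarging \<open>R\<close> to \<open>1 + R\<close> makes the binomial theorem
  applicable and costs nothing.\<close>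

lemma nn_expectation_power_finite:
  assumes B: "B \<in> bounded_sets M"
  shows "(\<integral>\<^sup>+\<xi>. of_nat (R ^ num_particles B \<xi>) \<partial>P) < \<infinity>"
proof -
  have [measurable]: "num_particles B \<in> measurable P (count_space UNIV)" by (rule num_particles_measurable[OF B])
  define c where "c = enn2real (mu B)"
  have c: "c \<ge> 0" by (simp add: c_def)
  have "(\<integral>\<^sup>+\<xi>. of_nat (R ^ num_particles B \<xi>) \<partial>P) \<le> (\<integral>\<^sup>+\<xi>. of_nat ((1 + R) ^ num_particles B \<xi>) \<partial>P)"
    by (intro nn_integral_mono of_nat_mono power_mono) auto
  also have "\<dots> = (\<integral>\<^sup>+\<xi>. (\<Sum>k. of_nat (R ^ k) * of_nat (num_particles B \<xi> choose k)) \<partial>P)"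
  proof (rule nn_integral_cong)
    fix \<xi>
    let ?N = "num_particles B \<xi>"
    have "(1 + R) ^ ?N = (\<Sum>k\<le>?N. (?N choose k) * R ^ k)"
      using binomial[of R 1 ?N] by (simp add: add.commute)
    then have "of_nat ((1 + R) ^ ?N) = (\<Sum>k\<le>?N. of_nat (R ^ k) * of_nat (?N choose k) :: ennreal)"
      by (simp add: mult.commute)
    also have "\<dots> = (\<Sum>k. of_nat (R ^ k) * of_nat (?N choose k))"
      by (rule suminf_finite[symmetric]) auto
    finally show "of_nat ((1 + R) ^ ?N) = (\<Sum>k. of_nat (R ^ k) * of_nat (?N choose k) :: ennreal)" .
  qed
  also have "\<dots> = (\<Sum>k. \<integral>\<^sup>+\<xi>. of_nat (R ^ k) * of_nat (num_particles B \<xi> choose k) \<partial>P)"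
    by (rule nn_integral_suminf) measurable
  also have "\<dots> = (\<Sum>k. of_nat (R ^ k) * (\<integral>\<^sup>+\<xi>. of_nat (num_particles B \<xi> choose k) \<partial>P))"
    by (intro suminf_cong nn_integral_cmult) measurable
  also have "\<dots> \<le> (\<Sum>k. ennreal ((real R * c) ^ k / fact k))"
  proof (intro suminf_le summableI)
    fix k
    have "of_nat (R ^ k) * (\<integral>\<^sup>+\<xi>. of_nat (num_particles B \<xi> choose k) \<partial>P) \<le> of_nat (R ^ k) * ennreal (c ^ k / fact k)"
      unfolding c_def by (intro mult_left_mono nn_expectation_binomial_le[OF B]) simp
    also have "\<dots> = ennreal ((real R * c) ^ k / fact k)"
      using c by (simp add: ennreal_of_nat_eq_real_of_nat ennreal_mult[symmetric] power_mult_distrib flip: of_nat_power)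
    finally show "of_nat (R ^ k) * (\<integral>\<^sup>+\<xi>. of_nat (num_particles B \<xi> choose k) \<partial>P) \<le> ennreal ((real R * c) ^ k / fact k)" .
  qed
  also have "\<dots> = ennreal (\<Sum>k. (real R * c) ^ k / fact k)"
    using c summable_exp[of "real R * c"] by (intro suminf_ennreal2) (auto simp: field_simps)
  also have "\<dots> < \<infinity>" by simp
  finally show ?thesis .
qed

section \<open>Factorial polynomials and their closure\<close>

text \<open>The linear span of the factorial monomials. As an inductive predicate it reduces linear
  statements to monomials, and bilinear ones by two nested inductions.\<close>

inductive falling_poly :: "('d config \<Rightarrow> complex) \<Rightarrow> bool" where
  monomial: "falling_monomial S L F \<Longrightarrow> falling_poly (\<lambda>\<xi>. of_nat (F \<xi>))"
| add: "falling_poly f \<Longrightarrow> falling_poly g \<Longrightarrow> falling_poly (\<lambda>\<xi>. f \<xi> + g \<xi>)"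
| scale: "falling_poly f \<Longrightarrow> falling_poly (\<lambda>\<xi>. c * f \<xi>)"

lemma falling_poly_const: "falling_poly (\<lambda>\<xi>. c)"
  using falling_poly.scale[OF falling_poly.monomial[OF falling_monomial_one], of c] by simp

lemma falling_poly_diff: "falling_poly f \<Longrightarrow> falling_poly g \<Longrightarrow> falling_poly (\<lambda>\<xi>. f \<xi> - g \<xi>)"
  using falling_poly.add[OF _ falling_poly.scale[of g "-1"], of f] by simp

lemma falling_poly_sum:
  "(\<And>i. i \<in> I \<Longrightarrow> falling_poly (f i)) \<Longrightarrow> falling_poly (\<lambda>\<xi>. \<Sum>i\<in>I. f i \<xi>)"
  by (induction I rule: infinite_finite_induct) (auto intro: falling_poly_const falling_poly.add)

lemma falling_poly_measurable: "falling_poly f \<Longrightarrow> f \<in> borel_measurable P"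
proof (induction rule: falling_poly.induct)
  case (monomial S L F)
  then show ?case by (intro measurable_compose[OF falling_monomial_measurable]) auto
qed auto

lemma falling_monomial_growth:
  assumes "falling_monomial S L F"
  shows "\<exists>C. \<forall>\<xi>\<in>space P. F \<xi> \<le> C * 2 ^ num_particles S \<xi>"
  using assms
proof (rule falling_monomialE)
  fix m :: nat and A k
  assume A: "\<And>i. i < m \<Longrightarrow> A i \<in> bounded_sets M" "disjoint_family_on A {..<m}" "(\<Union>i<m. A i) = S"
    and F: "F = (\<lambda>\<xi>. \<Prod>i<m. falling (num_particles (A i) \<xi>) (k i))"
  show ?thesis
  proof (intro exI[of _ "\<Prod>i<m. fact (k i)"] ballI)
    fix \<xi> assume \<xi>: "\<xi> \<in> space P"
    have "F \<xi> \<le> (\<Prod>i<m. fact (k i) * 2 ^ num_particles (A i) \<xi>)"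
      unfolding F falling_binomial by (intro prod_mono conjI mult_left_mono binomial_le_pow2) auto
    also have "\<dots> = (\<Prod>i<m. fact (k i)) * 2 ^ (\<Sum>i<m. num_particles (A i) \<xi>)"
      by (simp add: prod.distrib power_sum)
    also have "(\<Sum>i<m. num_particles (A i) \<xi>) = num_particles S \<xi>"
      unfolding A(3)[symmetric] using A \<xi>
      by (intro num_particles_UN[symmetric]) (auto simp: space_P bounded_sets_def)
    finally show "F \<xi> \<le> (\<Prod>i<m. fact (k i)) * 2 ^ num_particles S \<xi>" .
  qed
qed

lemma falling_poly_growth:
  "falling_poly f \<Longrightarrow> \<exists>S C. S \<in> bounded_sets M \<and> C \<ge> 0 \<and> (\<forall>\<xi>\<in>space P. cmod (f \<xi>) \<le> C * 2 ^ num_particles S \<xi>)"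
proof (induction rule: falling_poly.induct)
  case (monomial S L F)
  obtain C where C: "\<forall>\<xi>\<in>space P. F \<xi> \<le> C * 2 ^ num_particles S \<xi>"
    using falling_monomial_growth[OF monomial] by auto
  have "cmod (of_nat (F \<xi>)) \<le> real C * 2 ^ num_particles S \<xi>" if "\<xi> \<in> space P" for \<xi>
  proof -
    have "real (F \<xi>) \<le> real (C * 2 ^ num_particles S \<xi>)" using C that by (intro of_nat_mono) auto
    then show ?thesis by simp
  qed
  then show ?case using falling_monomial_support(1)[OF monomial] by (intro exI[of _ S] exI[of _ "real C"]) auto
next
  case (add f g)
  then obtain S C T D where f: "S \<in> bounded_sets M" "C \<ge> 0" "\<forall>\<xi>\<in>space P. cmod (f \<xi>) \<le> C * 2 ^ num_particles S \<xi>"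
    and g: "T \<in> bounded_sets M" "D \<ge> 0" "\<forall>\<xi>\<in>space P. cmod (g \<xi>) \<le> D * 2 ^ num_particles T \<xi>" by blast
  have "cmod (f \<xi> + g \<xi>) \<le> (C + D) * 2 ^ num_particles (S \<union> T) \<xi>" if \<xi>: "\<xi> \<in> space P" for \<xi>
  proof -
    have ST: "bounded (S \<union> T)" using f(1) g(1) by (simp add: bounded_sets_def)
    have "cmod (f \<xi> + g \<xi>) \<le> C * 2 ^ num_particles S \<xi> + D * 2 ^ num_particles T \<xi>"
      using f(3) g(3) \<xi> by (intro norm_triangle_le add_mono) auto
    also have "\<dots> \<le> C * 2 ^ num_particles (S \<union> T) \<xi> + D * 2 ^ num_particles (S \<union> T) \<xi>"
      using f(2) g(2) num_particles_mono[OF _ ST, of \<xi> "space M"] \<xi>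
      by (intro add_mono mult_left_mono power_increasing) (auto simp: space_P)
    finally show ?thesis by (simp add: distrib_right)
  qed
  then show ?case using f g bounded_sets_ops(1)[OF f(1) g(1)] by (intro exI[of _ "S \<union> T"] exI[of _ "C + D"]) auto
next
  case (scale f c)
  then obtain S C where f: "S \<in> bounded_sets M" "C \<ge> 0" "\<forall>\<xi>\<in>space P. cmod (f \<xi>) \<le> C * 2 ^ num_particles S \<xi>" by blast
  then show ?case
    by (intro exI[of _ S] exI[of _ "cmod c * C"]) (auto simp: norm_mult mult.assoc intro!: mult_left_mono)
qed

lemma growth_power_finite:
  assumes B: "B \<in> bounded_sets M" and C: "C \<ge> 0"
  shows "(\<integral>\<^sup>+\<xi>. ennreal ((C * real R ^ num_particles B \<xi>) ^ p) \<partial>P) < \<infinity>"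
proof -
  have [measurable]: "num_particles B \<in> measurable P (count_space UNIV)" by (rule num_particles_measurable[OF B])
  have "(\<integral>\<^sup>+\<xi>. ennreal ((C * real R ^ num_particles B \<xi>) ^ p) \<partial>P) =
    (\<integral>\<^sup>+\<xi>. ennreal (C ^ p) * of_nat ((R ^ p) ^ num_particles B \<xi>) \<partial>P)"
    using C by (intro nn_integral_cong)
      (simp add: power_mult_distrib ennreal_mult ennreal_of_nat_eq_real_of_nat mult.commute flip: power_mult)
  also have "\<dots> = ennreal (C ^ p) * (\<integral>\<^sup>+\<xi>. of_nat ((R ^ p) ^ num_particles B \<xi>) \<partial>P)"
    by (rule nn_integral_cmult) simp
  also have "\<dots> < \<infinity>"
    using nn_expectation_power_finite[OF B, of "R ^ p"] by (simp add: ennreal_mult_less_top)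
  finally show ?thesis .
qed

lemma falling_poly_Lp:
  assumes "falling_poly f"
  shows "(\<integral>\<^sup>+\<xi>. ennreal (cmod (f \<xi>) ^ p) \<partial>P) < \<infinity>"
proof -
  obtain S C where f: "S \<in> bounded_sets M" "C \<ge> 0" "\<forall>\<xi>\<in>space P. cmod (f \<xi>) \<le> C * 2 ^ num_particles S \<xi>"
    using falling_poly_growth[OF assms] by blast
  have "(\<integral>\<^sup>+\<xi>. ennreal (cmod (f \<xi>) ^ p) \<partial>P) \<le> (\<integral>\<^sup>+\<xi>. ennreal ((C * real 2 ^ num_particles S \<xi>) ^ p) \<partial>P)"
    using f by (intro nn_integral_mono ennreal_leI power_mono) auto
  also have "\<dots> < \<infinity>" by (rule growth_power_finite[OF f(1,2)])
  finally show ?thesis .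
qed

text \<open>Distances are measured by \<open>p\<close>-th powers of norms, without roots; the price
  is a factor \<open>2 ^ p\<close> in the triangle inequality.\<close>

definition Lp_closure :: "nat \<Rightarrow> ('d config \<Rightarrow> complex) \<Rightarrow> bool" where
  "Lp_closure p f \<longleftrightarrow> f \<in> borel_measurable P \<and>
     (\<forall>\<epsilon>>0. \<exists>g. falling_poly g \<and> (\<integral>\<^sup>+\<xi>. ennreal (cmod (f \<xi> - g \<xi>) ^ p) \<partial>P) < ennreal \<epsilon>)"

lemma nn_integral_norm_add_power:
  assumes [measurable]: "f \<in> borel_measurable P" "g \<in> borel_measurable P"
  shows "(\<integral>\<^sup>+\<xi>. ennreal (cmod (f \<xi> + g \<xi>) ^ p) \<partial>P) \<le>
    ennreal (2 ^ p) * ((\<integral>\<^sup>+\<xi>. ennreal (cmod (f \<xi>) ^ p) \<partial>P) + (\<integral>\<^sup>+\<xi>. ennreal (cmod (g \<xi>) ^ p) \<partial>P))"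
proof -
  have "(\<integral>\<^sup>+\<xi>. ennreal (cmod (f \<xi> + g \<xi>) ^ p) \<partial>P) \<le>
    (\<integral>\<^sup>+\<xi>. ennreal (2 ^ p) * (ennreal (cmod (f \<xi>) ^ p) + ennreal (cmod (g \<xi>) ^ p)) \<partial>P)"
  proof (rule nn_integral_mono)
    fix \<xi>
    have "ennreal (cmod (f \<xi> + g \<xi>) ^ p) \<le> ennreal (2 ^ p * (cmod (f \<xi>) ^ p + cmod (g \<xi>) ^ p))"
      by (intro ennreal_leI norm_add_power_le)
    then show "ennreal (cmod (f \<xi> + g \<xi>) ^ p) \<le> ennreal (2 ^ p) * (ennreal (cmod (f \<xi>) ^ p) + ennreal (cmod (g \<xi>) ^ p))"
      by (simp add: ennreal_mult)
  qed
  also have "\<dots> = ennreal (2 ^ p) * ((\<integral>\<^sup>+\<xi>. ennreal (cmod (f \<xi>) ^ p) \<partial>P) + (\<integral>\<^sup>+\<xi>. ennreal (cmod (g \<xi>) ^ p) \<partial>P))"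
    by (simp add: nn_integral_cmult nn_integral_add)
  finally show ?thesis .
qed

lemma Lp_closure_limit:
  assumes f: "f \<in> borel_measurable P"
    and approx: "\<And>\<epsilon>. \<epsilon> > 0 \<Longrightarrow> \<exists>f'. Lp_closure p f' \<and> (\<integral>\<^sup>+\<xi>. ennreal (cmod (f \<xi> - f' \<xi>) ^ p) \<partial>P) < ennreal \<epsilon>"
  shows "Lp_closure p f"
  unfolding Lp_closure_def
proof (intro conjI f allI impI)
  fix \<epsilon> :: real assume \<epsilon>: "\<epsilon> > 0"
  define \<delta> where "\<delta> = \<epsilon> / 2 ^ p / 2"
  have \<delta>: "\<delta> > 0" using \<epsilon> by (simp add: \<delta>_def)
  obtain f' where f': "Lp_closure p f'" "(\<integral>\<^sup>+\<xi>. ennreal (cmod (f \<xi> - f' \<xi>) ^ p) \<partial>P) < ennreal \<delta>"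
    using approx[OF \<delta>] by auto
  obtain g where g: "falling_poly g" "(\<integral>\<^sup>+\<xi>. ennreal (cmod (f' \<xi> - g \<xi>) ^ p) \<partial>P) < ennreal \<delta>"
    using f'(1) \<delta> unfolding Lp_closure_def by blast
  have [measurable]: "f' \<in> borel_measurable P" "g \<in> borel_measurable P"
    using f'(1) falling_poly_measurable[OF g(1)] by (auto simp: Lp_closure_def)
  have "(\<integral>\<^sup>+\<xi>. ennreal (cmod (f \<xi> - g \<xi>) ^ p) \<partial>P) = (\<integral>\<^sup>+\<xi>. ennreal (cmod ((f \<xi> - f' \<xi>) + (f' \<xi> - g \<xi>)) ^ p) \<partial>P)"
    by simp
  also have "\<dots> \<le> ennreal (2 ^ p) * ((\<integral>\<^sup>+\<xi>. ennreal (cmod (f \<xi> - f' \<xi>) ^ p) \<partial>P) + (\<integral>\<^sup>+\<xi>. ennreal (cmod (f' \<xi> - g \<xi>) ^ p) \<partial>P))"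
    using f by (intro nn_integral_norm_add_power) auto
  also have "\<dots> < ennreal (2 ^ p) * (ennreal \<delta> + ennreal \<delta>)"
    using f'(2) g(2) by (intro ennreal_mult_strict_left_mono add_strict_mono) auto
  also have "\<dots> = ennreal \<epsilon>"
    using \<delta> by (simp add: \<delta>_def ennreal_plus[symmetric] ennreal_mult[symmetric] del: ennreal_plus)
  finally show "\<exists>g. falling_poly g \<and> (\<integral>\<^sup>+\<xi>. ennreal (cmod (f \<xi> - g \<xi>) ^ p) \<partial>P) < ennreal \<epsilon>"
    using g(1) by blast
qed

lemma Lp_closure_poly: "p > 0 \<Longrightarrow> falling_poly g \<Longrightarrow> Lp_closure p g"
  unfolding Lp_closure_def using falling_poly_measurable[of g] by (auto intro!: exI[of _ g] simp: zero_power)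

lemma Lp_closure_add:
  assumes f: "Lp_closure p f" and g: "Lp_closure p g"
  shows "Lp_closure p (\<lambda>\<xi>. f \<xi> + g \<xi>)"
  unfolding Lp_closure_def
proof (intro conjI allI impI)
  have [measurable]: "f \<in> borel_measurable P" "g \<in> borel_measurable P" using f g by (auto simp: Lp_closure_def)
  show "(\<lambda>\<xi>. f \<xi> + g \<xi>) \<in> borel_measurable P" by measurable
  fix \<epsilon> :: real assume \<epsilon>: "\<epsilon> > 0"
  define \<delta> where "\<delta> = \<epsilon> / 2 ^ p / 2"
  have \<delta>: "\<delta> > 0" using \<epsilon> by (simp add: \<delta>_def)
  obtain f' where f': "falling_poly f'" "(\<integral>\<^sup>+\<xi>. ennreal (cmod (f \<xi> - f' \<xi>) ^ p) \<partial>P) < ennreal \<delta>"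
    using f \<delta> unfolding Lp_closure_def by blast
  obtain g' where g': "falling_poly g'" "(\<integral>\<^sup>+\<xi>. ennreal (cmod (g \<xi> - g' \<xi>) ^ p) \<partial>P) < ennreal \<delta>"
    using g \<delta> unfolding Lp_closure_def by blast
  note [measurable] = falling_poly_measurable[OF f'(1)] falling_poly_measurable[OF g'(1)]
  have "(\<integral>\<^sup>+\<xi>. ennreal (cmod (f \<xi> + g \<xi> - (f' \<xi> + g' \<xi>)) ^ p) \<partial>P) =
    (\<integral>\<^sup>+\<xi>. ennreal (cmod ((f \<xi> - f' \<xi>) + (g \<xi> - g' \<xi>)) ^ p) \<partial>P)"
    by (simp add: algebra_simps)
  also have "\<dots> \<le> ennreal (2 ^ p) * ((\<integral>\<^sup>+\<xi>. ennreal (cmod (f \<xi> - f' \<xi>) ^ p) \<partial>P) + (\<integral>\<^sup>+\<xi>. ennreal (cmod (g \<xi> - g' \<xi>) ^ p) \<partial>P))"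
    by (intro nn_integral_norm_add_power) auto
  also have "\<dots> < ennreal (2 ^ p) * (ennreal \<delta> + ennreal \<delta>)"
    using f'(2) g'(2) by (intro ennreal_mult_strict_left_mono add_strict_mono) auto
  also have "\<dots> = ennreal \<epsilon>"
    using \<delta> by (simp add: \<delta>_def ennreal_plus[symmetric] ennreal_mult[symmetric] del: ennreal_plus)
  finally show "\<exists>h. falling_poly h \<and> (\<integral>\<^sup>+\<xi>. ennreal (cmod (f \<xi> + g \<xi> - h \<xi>) ^ p) \<partial>P) < ennreal \<epsilon>"
    using falling_poly.add[OF f'(1) g'(1)] by (intro exI[of _ "\<lambda>\<xi>. f' \<xi> + g' \<xi>"]) auto
qed

lemma Lp_closure_scale:
  assumes f: "Lp_closure p f"
  shows "Lp_closure p (\<lambda>\<xi>. c * f \<xi>)"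
  unfolding Lp_closure_def
proof (intro conjI allI impI)
  have [measurable]: "f \<in> borel_measurable P" using f by (auto simp: Lp_closure_def)
  show "(\<lambda>\<xi>. c * f \<xi>) \<in> borel_measurable P" by measurable
  fix \<epsilon> :: real assume \<epsilon>: "\<epsilon> > 0"
  define \<delta> where "\<delta> = \<epsilon> / (1 + cmod c ^ p)"
  have c0: "1 + cmod c ^ p > 0" by (simp add: add_pos_nonneg)
  have \<delta>: "\<delta> > 0" using \<epsilon> c0 by (simp add: \<delta>_def)
  obtain g where g: "falling_poly g" "(\<integral>\<^sup>+\<xi>. ennreal (cmod (f \<xi> - g \<xi>) ^ p) \<partial>P) < ennreal \<delta>"
    using f \<delta> unfolding Lp_closure_def by blast
  note [measurable] = falling_poly_measurable[OF g(1)]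
  have "(\<integral>\<^sup>+\<xi>. ennreal (cmod (c * f \<xi> - c * g \<xi>) ^ p) \<partial>P) =
    (\<integral>\<^sup>+\<xi>. ennreal (cmod c ^ p) * ennreal (cmod (f \<xi> - g \<xi>) ^ p) \<partial>P)"
    by (simp add: norm_mult power_mult_distrib ennreal_mult flip: right_diff_distrib)
  also have "\<dots> = ennreal (cmod c ^ p) * (\<integral>\<^sup>+\<xi>. ennreal (cmod (f \<xi> - g \<xi>) ^ p) \<partial>P)"
    by (rule nn_integral_cmult) measurable
  also have "\<dots> \<le> ennreal (cmod c ^ p) * ennreal \<delta>"
    using g(2) by (intro mult_left_mono) auto
  also have "\<dots> = ennreal (cmod c ^ p * \<delta>)" using \<delta> by (simp add: ennreal_mult)
  also have "\<dots> < ennreal \<epsilon>"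
  proof -
    have "cmod c ^ p * \<delta> < (1 + cmod c ^ p) * \<delta>" using \<delta> by (intro mult_strict_right_mono) auto
    also have "\<dots> = \<epsilon>" using c0 by (simp add: \<delta>_def)
    finally show ?thesis using \<epsilon> by (simp add: ennreal_less_iff \<delta> less_imp_le)
  qed
  finally show "\<exists>h. falling_poly h \<and> (\<integral>\<^sup>+\<xi>. ennreal (cmod (c * f \<xi> - h \<xi>) ^ p) \<partial>P) < ennreal \<epsilon>"
    using falling_poly.scale[OF g(1), of c] by (intro exI[of _ "\<lambda>\<xi>. c * g \<xi>"]) auto
qed

lemma Lp_closure_sum:
  assumes "p > 0" "\<And>i. i \<in> I \<Longrightarrow> Lp_closure p (f i)"
  shows "Lp_closure p (\<lambda>\<xi>. \<Sum>i\<in>I. f i \<xi>)"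
  using assms(2)
  by (induction I rule: infinite_finite_induct)
    (auto intro: Lp_closure_add Lp_closure_poly[OF assms(1) falling_poly_const])

lemma Lp_closure_dominated:
  assumes p: "p > 0" and f: "f \<in> borel_measurable P" and fn: "\<And>n. Lp_closure p (fn n)"
    and lim: "\<And>\<xi>. \<xi> \<in> space P \<Longrightarrow> (\<lambda>n. fn n \<xi>) \<longlonglongrightarrow> f \<xi>"
    and D: "D \<in> borel_measurable P" "(\<integral>\<^sup>+\<xi>. ennreal (D \<xi> ^ p) \<partial>P) < \<infinity>"
    and bound: "\<And>n \<xi>. \<xi> \<in> space P \<Longrightarrow> cmod (fn n \<xi>) \<le> D \<xi>"
  shows "Lp_closure p f"
proof (rule Lp_closure_limit[OF f])
  fix \<epsilon> :: real assume \<epsilon>: "\<epsilon> > 0"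
  have [measurable]: "fn n \<in> borel_measurable P" for n using fn[of n] by (simp add: Lp_closure_def)
  note [measurable] = f D(1)
  have "(\<lambda>n. \<integral>\<^sup>+\<xi>. ennreal (cmod (f \<xi> - fn n \<xi>) ^ p) \<partial>P) \<longlonglongrightarrow> (\<integral>\<^sup>+\<xi>. 0 \<partial>P)"
  proof (rule nn_integral_dominated_convergence[where w="\<lambda>\<xi>. ennreal (2 ^ p) * ennreal (D \<xi> ^ p)"])
    show "AE \<xi> in P. ennreal (cmod (f \<xi> - fn n \<xi>) ^ p) \<le> ennreal (2 ^ p) * ennreal (D \<xi> ^ p)" for n
    proof (rule AE_I2)
      fix \<xi> assume \<xi>: "\<xi> \<in> space P"
      have D0: "0 \<le> D \<xi>" using bound[OF \<xi>, of 0] norm_ge_zero order_trans by blast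
      have "cmod (f \<xi>) \<le> D \<xi>"
        by (rule tendsto_upperbound[OF tendsto_norm[OF lim[OF \<xi>]]]) (use bound[OF \<xi>] in auto)
      then have "cmod (f \<xi> - fn n \<xi>) \<le> 2 * D \<xi>"
        using bound[OF \<xi>, of n] norm_triangle_ineq4[of "f \<xi>" "fn n \<xi>"] by linarith
      then have "cmod (f \<xi> - fn n \<xi>) ^ p \<le> 2 ^ p * D \<xi> ^ p"
        using power_mono[of "cmod (f \<xi> - fn n \<xi>)" "2 * D \<xi>" p] by (simp add: power_mult_distrib)
      then show "ennreal (cmod (f \<xi> - fn n \<xi>) ^ p) \<le> ennreal (2 ^ p) * ennreal (D \<xi> ^ p)"
        using D0 by (simp add: ennreal_mult[symmetric] ennreal_leI)
    qed
    show "(\<integral>\<^sup>+\<xi>. ennreal (2 ^ p) * ennreal (D \<xi> ^ p) \<partial>P) < \<infinity>"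
      using D(2) by (subst nn_integral_cmult) (auto simp: ennreal_mult_less_top)
    show "AE \<xi> in P. (\<lambda>n. ennreal (cmod (f \<xi> - fn n \<xi>) ^ p)) \<longlonglongrightarrow> 0"
    proof (rule AE_I2)
      fix \<xi> assume \<xi>: "\<xi> \<in> space P"
      have "(\<lambda>n. cmod (f \<xi> - fn n \<xi>) ^ p) \<longlonglongrightarrow> cmod (f \<xi> - f \<xi>) ^ p"
        by (intro tendsto_intros lim[OF \<xi>])
      then have "(\<lambda>n. cmod (f \<xi> - fn n \<xi>) ^ p) \<longlonglongrightarrow> 0"
        by (simp only: diff_self norm_zero zero_power[OF p])
      from tendsto_ennrealI[OF this] show "(\<lambda>n. ennreal (cmod (f \<xi> - fn n \<xi>) ^ p)) \<longlonglongrightarrow> 0" by simp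
    qed
  qed measurable
  then have "\<forall>\<^sub>F n in sequentially. (\<integral>\<^sup>+\<xi>. ennreal (cmod (f \<xi> - fn n \<xi>) ^ p) \<partial>P) < ennreal \<epsilon>"
    by (rule order_tendstoD(2)) (use \<epsilon> in simp)
  then obtain n where "(\<integral>\<^sup>+\<xi>. ennreal (cmod (f \<xi> - fn n \<xi>) ^ p) \<partial>P) < ennreal \<epsilon>"
    by (auto simp: eventually_sequentially)
  with fn show "\<exists>f'. Lp_closure p f' \<and> (\<integral>\<^sup>+\<xi>. ennreal (cmod (f \<xi> - f' \<xi>) ^ p) \<partial>P) < ennreal \<epsilon>" by blast
qed

lemma falling_poly_prod_binomial:
  fixes m :: nat
  assumes A: "\<And>i. i < m \<Longrightarrow> A i \<in> bounded_sets M" "disjoint_family_on A {..<m}"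
  shows "falling_poly (\<lambda>\<xi>. \<Prod>i<m. \<Sum>k\<le>L. c i k * of_nat (num_particles (A i) \<xi> choose k))"
proof -
  have "(\<Prod>i<m. \<Sum>k\<le>L. c i k * of_nat (num_particles (A i) \<xi> choose k)) =
    (\<Sum>g\<in>{..<m} \<rightarrow>\<^sub>E {..L}. (\<Prod>i<m. c i (g i) / fact (g i)) * of_nat (\<Prod>i<m. falling (num_particles (A i) \<xi>) (g i)))" for \<xi>
  proof -
    have "(\<Prod>i<m. \<Sum>k\<le>L. c i k * of_nat (num_particles (A i) \<xi> choose k)) =
      (\<Sum>g\<in>{..<m} \<rightarrow>\<^sub>E {..L}. \<Prod>i<m. c i (g i) * of_nat (num_particles (A i) \<xi> choose g i))"
      by (rule prod_sum_PiE) auto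
    also have "\<dots> = (\<Sum>g\<in>{..<m} \<rightarrow>\<^sub>E {..L}. (\<Prod>i<m. c i (g i) / fact (g i)) * of_nat (\<Prod>i<m. falling (num_particles (A i) \<xi>) (g i)))"
      by (simp add: falling_binomial prod.distrib[symmetric])
    finally show ?thesis .
  qed
  moreover have "falling_poly (\<lambda>\<xi>. \<Sum>g\<in>{..<m} \<rightarrow>\<^sub>E {..L}. (\<Prod>i<m. c i (g i) / fact (g i)) * of_nat (\<Prod>i<m. falling (num_particles (A i) \<xi>) (g i)))"
    by (intro falling_poly_sum falling_poly.scale falling_poly.monomial[OF falling_monomialI] A)
  ultimately show ?thesis by simp
qed

text \<open>The indicator is the limit of truncated inversion sums, one factor for each set.
  Expanded, such a product is a factorial polynomial since the sets are disjoint, and it is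
  dominated by \<open>4\<close> to the total count, which has all moments.\<close>

lemma Lp_closure_atom:
  fixes m :: nat
  assumes p: "p > 0" and A: "\<And>i. i < m \<Longrightarrow> A i \<in> bounded_sets M" "disjoint_family_on A {..<m}"
  shows "Lp_closure p (\<lambda>\<xi>. if \<forall>i<m. num_particles (A i) \<xi> = n i then 1 else 0)"
proof (rule Lp_closure_dominated[OF p, where D="\<lambda>\<xi>. 1 * real 4 ^ num_particles (\<Union>i<m. A i) \<xi>"])
  let ?q = "\<lambda>L \<xi>. \<Prod>i<m. \<Sum>k\<le>L. ((- 1) ^ (k + n i) * of_nat (k choose n i)) * of_nat (num_particles (A i) \<xi> choose k) :: complex"
  have Nm [measurable]: "num_particles (A i) \<in> measurable P (count_space UNIV)" if "i < m" for i
    using A(1)[OF that] by (rule num_particles_measurable)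
  have U: "(\<Union>i<m. A i) \<in> bounded_sets M" using A(1) by (intro bounded_sets_UN) auto
  note [measurable] = num_particles_measurable[OF U]
  have "{\<xi> \<in> space P. \<forall>i<m. num_particles (A i) \<xi> = n i} \<in> sets P"
  proof -
    have "{\<xi> \<in> space P. \<forall>i\<in>{..<m}. num_particles (A i) \<xi> = n i} \<in> sets P"
      using Nm by (intro sets.sets_Collect_finite_All) auto
    then show ?thesis by (simp add: Ball_def)
  qed
  then show "(\<lambda>\<xi>. if \<forall>i<m. num_particles (A i) \<xi> = n i then 1 else (0::complex)) \<in> borel_measurable P"
    by (intro measurable_If) auto
  show "Lp_closure p (?q L)" for L
    by (intro Lp_closure_poly[OF p] falling_poly_prod_binomial A)
  show "(\<lambda>\<xi>. 1 * real 4 ^ num_particles (\<Union>i<m. A i) \<xi>) \<in> borel_measurable P" by measurable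
  show "(\<integral>\<^sup>+\<xi>. ennreal ((1 * real 4 ^ num_particles (\<Union>i<m. A i) \<xi>) ^ p) \<partial>P) < \<infinity>"
    by (rule growth_power_finite[OF U]) simp
  fix \<xi> assume \<xi>: "\<xi> \<in> space P"
  have sum: "num_particles (\<Union>i<m. A i) \<xi> = (\<Sum>i<m. num_particles (A i) \<xi>)"
    using A \<xi> by (intro num_particles_UN) (auto simp: space_P bounded_sets_def)
  show "cmod (?q L \<xi>) \<le> 1 * real 4 ^ num_particles (\<Union>i<m. A i) \<xi>" for L
  proof -
    have "cmod (?q L \<xi>) \<le> (\<Prod>i<m. 4 ^ num_particles (A i) \<xi>)"
      unfolding prod_norm[symmetric] by (intro prod_mono conjI norm_ge_zero binomial_inversion_bound)
    then show ?thesis unfolding sum by (simp add: power_sum)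
  qed
  show "(\<lambda>L. ?q L \<xi>) \<longlonglongrightarrow> (if \<forall>i<m. num_particles (A i) \<xi> = n i then 1 else 0)"
  proof (rule tendsto_eventually)
    show "\<forall>\<^sub>F L in sequentially. ?q L \<xi> = (if \<forall>i<m. num_particles (A i) \<xi> = n i then 1 else 0)"
      using eventually_ge_at_top[of "num_particles (\<Union>i<m. A i) \<xi>"]
    proof eventually_elim
      case (elim L)
      have "num_particles (A i) \<xi> \<le> L" if "i < m" for i
        using elim sum member_le_sum[of i "{..<m}" "\<lambda>i. num_particles (A i) \<xi>"] that by simp
      then have "?q L \<xi> = (\<Prod>i<m. if num_particles (A i) \<xi> = n i then 1 else 0)"
        by (intro prod.cong refl binomial_inversion) auto
      also have "\<dots> = (if \<forall>i<m. num_particles (A i) \<xi> = n i then 1 else 0)"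
        by (auto intro!: prod.neutral prod_zero)
      finally show ?case .
    qed
  qed
qed

text \<open>Restricting all counts to values up to \<open>L\<close> leaves finitely many atoms;
  every configuration is reached once \<open>L\<close> exceeds its counts.\<close>

lemma Lp_closure_disjoint_counts:
  fixes m :: nat
  assumes p: "p > 0" and A: "\<And>i. i < m \<Longrightarrow> A i \<in> bounded_sets M" "disjoint_family_on A {..<m}"
  shows "Lp_closure p (\<lambda>\<xi>. if \<phi> (\<lambda>i\<in>{..<m}. num_particles (A i) \<xi>) then 1 else 0)"
proof -
  let ?N = "\<lambda>\<xi>. \<lambda>i\<in>{..<m}. num_particles (A i) \<xi>"
  let ?f = "\<lambda>L \<xi>. if (\<forall>i<m. num_particles (A i) \<xi> \<le> L) \<and> \<phi> (?N \<xi>) then 1 else (0::complex)"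
  have f: "Lp_closure p (?f L)" for L
  proof -
    have "?f L \<xi> = (\<Sum>k\<in>{k \<in> {..<m} \<rightarrow>\<^sub>E {..L}. \<phi> k}. if \<forall>i<m. num_particles (A i) \<xi> = k i then 1 else 0)" for \<xi>
    proof -
      have "(\<forall>i<m. num_particles (A i) \<xi> = k i) \<longleftrightarrow> k = ?N \<xi>" if "k \<in> {..<m} \<rightarrow>\<^sub>E {..L}" for k
        using that by (auto simp: fun_eq_iff PiE_iff extensional_def)
      then have "(\<Sum>k\<in>{k \<in> {..<m} \<rightarrow>\<^sub>E {..L}. \<phi> k}. if \<forall>i<m. num_particles (A i) \<xi> = k i then 1 else (0::complex)) =
        (\<Sum>k\<in>{k \<in> {..<m} \<rightarrow>\<^sub>E {..L}. \<phi> k}. if k = ?N \<xi> then 1 else 0)"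
        by (intro sum.cong) auto
      also have "\<dots> = (if ?N \<xi> \<in> {k \<in> {..<m} \<rightarrow>\<^sub>E {..L}. \<phi> k} then 1 else 0)"
        by (intro sum.delta finite_subset[OF _ finite_PiE[of "{..<m}" "\<lambda>_. {..L}"]]) auto
      also have "\<dots> = ?f L \<xi>" by (auto simp: PiE_iff)
      finally show ?thesis by simp
    qed
    then show ?thesis by (simp only:) (intro Lp_closure_sum[OF p] Lp_closure_atom[OF p] A)
  qed
  have lim: "(\<lambda>L. ?f L \<xi>) \<longlonglongrightarrow> (if \<phi> (?N \<xi>) then 1 else 0)" for \<xi>
  proof (rule tendsto_eventually)
    show "\<forall>\<^sub>F L in sequentially. ?f L \<xi> = (if \<phi> (?N \<xi>) then 1 else 0)"
      using eventually_ge_at_top[of "\<Sum>i<m. num_particles (A i) \<xi>"]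
    proof eventually_elim
      case (elim L)
      have "num_particles (A i) \<xi> \<le> L" if "i < m" for i
        using elim member_le_sum[of i "{..<m}" "\<lambda>i. num_particles (A i) \<xi>"] that by simp
      then show ?case by auto
    qed
  qed
  define F where "F L = ?f L" for L
  define G where "G = (\<lambda>\<xi>. if \<phi> (?N \<xi>) then 1 else (0::complex))"
  have F: "Lp_closure p (F L)" for L using f[of L] by (simp only: F_def)
  have FG: "(\<lambda>L. F L \<xi>) \<longlonglongrightarrow> G \<xi>" for \<xi> using lim[of \<xi>] by (simp only: F_def G_def)
  have "Lp_closure p G"
  proof (rule Lp_closure_dominated[where fn=F and D="\<lambda>_. 1"])
    show "G \<in> borel_measurable P"
    proof (rule borel_measurable_LIMSEQ_metric[where f=F])
      show "F L \<in> borel_measurable P" for L using F[of L] by (simp add: Lp_closure_def)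
    qed (rule FG)
    show "cmod (F n \<xi>) \<le> 1" for n \<xi> by (simp add: F_def)
  qed (use p F FG in \<open>auto simp: P.emeasure_space_1\<close>)
  then show ?thesis by (simp only: G_def)
qed

definition cylinder_event :: "nat \<Rightarrow> (nat \<Rightarrow> (real ^ 'd) set) \<Rightarrow> (nat \<Rightarrow> nat) \<Rightarrow> 'd config set" where
  "cylinder_event m B n = {\<xi> \<in> configurations (space M). \<forall>i<m. num_particles (B i) \<xi> = n i}"

text \<open>The counts of arbitrary sets are sums of the counts of the atoms of the algebra they generate.\<close>

lemma Lp_closure_cylinder_event:
  assumes p: "p > 0" and B: "\<And>i. i < m \<Longrightarrow> B i \<in> bounded_sets M"
  shows "Lp_closure p (indicator (cylinder_event m B n))"
proof -
  have "finite (Pow {..<m})" by simp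
  then obtain e where e: "bij_betw e {..<card (Pow {..<m})} (Pow {..<m})"
    using ex_bij_betw_nat_finite[of "Pow {..<m}"] unfolding atLeast0LessThan by blast
  define c where "c = card (Pow {..<m})"
  have e': "bij_betw e {..<c} (Pow {..<m})" using e by (simp add: c_def)
  define U where "U = (\<Union>i<m. B i)"
  have U: "U \<in> bounded_sets M" unfolding U_def by (intro bounded_sets_UN B) auto
  \<comment> \<open>The atom of points that lie in exactly the sets with index in
    \<open>e j\<close>. Intersecting with \<open>U\<close> keeps it bounded; the atom of the empty
    index set is empty.\<close>
  define A where "A j = {x \<in> U. \<forall>i<m. x \<in> B i \<longleftrightarrow> i \<in> e j}" for j
  have Ab: "A j \<in> bounded_sets M" for j
  proof -
    have "x \<in> A j \<longleftrightarrow> x \<in> U - (\<Union>i<m. if i \<in> e j then U - B i else B i)" for x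
    proof (cases "x \<in> U")
      case True
      then have "x \<in> (if i \<in> e j then U - B i else B i) \<longleftrightarrow> \<not> (x \<in> B i \<longleftrightarrow> i \<in> e j)" for i by simp
      with True show ?thesis by (simp only: A_def mem_Collect_eq Diff_iff UN_iff lessThan_iff) blast
    qed (simp add: A_def)
    then have eq: "A j = U - (\<Union>i<m. if i \<in> e j then U - B i else B i)" by blast
    have "(\<Union>i<m. if i \<in> e j then U - B i else B i) \<in> bounded_sets M"
      using U B by (intro bounded_sets_UN) (auto intro: bounded_sets_ops)
    then show ?thesis unfolding eq by (rule bounded_sets_ops(3)[OF U])
  qed
  have Ad: "disjoint_family_on A {..<c}"
    unfolding disjoint_family_on_def
  proof (intro ballI impI)
    fix i j assume ij: "i \<in> {..<c}" "j \<in> {..<c}" "i \<noteq> j"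
    then have "e i \<noteq> e j" "e i \<subseteq> {..<m}" "e j \<subseteq> {..<m}"
      using e' by (auto simp: bij_betw_def inj_on_def)
    then obtain l where "l < m" "l \<in> e i \<longleftrightarrow> l \<notin> e j" by blast
    then show "A i \<inter> A j = {}" by (auto simp: A_def)
  qed
  have BA: "B i = (\<Union>j\<in>{j \<in> {..<c}. i \<in> e j}. A j)" if i: "i < m" for i
  proof (intro equalityI subsetI)
    fix x assume x: "x \<in> B i"
    have "{l. l < m \<and> x \<in> B l} \<in> Pow {..<m}" by auto
    then have "{l. l < m \<and> x \<in> B l} \<in> e ` {..<c}"
      using bij_betw_imp_surj_on[OF e'] by (simp only:)
    then obtain j where j: "j < c" "e j = {l. l < m \<and> x \<in> B l}" by (elim imageE) simp
    have "x \<in> A j" using x i j(2) by (auto simp: A_def U_def)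
    then show "x \<in> (\<Union>j\<in>{j \<in> {..<c}. i \<in> e j}. A j)" using j x i by auto
  qed (use i in \<open>auto simp: A_def\<close>)
  let ?\<phi> = "\<lambda>k. \<forall>i<m. (\<Sum>j\<in>{j \<in> {..<c}. i \<in> e j}. k j) = n i"
  have num: "num_particles (B i) \<xi> = (\<Sum>j\<in>{j \<in> {..<c}. i \<in> e j}. num_particles (A j) \<xi>)"
    if "\<xi> \<in> configurations (space M)" "i < m" for \<xi> i
    unfolding BA[OF that(2)] using Ab that
    by (intro num_particles_UN[OF that(1)] disjoint_family_on_mono[OF _ Ad]) (auto simp: bounded_sets_def)
  define I where "I = (indicator (cylinder_event m B n) :: _ \<Rightarrow> complex)"
  define h where "h = (\<lambda>\<xi>. if ?\<phi> (\<lambda>j\<in>{..<c}. num_particles (A j) \<xi>) then 1 else (0::complex))"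
  have eq: "I \<xi> = h \<xi>" if \<xi>: "\<xi> \<in> space P" for \<xi>
  proof -
    have "(\<forall>i<m. num_particles (B i) \<xi> = n i) \<longleftrightarrow> ?\<phi> (\<lambda>j\<in>{..<c}. num_particles (A j) \<xi>)"
    proof (intro all_cong)
      fix i assume "i < m"
      have "(\<Sum>j\<in>{j \<in> {..<c}. i \<in> e j}. (\<lambda>j\<in>{..<c}. num_particles (A j) \<xi>) j) = num_particles (B i) \<xi>"
        unfolding num[OF \<xi>[unfolded space_P] \<open>i < m\<close>] by (intro sum.cong) auto
      then show "num_particles (B i) \<xi> = n i \<longleftrightarrow>
          (\<Sum>j\<in>{j \<in> {..<c}. i \<in> e j}. (\<lambda>j\<in>{..<c}. num_particles (A j) \<xi>) j) = n i"
        by (simp only:)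
    qed
    with \<xi> show ?thesis unfolding I_def h_def by (simp only: cylinder_event_def indicator_def space_P mem_Collect_eq simp_thms of_bool_def)
  qed
  have cl: "Lp_closure p h"
    unfolding h_def by (rule Lp_closure_disjoint_counts[OF p Ab Ad])
  have m: "I \<in> borel_measurable P"
    using measurable_cong[of P I h borel, OF eq] cl by (simp add: Lp_closure_def)
  have "Lp_closure p I"
  proof (rule Lp_closure_limit[OF m])
    fix \<epsilon> :: real assume "\<epsilon> > 0"
    moreover have "(\<integral>\<^sup>+\<xi>. ennreal (cmod (I \<xi> - h \<xi>) ^ p) \<partial>P) = (\<integral>\<^sup>+\<xi>. 0 \<partial>P)"
      using p by (intro nn_integral_cong) (simp add: eq zero_power)
    ultimately show "\<exists>f'. Lp_closure p f' \<and> (\<integral>\<^sup>+\<xi>. ennreal (cmod (I \<xi> - f' \<xi>) ^ p) \<partial>P) < ennreal \<epsilon>"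
      using cl by (intro exI[of _ h]) simp
  qed
  then show ?thesis by (simp only: I_def)
qed

definition cylinder_events :: "'d config set set" where
  "cylinder_events = {cylinder_event m B n | m B n. \<forall>i<m. B i \<in> bounded_sets M}"

lemma cylinder_event_sets:
  assumes "\<forall>i<m. B i \<in> bounded_sets M"
  shows "cylinder_event m B n \<in> sets P"
proof -
  have "{\<xi> \<in> space P. \<forall>i\<in>{..<m}. num_particles (B i) \<xi> = n i} \<in> sets P"
  proof (intro sets.sets_Collect_finite_All)
    fix i assume "i \<in> {..<m}"
    then have [measurable]: "num_particles (B i) \<in> measurable P (count_space UNIV)"
      using assms by (intro num_particles_measurable) auto
    show "{\<xi> \<in> space P. num_particles (B i) \<xi> = n i} \<in> sets P" by measurable
  qed simp
  moreover have "cylinder_event m B n = {\<xi> \<in> space P. \<forall>i\<in>{..<m}. num_particles (B i) \<xi> = n i}"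
    by (auto simp: cylinder_event_def space_P)
  ultimately show ?thesis by (simp only:)
qed

lemma sets_P_cylinder_events: "sets P = sigma_sets (configurations (space M)) cylinder_events"
proof (rule antisym)
  show "sets P \<subseteq> sigma_sets (configurations (space M)) cylinder_events"
    unfolding sets_P_sigma
  proof (rule sigma_sets_mono, rule subsetI)
    fix Y assume "Y \<in> cylinders"
    then obtain B n where B: "B \<in> bounded_sets M"
      and Y: "Y = {\<xi> \<in> configurations (space M). num_particles B \<xi> = n}" by auto
    have "Y = cylinder_event 1 (\<lambda>_. B) (\<lambda>_. n)" by (auto simp: Y cylinder_event_def)
    with B have "Y \<in> cylinder_events" unfolding cylinder_events_def by blast
    then show "Y \<in> sigma_sets (configurations (space M)) cylinder_events" by (rule sigma_sets.Basic)
  qed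
  have "cylinder_events \<subseteq> sets P"
    using cylinder_event_sets by (auto simp: cylinder_events_def)
  then show "sigma_sets (configurations (space M)) cylinder_events \<subseteq> sets P"
    unfolding space_P[symmetric] by (rule sets.sigma_sets_subset)
qed

lemma Int_stable_cylinder_events: "Int_stable cylinder_events"
proof (rule Int_stableI)
  fix a b assume "a \<in> cylinder_events" "b \<in> cylinder_events"
  then obtain m B n m' B' n' where a: "a = cylinder_event m B n" and b: "b = cylinder_event m' B' n'"
    and B: "\<forall>i<m. B i \<in> bounded_sets M" "\<forall>i<m'. B' i \<in> bounded_sets M"
    unfolding cylinder_events_def by blast
  let ?B = "\<lambda>i. if i < m then B i else B' (i - m)" and ?n = "\<lambda>i. if i < m then n i else n' (i - m)"
  have "a \<inter> b = cylinder_event (m + m') ?B ?n"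
  proof (intro equalityI subsetI)
    fix \<xi> assume \<xi>: "\<xi> \<in> cylinder_event (m + m') ?B ?n"
    have all: "\<forall>j<m + m'. num_particles (?B j) \<xi> = ?n j"
      using \<xi> unfolding cylinder_event_def mem_Collect_eq by (rule conjunct2)
    have "num_particles (B' i) \<xi> = n' i" if "i < m'" for i
      using all[rule_format, of "i + m"] that by simp
    moreover have "num_particles (B i) \<xi> = n i" if "i < m" for i
      using all[rule_format, of i] that by simp
    ultimately show "\<xi> \<in> a \<inter> b" using \<xi> by (simp add: a b cylinder_event_def)
  next
    fix \<xi> assume \<xi>: "\<xi> \<in> a \<inter> b"
    have "num_particles (?B i) \<xi> = ?n i" if "i < m + m'" for i
    proof (cases "i < m")
      case False
      then have "i - m < m'" using that by simp
      with False \<xi> show ?thesis by (simp add: a b cylinder_event_def)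
    qed (use \<xi> in \<open>simp add: a b cylinder_event_def\<close>)
    then show "\<xi> \<in> cylinder_event (m + m') ?B ?n" using \<xi> by (simp add: a cylinder_event_def)
  qed
  moreover have "\<forall>i<m + m'. ?B i \<in> bounded_sets M" using B by auto
  ultimately show "a \<inter> b \<in> cylinder_events" unfolding cylinder_events_def by blast
qed

text \<open>Cylinder events form an intersection-stable generator, and the closure admits
  complements and, by domination by \<open>1\<close>, disjoint countable unions.\<close>

lemma Lp_closure_indicator:
  assumes p: "p > 0" and A: "A \<in> sets P"
  shows "Lp_closure p (indicator A)"
proof -
  have "cylinder_events \<subseteq> Pow (configurations (space M))" by (auto simp: cylinder_events_def cylinder_event_def)
  from Int_stable_cylinder_events this A[unfolded sets_P_cylinder_events]
  show ?thesis
  proof (induction rule: sigma_sets_induct_disjoint)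
    case (basic A)
    then obtain m B n where "A = cylinder_event m B n" "\<forall>i<m. B i \<in> bounded_sets M"
      unfolding cylinder_events_def by blast
    then show ?case using Lp_closure_cylinder_event[OF p, of m B n] by simp
  next
    case empty
    have "Lp_closure p (\<lambda>_. 0)" by (rule Lp_closure_poly[OF p falling_poly_const])
    then show ?case by simp
  next
    case (compl A)
    then have As: "A \<in> sets P" by (simp add: sets_P_cylinder_events)
    define h :: "_ \<Rightarrow> complex" where "h = (\<lambda>\<xi>. 1 + (-1) * indicator A \<xi>)"
    define I :: "_ \<Rightarrow> complex" where "I = indicator (configurations (space M) - A)"
    have h: "Lp_closure p h"
      unfolding h_def by (intro Lp_closure_add Lp_closure_scale compl Lp_closure_poly[OF p falling_poly_const])
    have m: "I \<in> borel_measurable P"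
      using As unfolding I_def space_P[symmetric] by measurable
    have "I \<xi> = h \<xi>" if "\<xi> \<in> space P" for \<xi>
      using that by (auto simp: I_def h_def indicator_def space_P)
    then have z: "(\<integral>\<^sup>+\<xi>. ennreal (cmod (I \<xi> - h \<xi>) ^ p) \<partial>P) = (\<integral>\<^sup>+\<xi>. 0 \<partial>P)"
      using p by (intro nn_integral_cong) (simp add: zero_power)
    have "Lp_closure p I"
      by (rule Lp_closure_limit[OF m], rule exI[of _ h]) (use h z in simp)
    then show ?case by (simp only: I_def)
  next
    case (union A)
    then have As: "A i \<in> sets P" for i by (auto simp: sets_P_cylinder_events)
    define F :: "nat \<Rightarrow> _ \<Rightarrow> complex" where "F n = (\<lambda>\<xi>. \<Sum>i<n. indicator (A i) \<xi>)" for n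
    define I :: "_ \<Rightarrow> complex" where "I = indicator (\<Union>i. A i)"
    have sum: "F n \<xi> = indicator (\<Union>i<n. A i) \<xi>" for n \<xi>
      unfolding F_def using union(1) by (intro indicator_UN_disjoint[symmetric]) (auto simp: disjoint_family_on_def)
    have F: "Lp_closure p (F n)" for n
      unfolding F_def by (intro Lp_closure_sum[OF p] union)
    have "Lp_closure p I"
    proof (rule Lp_closure_dominated[where fn=F and D="\<lambda>_. 1"])
      show "I \<in> borel_measurable P" using As unfolding I_def by measurable
      show "(\<lambda>n. F n \<xi>) \<longlonglongrightarrow> I \<xi>" for \<xi>
        unfolding sum I_def by (rule LIMSEQ_indicator_UN)
      show "cmod (F n \<xi>) \<le> 1" for n \<xi>
        unfolding sum by (simp add: indicator_def)
    qed (use p F in \<open>auto simp: P.emeasure_space_1\<close>)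
    then show ?case by (simp only: I_def)
  qed
qed

text \<open>Simple functions dominated by twice the modulus of \<open>f\<close> converge to
  \<open>f\<close>; each is a combination of indicators, which lie in the closure.\<close>

theorem falling_poly_dense:
  assumes p: "p > 0" and f: "f \<in> borel_measurable P" "(\<integral>\<^sup>+\<xi>. ennreal (cmod (f \<xi>) ^ p) \<partial>P) < \<infinity>"
    and \<epsilon>: "\<epsilon> > 0"
  shows "\<exists>g. falling_poly g \<and> (\<integral>\<^sup>+\<xi>. ennreal (cmod (f \<xi> - g \<xi>) ^ p) \<partial>P) < ennreal \<epsilon>"
proof -
  obtain s where s: "\<And>i. simple_function P (s i)" "\<And>\<xi>. \<xi> \<in> space P \<Longrightarrow> (\<lambda>i. s i \<xi>) \<longlonglongrightarrow> f \<xi>"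
    "\<And>i \<xi>. \<xi> \<in> space P \<Longrightarrow> dist (s i \<xi>) 0 \<le> 2 * dist (f \<xi>) 0"
    using borel_measurable_implies_sequence_metric[OF f(1), of 0] by blast
  note [measurable] = f(1)
  have simple: "Lp_closure p (s i)" for i
  proof -
    have sm: "s i \<in> borel_measurable P" using s(1) by (rule borel_measurable_simple_function)
    define g where "g = (\<lambda>\<xi>. \<Sum>y\<in>s i ` space P. y * indicator (s i -` {y} \<inter> space P) \<xi>)"
    have g: "Lp_closure p g"
      unfolding g_def using s(1)[of i]
      by (intro Lp_closure_sum[OF p] Lp_closure_scale Lp_closure_indicator[OF p]) (auto dest: simple_functionD)
    have "s i \<xi> = g \<xi>" if "\<xi> \<in> space P" for \<xi>
    proof -
      have "s i \<xi> = (\<Sum>y\<in>s i ` space P. indicator (s i -` {y} \<inter> space P) \<xi> *\<^sub>R y)"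
        by (rule simple_function_indicator_representation_banach[OF s(1) that])
      also have "\<dots> = g \<xi>"
        unfolding g_def by (intro sum.cong refl) (simp add: indicator_def)
      finally show ?thesis .
    qed
    then have z: "(\<integral>\<^sup>+\<xi>. ennreal (cmod (s i \<xi> - g \<xi>) ^ p) \<partial>P) = (\<integral>\<^sup>+\<xi>. 0 \<partial>P)"
      using p by (intro nn_integral_cong) (simp add: zero_power)
    show ?thesis
      by (rule Lp_closure_limit[OF sm], rule exI[of _ g]) (use g z in simp)
  qed
  have "Lp_closure p f"
  proof (rule Lp_closure_dominated[where fn=s and D="\<lambda>\<xi>. 2 * cmod (f \<xi>)"])
    have "(\<integral>\<^sup>+\<xi>. ennreal ((2 * cmod (f \<xi>)) ^ p) \<partial>P) = (\<integral>\<^sup>+\<xi>. ennreal (2 ^ p) * ennreal (cmod (f \<xi>) ^ p) \<partial>P)"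
      by (simp add: power_mult_distrib ennreal_mult)
    also have "\<dots> = ennreal (2 ^ p) * (\<integral>\<^sup>+\<xi>. ennreal (cmod (f \<xi>) ^ p) \<partial>P)"
      by (rule nn_integral_cmult) measurable
    also have "\<dots> < \<infinity>" using f(2) by (simp add: ennreal_mult_less_top)
    finally show "(\<integral>\<^sup>+\<xi>. ennreal ((2 * cmod (f \<xi>)) ^ p) \<partial>P) < \<infinity>" .
    show "(\<lambda>\<xi>. 2 * cmod (f \<xi>)) \<in> borel_measurable P" by measurable
    show "cmod (s n \<xi>) \<le> 2 * cmod (f \<xi>)" if "\<xi> \<in> space P" for n \<xi> using s(3)[OF that] by simp
  qed (fact p f(1) simple s(2))+
  with \<epsilon> show ?thesis unfolding Lp_closure_def by blast
qed

subsection \<open>Mixing\<close>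

abbreviation translate :: "real ^ 'd \<Rightarrow> (real ^ 'd) set \<Rightarrow> (real ^ 'd) set" where
  "translate t A \<equiv> (\<lambda>x. x - t) ` A"

lemma falling_monomial_prod:
  assumes "\<And>a. a \<le> r \<Longrightarrow> falling_monomial (S a) (L a) (F a)" "disjoint_family_on S {..r}"
  shows "falling_monomial (\<Union>a\<le>r. S a) (concat (map L [0..<Suc r])) (\<lambda>\<xi>. \<Prod>a\<le>r. F a \<xi>)"
  using assms
proof (induction r)
  case (Suc r)
  have "disjoint_family_on S {..r}" using Suc.prems(2) by (rule disjoint_family_on_mono[rotated]) auto
  with Suc have IH: "falling_monomial (\<Union>a\<le>r. S a) (concat (map L [0..<Suc r])) (\<lambda>\<xi>. \<Prod>a\<le>r. F a \<xi>)" by simp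
  have "S a \<inter> S (Suc r) = {}" if "a \<le> r" for a
    using Suc.prems(2) that by (simp add: disjoint_family_on_def)
  then have "(\<Union>a\<le>r. S a) \<inter> S (Suc r) = {}" by blast
  from falling_monomial_mult[OF IH Suc.prems(1)[OF order_refl] this]
  moreover have "(\<Union>a\<le>Suc r. S a) = (\<Union>a\<le>r. S a) \<union> S (Suc r)" by (auto simp: atMost_Suc)
  moreover have "concat (map L [0..<Suc (Suc r)]) = concat (map L [0..<Suc r]) @ L (Suc r)" by simp
  moreover have "(\<lambda>\<xi>. \<Prod>a\<le>Suc r. F a \<xi>) = (\<lambda>\<xi>. (\<Prod>a\<le>r. F a \<xi>) * F (Suc r) \<xi>)" by simp
  ultimately show ?case by (simp only:)
qed simp

definition expect :: "('d config \<Rightarrow> nat) \<Rightarrow> real" where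
  "expect F = (\<integral>\<xi>. real (F \<xi>) \<partial>P)"

lemma expect_nn:
  assumes F: "falling_monomial S L F"
  shows "(\<integral>\<^sup>+\<xi>. of_nat (F \<xi>) \<partial>P) = ennreal (expect F)" "expect F \<ge> 0" "integrable P (\<lambda>\<xi>. real (F \<xi>))"
proof -
  note [measurable] = falling_monomial_measurable[OF F]
  show i: "integrable P (\<lambda>\<xi>. real (F \<xi>))"
    using nn_expectation_monomial_finite[OF F]
    by (intro integrableI_bounded) (auto simp: ennreal_of_nat_eq_real_of_nat)
  show "expect F \<ge> 0" unfolding expect_def by (rule integral_nonneg_AE) auto
  show "(\<integral>\<^sup>+\<xi>. of_nat (F \<xi>) \<partial>P) = ennreal (expect F)"
    unfolding expect_def using nn_integral_eq_integral[OF i] by (simp add: ennreal_of_nat_eq_real_of_nat)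
qed

lemma expect_shift:
  assumes "falling_monomial S L F" "t \<in> space M"
  shows "expect (\<lambda>\<xi>. F (shift t \<xi>)) = expect F"
proof -
  note [measurable] = falling_monomial_measurable[OF assms(1)]
  show ?thesis unfolding expect_def by (rule integral_shift_P[OF assms(2)]) measurable
qed

lemma covariance_bound:
  assumes F: "falling_monomial S L F" and G: "falling_monomial S' L' G" and disj: "S \<inter> S' = {}"
  shows "ennreal \<bar>expect (\<lambda>\<xi>. F \<xi> * G \<xi>) - expect F * expect G\<bar> \<le>
    fact (length L + length L') * of_nat (length L * length L') *
      (1 + mu (S \<union> S')) ^ (length L + length L') * W S S'" (is "_ \<le> ?C")
proof -
  have SS: "S \<union> S' \<in> bounded_sets M" "S \<in> bounded_sets M" "S' \<in> bounded_sets M"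
    using falling_monomial_support(1)[OF F] falling_monomial_support(1)[OF G] by (auto intro: bounded_sets_ops)
  have "?C < \<top>"
    using mu_finite[OF SS(1)] W_finite[OF SS(2,3)]
    by (simp add: ennreal_mult_less_top of_nat_less_top power_less_top_ennreal flip: ennreal_fact)
  then obtain c where c: "?C = ennreal c" "c \<ge> 0" by (cases "?C") auto
  note FG = expect_nn[OF falling_monomial_mult[OF F G disj]]
  note n = nn_expectation_mult_monomials[OF F G disj, unfolded c FG(1) expect_nn(1)[OF F] expect_nn(1)[OF G]]
  have "expect (\<lambda>\<xi>. F \<xi> * G \<xi>) \<le> expect F * expect G + c"
    "expect F * expect G \<le> expect (\<lambda>\<xi>. F \<xi> * G \<xi>) + c"
    using n FG(2) expect_nn(2)[OF F] expect_nn(2)[OF G] c(2)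
    by (simp_all add: ennreal_mult[symmetric] ennreal_plus[symmetric] del: ennreal_plus)
  then show ?thesis unfolding c(1) by (intro ennreal_leI) (simp add: abs_le_iff)
qed

lemma translate_disjoint:
  assumes "A \<in> bounded_sets M" "B \<in> bounded_sets M"
  shows "\<exists>R. \<forall>s t. R \<le> norm (t - s) \<longrightarrow> translate s A \<inter> translate t B = {}"
proof -
  obtain a where a: "\<And>x. x \<in> A \<Longrightarrow> norm x \<le> a" using assms(1) by (auto simp: bounded_sets_def bounded_iff)
  obtain b where b: "\<And>x. x \<in> B \<Longrightarrow> norm x \<le> b" using assms(2) by (auto simp: bounded_sets_def bounded_iff)
  have "translate s A \<inter> translate t B = {}" if "a + b + 1 \<le> norm (t - s)" for s t
  proof (rule ccontr)
    assume "translate s A \<inter> translate t B \<noteq> {}"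
    then obtain x y where "x \<in> A" "y \<in> B" "x - s = y - t" by auto
    then have "t - s = y - x" by (simp add: algebra_simps)
    then have "norm (t - s) \<le> b + a"
      using norm_triangle_ineq4[of y x] a[OF \<open>x \<in> A\<close>] b[OF \<open>y \<in> B\<close>] by simp
    with that show False by simp
  qed
  then show ?thesis by blast
qed

text \<open>Induction on the number of factors: the last shifted monomial is decoupled from the
  product of the others, which is one monomial because distant supports are disjoint. The constant
  in the covariance bound depends only on degrees and on \<open>mu\<close> of the supports, and
  neither changes under shifts.\<close>

lemma mixing_monomials:
  fixes r :: nat
  assumes F: "\<And>a. a \<le> r \<Longrightarrow> falling_monomial (S a) (L a) (F a)" and \<epsilon>: "\<epsilon> > 0"
  shows "\<exists>R. \<forall>s. (\<forall>a\<le>r. s a \<in> space M) \<and> (\<forall>a\<le>r. \<forall>b\<le>r. a < b \<longrightarrow> R \<le> norm (s b - s a)) \<longrightarrow>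
    \<bar>expect (\<lambda>\<xi>. \<Prod>a\<le>r. F a (shift (s a) \<xi>)) - (\<Prod>a\<le>r. expect (F a))\<bar> < \<epsilon>"
  using F \<epsilon>
proof (induction r arbitrary: \<epsilon>)
  case 0
  then show ?case using expect_shift[OF 0(1)[of 0]] by (intro exI[of _ 0]) simp
next
  case (Suc r)
  have Sb: "S a \<in> bounded_sets M" if "a \<le> Suc r" for a
    using falling_monomial_support(1)[OF Suc.prems(1)[OF that]] .
  let ?e = "expect (F (Suc r))"
  have e0: "?e \<ge> 0" using expect_nn(2)[OF Suc.prems(1)[of "Suc r"]] by simp
  \<comment> \<open>Half of \<open>\<epsilon>\<close> goes to the induction hypothesis multiplied by
    the last expectation, a quarter (through \<open>\<epsilon>2\<close>) to decoupling the last
    factor; the \<open>1 +\<close> in both denominators avoids division by zero.\<close>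
  define \<epsilon>1 where "\<epsilon>1 = \<epsilon> / (2 * (1 + ?e))"
  have \<epsilon>1: "\<epsilon>1 > 0" using Suc.prems(2) e0 by (simp add: \<epsilon>1_def)
  have "\<exists>R. \<forall>s. (\<forall>a\<le>r. s a \<in> space M) \<and> (\<forall>a\<le>r. \<forall>b\<le>r. a < b \<longrightarrow> R \<le> norm (s b - s a)) \<longrightarrow>
    \<bar>expect (\<lambda>\<xi>. \<Prod>a\<le>r. F a (shift (s a) \<xi>)) - (\<Prod>a\<le>r. expect (F a))\<bar> < \<epsilon>1"
    by (intro Suc.IH \<epsilon>1 Suc.prems(1)) simp
  then obtain R1 where R1: "\<And>s. (\<forall>a\<le>r. s a \<in> space M) \<and> (\<forall>a\<le>r. \<forall>b\<le>r. a < b \<longrightarrow> R1 \<le> norm (s b - s a)) \<Longrightarrow>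
    \<bar>expect (\<lambda>\<xi>. \<Prod>a\<le>r. F a (shift (s a) \<xi>)) - (\<Prod>a\<le>r. expect (F a))\<bar> < \<epsilon>1" by blast
  \<comment> \<open>The total intensity of the supports; it is also the intensity of the union of
    any disjoint translates of them.\<close>
  define m where "m = (\<Sum>a\<le>Suc r. mu (S a))"
  have m: "m < \<top>" unfolding m_def using mu_finite[OF Sb] by (auto simp: ennreal_sum_less_top)
  define n1 n2 where "n1 = length (concat (map L [0..<Suc r]))" and "n2 = length (L (Suc r))"
  define C where "C = fact (n1 + n2) * of_nat (n1 * n2) * (1 + m) ^ (n1 + n2)"
  have C: "C < \<top>" unfolding C_def using m
    by (simp add: ennreal_mult_less_top of_nat_less_top power_less_top_ennreal flip: ennreal_fact)
  then obtain c where c: "C = ennreal c" "c \<ge> 0" by (cases C) auto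
  define \<epsilon>2 where "\<epsilon>2 = \<epsilon> / (4 * (1 + c) * (real r + 1))"
  have \<epsilon>2: "\<epsilon>2 > 0" using Suc.prems(2) c by (simp add: \<epsilon>2_def)
  have "\<exists>R. \<forall>t\<in>space M. R \<le> norm t \<longrightarrow> W (S a) (translate t (S (Suc r))) < ennreal \<epsilon>2" if "a \<le> r" for a
    using that Sb \<epsilon>2 by (intro W_translate_tendsto_0) auto
  then obtain R2 where R2: "\<And>a t. a \<le> r \<Longrightarrow> t \<in> space M \<Longrightarrow> R2 a \<le> norm t \<Longrightarrow> W (S a) (translate t (S (Suc r))) < ennreal \<epsilon>2"
    by metis
  have "\<exists>R. \<forall>s t. R \<le> norm (t - s) \<longrightarrow> translate s (S a) \<inter> translate t (S b) = {}" if "a \<le> Suc r" "b \<le> Suc r" for a b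
    using that Sb by (intro translate_disjoint) auto
  then obtain R3 where R3: "\<And>a b s t. a \<le> Suc r \<Longrightarrow> b \<le> Suc r \<Longrightarrow> R3 a b \<le> norm (t - s) \<Longrightarrow> translate s (S a) \<inter> translate t (S b) = {}"
    by metis
  define R where "R = \<bar>R1\<bar> + (\<Sum>a\<le>r. \<bar>R2 a\<bar>) + (\<Sum>a\<le>Suc r. \<Sum>b\<le>Suc r. \<bar>R3 a b\<bar>)"
  have RR1: "R1 \<le> R"
  proof -
    have "0 \<le> (\<Sum>a\<le>r. \<bar>R2 a\<bar>)" "0 \<le> (\<Sum>a\<le>Suc r. \<Sum>b\<le>Suc r. \<bar>R3 a b\<bar>)" by (intro sum_nonneg; simp)+
    then show ?thesis unfolding R_def by linarith
  qed
  have RR2: "R2 a \<le> R" if "a \<le> r" for a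
  proof -
    have "\<bar>R2 a\<bar> \<le> (\<Sum>a\<le>r. \<bar>R2 a\<bar>)" using that by (intro member_le_sum) auto
    moreover have "0 \<le> (\<Sum>a\<le>Suc r. \<Sum>b\<le>Suc r. \<bar>R3 a b\<bar>)" by (intro sum_nonneg) auto
    ultimately show ?thesis unfolding R_def by linarith
  qed
  have RR3: "R3 a b \<le> R" if "a \<le> Suc r" "b \<le> Suc r" for a b
  proof -
    have "\<bar>R3 a b\<bar> \<le> (\<Sum>b\<le>Suc r. \<bar>R3 a b\<bar>)" using that by (intro member_le_sum) auto
    also have "\<dots> \<le> (\<Sum>a\<le>Suc r. \<Sum>b\<le>Suc r. \<bar>R3 a b\<bar>)"
      using that by (intro member_le_sum[where f="\<lambda>a. \<Sum>b\<le>Suc r. \<bar>R3 a b\<bar>"]) (auto intro: sum_nonneg)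
    finally have "\<bar>R3 a b\<bar> \<le> (\<Sum>a\<le>Suc r. \<Sum>b\<le>Suc r. \<bar>R3 a b\<bar>)" .
    moreover have "0 \<le> (\<Sum>a\<le>r. \<bar>R2 a\<bar>)" by (intro sum_nonneg) auto
    ultimately show ?thesis unfolding R_def by linarith
  qed
  show ?case
  proof (intro exI[of _ R] allI impI, elim conjE)
    fix s assume s: "\<forall>a\<le>Suc r. s a \<in> space M" and far: "\<forall>a\<le>Suc r. \<forall>b\<le>Suc r. a < b \<longrightarrow> R \<le> norm (s b - s a)"
    define S' where "S' a = translate (s a) (S a)" for a
    define L' where "L' a = map (translate (s a)) (L a)" for a
    define F' where "F' a = (\<lambda>\<xi>. F a (shift (s a) \<xi>))" for a
    have F': "falling_monomial (S' a) (L' a) (F' a)" if "a \<le> Suc r" for a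
      unfolding S'_def L'_def F'_def using that s by (intro falling_monomial_shift Suc.prems(1)) auto
    have S'M: "S' a \<in> sets M" if "a \<le> Suc r" for a
      using falling_monomial_support(1)[OF F'[OF that]] by (rule bounded_sets_sets)
    have disj: "S' a \<inter> S' b = {}" if "a < b" "b \<le> Suc r" for a b
      unfolding S'_def using that far RR3[of a b] by (intro R3) (auto intro: order_trans)
    have fam: "disjoint_family_on S' {..Suc r}"
      unfolding disjoint_family_on_def
    proof (intro ballI impI)
      fix a b assume "a \<in> {..Suc r}" "b \<in> {..Suc r}" "a \<noteq> b"
      then show "S' a \<inter> S' b = {}" using disj[of a b] disj[of b a] by (cases "a < b") auto
    qed
    have fam': "disjoint_family_on S' {..r}" using fam by (rule disjoint_family_on_mono[rotated]) auto
    define G where "G = (\<lambda>\<xi>. \<Prod>a\<le>r. F' a \<xi>)"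
    define U where "U = (\<Union>a\<le>r. S' a)"
    have G: "falling_monomial U (concat (map L' [0..<Suc r])) G"
      unfolding G_def U_def using F' fam' by (intro falling_monomial_prod) auto
    have UV: "U \<inter> S' (Suc r) = {}" unfolding U_def using disj[of _ "Suc r"] by (auto simp: less_Suc_eq_le)
    have "mu (U \<union> S' (Suc r)) = mu (\<Union>a\<le>Suc r. S' a)" unfolding U_def by (simp add: atMost_Suc Un_commute)
    also have "\<dots> = (\<Sum>a\<le>Suc r. mu (S' a))" using fam S'M by (intro mu_UN) auto
    also have "\<dots> = m" unfolding m_def S'_def using s Sb by (intro sum.cong mu_translate) auto
    finally have muU: "mu (U \<union> S' (Suc r)) = m" .
    have len: "length (concat (map L' [0..<Suc r])) = n1" "length (L' (Suc r)) = n2"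
      by (simp_all add: n1_def n2_def L'_def length_concat o_def)
    have "W U (S' (Suc r)) = (\<Sum>a\<le>r. W (S' a) (S' (Suc r)))"
      using W_UN[of "{..r}" S' "{Suc r}" S'] fam' S'M unfolding U_def by (simp add: disjoint_family_on_def)
    also have "\<dots> \<le> (\<Sum>a\<le>r. ennreal \<epsilon>2)"
    proof (intro sum_mono)
      fix a assume a: "a \<in> {..r}"
      have sa: "s a \<in> space M" "s (Suc r) \<in> space M" using s a by auto
      \<comment> \<open>Moving both sets back by \<open>s a\<close> leaves a fixed set and a
        translate by the time difference \<open>s (Suc r) - s a\<close>, the situation in which
        \<open>R2\<close> was chosen. The sets are disjoint, so \<open>W\<close> is
        invariant.\<close>
      have "W (S' a) (S' (Suc r)) = W (translate (- s a) (S' a)) (translate (- s a) (S' (Suc r)))"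
        using falling_monomial_support(1)[OF F'] a disj[of a "Suc r"] space_closed(3)[OF sa(1)]
        by (intro W_translate_disjoint[symmetric]) auto
      also have "translate (- s a) (S' a) = S a" unfolding S'_def by (simp add: image_image)
      also have "translate (- s a) (S' (Suc r)) = translate (s (Suc r) - s a) (S (Suc r))"
        unfolding S'_def by (auto simp: image_image algebra_simps)
      also have "W (S a) (translate (s (Suc r) - s a) (S (Suc r))) < ennreal \<epsilon>2"
        using a far[rule_format, of a "Suc r"] RR2[of a] space_diff[OF sa(2,1)]
        by (intro R2) (auto intro: order_trans)
      finally show "W (S' a) (S' (Suc r)) \<le> ennreal \<epsilon>2" by (rule less_imp_le)
    qed
    also have "\<dots> = ennreal ((real r + 1) * \<epsilon>2)"
      using \<epsilon>2 by (simp add: ennreal_mult ennreal_of_nat_eq_real_of_nat add.commute)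
    finally have Wle: "W U (S' (Suc r)) \<le> ennreal ((real r + 1) * \<epsilon>2)" .
    have "ennreal \<bar>expect (\<lambda>\<xi>. G \<xi> * F' (Suc r) \<xi>) - expect G * expect (F' (Suc r))\<bar> \<le> C * W U (S' (Suc r))"
      using covariance_bound[OF G F'[OF order_refl] UV] unfolding muU len C_def .
    also have "\<dots> \<le> ennreal c * ennreal ((real r + 1) * \<epsilon>2)"
      unfolding c(1) using Wle by (intro mult_left_mono) auto
    also have "\<dots> = ennreal (c * ((real r + 1) * \<epsilon>2))" using c \<epsilon>2 by (simp add: ennreal_mult)
    finally have "\<bar>expect (\<lambda>\<xi>. G \<xi> * F' (Suc r) \<xi>) - expect G * expect (F' (Suc r))\<bar> \<le> c * ((real r + 1) * \<epsilon>2)"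
      using c \<epsilon>2 by (simp add: ennreal_le_iff)
    also have "c * ((real r + 1) * \<epsilon>2) \<le> \<epsilon> / 4"
    proof -
      have "c * ((real r + 1) * \<epsilon>2) = (c / (1 + c)) * (\<epsilon> / 4)"
        using c by (simp add: \<epsilon>2_def divide_simps)
      also have "\<dots> \<le> 1 * (\<epsilon> / 4)" using c Suc.prems(2) by (intro mult_right_mono) auto
      finally show ?thesis by simp
    qed
    finally have 1: "\<bar>expect (\<lambda>\<xi>. G \<xi> * F' (Suc r) \<xi>) - expect G * ?e\<bar> \<le> \<epsilon> / 4"
      unfolding F'_def using expect_shift[OF Suc.prems(1)[of "Suc r"]] s by simp
    have "\<bar>expect G - (\<Prod>a\<le>r. expect (F a))\<bar> < \<epsilon>1"
      unfolding G_def F'_def using s far RR1 by (intro R1) (auto intro: order_trans)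
    then have "\<bar>expect G - (\<Prod>a\<le>r. expect (F a))\<bar> * ?e \<le> \<epsilon>1 * ?e" using e0 by (intro mult_right_mono) auto
    also have "\<epsilon>1 * ?e \<le> \<epsilon> / 2"
    proof -
      have "\<epsilon>1 * ?e = (?e / (1 + ?e)) * (\<epsilon> / 2)" using e0 by (simp add: \<epsilon>1_def divide_simps)
      also have "\<dots> \<le> 1 * (\<epsilon> / 2)" using e0 Suc.prems(2) by (intro mult_right_mono) auto
      finally show ?thesis by simp
    qed
    finally have 2: "\<bar>expect G * ?e - (\<Prod>a\<le>r. expect (F a)) * ?e\<bar> \<le> \<epsilon> / 2"
      using e0 by (simp add: abs_mult flip: left_diff_distrib)
    have "(\<lambda>\<xi>. \<Prod>a\<le>Suc r. F a (shift (s a) \<xi>)) = (\<lambda>\<xi>. G \<xi> * F' (Suc r) \<xi>)"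
      by (auto simp: G_def F'_def)
    moreover have "(\<Prod>a\<le>Suc r. expect (F a)) = (\<Prod>a\<le>r. expect (F a)) * ?e" by simp
    ultimately show "\<bar>expect (\<lambda>\<xi>. \<Prod>a\<le>Suc r. F a (shift (s a) \<xi>)) - (\<Prod>a\<le>Suc r. expect (F a))\<bar> < \<epsilon>"
      using 1 2 Suc.prems(2) by (simp only:)
  qed
qed

section \<open>Mixing: from monomials to integrable observables\<close>

text \<open>Takes the place of Hoelder's inequality. Dividing one factor by
  \<open>\<eta> ^ r\<close> and multiplying the \<open>r\<close> others by \<open>\<eta>\<close>
  preserves the product, which is at most the largest factor to the power \<open>r + 1\<close>,
  hence at most the sum of all these powers. Once \<open>\<eta>\<close> is small, a sufficiently
  small distinguished factor makes the whole bound small.\<close>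

lemma prod_le_weighted:
  fixes v :: "nat \<Rightarrow> real"
  assumes j: "j \<le> r" and x: "x \<ge> 0" and v: "\<And>i. v i \<ge> 0" and \<eta>: "\<eta> > 0"
  shows "x * (\<Prod>i\<in>{..r} - {j}. v i) \<le> (x / \<eta> ^ r) ^ (r + 1) + \<eta> ^ (r + 1) * (\<Sum>i\<in>{..r} - {j}. v i ^ (r + 1))"
proof -
  define y where "y i = (if i = j then x / \<eta> ^ r else \<eta> * v i)" for i
  have y0: "y i \<ge> 0" for i using x v \<eta> by (simp add: y_def)
  have split: "{..r} = insert j ({..r} - {j})" using j by auto
  have card: "card ({..r} - {j}) = r" using j by simp
  have "(\<Prod>i\<le>r. y i) = y j * (\<Prod>i\<in>{..r} - {j}. y i)"
    using j by (subst prod.remove[of _ j]) auto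
  also have "(\<Prod>i\<in>{..r} - {j}. y i) = (\<Prod>i\<in>{..r} - {j}. \<eta> * v i)"
    by (intro prod.cong) (auto simp: y_def)
  also have "\<dots> = \<eta> ^ r * (\<Prod>i\<in>{..r} - {j}. v i)"
    by (simp only: prod.distrib prod_constant card)
  finally have eq: "(\<Prod>i\<le>r. y i) = x * (\<Prod>i\<in>{..r} - {j}. v i)"
    using \<eta> by (simp add: y_def)
  define k where "k = (SOME k. k \<le> r \<and> (\<forall>i\<le>r. y i \<le> y k))"
  have k: "k \<le> r \<and> (\<forall>i\<le>r. y i \<le> y k)"
    unfolding k_def
  proof (rule someI_ex)
    have "Max (y ` {..r}) \<in> y ` {..r}" by (intro Max_in) auto
    then obtain l where l': "Max (y ` {..r}) = y l" "l \<in> {..r}" by (rule imageE)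
    then have l: "l \<le> r" "Max (y ` {..r}) = y l" by simp_all
    moreover have "y i \<le> y l" if "i \<le> r" for i unfolding l(2)[symmetric] using that by (intro Max_ge) auto
    ultimately show "\<exists>k. k \<le> r \<and> (\<forall>i\<le>r. y i \<le> y k)" by blast
  qed
  have "(\<Prod>i\<le>r. y i) \<le> (\<Prod>i\<le>r. y k)" using k y0 by (intro prod_mono) auto
  also have "\<dots> = y k ^ (r + 1)" by simp
  also have "\<dots> \<le> (\<Sum>i\<le>r. y i ^ (r + 1))" using k y0 by (intro member_le_sum) auto
  also have "\<dots> = y j ^ (r + 1) + (\<Sum>i\<in>{..r} - {j}. y i ^ (r + 1))"
    using j by (subst sum.remove[of _ j]) auto
  also have "(\<Sum>i\<in>{..r} - {j}. y i ^ (r + 1)) = (\<Sum>i\<in>{..r} - {j}. (\<eta> * v i) ^ (r + 1))"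
    by (intro sum.cong) (auto simp: y_def)
  also have "\<dots> = \<eta> ^ (r + 1) * (\<Sum>i\<in>{..r} - {j}. v i ^ (r + 1))"
    by (simp only: power_mult_distrib sum_distrib_left)
  finally show ?thesis unfolding eq by (simp add: y_def)
qed

definition Lspace :: "nat \<Rightarrow> ('d config \<Rightarrow> complex) \<Rightarrow> bool" where
  "Lspace r f \<longleftrightarrow> f \<in> borel_measurable P \<and> integrable P (\<lambda>\<xi>. cmod (f \<xi>) ^ (r + 1))"

lemma Lspace_iff:
  "Lspace r f \<longleftrightarrow> f \<in> borel_measurable P \<and> (\<integral>\<^sup>+\<xi>. ennreal (cmod (f \<xi>) ^ (r + 1)) \<partial>P) < \<infinity>"
  by (auto simp: Lspace_def integrable_iff_bounded)

lemma falling_poly_Lspace: "falling_poly f \<Longrightarrow> Lspace r f"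
  by (simp only: Lspace_iff falling_poly_measurable falling_poly_Lp simp_thms)

lemma Lspace_shift: "Lspace r f \<Longrightarrow> t \<in> space M \<Longrightarrow> Lspace r (\<lambda>\<xi>. f (shift t \<xi>))"
  unfolding Lspace_def using integrable_shift_P[of t "\<lambda>\<xi>. cmod (f \<xi>) ^ (r + 1)"] by auto

lemma Lspace_integral_shift:
  "Lspace r f \<Longrightarrow> t \<in> space M \<Longrightarrow> (\<integral>\<xi>. cmod (f (shift t \<xi>)) ^ (r + 1) \<partial>P) = (\<integral>\<xi>. cmod (f \<xi>) ^ (r + 1) \<partial>P)"
  unfolding Lspace_def by (intro integral_shift_P) auto

lemma Lspace_diff: "Lspace r f \<Longrightarrow> Lspace r g \<Longrightarrow> Lspace r (\<lambda>\<xi>. f \<xi> - g \<xi>)"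
proof -
  assume f: "Lspace r f" and g: "Lspace r g"
  then have [measurable]: "f \<in> borel_measurable P" "g \<in> borel_measurable P" by (auto simp: Lspace_def)
  have "(\<integral>\<^sup>+\<xi>. ennreal (cmod (f \<xi> + - g \<xi>) ^ (r + 1)) \<partial>P) < \<infinity>"
    using f g by (intro le_less_trans[OF nn_integral_norm_add_power]) (auto simp: Lspace_iff ennreal_mult_less_top)
  then show ?thesis unfolding Lspace_iff by simp
qed

lemma Lspace_prod_integrable:
  assumes f: "\<And>i. i \<le> r \<Longrightarrow> Lspace r (f i)" and j: "j \<le> r" and \<eta>: "\<eta> > 0"
  shows "integrable P (\<lambda>\<xi>. f j \<xi> * (\<Prod>i\<in>{..r} - {j}. f i \<xi>))"
    "(\<integral>\<xi>. cmod (f j \<xi> * (\<Prod>i\<in>{..r} - {j}. f i \<xi>)) \<partial>P) \<le>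
      (\<integral>\<xi>. cmod (f j \<xi>) ^ (r + 1) \<partial>P) / \<eta> ^ (r * (r + 1)) +
      \<eta> ^ (r + 1) * (\<Sum>i\<in>{..r} - {j}. \<integral>\<xi>. cmod (f i \<xi>) ^ (r + 1) \<partial>P)"
proof -
  have fm: "f i \<in> borel_measurable P" if "i \<le> r" for i using f[OF that] by (simp add: Lspace_def)
  have fi: "integrable P (\<lambda>\<xi>. cmod (f i \<xi>) ^ (r + 1))" if "i \<le> r" for i using f[OF that] by (simp add: Lspace_def)
  let ?b = "\<lambda>\<xi>. cmod (f j \<xi>) ^ (r + 1) / \<eta> ^ (r * (r + 1)) + \<eta> ^ (r + 1) * (\<Sum>i\<in>{..r} - {j}. cmod (f i \<xi>) ^ (r + 1))"
  have bound: "cmod (f j \<xi> * (\<Prod>i\<in>{..r} - {j}. f i \<xi>)) \<le> ?b \<xi>" for \<xi>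
    using prod_le_weighted[OF j norm_ge_zero[of "f j \<xi>"], of "\<lambda>i. cmod (f i \<xi>)", OF norm_ge_zero \<eta>]
    by (simp only: norm_mult prod_norm power_divide power_mult)
  have bi: "integrable P ?b"
    using fi j by (intro Bochner_Integration.integrable_add integrable_mult_right Bochner_Integration.integrable_sum integrable_divide) auto
  have m: "(\<lambda>\<xi>. f j \<xi> * (\<Prod>i\<in>{..r} - {j}. f i \<xi>)) \<in> borel_measurable P"
    using fm j by (intro borel_measurable_times borel_measurable_prod) auto
  show i: "integrable P (\<lambda>\<xi>. f j \<xi> * (\<Prod>i\<in>{..r} - {j}. f i \<xi>))"
    by (rule Bochner_Integration.integrable_bound[OF bi m]) (use bound in \<open>auto intro!: AE_I2 order_trans[OF bound]\<close>)
  have "(\<integral>\<xi>. cmod (f j \<xi> * (\<Prod>i\<in>{..r} - {j}. f i \<xi>)) \<partial>P) \<le> (\<integral>\<xi>. ?b \<xi> \<partial>P)"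
    by (intro integral_mono integrable_norm i bi bound)
  also have "\<dots> = (\<integral>\<xi>. cmod (f j \<xi>) ^ (r + 1) / \<eta> ^ (r * (r + 1)) \<partial>P) +
      (\<integral>\<xi>. \<eta> ^ (r + 1) * (\<Sum>i\<in>{..r} - {j}. cmod (f i \<xi>) ^ (r + 1)) \<partial>P)"
    using fi j by (intro Bochner_Integration.integral_add integrable_mult_right Bochner_Integration.integrable_sum integrable_divide) auto
  also have "(\<integral>\<xi>. \<eta> ^ (r + 1) * (\<Sum>i\<in>{..r} - {j}. cmod (f i \<xi>) ^ (r + 1)) \<partial>P) =
      \<eta> ^ (r + 1) * (\<integral>\<xi>. (\<Sum>i\<in>{..r} - {j}. cmod (f i \<xi>) ^ (r + 1)) \<partial>P)"
    by (rule integral_mult_right_zero)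
  also have "(\<integral>\<xi>. (\<Sum>i\<in>{..r} - {j}. cmod (f i \<xi>) ^ (r + 1)) \<partial>P) = (\<Sum>i\<in>{..r} - {j}. \<integral>\<xi>. cmod (f i \<xi>) ^ (r + 1) \<partial>P)"
    using fi by (intro Bochner_Integration.integral_sum) auto
  finally show "(\<integral>\<xi>. cmod (f j \<xi> * (\<Prod>i\<in>{..r} - {j}. f i \<xi>)) \<partial>P) \<le>
      (\<integral>\<xi>. cmod (f j \<xi>) ^ (r + 1) \<partial>P) / \<eta> ^ (r * (r + 1)) +
      \<eta> ^ (r + 1) * (\<Sum>i\<in>{..r} - {j}. \<integral>\<xi>. cmod (f i \<xi>) ^ (r + 1) \<partial>P)"
    by simp
qed

lemma Lspace_integrable:
  assumes "Lspace r f"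
  shows "integrable P f"
proof -
  have "integrable P (\<lambda>\<xi>. f \<xi> * (\<Prod>i\<in>{..r} - {0}. 1))"
    by (rule Lspace_prod_integrable(1)[of r "\<lambda>i. if i = 0 then f else (\<lambda>_. 1)" 0 1, simplified, THEN Bochner_Integration.integrable_cong[THEN iffD1, rotated 2]])
      (use assms in \<open>auto simp: Lspace_def\<close>)
  then show ?thesis by simp
qed

definition times :: "(nat \<Rightarrow> real ^ 'd) \<Rightarrow> nat \<Rightarrow> real ^ 'd" where
  "times t i = (\<Sum>l=1..i. t l)"

abbreviation far :: "nat \<Rightarrow> (nat \<Rightarrow> real ^ 'd) filter" where
  "far r \<equiv> increments_to_infinity (space M) r"

lemma eventually_far_iff:
  "eventually Q (far r) \<longleftrightarrow> (\<exists>R. \<forall>t. (\<forall>i\<in>{1..r}. t i \<in> space M) \<and>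
        (\<forall>i\<in>{1..r}. \<forall>j\<in>{i..r}. R \<le> norm (\<Sum>l=i..j. t l)) \<longrightarrow> Q t)"
proof -
  let ?S = "\<lambda>R::real. {t. (\<forall>i\<in>{1..r}. t i \<in> space M) \<and> (\<forall>i\<in>{1..r}. \<forall>j\<in>{i..r}. R \<le> norm (\<Sum>l=i..j. t l))}"
  have "eventually Q (INF R\<in>UNIV. principal (?S R)) \<longleftrightarrow> (\<exists>R\<in>UNIV. eventually Q (principal (?S R)))"
  proof (rule eventually_INF_base)
    fix a b :: real
    show "\<exists>x\<in>UNIV. principal (?S x) \<le> inf (principal (?S a)) (principal (?S b))"
      by (intro bexI[of _ "max a b"]) auto
  qed simp
  then show ?thesis unfolding increments_to_infinity_def by (simp add: eventually_principal)
qed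

lemma times_space:
  assumes "\<forall>i\<in>{1..r}. t i \<in> space M" "a \<le> r"
  shows "times t a \<in> space M"
  using assms(2)
proof (induction a)
  case (Suc a)
  then show ?case using assms(1) space_closed(2)[of "times t a" "t (Suc a)"] by (simp add: times_def)
qed (simp add: times_def space_closed)

text \<open>Differences of two observation times are exactly the block sums of increments that the
  filter sends to infinity.\<close>

lemma eventually_far:
  assumes "\<And>t. (\<forall>a\<le>r. times t a \<in> space M) \<Longrightarrow> (\<forall>a\<le>r. \<forall>b\<le>r. a < b \<longrightarrow> R \<le> norm (times t b - times t a)) \<Longrightarrow> Q t"
  shows "eventually Q (far r)"
  unfolding eventually_far_iff
proof (intro exI[of _ R] allI impI, elim conjE)
  fix t assume t: "\<forall>i\<in>{1..r}. t i \<in> space M" "\<forall>i\<in>{1..r}. \<forall>j\<in>{i..r}. R \<le> norm (\<Sum>l=i..j. t l)"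
  show "Q t"
  proof (rule assms)
    show "\<forall>a\<le>r. times t a \<in> space M" using times_space[OF t(1)] by blast
    show "\<forall>a\<le>r. \<forall>b\<le>r. a < b \<longrightarrow> R \<le> norm (times t b - times t a)"
    proof (intro allI impI)
      fix a b assume ab: "a \<le> r" "b \<le> r" "a < b"
      have "{1..b} = {1..a} \<union> {Suc a..b}" using ab by auto
      then have "times t b = times t a + (\<Sum>l=Suc a..b. t l)"
        unfolding times_def by (simp only:) (rule sum.union_disjoint, auto)
      then show "R \<le> norm (times t b - times t a)" using t(2) ab by auto
    qed
  qed
qed

definition mixes :: "nat \<Rightarrow> (nat \<Rightarrow> 'd config \<Rightarrow> complex) \<Rightarrow> bool" where
  "mixes r f \<longleftrightarrow> ((\<lambda>t. \<integral>\<xi>. (\<Prod>i\<le>r. f i (shift (times t i) \<xi>)) \<partial>P) \<longlongrightarrow> (\<Prod>i\<le>r. \<integral>\<xi>. f i \<xi> \<partial>P)) (far r)"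

lemma mixes_monomials:
  assumes F: "\<And>a. a \<le> r \<Longrightarrow> falling_monomial (S a) (L a) (F a)"
  shows "mixes r (\<lambda>a \<xi>. of_nat (F a \<xi>))"
  unfolding mixes_def tendsto_iff
proof (intro allI impI)
  fix \<epsilon> :: real assume "\<epsilon> > 0"
  obtain R where R: "\<And>s. (\<forall>a\<le>r. s a \<in> space M) \<and> (\<forall>a\<le>r. \<forall>b\<le>r. a < b \<longrightarrow> R \<le> norm (s b - s a)) \<Longrightarrow>
    \<bar>expect (\<lambda>\<xi>. \<Prod>a\<le>r. F a (shift (s a) \<xi>)) - (\<Prod>a\<le>r. expect (F a))\<bar> < \<epsilon>"
    using mixing_monomials[of r S L F, OF F \<open>\<epsilon> > 0\<close>] by blast
  have c: "(\<integral>\<xi>. of_nat (G \<xi>) \<partial>P) = complex_of_real (expect G)" for G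
  proof -
    have "(\<integral>\<xi>. complex_of_nat (G \<xi>) \<partial>P) = (\<integral>\<xi>. complex_of_real (real (G \<xi>)) \<partial>P)" by simp
    then show ?thesis unfolding expect_def Bochner_Integration.integral_complex_of_real .
  qed
  show "\<forall>\<^sub>F t in far r. dist (\<integral>\<xi>. (\<Prod>i\<le>r. complex_of_nat (F i (shift (times t i) \<xi>))) \<partial>P) (\<Prod>i\<le>r. \<integral>\<xi>. complex_of_nat (F i \<xi>) \<partial>P) < \<epsilon>"
  proof (rule eventually_far[where R=R])
    fix t assume "\<forall>a\<le>r. times t a \<in> space M" "\<forall>a\<le>r. \<forall>b\<le>r. a < b \<longrightarrow> R \<le> norm (times t b - times t a)"
    then have "\<bar>expect (\<lambda>\<xi>. \<Prod>a\<le>r. F a (shift (times t a) \<xi>)) - (\<Prod>a\<le>r. expect (F a))\<bar> < \<epsilon>"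
      by (intro R) blast
    then show "dist (\<integral>\<xi>. (\<Prod>i\<le>r. complex_of_nat (F i (shift (times t i) \<xi>))) \<partial>P) (\<Prod>i\<le>r. \<integral>\<xi>. complex_of_nat (F i \<xi>) \<partial>P) < \<epsilon>"
      unfolding c of_nat_prod[symmetric] of_real_prod[symmetric] dist_norm of_real_diff[symmetric] norm_of_real .
  qed
qed

text \<open>Isolates one observable, on which both sides depend linearly, so that the observables
  can be generalised one at a time.\<close>

lemma mixes_slot:
  assumes j: "j \<le> r"
  shows "mixes r (f(j := g)) \<longleftrightarrow>
    ((\<lambda>t. \<integral>\<xi>. g (shift (times t j) \<xi>) * (\<Prod>i\<in>{..r} - {j}. f i (shift (times t i) \<xi>)) \<partial>P) \<longlongrightarrow>
      (\<integral>\<xi>. g \<xi> \<partial>P) * (\<Prod>i\<in>{..r} - {j}. \<integral>\<xi>. f i \<xi> \<partial>P)) (far r)"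
proof -
  have "(\<Prod>i\<le>r. h i) = h j * (\<Prod>i\<in>{..r} - {j}. h i)" for h :: "nat \<Rightarrow> complex"
    using j by (intro prod.remove) auto
  then show ?thesis unfolding mixes_def by (simp cong: prod.cong_simp)
qed

lemma mixes_slot_poly:
  assumes j: "j \<le> r" and f: "\<And>i. i \<le> r \<Longrightarrow> i \<noteq> j \<Longrightarrow> Lspace r (f i)"
    and base: "\<And>S L F. falling_monomial S L F \<Longrightarrow> mixes r (f(j := (\<lambda>\<xi>. of_nat (F \<xi>))))"
    and g: "falling_poly g"
  shows "mixes r (f(j := g))"
  using g
proof (induction rule: falling_poly.induct)
  case (monomial S L F)
  then show ?case by (rule base)
next
  case (add g h)
  let ?D = "\<lambda>t \<xi>. \<Prod>i\<in>{..r} - {j}. f i (shift (times t i) \<xi>)"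
  let ?c = "\<Prod>i\<in>{..r} - {j}. \<integral>\<xi>. f i \<xi> \<partial>P"
  have int: "integrable P (\<lambda>\<xi>. u (shift (times t j) \<xi>) * ?D t \<xi>)"
    if "falling_poly u" "\<forall>a\<le>r. times t a \<in> space M" for u t
  proof -
    define h where "h i = (\<lambda>\<xi>. (f(j := u)) i (shift (times t i) \<xi>))" for i
    have "Lspace r (h i)" if "i \<le> r" for i
      unfolding h_def using f falling_poly_Lspace[OF \<open>falling_poly u\<close>] that \<open>\<forall>a\<le>r. _\<close>
      by (intro Lspace_shift) auto
    from Lspace_prod_integrable(1)[of r h j 1, OF this j] show ?thesis
      by (simp add: h_def cong: prod.cong_simp)
  qed
  have "((\<lambda>t. (\<integral>\<xi>. g (shift (times t j) \<xi>) * ?D t \<xi> \<partial>P) + (\<integral>\<xi>. h (shift (times t j) \<xi>) * ?D t \<xi> \<partial>P)) \<longlongrightarrow>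
      (\<integral>\<xi>. g \<xi> \<partial>P) * ?c + (\<integral>\<xi>. h \<xi> \<partial>P) * ?c) (far r)"
    using add.IH unfolding mixes_slot[OF j] by (intro tendsto_add)
  moreover have "\<forall>\<^sub>F t in far r. (\<integral>\<xi>. g (shift (times t j) \<xi>) * ?D t \<xi> \<partial>P) + (\<integral>\<xi>. h (shift (times t j) \<xi>) * ?D t \<xi> \<partial>P) =
      (\<integral>\<xi>. (g (shift (times t j) \<xi>) + h (shift (times t j) \<xi>)) * ?D t \<xi> \<partial>P)"
  proof (rule eventually_far[where R=0])
    fix t assume t: "\<forall>a\<le>r. times t a \<in> space M"
    show "(\<integral>\<xi>. g (shift (times t j) \<xi>) * ?D t \<xi> \<partial>P) + (\<integral>\<xi>. h (shift (times t j) \<xi>) * ?D t \<xi> \<partial>P) =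
      (\<integral>\<xi>. (g (shift (times t j) \<xi>) + h (shift (times t j) \<xi>)) * ?D t \<xi> \<partial>P)"
      unfolding distrib_right using int[OF add.hyps(1) t] int[OF add.hyps(2) t] by simp
  qed
  moreover have "(\<integral>\<xi>. g \<xi> \<partial>P) * ?c + (\<integral>\<xi>. h \<xi> \<partial>P) * ?c = (\<integral>\<xi>. g \<xi> + h \<xi> \<partial>P) * ?c"
    using Lspace_integrable[OF falling_poly_Lspace[OF add.hyps(1)]] Lspace_integrable[OF falling_poly_Lspace[OF add.hyps(2)]]
    by (simp add: distrib_right)
  ultimately show ?case unfolding mixes_slot[OF j] by (simp add: tendsto_cong)
next
  case (scale g c)
  from tendsto_mult_left[OF scale.IH[unfolded mixes_slot[OF j]], of c]
  show ?case unfolding mixes_slot[OF j] by (simp add: mult.assoc)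
qed

text \<open>With \<open>g'\<close> a factorial polynomial near \<open>g\<close>, the error has three
  parts: the slot filled with \<open>g - g'\<close>, uniformly in the times by invariance; the
  mixing error of \<open>g'\<close>; and the change of the limit.\<close>

lemma mixes_slot_limit:
  assumes j: "j \<le> r" and f: "\<And>i. i \<le> r \<Longrightarrow> i \<noteq> j \<Longrightarrow> Lspace r (f i)"
    and poly: "\<And>g. falling_poly g \<Longrightarrow> mixes r (f(j := g))"
    and g: "Lspace r g"
  shows "mixes r (f(j := g))"
  unfolding mixes_slot[OF j] tendsto_iff
proof (intro allI impI)
  let ?D = "\<lambda>t \<xi>. \<Prod>i\<in>{..r} - {j}. f i (shift (times t i) \<xi>)"
  let ?c = "\<Prod>i\<in>{..r} - {j}. \<integral>\<xi>. f i \<xi> \<partial>P"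
  fix \<epsilon> :: real assume \<epsilon>: "\<epsilon> > 0"
  define A where "A = (\<Sum>i\<in>{..r} - {j}. \<integral>\<xi>. cmod (f i \<xi>) ^ (r + 1) \<partial>P)"
  have A0: "A \<ge> 0" unfolding A_def by (intro sum_nonneg integral_nonneg_AE) auto
  \<comment> \<open>\<open>A\<close> bounds the other observables in the joint integral;
    \<open>real r\<close> plays the same role when they are replaced by the constant
    \<open>1\<close>, in estimating the integral of \<open>u\<close> alone. \<open>A'\<close> covers
    both.\<close>
  define A' where "A' = A + real r"
  have A'0: "A' \<ge> 0" using A0 by (simp add: A'_def)
  define m where "m = 1 + cmod ?c"
  have m: "m \<ge> 1" by (simp add: m_def)
  \<comment> \<open>\<open>\<eta>\<close> makes the contribution of the other slots at most
    \<open>\<epsilon> / (8 * m)\<close>, and \<open>\<delta>\<close> then does the same for the slot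
    of \<open>u\<close> after division by \<open>\<eta> ^ (r * (r + 1))\<close>. The factor
    \<open>m\<close> absorbs the product of the other means.\<close>
  define \<eta> where "\<eta> = min 1 (\<epsilon> / (8 * m * (1 + A')))"
  have \<eta>: "\<eta> > 0" "\<eta> \<le> 1" using \<epsilon> m A'0 by (auto simp: \<eta>_def)
  define \<delta> where "\<delta> = \<epsilon> / (8 * m) * \<eta> ^ (r * (r + 1))"
  have \<delta>: "\<delta> > 0" using \<epsilon> m \<eta> by (simp add: \<delta>_def)
  obtain g' where g': "falling_poly g'" "(\<integral>\<^sup>+\<xi>. ennreal (cmod (g \<xi> - g' \<xi>) ^ (r + 1)) \<partial>P) < ennreal \<delta>"
    using falling_poly_dense[of "r + 1" g \<delta>] g \<delta> unfolding Lspace_iff by auto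
  define u where "u = (\<lambda>\<xi>. g \<xi> - g' \<xi>)"
  have u: "Lspace r u" unfolding u_def by (intro Lspace_diff g falling_poly_Lspace g')
  have u\<delta>: "(\<integral>\<xi>. cmod (u \<xi>) ^ (r + 1) \<partial>P) < \<delta>"
  proof -
    have "ennreal (\<integral>\<xi>. cmod (u \<xi>) ^ (r + 1) \<partial>P) = (\<integral>\<^sup>+\<xi>. ennreal (cmod (u \<xi>) ^ (r + 1)) \<partial>P)"
      using u unfolding Lspace_def by (intro nn_integral_eq_integral[symmetric]) auto
    also have "\<dots> < ennreal \<delta>" using g'(2) by (simp only: u_def)
    finally show ?thesis using \<delta> by (simp add: ennreal_less_iff integral_nonneg_AE)
  qed
  have small: "(\<integral>\<xi>. cmod (u \<xi>) ^ (r + 1) \<partial>P) / \<eta> ^ (r * (r + 1)) + \<eta> ^ (r + 1) * B \<le> \<epsilon> / (4 * m)" if B: "0 \<le> B" "B \<le> A'" for B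
  proof -
    have "(\<integral>\<xi>. cmod (u \<xi>) ^ (r + 1) \<partial>P) / \<eta> ^ (r * (r + 1)) \<le> \<delta> / \<eta> ^ (r * (r + 1))"
      using u\<delta> \<eta> by (intro divide_right_mono) auto
    also have "\<dots> = \<epsilon> / (8 * m)" using \<eta> by (simp add: \<delta>_def)
    finally have 1: "(\<integral>\<xi>. cmod (u \<xi>) ^ (r + 1) \<partial>P) / \<eta> ^ (r * (r + 1)) \<le> \<epsilon> / (8 * m)" .
    have "\<eta> ^ (r + 1) * B \<le> \<eta> * (1 + A')"
      using \<eta> B power_le_one[of \<eta> r] by (intro mult_mono) (auto simp: mult_left_le)
    also have "\<dots> \<le> \<epsilon> / (8 * m * (1 + A')) * (1 + A')" using A'0 by (intro mult_right_mono) (auto simp: \<eta>_def)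
    also have "\<dots> = \<epsilon> / (8 * m)" using A'0 by simp
    finally have "\<eta> ^ (r + 1) * B \<le> \<epsilon> / (8 * m)" .
    moreover have "\<epsilon> / (8 * m) + \<epsilon> / (8 * m) = \<epsilon> / (4 * m)" by simp
    ultimately show ?thesis using 1 by linarith
  qed
  have em: "\<epsilon> / (4 * m) \<le> \<epsilon> / 4" "\<epsilon> / (4 * m) * cmod ?c \<le> \<epsilon> / 4"
  proof -
    show "\<epsilon> / (4 * m) \<le> \<epsilon> / 4" using m \<epsilon> by (intro divide_left_mono) auto
    have "\<epsilon> / (4 * m) * cmod ?c \<le> \<epsilon> / (4 * m) * m" using m \<epsilon> by (intro mult_left_mono) (auto simp: m_def)
    then show "\<epsilon> / (4 * m) * cmod ?c \<le> \<epsilon> / 4" using m by simp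
  qed
  have first: "cmod (\<integral>\<xi>. u (shift (times t j) \<xi>) * ?D t \<xi> \<partial>P) \<le> \<epsilon> / (4 * m)"
      and int: "\<And>v. Lspace r v \<Longrightarrow> integrable P (\<lambda>\<xi>. v (shift (times t j) \<xi>) * ?D t \<xi>)"
    if t: "\<forall>a\<le>r. times t a \<in> space M" for t
  proof -
    have h: "Lspace r ((\<lambda>\<xi>. (f(j := v)) i (shift (times t i) \<xi>)))" if "Lspace r v" "i \<le> r" for v i
      using f t that by (intro Lspace_shift) auto
    have P: "(\<Prod>i\<in>{..r} - {j}. (f(j := v)) i (shift (times t i) \<xi>)) = ?D t \<xi>" for v \<xi>
      by (intro prod.cong) auto
    show "integrable P (\<lambda>\<xi>. v (shift (times t j) \<xi>) * ?D t \<xi>)" if "Lspace r v" for v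
      using Lspace_prod_integrable(1)[of r "\<lambda>i \<xi>. (f(j := v)) i (shift (times t i) \<xi>)" j 1, OF h[OF that] j] unfolding P by simp
    have "cmod (\<integral>\<xi>. u (shift (times t j) \<xi>) * ?D t \<xi> \<partial>P) \<le> (\<integral>\<xi>. cmod (u (shift (times t j) \<xi>) * ?D t \<xi>) \<partial>P)"
      by (rule integral_norm_bound)
    also have "\<dots> \<le> (\<integral>\<xi>. cmod ((f(j := u)) j (shift (times t j) \<xi>)) ^ (r + 1) \<partial>P) / \<eta> ^ (r * (r + 1)) +
      \<eta> ^ (r + 1) * (\<Sum>i\<in>{..r} - {j}. \<integral>\<xi>. cmod ((f(j := u)) i (shift (times t i) \<xi>)) ^ (r + 1) \<partial>P)"
      using Lspace_prod_integrable(2)[of r "\<lambda>i \<xi>. (f(j := u)) i (shift (times t i) \<xi>)" j \<eta>, OF h[OF u] j \<eta>(1)]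
      unfolding P by simp
    also have "(\<Sum>i\<in>{..r} - {j}. \<integral>\<xi>. cmod ((f(j := u)) i (shift (times t i) \<xi>)) ^ (r + 1) \<partial>P) = A"
      unfolding A_def
    proof (intro sum.cong refl)
      fix i assume i: "i \<in> {..r} - {j}"
      then have "(f(j := u)) i = f i" by simp
      then show "(\<integral>\<xi>. cmod ((f(j := u)) i (shift (times t i) \<xi>)) ^ (r + 1) \<partial>P) = (\<integral>\<xi>. cmod (f i \<xi>) ^ (r + 1) \<partial>P)"
        using i f t by (simp only:) (intro Lspace_integral_shift, auto)
    qed
    also have "(\<integral>\<xi>. cmod ((f(j := u)) j (shift (times t j) \<xi>)) ^ (r + 1) \<partial>P) = (\<integral>\<xi>. cmod (u \<xi>) ^ (r + 1) \<partial>P)"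
      unfolding fun_upd_same using t j by (intro Lspace_integral_shift u) auto
    also have "(\<integral>\<xi>. cmod (u \<xi>) ^ (r + 1) \<partial>P) / \<eta> ^ (r * (r + 1)) + \<eta> ^ (r + 1) * A \<le> \<epsilon> / (4 * m)"
      using A0 by (intro small) (auto simp: A'_def)
    finally show "cmod (\<integral>\<xi>. u (shift (times t j) \<xi>) * ?D t \<xi> \<partial>P) \<le> \<epsilon> / (4 * m)" .
  qed
  have third: "cmod (\<integral>\<xi>. u \<xi> \<partial>P) \<le> \<epsilon> / (4 * m)"
  proof -
    define h where "h i = (if i = j then u else (\<lambda>_. 1))" for i
    have h: "Lspace r (h i)" for i using u by (auto simp: h_def Lspace_def)
    have P: "(\<Prod>i\<in>{..r} - {j}. h i \<xi>) = 1" for \<xi> by (intro prod.neutral) (auto simp: h_def)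
    have S: "(\<Sum>i\<in>{..r} - {j}. \<integral>\<xi>. cmod (h i \<xi>) ^ (r + 1) \<partial>P) = real r"
      using j by (simp add: h_def P.prob_space)
    have "cmod (\<integral>\<xi>. u \<xi> \<partial>P) \<le> (\<integral>\<xi>. cmod (u \<xi>) \<partial>P)" by (rule integral_norm_bound)
    also have "\<dots> \<le> (\<integral>\<xi>. cmod (u \<xi>) ^ (r + 1) \<partial>P) / \<eta> ^ (r * (r + 1)) + \<eta> ^ (r + 1) * real r"
      using Lspace_prod_integrable(2)[of r h j \<eta>, OF h j \<eta>(1)] unfolding P S by (simp add: h_def)
    also have "\<dots> \<le> \<epsilon> / (4 * m)" using A0 by (intro small) (auto simp: A'_def)
    finally show ?thesis .
  qed
  have "\<forall>\<^sub>F t in far r. dist (\<integral>\<xi>. g' (shift (times t j) \<xi>) * ?D t \<xi> \<partial>P) ((\<integral>\<xi>. g' \<xi> \<partial>P) * ?c) < \<epsilon> / 4"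
    using poly[OF g'(1), unfolded mixes_slot[OF j] tendsto_iff, rule_format, of "\<epsilon> / 4"] \<epsilon> by (simp only: zero_less_divide_iff) simp
  moreover have "\<forall>\<^sub>F t in far r. \<forall>a\<le>r. times t a \<in> space M"
    by (rule eventually_far[where R=0]) blast
  ultimately show "\<forall>\<^sub>F t in far r. dist (\<integral>\<xi>. g (shift (times t j) \<xi>) * ?D t \<xi> \<partial>P) ((\<integral>\<xi>. g \<xi> \<partial>P) * ?c) < \<epsilon>"
  proof eventually_elim
    case (elim t)
    have "(\<integral>\<xi>. g (shift (times t j) \<xi>) * ?D t \<xi> \<partial>P) =
      (\<integral>\<xi>. u (shift (times t j) \<xi>) * ?D t \<xi> + g' (shift (times t j) \<xi>) * ?D t \<xi> \<partial>P)"
      by (simp add: u_def algebra_simps)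
    also have "\<dots> = (\<integral>\<xi>. u (shift (times t j) \<xi>) * ?D t \<xi> \<partial>P) + (\<integral>\<xi>. g' (shift (times t j) \<xi>) * ?D t \<xi> \<partial>P)"
      by (intro Bochner_Integration.integral_add int[OF elim(2)] u falling_poly_Lspace g')
    finally have 1: "(\<integral>\<xi>. g (shift (times t j) \<xi>) * ?D t \<xi> \<partial>P) =
      (\<integral>\<xi>. u (shift (times t j) \<xi>) * ?D t \<xi> \<partial>P) + (\<integral>\<xi>. g' (shift (times t j) \<xi>) * ?D t \<xi> \<partial>P)" .
    have 2: "(\<integral>\<xi>. g \<xi> \<partial>P) = (\<integral>\<xi>. u \<xi> \<partial>P) + (\<integral>\<xi>. g' \<xi> \<partial>P)"
      unfolding u_def using Lspace_integrable[OF g] Lspace_integrable[OF falling_poly_Lspace[OF g'(1)]] by simp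
    have 3: "cmod ((\<integral>\<xi>. u \<xi> \<partial>P) * ?c) \<le> \<epsilon> / 4"
      using mult_right_mono[OF third norm_ge_zero[of ?c]] em(2) unfolding norm_mult by linarith
    have 4: "cmod (\<integral>\<xi>. u (shift (times t j) \<xi>) * ?D t \<xi> \<partial>P) \<le> \<epsilon> / 4"
      using first[OF elim(2)] em(1) by linarith
    have tri: "cmod ((a + b) - (x + y) * c) < \<epsilon>" if "cmod a \<le> \<epsilon> / 4" "cmod (x * c) \<le> \<epsilon> / 4" "dist b (y * c) < \<epsilon> / 4" for a b x y c
    proof -
      have eq: "(a + b) - (x + y) * c = a + (b - y * c) - x * c" by (simp add: algebra_simps)
      have "cmod ((a + b) - (x + y) * c) \<le> cmod a + cmod (b - y * c) + cmod (x * c)"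
        unfolding eq using norm_triangle_ineq4[of "a + (b - y * c)" "x * c"] norm_triangle_ineq[of a "b - y * c"] by linarith
      with that \<epsilon> show ?thesis by (simp add: dist_norm)
    qed
    show ?case unfolding 1 2 dist_norm by (rule tri[OF 4 3 elim(1)])
  qed
qed

text \<open>Slots are released one by one: at stage \<open>n\<close> those with index at least
  \<open>n\<close> still hold monomials. Stage \<open>0\<close> is mixing for monomials, and stage
  \<open>Suc r\<close> constrains no slot.\<close>

lemma mixes_Lspace:
  assumes f: "\<And>i. i \<le> r \<Longrightarrow> Lspace r (f i)"
  shows "mixes r f"
proof -
  have "mixes r f" if "\<And>i. i \<le> r \<Longrightarrow> Lspace r (f i)"
    "\<And>i. i \<le> r \<Longrightarrow> n \<le> i \<Longrightarrow> \<exists>S L F. falling_monomial S L F \<and> f i = (\<lambda>\<xi>. of_nat (F \<xi>))" for n f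
    using that
  proof (induction n arbitrary: f)
    case 0
    then have "\<forall>i. \<exists>S L F. i \<le> r \<longrightarrow> falling_monomial S L F \<and> f i = (\<lambda>\<xi>. of_nat (F \<xi>))" by blast
    then obtain S L F where F: "\<And>i. i \<le> r \<Longrightarrow> falling_monomial (S i) (L i) (F i)"
      "\<And>i. i \<le> r \<Longrightarrow> f i = (\<lambda>\<xi>. of_nat (F i \<xi>))" by metis
    have "mixes r (\<lambda>a \<xi>. of_nat (F a \<xi>)) \<longleftrightarrow> mixes r f"
      unfolding mixes_def using F(2) by (simp cong: prod.cong_simp)
    with mixes_monomials[of r S L F, OF F(1)] show ?case by blast
  next
    case (Suc n)
    show ?case
    proof (cases "n \<le> r")
      case True
      have "mixes r (f(n := f n))"
      proof (rule mixes_slot_limit[OF True])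
        fix g assume g: "falling_poly g"
        show "mixes r (f(n := g))"
        proof (rule mixes_slot_poly[OF True _ _ g])
          fix S L F assume F: "falling_monomial S L F"
          have "Lspace r (\<lambda>\<xi>. of_nat (F \<xi>))" by (rule falling_poly_Lspace[OF falling_poly.monomial[OF F]])
          then show "mixes r (f(n := \<lambda>\<xi>. of_nat (F \<xi>)))"
            using Suc.prems F by (intro Suc.IH) auto
        qed (use Suc.prems in auto)
      qed (use Suc.prems True in auto)
      then show ?thesis by simp
    next
      case False
      then show ?thesis using Suc.prems by (intro Suc.IH) auto
    qed
  qed
  from this[of f "Suc r"] f show ?thesis by auto
qed

theorem mixing: "mixing_of_multiplicity M P r"
  unfolding mixing_of_multiplicity_def
proof (intro allI impI)
  fix f :: "nat \<Rightarrow> 'd config \<Rightarrow> complex"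
  assume "\<forall>i\<le>r. f i \<in> borel_measurable P \<and> integrable P (\<lambda>\<xi>. cmod (f i \<xi>) ^ (r + 1))"
  then have "mixes r f" by (intro mixes_Lspace) (simp add: Lspace_def)
  then show "((\<lambda>t. \<integral>\<xi>. (\<Prod>i\<le>r. f i (shift (\<Sum>l=1..i. t l) \<xi>)) \<partial>P) \<longlongrightarrow> (\<Prod>i\<le>r. \<integral>\<xi>. f i \<xi> \<partial>P)) (far r)"
    by (simp only: mixes_def times_def)
qed

theorem ergodic: "ergodic_field M P"
  unfolding ergodic_field_def
proof (intro ballI impI)
  fix A assume A: "A \<in> sets P" and inv: "\<forall>t\<in>space M. shift t ` A = A"
  let ?f = "\<lambda>i::nat. \<lambda>\<xi>. indicator A \<xi> :: complex"
  have c: "(\<integral>\<xi>. indicator A \<xi> \<partial>P) = complex_of_real (measure P A)"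
  proof -
    have "(\<integral>\<xi>. indicator A \<xi> \<partial>P) = (\<integral>\<xi>. complex_of_real (indicator A \<xi>) \<partial>P)" by (simp add: of_real_indicator)
    also have "\<dots> = complex_of_real (\<integral>\<xi>. indicator A \<xi> \<partial>P)" by (rule Bochner_Integration.integral_complex_of_real)
    finally show ?thesis using A by simp
  qed
  have "mixes 1 ?f"
    using A by (intro mixes_Lspace) (auto simp: Lspace_def indicator_def intro!: P.integrable_const_bound[of _ 1])
  then have lim: "((\<lambda>t. \<integral>\<xi>. (\<Prod>i\<le>1. indicator A (shift (times t i) \<xi>)) \<partial>P) \<longlongrightarrow> complex_of_real (measure P A) * complex_of_real (measure P A)) (far 1)"
    unfolding mixes_def c[symmetric] by (simp only: One_nat_def prod.atMost_Suc atMost_0 prod.insert finite.emptyI empty_iff prod.empty mult_1_right simp_thms)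
  have mem: "shift t \<xi> \<in> A \<longleftrightarrow> \<xi> \<in> A" if t: "t \<in> space M" for t \<xi>
  proof
    assume "shift t \<xi> \<in> A"
    then have "shift (- t) (shift t \<xi>) \<in> shift (- t) ` A" by (rule imageI)
    then show "\<xi> \<in> A" using inv space_closed(3)[OF t] by (simp add: shift_shift)
  next
    assume "\<xi> \<in> A"
    then have "shift t \<xi> \<in> shift t ` A" by (rule imageI)
    then show "shift t \<xi> \<in> A" using inv t by simp
  qed
  have "\<forall>\<^sub>F t in far 1. (\<integral>\<xi>. (\<Prod>i\<le>1. indicator A (shift (times t i) \<xi>)) \<partial>P) = complex_of_real (measure P A)"
  proof (rule eventually_far[where R=0])
    fix t assume "\<forall>a\<le>1. times t a \<in> space M"
    then have "(\<Prod>i\<le>1. indicator A (shift (times t i) \<xi>)) = (indicator A \<xi> :: complex)" for \<xi>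
      by (simp add: indicator_def mem)
    then show "(\<integral>\<xi>. (\<Prod>i\<le>1. indicator A (shift (times t i) \<xi>)) \<partial>P) = complex_of_real (measure P A)"
      unfolding c[symmetric] by (simp only:)
  qed
  then have "((\<lambda>t. complex_of_real (measure P A)) \<longlongrightarrow> complex_of_real (measure P A) * complex_of_real (measure P A)) (far 1)"
    using lim by (simp add: tendsto_cong)
  \<comment> \<open>Limits are unique only along a proper filter; diagonal lattice vectors of
    growing length show that it is one.\<close>
  moreover have "far 1 \<noteq> bot"
  proof -
    have "filterlim (\<lambda>n::nat. \<lambda>_::nat. (\<chi> i. real n) :: real ^ 'd) (far 1) sequentially"
    proof (intro filterlim_increments_to_infinity)
      have "((\<chi> i. real n) :: real ^ 'd) \<in> space M" for n
        by (rule subsetD[OF int_lattice_subset]) (simp add: int_lattice_def)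
      then show "\<forall>\<^sub>F n in sequentially. ((\<chi> i. real n) :: real ^ 'd) \<in> space M" by simp
    qed (simp add: filterlim_real_sequentially)
    then show ?thesis by (metis filterlim_def filtermap_bot_iff le_bot trivial_limit_sequentially)
  qed
  ultimately have "complex_of_real (measure P A) = complex_of_real (measure P A) * complex_of_real (measure P A)"
    by (intro tendsto_unique[OF _ tendsto_const]) auto
  then have "measure P A = measure P A * measure P A" by (metis of_real_eq_iff of_real_mult)
  then show "measure P A \<in> {0, 1}" by auto
qed

end

subsection \<open>Positive definite functions\<close>

context prob_space
begin

lemma distr_two_components:
  assumes "finite I" "i \<in> I" "j \<in> I" "i \<noteq> j"
  shows "distr (powM I) (M \<Otimes>\<^sub>M M) (\<lambda>x. (x i, x j)) = M \<Otimes>\<^sub>M M"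
proof (rule measure_eqI)
  fix A assume "A \<in> sets (distr (powM I) (M \<Otimes>\<^sub>M M) (\<lambda>x. (x i, x j)))"
  then have A: "A \<in> sets (M \<Otimes>\<^sub>M M)" by simp
  have m: "(\<lambda>x. (x i, x j)) \<in> measurable (powM I) (M \<Otimes>\<^sub>M M)"
    using assms by (intro measurable_Pair measurable_component_singleton) auto
  have "emeasure (distr (powM I) (M \<Otimes>\<^sub>M M) (\<lambda>x. (x i, x j))) A =
    (\<integral>\<^sup>+x. indicator A (x i, x j) \<partial>powM I)"
    using A nn_integral_distr[OF m, of "indicator A"] by simp
  also have "\<dots> = (\<integral>\<^sup>+z. indicator A (fst z, snd z) \<partial>(M \<Otimes>\<^sub>M M))"
    using nn_integral_PiM_pair_prod[OF assms, of "\<lambda>x y. indicator A (x, y)" "\<lambda>_ _. 1"] A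
    by (simp add: emeasure_space_1)
  also have "\<dots> = emeasure (M \<Otimes>\<^sub>M M) A" using A by simp
  finally show "emeasure (distr (powM I) (M \<Otimes>\<^sub>M M) (\<lambda>x. (x i, x j))) A = emeasure (M \<Otimes>\<^sub>M M) A" .
qed simp

text \<open>
  Averaging the quadratic form over \<open>N\<close> independent sample points gives \<open>N d + N (N - 1) J\<close> with
  \<open>J\<close> the double integral and \<open>d\<close> the value on the diagonal; letting \<open>N\<close> grow shows that \<open>J\<close>
  is non-negative.
\<close>

lemma positive_definite_double_integral:
  fixes f :: "'a \<times> 'a \<Rightarrow> complex"
  assumes f [measurable]: "f \<in> borel_measurable (M \<Otimes>\<^sub>M M)" and bound: "\<And>z. cmod (f z) \<le> c"
    and diag: "\<And>x. x \<in> space M \<Longrightarrow> f (x, x) = d"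
    and pd: "\<And>(N::nat) x. (\<And>i. i < N \<Longrightarrow> x i \<in> space M) \<Longrightarrow> (\<Sum>i<N. \<Sum>j<N. f (x i, x j)) \<in> \<real>\<^sub>\<ge>\<^sub>0"
  shows "(\<integral>z. f z \<partial>(M \<Otimes>\<^sub>M M)) \<in> \<real>\<^sub>\<ge>\<^sub>0"
proof -
  define J where "J = (\<integral>z. f z \<partial>(M \<Otimes>\<^sub>M M))"
  have main: "of_nat N * d + of_nat (N * (N - 1)) * J \<in> \<real>\<^sub>\<ge>\<^sub>0" for N :: nat
  proof -
    interpret PN: prob_space "powM {..<N}"
      by (rule prob_space_PiM) (rule prob_space_axioms)
    have pm: "(\<lambda>x. (x i, x j)) \<in> measurable (powM {..<N}) (M \<Otimes>\<^sub>M M)" if "i < N" "j < N" for i j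
      using that by (intro measurable_Pair measurable_component_singleton) auto
    have fm: "(\<lambda>x. f (x i, x j)) \<in> borel_measurable (powM {..<N})" if "i < N" "j < N" for i j
      using measurable_compose[OF pm[OF that] f] .
    have fi: "integrable (powM {..<N}) (\<lambda>x. f (x i, x j))" if "i < N" "j < N" for i j
      using fm[OF that] bound by (intro PN.integrable_const_bound[of _ c]) auto
    let ?I = "\<lambda>i j. \<integral>x. f (x i, x j) \<partial>powM {..<N}"
    have ii: "?I i i = d" if "i < N" for i
    proof -
      have "?I i i = (\<integral>x. d \<partial>powM {..<N})"
        using that by (intro Bochner_Integration.integral_cong) (auto simp: diag space_PiM PiE_iff)
      then show ?thesis by (simp add: PN.prob_space)
    qed
    have ij: "?I i j = J" if "i < N" "j < N" "i \<noteq> j" for i j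
      using integral_distr[OF pm[OF that(1,2)] f] that unfolding J_def
      by (subst (asm) distr_two_components) auto
    have "(\<integral>x. (\<Sum>i<N. \<Sum>j<N. f (x i, x j)) \<partial>powM {..<N}) = (\<Sum>i<N. \<Sum>j<N. ?I i j)"
    proof -
      have "(\<integral>x. (\<Sum>i<N. \<Sum>j<N. f (x i, x j)) \<partial>powM {..<N}) = (\<Sum>i<N. \<integral>x. (\<Sum>j<N. f (x i, x j)) \<partial>powM {..<N})"
        using fi by (intro Bochner_Integration.integral_sum Bochner_Integration.integrable_sum) auto
      also have "\<dots> = (\<Sum>i<N. \<Sum>j<N. ?I i j)"
        using fi by (intro sum.cong refl Bochner_Integration.integral_sum) auto
      finally show ?thesis .
    qed
    also have "\<dots> = (\<Sum>i<N. \<Sum>j<N. if j = i then d else J)"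
      using ii ij by (intro sum.cong refl) auto
    also have "\<dots> = (\<Sum>i<N. d + of_nat (N - 1) * J)"
    proof (intro sum.cong refl)
      fix i assume i: "i \<in> {..<N}"
      have "(\<Sum>j<N. if j = i then d else J) = d + (\<Sum>j\<in>{..<N} - {i}. if j = i then d else J)"
        using i by (subst sum.remove[of _ i]) auto
      also have "(\<Sum>j\<in>{..<N} - {i}. if j = i then d else J) = (\<Sum>j\<in>{..<N} - {i}. J)"
        by (intro sum.cong) auto
      finally show "(\<Sum>j<N. if j = i then d else J) = d + of_nat (N - 1) * J" using i by simp
    qed
    also have "\<dots> = of_nat N * d + of_nat (N * (N - 1)) * J"
      by (simp only: sum_constant card_lessThan distrib_left of_nat_mult mult.assoc)
    finally have eq: "(\<integral>x. (\<Sum>i<N. \<Sum>j<N. f (x i, x j)) \<partial>powM {..<N}) = of_nat N * d + of_nat (N * (N - 1)) * J" .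
    have int: "integrable (powM {..<N}) (\<lambda>x. \<Sum>i<N. \<Sum>j<N. f (x i, x j))"
      using fi by (intro Bochner_Integration.integrable_sum) auto
    have nn: "Re (\<Sum>i<N. \<Sum>j<N. f (x i, x j)) \<ge> 0" "Im (\<Sum>i<N. \<Sum>j<N. f (x i, x j)) = 0"
      if "x \<in> space (powM {..<N})" for x
      using pd[of N x] that unfolding complex_nonneg_Reals_iff by (auto simp: space_PiM PiE_iff)
    have "Re (\<integral>x. (\<Sum>i<N. \<Sum>j<N. f (x i, x j)) \<partial>powM {..<N}) \<ge> 0"
      unfolding integral_Re[OF int, symmetric] using nn(1) by (intro integral_nonneg_AE AE_I2)
    moreover have "Im (\<integral>x. (\<Sum>i<N. \<Sum>j<N. f (x i, x j)) \<partial>powM {..<N}) = 0"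
      unfolding integral_Im[OF int, symmetric] using nn(2)
      by (subst Bochner_Integration.integral_cong[OF refl, of _ _ "\<lambda>_. 0"]) auto
    ultimately show ?thesis unfolding eq[symmetric] complex_nonneg_Reals_iff by blast
  qed
  \<comment> \<open>One sample point shows that \<open>d\<close> is real, two points then show the
    same for \<open>J\<close>.\<close>
  have im: "Im J = 0" using main[of 1] main[of 2] by (simp add: complex_nonneg_Reals_iff)
  have "Re J \<ge> 0"
  proof (rule ccontr)
    assume neg: "\<not> Re J \<ge> 0"
    obtain n :: nat where n: "Re d / (- Re J) < real n" using reals_Archimedean2 by blast
    have "0 \<le> Re (of_nat (Suc n) * d + of_nat (Suc n * (Suc n - 1)) * J)"
      using main[of "Suc n"] unfolding complex_nonneg_Reals_iff by blast
    also have "\<dots> = real (Suc n) * (Re d + real n * Re J)"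
      by (simp add: algebra_simps)
    finally have "0 \<le> Re d + real n * Re J" by (simp add: zero_le_mult_iff)
    moreover have "0 < - Re J" using neg by simp
    then have "Re d < real n * (- Re J)" using n by (simp only: pos_divide_less_eq)
    ultimately show False by simp
  qed
  with im show ?thesis by (simp add: J_def complex_nonneg_Reals_iff)
qed

end

context one_particle_space
begin

text \<open>For two independent uniform points of a large box the mean of \<open>D (s - t)\<close>
  is non-negative. Up to a positive factor it is the integral of \<open>D\<close> against the
  overlap ratio of the box with its translates, and this ratio tends to \<open>1\<close> while
  staying below it.\<close>

lemma positive_definite_integral:
  fixes D :: "real ^ 'd \<Rightarrow> complex"
  assumes D: "integrable M D" and bound: "\<And>t. cmod (D t) \<le> c"
    and pd: "\<And>(N::nat) t. (\<And>i. i < N \<Longrightarrow> t i \<in> space M) \<Longrightarrow> (\<Sum>i<N. \<Sum>j<N. D (t j - t i)) \<in> \<real>\<^sub>\<ge>\<^sub>0"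
  shows "(\<integral>t. D t \<partial>M) \<in> \<real>\<^sub>\<ge>\<^sub>0"
proof -
  interpret MM: pair_sigma_finite M M ..
  have Dm [measurable]: "D \<in> borel_measurable M" using D by auto
  \<comment> \<open>The fraction of the box that stays in the box when moved by \<open>u\<close>; it
    is the autocorrelation of the uniform density up to the volume.\<close>
  define \<psi> where "\<psi> n u = measure M {x \<in> fbox n. x + u \<in> fbox n} / measure M (fbox n)" for n u
  have fb [measurable]: "fbox n \<in> sets M" for n using fbox_bounded_sets by (rule bounded_sets_sets)
  have addm: "(\<lambda>z. indicator (fbox n) (fst z + snd z) :: real) \<in> borel_measurable (M \<Otimes>\<^sub>M M)" for n
    using measurable_compose[OF measurable_add_pair borel_measurable_indicator[OF fb[of n]]] .
  have pos: "measure M (fbox n) > 0" if "n > 0" for n using that by (simp add: measure_fbox)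
  have fin: "emeasure M (fbox n) < \<infinity>" for n by (rule emeasure_bounded_sets[OF fbox_bounded_sets])
  have \<psi>m: "\<psi> n \<in> borel_measurable M" and \<psi>int: "u \<in> space M \<Longrightarrow> (\<integral>t. indicat_real (fbox n) t * indicat_real (fbox n) (t + u) \<partial>M) = \<psi> n u * measure M (fbox n)"
    if n: "n > 0" for n u
  proof -
    have e: "(\<integral>t. indicat_real (fbox n) t * indicat_real (fbox n) (t + u) \<partial>M) = measure M {x \<in> fbox n. x + u \<in> fbox n}" if u: "u \<in> space M" for u
    proof -
      have s: "{x \<in> fbox n. x + u \<in> fbox n} \<in> sets M"
      proof -
        have "{x \<in> fbox n. x + u \<in> fbox n} = fbox n \<inter> ((\<lambda>x. x + u) -` fbox n \<inter> space M)" by (auto simp: fbox_def)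
        then show ?thesis using measurable_sets[OF measurable_shift[OF u] fb] by simp
      qed
      have "(\<integral>t. indicat_real (fbox n) t * indicat_real (fbox n) (t + u) \<partial>M) = (\<integral>t. indicat_real {x \<in> fbox n. x + u \<in> fbox n} t \<partial>M)"
        by (intro Bochner_Integration.integral_cong) (auto simp: indicator_def)
      also have "\<dots> = measure M {x \<in> fbox n. x + u \<in> fbox n}"
        using s sets.sets_into_space[OF s] by (simp add: Int_absorb2)
      finally show ?thesis .
    qed
    then show "u \<in> space M \<Longrightarrow> (\<integral>t. indicat_real (fbox n) t * indicat_real (fbox n) (t + u) \<partial>M) = \<psi> n u * measure M (fbox n)"
      using pos[OF n] by (simp add: \<psi>_def)
    have "(\<lambda>u. (\<integral>t. indicat_real (fbox n) t * indicat_real (fbox n) (t + u) \<partial>M) / measure M (fbox n)) \<in> borel_measurable M"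
    proof (intro borel_measurable_divide borel_measurable_lebesgue_integral)
      have "(\<lambda>z. indicator (fbox n) (snd z) * indicator (fbox n) (snd z + fst z) :: real) \<in> borel_measurable (M \<Otimes>\<^sub>M M)"
        using addm[of n] by (simp add: add.commute)
      then show "(\<lambda>(x, y). indicator (fbox n) y * indicator (fbox n) (y + x) :: real) \<in> borel_measurable (M \<Otimes>\<^sub>M M)"
        by (simp add: case_prod_beta)
    qed simp
    then show "\<psi> n \<in> borel_measurable M"
      by (rule measurable_cong[THEN iffD1, rotated]) (use e in \<open>auto simp: \<psi>_def\<close>)
  qed
  have \<psi>01: "0 \<le> \<psi> n u" "\<psi> n u \<le> 1" if n: "n > 0" for n u
  proof -
    show "0 \<le> \<psi> n u" by (simp add: \<psi>_def)
    have "measure M {x \<in> fbox n. x + u \<in> fbox n} \<le> measure M (fbox n)"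
    proof (cases "{x \<in> fbox n. x + u \<in> fbox n} \<in> sets M")
      case True
      then show ?thesis using fb[of n] fin[of n] by (intro measure_mono_fmeasurable) (auto simp: fmeasurable_def)
    qed (simp add: measure_notin_sets)
    then show "\<psi> n u \<le> 1" using pos[OF n] by (simp add: \<psi>_def divide_le_eq_1)
  qed
  have avg: "(\<integral>u. \<psi> n u *\<^sub>R D u \<partial>M) \<in> \<real>\<^sub>\<ge>\<^sub>0" if n: "n > 0" for n
  proof -
    define v where "v = measure M (fbox n)"
    have v: "v > 0" using pos[OF n] by (simp add: v_def)
    \<comment> \<open>The density of the uniform distribution on the box; \<open>w\<close> is the
      probability space to which the averaging lemma is applied.\<close>
    define g where "g t = indicator (fbox n) t / v" for t
    have g [measurable]: "g \<in> borel_measurable M" unfolding g_def by measurable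
    have g0: "g t \<ge> 0" for t using v by (simp add: g_def)
    define w where "w = density M (\<lambda>t. ennreal (g t))"
    have "emeasure w (space w) = (\<integral>\<^sup>+t. ennreal (1 / v) * indicator (fbox n) t \<partial>M)"
      unfolding w_def by (subst emeasure_density) (auto simp: g_def indicator_def intro!: nn_integral_cong)
    also have "\<dots> = ennreal (1 / v) * ennreal v"
      using fin[of n] by (simp add: nn_integral_cmult_indicator v_def emeasure_eq_ennreal_measure less_top)
    also have "\<dots> = 1" using v by (simp add: ennreal_mult[symmetric])
    finally interpret w: prob_space w by (rule prob_spaceI)
    interpret ww: pair_prob_space w w ..
    have sets_w: "sets w = sets M" "space w = space M" by (simp_all add: w_def)
    have setsww: "sets (w \<Otimes>\<^sub>M w) = sets (M \<Otimes>\<^sub>M M)" using sets_w(1) by (intro sets_pair_measure_cong)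
    have fM: "(\<lambda>z. D (snd z - fst z)) \<in> borel_measurable (M \<Otimes>\<^sub>M M)"
    proof -
      have "(\<lambda>z. (snd z, fst z)) \<in> measurable (M \<Otimes>\<^sub>M M) (M \<Otimes>\<^sub>M M)" by measurable
      from measurable_compose[OF measurable_compose[OF this measurable_diff_pair] Dm] show ?thesis by simp
    qed
    have fw: "(\<lambda>z. D (snd z - fst z)) \<in> borel_measurable (w \<Otimes>\<^sub>M w)"
      using fM measurable_cong_sets[OF setsww refl] by blast
    have J: "(\<integral>z. D (snd z - fst z) \<partial>(w \<Otimes>\<^sub>M w)) \<in> \<real>\<^sub>\<ge>\<^sub>0"
    proof (rule w.positive_definite_double_integral[OF fw bound])
      show "(\<Sum>i<N. \<Sum>j<N. D (snd (x i, x j) - fst (x i, x j))) \<in> \<real>\<^sub>\<ge>\<^sub>0" if "\<And>i. i < N \<Longrightarrow> x i \<in> space w" for N :: nat and x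
        using pd[of N x] that by (simp add: sets_w)
      show "D (snd (x, x) - fst (x, x)) = D 0" for x by simp
    qed
    have iw: "integrable (w \<Otimes>\<^sub>M w) (\<lambda>z. D (snd z - fst z))"
      using fw bound by (intro ww.P.integrable_const_bound[of _ c]) auto
    have gD: "integrable (M \<Otimes>\<^sub>M M) (\<lambda>z. (g (fst z) * g (fst z + snd z)) *\<^sub>R D (snd z))"
    proof -
      have m: "(\<lambda>z. (g (fst z) * g (fst z + snd z)) *\<^sub>R D (snd z)) \<in> borel_measurable (M \<Otimes>\<^sub>M M)"
        using addm[of n] unfolding g_def by measurable
      have "(\<integral>\<^sup>+z. ennreal (norm ((g (fst z) * g (fst z + snd z)) *\<^sub>R D (snd z))) \<partial>(M \<Otimes>\<^sub>M M)) \<le>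
        (\<integral>\<^sup>+z. (ennreal (1 / v) * ennreal (g (fst z))) * ennreal (cmod (D (snd z))) \<partial>(M \<Otimes>\<^sub>M M))"
      proof (intro nn_integral_mono)
        fix z :: "(real ^ 'd) \<times> (real ^ 'd)"
        have "g (fst z + snd z) \<le> 1 / v" using v by (simp add: g_def indicator_def)
        then have "norm ((g (fst z) * g (fst z + snd z)) *\<^sub>R D (snd z)) \<le> (1 / v * g (fst z)) * cmod (D (snd z))"
        proof -
          have "norm ((g (fst z) * g (fst z + snd z)) *\<^sub>R D (snd z)) = (g (fst z + snd z) * g (fst z)) * cmod (D (snd z))"
            using g0 by (simp add: abs_mult mult.commute)
          also have "\<dots> \<le> (1 / v * g (fst z)) * cmod (D (snd z))"
            using \<open>g (fst z + snd z) \<le> 1 / v\<close> g0 by (intro mult_right_mono) auto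
          finally show ?thesis .
        qed
        then have "ennreal (norm ((g (fst z) * g (fst z + snd z)) *\<^sub>R D (snd z))) \<le> ennreal ((1 / v * g (fst z)) * cmod (D (snd z)))"
          by (rule ennreal_leI)
        also have "\<dots> = (ennreal (1 / v) * ennreal (g (fst z))) * ennreal (cmod (D (snd z)))"
          using v g0[of "fst z"] by (subst ennreal_mult) (auto simp: ennreal_mult simp del: times_divide_eq_left)
        finally show "ennreal (norm ((g (fst z) * g (fst z + snd z)) *\<^sub>R D (snd z))) \<le> (ennreal (1 / v) * ennreal (g (fst z))) * ennreal (cmod (D (snd z)))" .
      qed
      also have "\<dots> = (\<integral>\<^sup>+t. \<integral>\<^sup>+u. (ennreal (1 / v) * ennreal (g t)) * ennreal (cmod (D u)) \<partial>M \<partial>M)"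
        by (subst nn_integral_fst[symmetric]) auto
      also have "\<dots> = (\<integral>\<^sup>+t. (ennreal (1 / v) * ennreal (g t)) * (\<integral>\<^sup>+u. ennreal (cmod (D u)) \<partial>M) \<partial>M)"
        by (intro nn_integral_cong nn_integral_cmult) measurable
      also have "\<dots> = ennreal (1 / v) * (\<integral>\<^sup>+t. ennreal (g t) \<partial>M) * (\<integral>\<^sup>+u. ennreal (cmod (D u)) \<partial>M)"
        by (simp add: nn_integral_multc nn_integral_cmult)
      also have "\<dots> < \<infinity>"
      proof -
        have "(\<integral>\<^sup>+t. ennreal (g t) \<partial>M) = emeasure w (space w)"
          unfolding w_def by (subst emeasure_density) (auto intro!: nn_integral_cong)
        then show ?thesis using D w.emeasure_space_1 by (simp add: integrable_iff_bounded ennreal_mult_less_top)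
      qed
      finally show ?thesis using m by (intro integrableI_bounded)
    qed
    have "(\<integral>z. D (snd z - fst z) \<partial>(w \<Otimes>\<^sub>M w)) = (\<integral>t. \<integral>s. D (s - t) \<partial>w \<partial>w)"
      using ww.integral_fst'[OF iw] by simp
    also have "\<dots> = (\<integral>t. g t *\<^sub>R (\<integral>s. g s *\<^sub>R D (s - t) \<partial>M) \<partial>M)"
    proof -
      have in1: "(\<integral>s. D (s - t) \<partial>w) = (\<integral>s. g s *\<^sub>R D (s - t) \<partial>M)" if t: "t \<in> space M" for t
      proof -
        have "(\<lambda>s. D (s + - t)) \<in> borel_measurable M"
          using measurable_compose[OF measurable_shift[OF space_closed(3)[OF t]] Dm] .
        then show ?thesis unfolding w_def using g0 by (subst integral_density) auto
      qed
      have "(\<integral>t. \<integral>s. D (s - t) \<partial>w \<partial>w) = (\<integral>t. \<integral>s. g s *\<^sub>R D (s - t) \<partial>M \<partial>w)"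
        by (rule Bochner_Integration.integral_cong[OF refl]) (simp add: in1 sets_w)
      also have "\<dots> = (\<integral>t. g t *\<^sub>R (\<integral>s. g s *\<^sub>R D (s - t) \<partial>M) \<partial>M)"
        unfolding w_def
      proof (rule integral_density)
        have "(\<lambda>z. g (snd z) *\<^sub>R D (snd z - fst z)) \<in> borel_measurable (M \<Otimes>\<^sub>M M)" using fM by measurable
        then show "(\<lambda>t. \<integral>s. g s *\<^sub>R D (s - t) \<partial>M) \<in> borel_measurable M"
          by (intro borel_measurable_lebesgue_integral) (simp add: case_prod_beta)
      qed (use g0 in auto)
      finally show ?thesis .
    qed
    also have "\<dots> = (\<integral>t. \<integral>u. (g t * g (t + u)) *\<^sub>R D u \<partial>M \<partial>M)"
    proof (rule Bochner_Integration.integral_cong[OF refl])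
      fix t assume t: "t \<in> space M"
      have "(\<integral>s. g s *\<^sub>R D (s - t) \<partial>M) = (\<integral>s. g s *\<^sub>R D (s - t) \<partial>distr M M (\<lambda>x. x + t))"
        by (simp add: distr_shift[OF t])
      also have "\<dots> = (\<integral>u. g (u + t) *\<^sub>R D (u + t - t) \<partial>M)"
      proof (rule integral_distr[OF measurable_shift[OF t]])
        have "(\<lambda>s. D (s + - t)) \<in> borel_measurable M"
          using measurable_compose[OF measurable_shift[OF space_closed(3)[OF t]] Dm] .
        then show "(\<lambda>s. g s *\<^sub>R D (s - t)) \<in> borel_measurable M" by simp
      qed
      finally show "g t *\<^sub>R (\<integral>s. g s *\<^sub>R D (s - t) \<partial>M) = (\<integral>u. (g t * g (t + u)) *\<^sub>R D u \<partial>M)"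
        by (simp add: add.commute flip: scaleR_scaleR)
    qed
    also have "\<dots> = (\<integral>u. \<integral>t. (g t * g (t + u)) *\<^sub>R D u \<partial>M \<partial>M)"
      by (rule MM.Fubini_integral[symmetric]) (use gD in \<open>simp only: case_prod_unfold\<close>)
    also have "\<dots> = (\<integral>u. (\<psi> n u / v) *\<^sub>R D u \<partial>M)"
    proof (rule Bochner_Integration.integral_cong[OF refl])
      fix u assume u: "u \<in> space M"
      have "(\<integral>t. (g t * g (t + u)) *\<^sub>R D u \<partial>M) = (\<integral>t. (g t * g (t + u)) \<partial>M) *\<^sub>R D u"
      proof (rule integral_scaleR_left)
        have m: "(\<lambda>t. g (t + u)) \<in> borel_measurable M" using measurable_compose[OF measurable_shift[OF u] g] .
        have "integrable M (\<lambda>t. 1 / v * g t)"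
        proof (intro integrable_mult_right)
          have "(\<integral>\<^sup>+t. ennreal (g t) \<partial>M) = emeasure w (space w)"
            unfolding w_def by (subst emeasure_density) (auto intro!: nn_integral_cong)
          then show "integrable M g" using g0 w.emeasure_space_1 by (intro integrableI_bounded) auto
        qed
        then show "integrable M (\<lambda>t. g t * g (t + u))"
        proof (rule Bochner_Integration.integrable_bound)
          show "AE t in M. norm (g t * g (t + u)) \<le> norm (1 / v * g t)"
          proof (rule AE_I2)
            fix t
            have "g (t + u) \<le> 1 / v" using v by (simp add: g_def indicator_def)
            then have "g (t + u) * g t \<le> 1 / v * g t" using g0 by (intro mult_right_mono)
            then show "norm (g t * g (t + u)) \<le> norm (1 / v * g t)" using g0 v by (simp add: abs_mult mult.commute)
          qed
        qed (use m in measurable)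
      qed
      also have "(\<integral>t. (g t * g (t + u)) \<partial>M) = (\<integral>t. (indicator (fbox n) t * indicator (fbox n) (t + u)) / v\<^sup>2 \<partial>M)"
        unfolding g_def by (simp add: power2_eq_square)
      also have "\<dots> = \<psi> n u / v" using \<psi>int[OF n u] v by (simp add: v_def power2_eq_square)
      finally show "(\<integral>t. (g t * g (t + u)) *\<^sub>R D u \<partial>M) = (\<psi> n u / v) *\<^sub>R D u" .
    qed
    also have "\<dots> = (1 / v) *\<^sub>R (\<integral>u. \<psi> n u *\<^sub>R D u \<partial>M)"
      unfolding integral_scaleR_right[symmetric] by simp
    finally have "(1 / v) *\<^sub>R (\<integral>u. \<psi> n u *\<^sub>R D u \<partial>M) \<in> \<real>\<^sub>\<ge>\<^sub>0" using J by simp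
    then show ?thesis using v by (simp add: complex_nonneg_Reals_iff zero_le_mult_iff zero_le_divide_iff)
  qed
  have "(\<lambda>n. \<integral>u. \<psi> n u *\<^sub>R D u \<partial>M) \<longlonglongrightarrow> (\<integral>u. D u \<partial>M)"
  proof (rule LIMSEQ_offset[where k=1], rule integral_dominated_convergence[where w="\<lambda>u. cmod (D u)"])
    show "AE u in M. (\<lambda>n. \<psi> (n + 1) u *\<^sub>R D u) \<longlonglongrightarrow> D u"
    proof (rule AE_I2)
      fix u assume u: "u \<in> space M"
      have "(\<lambda>n. \<psi> n u *\<^sub>R D u) \<longlonglongrightarrow> 1 *\<^sub>R D u"
        using folner_ratio[OF u] unfolding \<psi>_def by (intro tendsto_scaleR tendsto_const)
      from LIMSEQ_ignore_initial_segment[OF this, of 1] show "(\<lambda>n. \<psi> (n + 1) u *\<^sub>R D u) \<longlonglongrightarrow> D u" by simp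
    qed
    show "AE u in M. norm (\<psi> (n + 1) u *\<^sub>R D u) \<le> cmod (D u)" for n
      using \<psi>01[of "n + 1"] by (auto intro!: mult_left_le_one_le)
    show "(\<lambda>u. \<psi> (n + 1) u *\<^sub>R D u) \<in> borel_measurable M" for n using \<psi>m[of "n + 1"] by measurable
  qed (use D in auto)
  moreover have "\<forall>\<^sub>F n in sequentially. (\<integral>u. \<psi> n u *\<^sub>R D u \<partial>M) \<in> \<real>\<^sub>\<ge>\<^sub>0"
    using eventually_gt_at_top[of 0] by eventually_elim (rule avg)
  ultimately show ?thesis
    by (intro Lim_in_closed_set[OF closed_nonneg_Reals_complex]) auto
qed

end

subsection \<open>Fourier inversion\<close>

lemma lborel_integral_prod_Basis:
  fixes f :: "'a::euclidean_space \<Rightarrow> real \<Rightarrow> complex"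
  assumes f: "\<And>b. b \<in> Basis \<Longrightarrow> integrable lborel (f b)"
  shows "integrable lborel (\<lambda>x::'a. \<Prod>b\<in>Basis. f b (x \<bullet> b))"
    "(\<integral>x. (\<Prod>b\<in>Basis. f b ((x::'a) \<bullet> b)) \<partial>lborel) = (\<Prod>b\<in>Basis. \<integral>x. f b x \<partial>lborel)"
proof -
  have psf: "product_sigma_finite (\<lambda>_::'a. lborel :: real measure)" by standard
  let ?P = "\<Pi>\<^sub>M b\<in>(Basis :: 'a set). (lborel :: real measure)"
  let ?T = "\<lambda>f. \<Sum>b\<in>Basis. f b *\<^sub>R b :: 'a"
  have T: "?T \<in> measurable ?P borel" by measurable
  have m: "(\<lambda>x::'a. \<Prod>b\<in>Basis. f b (x \<bullet> b)) \<in> borel_measurable borel"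
  proof (intro borel_measurable_prod)
    fix b :: 'a assume "b \<in> Basis"
    then have "f b \<in> borel_measurable borel" using f[of b] by auto
    then show "(\<lambda>x::'a. f b (x \<bullet> b)) \<in> borel_measurable borel" by measurable
  qed
  have eq: "(\<Prod>b\<in>Basis. f b (?T x \<bullet> b)) = (\<Prod>b\<in>Basis. f b (x b))" for x
    by (intro prod.cong refl) (simp add: inner_sum_left inner_Basis if_distrib cong: if_cong)
  have "integrable ?P (\<lambda>x. \<Prod>b\<in>Basis. f b (x b))"
    using f by (intro product_sigma_finite.product_integrable_prod[OF psf]) auto
  then show "integrable lborel (\<lambda>x::'a. \<Prod>b\<in>Basis. f b (x \<bullet> b))"
    unfolding lborel_eq[where 'a='a] integrable_distr_eq[OF T m] eq .
  have "(\<integral>x. (\<Prod>b\<in>Basis. f b (x \<bullet> b)) \<partial>lborel) = (\<integral>x. (\<Prod>b\<in>Basis. f b (x b)) \<partial>?P)"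
    unfolding lborel_eq[where 'a='a] integral_distr[OF T m] eq ..
  also have "\<dots> = (\<Prod>b\<in>Basis. \<integral>x. f b x \<partial>lborel)"
    using f by (intro product_sigma_finite.product_integral_prod[OF psf]) auto
  finally show "(\<integral>x. (\<Prod>b\<in>Basis. f b (x \<bullet> b)) \<partial>lborel) = (\<Prod>b\<in>Basis. \<integral>x. f b x \<partial>lborel)" .
qed

definition character :: "'a::real_inner \<Rightarrow> 'a \<Rightarrow> complex" where
  "character t l = exp (\<i> * complex_of_real (inner t l))"

lemma norm_character [simp]: "cmod (character t l) = 1"
  by (simp add: character_def)

lemma character_add: "character (s + t) l = character s l * character t l"
  by (simp add: character_def inner_add_left distrib_left exp_add)

lemma character_0 [simp]: "character 0 l = 1"
  by (simp add: character_def)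

lemma cnj_character: "cnj (character t l) = character (- t) l"
  by (simp add: character_def exp_cnj)

lemma character_Basis: "character t (l :: 'a::euclidean_space) = (\<Prod>b\<in>Basis. exp (\<i> * complex_of_real ((t \<bullet> b) * (l \<bullet> b))))"
  unfolding character_def euclidean_inner[of t l] by (simp add: sum_distrib_left exp_sum)

text \<open>The characteristic function of the standard normal law, cleared of the normalising
  constant.\<close>

lemma gaussian_fourier_1:
  "integrable lborel (\<lambda>x. complex_of_real (exp (- x\<^sup>2 / 2)) * exp (\<i> * complex_of_real (u * x)))"
  "(\<integral>x. complex_of_real (exp (- x\<^sup>2 / 2)) * exp (\<i> * complex_of_real (u * x)) \<partial>lborel) =
    complex_of_real (sqrt (2 * pi) * exp (- u\<^sup>2 / 2))"
proof -
  have d: "std_normal_density x = exp (- x\<^sup>2 / 2) / sqrt (2 * pi)" for x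
    by (simp add: std_normal_density_def)
  have eq: "complex_of_real (exp (- x\<^sup>2 / 2)) * exp (\<i> * complex_of_real (u * x)) =
    complex_of_real (sqrt (2 * pi)) * (std_normal_density x *\<^sub>R exp (\<i> * complex_of_real (u * x)))" for x
    unfolding d scaleR_conv_of_real by simp
  have i0: "integrable lborel std_normal_density" by (rule integrable_normal_density) simp
  have i: "integrable lborel (\<lambda>x. std_normal_density x *\<^sub>R exp (\<i> * complex_of_real (u * x)))"
    by (rule Bochner_Integration.integrable_bound[OF i0]) auto
  show "integrable lborel (\<lambda>x. complex_of_real (exp (- x\<^sup>2 / 2)) * exp (\<i> * complex_of_real (u * x)))"
    unfolding eq by (rule integrable_mult_right[OF i])
  have "(\<integral>x. std_normal_density x *\<^sub>R exp (\<i> * complex_of_real (u * x)) \<partial>lborel) = char std_normal_distribution u"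
    unfolding char_def by (subst integral_density) auto
  also have "\<dots> = complex_of_real (exp (- u\<^sup>2 / 2))" by (simp add: char_std_normal_distribution)
  finally have c: "(\<integral>x. std_normal_density x *\<^sub>R exp (\<i> * complex_of_real (u * x)) \<partial>lborel) = complex_of_real (exp (- u\<^sup>2 / 2))" .
  show "(\<integral>x. complex_of_real (exp (- x\<^sup>2 / 2)) * exp (\<i> * complex_of_real (u * x)) \<partial>lborel) =
    complex_of_real (sqrt (2 * pi) * exp (- u\<^sup>2 / 2))"
    unfolding eq integral_mult_right_zero unfolding c by (simp only: of_real_mult)
qed

definition gauss :: "'a::real_inner \<Rightarrow> real" where
  "gauss x = exp (- (norm x)\<^sup>2 / 2)"

lemma gauss_measurable [measurable]: "(gauss :: 'a::euclidean_space \<Rightarrow> real) \<in> borel_measurable borel"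
  unfolding gauss_def by measurable

lemma gauss_bounds [simp]: "0 \<le> gauss x" "gauss x \<le> 1" "\<bar>gauss x\<bar> = gauss x"
  by (auto simp: gauss_def)

lemma gauss_Basis: "gauss (x :: 'a::euclidean_space) = (\<Prod>b\<in>Basis. exp (- (x \<bullet> b)\<^sup>2 / 2))"
proof -
  have "- (norm x)\<^sup>2 / 2 = (\<Sum>b\<in>Basis. - (x \<bullet> b)\<^sup>2 / 2)"
    unfolding power2_norm_eq_inner euclidean_inner[of x x]
    by (simp add: sum_negf sum_divide_distrib power2_eq_square)
  then show ?thesis unfolding gauss_def by (simp only: exp_sum[OF finite_Basis])
qed

lemma gaussian_fourier:
  fixes u :: "'a::euclidean_space"
  shows "integrable lborel (\<lambda>x. complex_of_real (gauss x) * character u x)"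
    "(\<integral>x. complex_of_real (gauss x) * character u x \<partial>lborel) = complex_of_real (sqrt (2 * pi) ^ DIM('a) * gauss u)"
proof -
  let ?f = "\<lambda>b x. complex_of_real (exp (- x\<^sup>2 / 2)) * exp (\<i> * complex_of_real ((u \<bullet> b) * x))"
  have eq: "complex_of_real (gauss x) * character u x = (\<Prod>b\<in>Basis. ?f b (x \<bullet> b))" for x
    unfolding gauss_Basis character_Basis of_real_prod prod.distrib ..
  show "integrable lborel (\<lambda>x. complex_of_real (gauss x) * character u x)"
    unfolding eq by (rule lborel_integral_prod_Basis(1)) (rule gaussian_fourier_1)
  have "(\<integral>x. complex_of_real (gauss x) * character u x \<partial>lborel) = (\<Prod>b\<in>Basis. \<integral>x. ?f b x \<partial>lborel)"
    unfolding eq by (rule lborel_integral_prod_Basis(2)) (rule gaussian_fourier_1)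
  also have "\<dots> = complex_of_real (sqrt (2 * pi) ^ DIM('a) * gauss u)"
    unfolding gaussian_fourier_1(2) of_real_prod[symmetric] gauss_Basis by (simp only: prod.distrib prod_constant)
  finally show "(\<integral>x. complex_of_real (gauss x) * character u x \<partial>lborel) = complex_of_real (sqrt (2 * pi) ^ DIM('a) * gauss u)" .
qed

lemma integrable_gauss: "integrable lborel (gauss :: 'a::euclidean_space \<Rightarrow> real)"
  and integral_gauss: "(\<integral>x. gauss x \<partial>(lborel :: 'a::euclidean_space measure)) = sqrt (2 * pi) ^ DIM('a)"
proof -
  have "integrable lborel (\<lambda>x::'a. complex_of_real (gauss x))" using gaussian_fourier(1)[of "0::'a"] by simp
  then show i: "integrable lborel (gauss :: 'a \<Rightarrow> real)" by (simp only: complex_of_real_integrable_eq)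
  have "complex_of_real (\<integral>x. gauss x \<partial>(lborel :: 'a measure)) = complex_of_real (sqrt (2 * pi) ^ DIM('a))"
    using gaussian_fourier(2)[of "0::'a"] unfolding Bochner_Integration.integral_complex_of_real[symmetric]
    by (simp add: gauss_def)
  then show "(\<integral>x. gauss x \<partial>(lborel :: 'a measure)) = sqrt (2 * pi) ^ DIM('a)" by (simp only: of_real_eq_iff)
qed

lemma lborel_integral_affine:
  fixes f :: "'a::euclidean_space \<Rightarrow> complex"
  assumes c: "c \<noteq> 0" and f: "f \<in> borel_measurable borel"
  shows "(\<integral>x. f x \<partial>lborel) = \<bar>c\<bar> ^ DIM('a) *\<^sub>R (\<integral>x. f (t + c *\<^sub>R x) \<partial>lborel)"
    "integrable lborel f \<longleftrightarrow> integrable lborel (\<lambda>x. f (t + c *\<^sub>R x))"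
proof -
  have T: "(\<lambda>x::'a. t + c *\<^sub>R x) \<in> measurable lborel borel" by measurable
  have l: "lborel = density (distr lborel borel (\<lambda>x::'a. t + c *\<^sub>R x)) (\<lambda>_. ennreal (\<bar>c\<bar> ^ DIM('a)))"
    using lborel_affine[OF c, of t] by simp
  have "(\<integral>x. f x \<partial>lborel) = (\<integral>x. (\<bar>c\<bar> ^ DIM('a)) *\<^sub>R f x \<partial>distr lborel borel (\<lambda>x::'a. t + c *\<^sub>R x))"
    using f by (subst l, subst integral_density) auto
  also have "\<dots> = (\<integral>x. (\<bar>c\<bar> ^ DIM('a)) *\<^sub>R f (t + c *\<^sub>R x) \<partial>lborel)"
    using f by (subst integral_distr[OF T]) auto
  finally show "(\<integral>x. f x \<partial>lborel) = \<bar>c\<bar> ^ DIM('a) *\<^sub>R (\<integral>x. f (t + c *\<^sub>R x) \<partial>lborel)" by simp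
  have "integrable lborel f \<longleftrightarrow> integrable (distr lborel borel (\<lambda>x::'a. t + c *\<^sub>R x)) (\<lambda>x. (\<bar>c\<bar> ^ DIM('a)) *\<^sub>R f x)"
    using f by (subst l, subst integrable_density) auto
  also have "\<dots> \<longleftrightarrow> integrable lborel (\<lambda>x. (\<bar>c\<bar> ^ DIM('a)) *\<^sub>R f (t + c *\<^sub>R x))"
    using f by (subst integrable_distr_eq[OF T]) auto
  also have "\<dots> \<longleftrightarrow> integrable lborel (\<lambda>x. f (t + c *\<^sub>R x))"
  proof
    assume "integrable lborel (\<lambda>x. (\<bar>c\<bar> ^ DIM('a)) *\<^sub>R f (t + c *\<^sub>R x))"
    from integrable_scaleR_right[OF this, of "inverse (\<bar>c\<bar> ^ DIM('a))"]
    show "integrable lborel (\<lambda>x. f (t + c *\<^sub>R x))" using c by simp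
  qed (rule integrable_scaleR_right)
  finally show "integrable lborel f \<longleftrightarrow> integrable lborel (\<lambda>x. f (t + c *\<^sub>R x))" .
qed

lemma (in pair_sigma_finite) integrable_prod_mult_bounded:
  fixes f :: "'a \<Rightarrow> real" and g :: "'b \<Rightarrow> real" and k :: "'a \<times> 'b \<Rightarrow> complex"
  assumes f: "integrable M1 f" and g: "integrable M2 g" and k: "k \<in> borel_measurable (M1 \<Otimes>\<^sub>M M2)"
    and bound: "\<And>z. cmod (k z) \<le> f (fst z) * g (snd z)" and nn: "\<And>x. 0 \<le> f x" "\<And>x. 0 \<le> g x"
  shows "integrable (M1 \<Otimes>\<^sub>M M2) k"
proof (rule integrableI_bounded[OF k])
  have [measurable]: "f \<in> borel_measurable M1" "g \<in> borel_measurable M2" using f g by auto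
  have "(\<integral>\<^sup>+z. ennreal (norm (k z)) \<partial>(M1 \<Otimes>\<^sub>M M2)) \<le> (\<integral>\<^sup>+z. ennreal (f (fst z)) * ennreal (g (snd z)) \<partial>(M1 \<Otimes>\<^sub>M M2))"
    using bound nn by (intro nn_integral_mono) (auto simp: ennreal_mult[symmetric] intro!: ennreal_leI)
  also have "\<dots> = (\<integral>\<^sup>+x. \<integral>\<^sup>+y. ennreal (f x) * ennreal (g y) \<partial>M2 \<partial>M1)"
    by (subst M2.nn_integral_fst[symmetric]) auto
  also have "\<dots> = (\<integral>\<^sup>+x. ennreal (f x) \<partial>M1) * (\<integral>\<^sup>+y. ennreal (g y) \<partial>M2)"
    by (simp add: nn_integral_cmult nn_integral_multc)
  also have "\<dots> < \<infinity>"
    using f g nn by (simp add: integrable_iff_bounded ennreal_mult_less_top)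
  finally show "(\<integral>\<^sup>+z. ennreal (norm (k z)) \<partial>(M1 \<Otimes>\<^sub>M M2)) < \<infinity>" .
qed

text \<open>Gaussian summation. With the weight \<open>gauss (e n *\<^sub>R l)\<close> the inverse
  transform of \<open>h\<close> is a Gaussian average of \<open>C\<close> around \<open>t\<close>,
  which tends to a multiple of \<open>C t\<close> by continuity. At \<open>t = 0\<close> this bounds
  the weighted integrals of \<open>h\<close>, and as \<open>h\<close> is non-negative, Fatou's lemma
  makes it integrable; the weight is then removed by domination.\<close>

lemma fourier_inversion_lborel:
  fixes C :: "'a::euclidean_space \<Rightarrow> complex"
  assumes C: "integrable lborel C" and bound: "\<And>t. cmod (C t) \<le> c" and cont: "continuous_on UNIV C"
    and pos: "\<And>l. (\<integral>t. C t * character (- t) l \<partial>lborel) \<in> \<real>\<^sub>\<ge>\<^sub>0"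
  defines "h \<equiv> \<lambda>l. Re (\<integral>t. C t * character (- t) l \<partial>lborel)"
  shows "integrable lborel h"
    "(\<integral>l. character t l * complex_of_real (h l) \<partial>lborel) = (2 * pi) ^ DIM('a) *\<^sub>R C t"
proof -
  have Cm [measurable]: "C \<in> borel_measurable borel" using C by auto
  have H: "(\<integral>t. C t * character (- t) l \<partial>lborel) = complex_of_real (h l)" and h0: "0 \<le> h l" for l
    using pos[of l] unfolding h_def complex_nonneg_Reals_iff by (auto simp: complex_eq_iff)
  have km: "(\<lambda>z. C (snd z) * character (- snd z) (fst z)) \<in> borel_measurable lborel2"
    unfolding character_def by measurable
  have hm [measurable]: "h \<in> borel_measurable borel"
  proof -
    have "(\<lambda>l. \<integral>t. C t * character (- t) l \<partial>lborel) \<in> borel_measurable lborel"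
      by (rule lborel.borel_measurable_lebesgue_integral) (use km in \<open>simp only: case_prod_unfold\<close>)
    then show ?thesis unfolding h_def by simp
  qed
  define e where "e n = 1 / real (Suc n)" for n
  have e: "e n > 0" for n by (simp add: e_def)
  have e0: "e \<longlonglongrightarrow> 0" unfolding e_def using LIMSEQ_inverse_real_of_nat by (simp add: inverse_eq_divide)
  have gi: "integrable lborel (\<lambda>l::'a. gauss (e n *\<^sub>R l))" for n
  proof -
    have "integrable lborel (\<lambda>l::'a. complex_of_real (gauss l))"
      using integrable_gauss by (simp only: complex_of_real_integrable_eq)
    then have "integrable lborel (\<lambda>l::'a. complex_of_real (gauss (0 + e n *\<^sub>R l)))"
      using lborel_integral_affine(2)[of "e n" "\<lambda>l::'a. complex_of_real (gauss l)" 0] e[of n] by simp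
    then show ?thesis by (simp only: add_0 complex_of_real_integrable_eq)
  qed
  \<comment> \<open>After Fubini the inner integral over frequencies is a Gaussian in
    \<open>(t - s) / e n\<close>; the substitution of \<open>t - e n *\<^sub>R y\<close> for
    \<open>s\<close> cancels the power of \<open>e n\<close>.\<close>
  have smooth: "(\<integral>l. (gauss (e n *\<^sub>R l) * h l) *\<^sub>R character t l \<partial>lborel) =
    complex_of_real (sqrt (2 * pi) ^ DIM('a)) * (\<integral>y. gauss y *\<^sub>R C (t - e n *\<^sub>R y) \<partial>lborel)" for n t
  proof -
    have m: "(\<lambda>z. gauss (e n *\<^sub>R fst z) *\<^sub>R (C (snd z) * character (t - snd z) (fst z))) \<in> borel_measurable lborel2"
      unfolding character_def by measurable
    have i: "integrable lborel2 (\<lambda>z. gauss (e n *\<^sub>R fst z) *\<^sub>R (C (snd z) * character (t - snd z) (fst z)))"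
      by (rule lborel_pair.integrable_prod_mult_bounded[OF gi[of n] integrable_norm[OF C] m])
        (auto simp: norm_mult abs_of_nonneg gauss_bounds)
    have "(\<integral>l. (gauss (e n *\<^sub>R l) * h l) *\<^sub>R character t l \<partial>lborel) =
      (\<integral>l. \<integral>s. gauss (e n *\<^sub>R l) *\<^sub>R (C s * character (t - s) l) \<partial>lborel \<partial>lborel)"
    proof (rule Bochner_Integration.integral_cong[OF refl])
      fix l :: 'a
      have "(gauss (e n *\<^sub>R l) * h l) *\<^sub>R character t l = gauss (e n *\<^sub>R l) *\<^sub>R (character t l * (\<integral>s. C s * character (- s) l \<partial>lborel))"
        unfolding H by (simp add: scaleR_conv_of_real)
      also have "character t l * (\<integral>s. C s * character (- s) l \<partial>lborel) = (\<integral>s. C s * character (t - s) l \<partial>lborel)"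
        unfolding integral_mult_right_zero[symmetric]
        by (intro Bochner_Integration.integral_cong) (simp_all add: diff_conv_add_uminus character_add del: add_uminus_conv_diff)
      finally show "(gauss (e n *\<^sub>R l) * h l) *\<^sub>R character t l = (\<integral>s. gauss (e n *\<^sub>R l) *\<^sub>R (C s * character (t - s) l) \<partial>lborel)"
        by simp
    qed
    also have "\<dots> = (\<integral>s. \<integral>l. gauss (e n *\<^sub>R l) *\<^sub>R (C s * character (t - s) l) \<partial>lborel \<partial>lborel)"
      by (rule lborel_pair.Fubini_integral[symmetric]) (use i in \<open>simp only: case_prod_unfold\<close>)
    also have "\<dots> = (\<integral>s. C s * (complex_of_real (sqrt (2 * pi) ^ DIM('a)) * complex_of_real (gauss ((1 / e n) *\<^sub>R (t - s)) / e n ^ DIM('a))) \<partial>lborel)"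
    proof (rule Bochner_Integration.integral_cong[OF refl])
      fix s :: 'a
      have "(\<integral>l. complex_of_real (gauss l) * character ((1 / e n) *\<^sub>R (t - s)) l \<partial>lborel) =
        \<bar>e n\<bar> ^ DIM('a) *\<^sub>R (\<integral>l. complex_of_real (gauss (0 + e n *\<^sub>R l)) * character ((1 / e n) *\<^sub>R (t - s)) (0 + e n *\<^sub>R l) \<partial>lborel)"
        using e[of n] by (intro lborel_integral_affine(1)) (auto simp: character_def)
      also have "(\<integral>l. complex_of_real (gauss (0 + e n *\<^sub>R l)) * character ((1 / e n) *\<^sub>R (t - s)) (0 + e n *\<^sub>R l) \<partial>lborel) =
        (\<integral>l. gauss (e n *\<^sub>R l) *\<^sub>R character (t - s) l \<partial>lborel)"
        using e[of n] by (intro Bochner_Integration.integral_cong) (simp_all add: character_def scaleR_conv_of_real)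
      finally have "(\<integral>l. gauss (e n *\<^sub>R l) *\<^sub>R character (t - s) l \<partial>lborel) =
        complex_of_real (sqrt (2 * pi) ^ DIM('a)) * complex_of_real (gauss ((1 / e n) *\<^sub>R (t - s)) / e n ^ DIM('a))"
        unfolding gaussian_fourier(2) using e[of n] by (simp add: scaleR_conv_of_real field_simps)
      moreover have "(\<integral>l. gauss (e n *\<^sub>R l) *\<^sub>R (C s * character (t - s) l) \<partial>lborel) =
        C s * (\<integral>l. gauss (e n *\<^sub>R l) *\<^sub>R character (t - s) l \<partial>lborel)"
        unfolding integral_mult_right_zero[symmetric] by simp
      ultimately show "(\<integral>l. gauss (e n *\<^sub>R l) *\<^sub>R (C s * character (t - s) l) \<partial>lborel) =
        C s * (complex_of_real (sqrt (2 * pi) ^ DIM('a)) * complex_of_real (gauss ((1 / e n) *\<^sub>R (t - s)) / e n ^ DIM('a)))"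
        by simp
    qed
    also have "\<dots> = \<bar>- e n\<bar> ^ DIM('a) *\<^sub>R (\<integral>y. C (t + (- e n) *\<^sub>R y) * (complex_of_real (sqrt (2 * pi) ^ DIM('a)) *
        complex_of_real (gauss ((1 / e n) *\<^sub>R (t - (t + (- e n) *\<^sub>R y))) / e n ^ DIM('a))) \<partial>lborel)"
      using e[of n] by (intro lborel_integral_affine(1)) auto
    also have "\<dots> = (\<integral>y. complex_of_real (sqrt (2 * pi) ^ DIM('a)) * (gauss y *\<^sub>R C (t - e n *\<^sub>R y)) \<partial>lborel)"
      unfolding integral_scaleR_right[symmetric] using e[of n]
      by (intro Bochner_Integration.integral_cong) (simp_all add: scaleR_conv_of_real field_simps)
    finally show ?thesis by (simp only: integral_mult_right_zero)
  qed
  have lim: "(\<lambda>n. complex_of_real (sqrt (2 * pi) ^ DIM('a)) * (\<integral>y. gauss y *\<^sub>R C (t - e n *\<^sub>R y) \<partial>lborel)) \<longlonglongrightarrow> (2 * pi) ^ DIM('a) *\<^sub>R C t" for t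
  proof -
    have "(\<lambda>n. \<integral>y. gauss y *\<^sub>R C (t - e n *\<^sub>R y) \<partial>lborel) \<longlonglongrightarrow> (\<integral>y. gauss (y::'a) *\<^sub>R C t \<partial>lborel)"
    proof (rule integral_dominated_convergence[OF _ _ integrable_mult_right[OF integrable_gauss, of c]])
      show "AE y in lborel. (\<lambda>n. gauss y *\<^sub>R C (t - e n *\<^sub>R y)) \<longlonglongrightarrow> gauss y *\<^sub>R C t"
      proof (rule AE_I2)
        fix y :: 'a
        have "(\<lambda>n. t - e n *\<^sub>R y) \<longlonglongrightarrow> t - 0 *\<^sub>R y" by (intro tendsto_intros e0)
        then have "(\<lambda>n. C (t - e n *\<^sub>R y)) \<longlonglongrightarrow> C (t - 0 *\<^sub>R y)"
          using cont by (intro isCont_tendsto_compose[of _ C]) (auto simp: continuous_on_eq_continuous_at)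
        then show "(\<lambda>n. gauss y *\<^sub>R C (t - e n *\<^sub>R y)) \<longlonglongrightarrow> gauss y *\<^sub>R C t"
          by (intro tendsto_scaleR tendsto_const) simp
      qed
      show "AE y in lborel. norm (gauss y *\<^sub>R C (t - e n *\<^sub>R y)) \<le> c * gauss y" for n
        using bound gauss_bounds by (auto intro!: AE_I2 mult_right_mono simp: mult.commute[of _ "gauss _"] intro: mult_left_mono)
    qed measurable
    then have "(\<lambda>n. complex_of_real (sqrt (2 * pi) ^ DIM('a)) * (\<integral>y. gauss y *\<^sub>R C (t - e n *\<^sub>R y) \<partial>lborel)) \<longlonglongrightarrow>
      complex_of_real (sqrt (2 * pi) ^ DIM('a)) * (\<integral>y. gauss (y::'a) *\<^sub>R C t \<partial>lborel)" by (rule tendsto_mult_left)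
    also have "(\<integral>y. gauss (y::'a) *\<^sub>R C t \<partial>lborel) = (sqrt (2 * pi) ^ DIM('a)) *\<^sub>R C t"
      using integrable_gauss by (subst integral_scaleR_left) (auto simp: integral_gauss)
    also have "complex_of_real (sqrt (2 * pi) ^ DIM('a)) * ((sqrt (2 * pi) ^ DIM('a)) *\<^sub>R C t) = (2 * pi) ^ DIM('a) *\<^sub>R C t"
    proof -
      have "sqrt (2 * pi) ^ DIM('a) * sqrt (2 * pi) ^ DIM('a) = (2 * pi) ^ DIM('a)"
        unfolding power_mult_distrib[symmetric] by simp
      moreover have "complex_of_real a * (b *\<^sub>R C t) = (a * b) *\<^sub>R C t" for a b by (simp add: scaleR_conv_of_real)
      ultimately show ?thesis by (simp only:)
    qed
    finally show ?thesis .
  qed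
  have ghi: "integrable lborel (\<lambda>l. gauss (e n *\<^sub>R l) * h l)" for n
  proof -
    have "\<bar>h l\<bar> \<le> (\<integral>t. cmod (C t) \<partial>lborel)" for l
    proof -
      have "\<bar>h l\<bar> \<le> cmod (\<integral>t. C t * character (- t) l \<partial>lborel)" unfolding h_def by (rule abs_Re_le_cmod)
      also have "\<dots> \<le> (\<integral>t. cmod (C t * character (- t) l) \<partial>lborel)" by (rule integral_norm_bound)
      finally show ?thesis by (simp add: norm_mult)
    qed
    then have "\<bar>gauss (e n *\<^sub>R l) * h l\<bar> \<le> gauss (e n *\<^sub>R l) * (\<integral>t. cmod (C t) \<partial>lborel)" for l
      unfolding abs_mult by (intro mult_mono) auto
    then show ?thesis using gi[of n]
      by (intro Bochner_Integration.integrable_bound[OF integrable_mult_left[OF gi[of n], of "\<integral>t. cmod (C t) \<partial>lborel"]])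
        (auto intro!: AE_I2 order_trans[OF _ abs_ge_self])
  qed
  have glim: "(\<lambda>n. gauss (e n *\<^sub>R l)) \<longlonglongrightarrow> 1" for l :: 'a
  proof -
    have "(\<lambda>n. exp (- (norm (e n *\<^sub>R l))\<^sup>2 / 2)) \<longlonglongrightarrow> exp (- (norm (0 *\<^sub>R l))\<^sup>2 / 2)"
      by (intro tendsto_intros e0) simp
    then show ?thesis by (simp add: gauss_def)
  qed
  \<comment> \<open>Convergence of the weighted integrals needs no integrability of \<open>h\<close>
    beforehand, since each weighted integrand is dominated by a multiple of a Gaussian.\<close>
  show hi: "integrable lborel h"
  proof (rule integrableI_bounded)
    have "(\<integral>\<^sup>+l. ennreal (h l) \<partial>lborel) = (\<integral>\<^sup>+l. liminf (\<lambda>n. ennreal (gauss (e n *\<^sub>R l) * h l)) \<partial>lborel)"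
    proof (rule nn_integral_cong)
      fix l
      have "(\<lambda>n. gauss (e n *\<^sub>R l) * h l) \<longlonglongrightarrow> 1 * h l" by (intro tendsto_intros glim)
      from tendsto_ennrealI[OF this] show "ennreal (h l) = liminf (\<lambda>n. ennreal (gauss (e n *\<^sub>R l) * h l))"
        by (simp add: lim_imp_Liminf)
    qed
    also have "\<dots> \<le> liminf (\<lambda>n. \<integral>\<^sup>+l. ennreal (gauss (e n *\<^sub>R l) * h l) \<partial>lborel)"
      by (rule nn_integral_liminf) measurable
    also have "\<dots> = ennreal (Re ((2 * pi) ^ DIM('a) *\<^sub>R C 0))"
    proof (intro lim_imp_Liminf)
      have eq: "(\<integral>\<^sup>+l. ennreal (gauss (e n *\<^sub>R l) * h l) \<partial>lborel) =
        ennreal (Re (complex_of_real (sqrt (2 * pi) ^ DIM('a)) * (\<integral>y. gauss y *\<^sub>R C (0 - e n *\<^sub>R y) \<partial>lborel)))" for n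
      proof -
        have "(\<integral>\<^sup>+l. ennreal (gauss (e n *\<^sub>R l) * h l) \<partial>lborel) = ennreal (\<integral>l. gauss (e n *\<^sub>R l) * h l \<partial>lborel)"
          using h0 by (intro nn_integral_eq_integral ghi) (auto intro!: AE_I2)
        also have "(\<integral>l. gauss (e n *\<^sub>R l) * h l \<partial>lborel) = Re (\<integral>l. (gauss (e n *\<^sub>R l) * h l) *\<^sub>R character 0 l \<partial>lborel)"
          by (simp add: scaleR_conv_of_real flip: of_real_mult)
        finally show ?thesis unfolding smooth .
      qed
      show "(\<lambda>n. \<integral>\<^sup>+l. ennreal (gauss (e n *\<^sub>R l) * h l) \<partial>lborel) \<longlonglongrightarrow> ennreal (Re ((2 * pi) ^ DIM('a) *\<^sub>R C 0))"
        unfolding eq by (intro tendsto_ennrealI tendsto_Re lim)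
    qed simp
    also have "\<dots> < \<infinity>" by simp
    finally show "(\<integral>\<^sup>+l. ennreal (norm (h l)) \<partial>lborel) < \<infinity>" using h0 by simp
  qed simp
  have "(\<lambda>n. \<integral>l. (gauss (e n *\<^sub>R l) * h l) *\<^sub>R character t l \<partial>lborel) \<longlonglongrightarrow> (\<integral>l. character t l * complex_of_real (h l) \<partial>lborel)"
  proof (rule integral_dominated_convergence[OF _ _ hi])
    show "AE l in lborel. (\<lambda>n. (gauss (e n *\<^sub>R l) * h l) *\<^sub>R character t l) \<longlonglongrightarrow> character t l * complex_of_real (h l)"
    proof (rule AE_I2)
      fix l
      have "(\<lambda>n. (gauss (e n *\<^sub>R l) * h l) *\<^sub>R character t l) \<longlonglongrightarrow> (1 * h l) *\<^sub>R character t l"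
        by (intro tendsto_intros glim)
      then show "(\<lambda>n. (gauss (e n *\<^sub>R l) * h l) *\<^sub>R character t l) \<longlonglongrightarrow> character t l * complex_of_real (h l)"
        by (simp add: scaleR_conv_of_real mult.commute)
    qed
    show "AE l in lborel. norm ((gauss (e n *\<^sub>R l) * h l) *\<^sub>R character t l) \<le> h l" for n
      using gauss_bounds h0 by (auto intro!: AE_I2 mult_left_le_one_le simp: abs_mult)
  qed (auto simp: character_def)
  then show "(\<integral>l. character t l * complex_of_real (h l) \<partial>lborel) = (2 * pi) ^ DIM('a) *\<^sub>R C t"
    unfolding smooth using lim[of t] by (rule LIMSEQ_unique)
qed

lemma integral_exp_period:
  assumes k: "k \<in> \<int>"
  shows "(\<integral>x. indicator {0..2 * pi} x *\<^sub>R exp (\<i> * complex_of_real (k * x)) \<partial>lborel) = (if k = 0 then 2 * pi else 0)"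
proof (cases "k = 0")
  case True
  have "(\<integral>x. indicator {0..2 * pi} x *\<^sub>R (1::complex) \<partial>lborel) = complex_of_real (2 * pi) - complex_of_real 0"
    by (rule integral_FTC_Icc) (auto intro!: derivative_eq_intros)
  with True show ?thesis by simp
next
  case False
  define F where "F x = exp (\<i> * complex_of_real (k * x)) / (\<i> * complex_of_real k)" for x
  have "(\<integral>x. indicator {0..2 * pi} x *\<^sub>R exp (\<i> * complex_of_real (k * x)) \<partial>lborel) = F (2 * pi) - F 0"
  proof (rule integral_FTC_Icc)
    fix x
    have "((\<lambda>z. exp (a * z) / a) has_field_derivative exp (a * w)) (at w)" if "a \<noteq> 0" for a w :: complex
      using that by (auto intro!: derivative_eq_intros)
    from has_vector_derivative_real_field[OF this, of "\<i> * complex_of_real k" x "{0..2 * pi}"]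
    show "(F has_vector_derivative exp (\<i> * complex_of_real (k * x))) (at x within {0..2 * pi})"
      using False by (simp add: F_def[abs_def] mult.assoc)
  qed (auto intro!: continuous_intros)
  also have "F (2 * pi) = F 0"
    using k by (auto simp: F_def Ints_def mult.commute)
  finally show ?thesis using False by simp
qed

context one_particle_space
begin

lemma integral_character_period:
  assumes u: "u \<in> (int_lattice :: (real ^ 'd) set)" and \<Lambda>: "\<Lambda> = {l. \<forall>i. 0 \<le> vec_nth l i \<and> vec_nth l i \<le> 2 * pi}"
  shows "(\<integral>l. indicator \<Lambda> l *\<^sub>R character u l \<partial>lborel) = (if u = 0 then (2 * pi) ^ CARD('d) else 0)"
proof -
  let ?f = "\<lambda>b x. indicator {0..2 * pi} x *\<^sub>R exp (\<i> * complex_of_real ((u \<bullet> b) * x))"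
  have B: "Basis = range (\<lambda>i::'d. axis i (1::real))" by (auto simp: Basis_vec_def)
  have int: "u \<bullet> b \<in> \<int>" if "b \<in> Basis" for b
    using u that by (auto simp: B int_lattice_def inner_axis)
  have ind: "(indicator \<Lambda> l :: real) = (\<Prod>b\<in>Basis. indicator {0..2 * pi} (l \<bullet> b))" for l
  proof (cases "l \<in> \<Lambda>")
    case True
    then show ?thesis unfolding B \<Lambda> by (subst prod.neutral) (auto simp: inner_axis)
  next
    case False
    then obtain i where "\<not> (0 \<le> l $ i \<and> l $ i \<le> 2 * pi)" unfolding \<Lambda> by auto
    then have "\<exists>b\<in>Basis. indicator {0..2 * pi} (l \<bullet> b) = (0::real)"
      unfolding B by (intro bexI[of _ "axis i 1"]) (auto simp: inner_axis)
    then show ?thesis using False by (simp add: prod_zero)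
  qed
  have eq: "indicator \<Lambda> l *\<^sub>R character u l = (\<Prod>b\<in>Basis. ?f b (l \<bullet> b))" for l
    unfolding ind character_Basis prod.distrib scaleR_conv_of_real of_real_prod ..
  have "(\<integral>l. indicator \<Lambda> l *\<^sub>R character u l \<partial>lborel) = (\<Prod>b\<in>Basis. \<integral>x. ?f b x \<partial>lborel)"
    unfolding eq by (rule lborel_integral_prod_Basis(2))
      (intro borel_integrable_compact compact_Icc continuous_intros)
  also have "\<dots> = (\<Prod>b\<in>(Basis :: (real ^ 'd) set). complex_of_real (if u \<bullet> b = 0 then 2 * pi else 0))"
    by (intro prod.cong refl integral_exp_period int)
  also have "\<dots> = (if u = 0 then (2 * pi) ^ CARD('d) else 0)"
  proof (cases "u = 0")
    case False
    then obtain b where "b \<in> Basis" "u \<bullet> b \<noteq> 0" by (metis euclidean_all_zero_iff)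
    then show ?thesis using False by (subst prod_zero) auto
  qed simp
  finally show ?thesis .
qed

text \<open>\<open>C\<close> is absolutely summable, so \<open>h\<close> is bounded and integrable
  on the period box. Fubini and the orthogonality of the characters there leave only the coefficient
  at \<open>t\<close>.\<close>

lemma fourier_inversion_lattice:
  fixes C :: "real ^ 'd \<Rightarrow> complex" and \<Lambda> :: "(real ^ 'd) set"
  assumes M: "M = count_space int_lattice" and \<Lambda>: "\<Lambda> = {l. \<forall>i. 0 \<le> vec_nth l i \<and> vec_nth l i \<le> 2 * pi}"
    and C: "integrable M C"
    and pos: "\<And>l. (\<integral>t. C t * character (- t) l \<partial>M) \<in> \<real>\<^sub>\<ge>\<^sub>0"
  defines "h \<equiv> \<lambda>l. Re (\<integral>t. C t * character (- t) l \<partial>M)"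
  shows "set_integrable lborel \<Lambda> h"
    "t \<in> space M \<Longrightarrow> (LINT l:\<Lambda>|lborel. character t l * complex_of_real (h l)) = (2 * pi) ^ CARD('d) *\<^sub>R C t"
proof -
  interpret L: pair_sigma_finite M "lborel :: (real ^ 'd) measure" by standard
  have H: "(\<integral>t. C t * character (- t) l \<partial>M) = complex_of_real (h l)" for l
    using pos[of l] unfolding h_def complex_nonneg_Reals_iff by (auto simp: complex_eq_iff)
  have "\<Lambda> = cbox 0 (\<chi> i. 2 * pi)" unfolding \<Lambda> by (auto simp: mem_box_cart)
  then have \<Lambda>m [measurable]: "\<Lambda> \<in> sets borel" and \<Lambda>i: "integrable lborel (indicator \<Lambda> :: _ \<Rightarrow> real)"
    by (auto simp: integrable_indicator_iff emeasure_lborel_cbox_finite[unfolded infinity_ennreal_def])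
  have ch: "(\<lambda>z. character (f (fst z)) (snd z)) \<in> borel_measurable (M \<Otimes>\<^sub>M lborel)"
    if "f \<in> borel_measurable M" for f :: "real ^ 'd \<Rightarrow> real ^ 'd"
    unfolding character_def using measurable_compose[OF measurable_fst that] by measurable
  have Cm [measurable]: "C \<in> borel_measurable M" using C by auto
  define k where "k = (\<lambda>t z. indicator \<Lambda> (snd z) *\<^sub>R (C (fst z) * character (t - fst z) (snd z)))"
  have km: "k t \<in> borel_measurable (M \<Otimes>\<^sub>M lborel)" for t
    unfolding k_def by (intro borel_measurable_scaleR borel_measurable_times ch) measurable
  have ki: "integrable (M \<Otimes>\<^sub>M lborel) (k t)" for t
    by (rule L.integrable_prod_mult_bounded[OF integrable_norm[OF C] \<Lambda>i km])
      (auto simp: k_def norm_mult split: split_indicator)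
  have outer: "(\<integral>s. k t (s, l) \<partial>M) = indicator \<Lambda> l *\<^sub>R (character t l * complex_of_real (h l))" for t l
  proof -
    have "(\<integral>s. k t (s, l) \<partial>M) = (\<integral>s. (indicator \<Lambda> l *\<^sub>R character t l) * (C s * character (- s) l) \<partial>M)"
      by (intro Bochner_Integration.integral_cong refl)
        (simp add: k_def diff_conv_add_uminus character_add del: add_uminus_conv_diff)
    also have "\<dots> = (indicator \<Lambda> l *\<^sub>R character t l) * complex_of_real (h l)"
      unfolding integral_mult_right_zero H ..
    finally show ?thesis by simp
  qed
  have oi: "integrable lborel (\<lambda>l. \<integral>s. k t (s, l) \<partial>M)" for t
    using L.integrable_snd[of "\<lambda>s l. k t (s, l)"] ki by simp
  from oi[of 0] have "integrable lborel (\<lambda>l. complex_of_real (indicator \<Lambda> l *\<^sub>R h l))"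
    unfolding outer by (simp add: scaleR_conv_of_real)
  then show "set_integrable lborel \<Lambda> h"
    unfolding set_integrable_def by (simp only: complex_of_real_integrable_eq)
  assume t: "t \<in> space M"
  have tl: "t \<in> int_lattice" using t M by simp
  have "(LINT l:\<Lambda>|lborel. character t l * complex_of_real (h l)) = (\<integral>l. \<integral>s. k t (s, l) \<partial>M \<partial>lborel)"
    unfolding set_lebesgue_integral_def outer ..
  also have "\<dots> = (\<integral>s. \<integral>l. k t (s, l) \<partial>lborel \<partial>M)"
    by (rule L.Fubini_integral) (use ki in simp)
  also have "\<dots> = (\<integral>s. indicator {t} s *\<^sub>R ((2 * pi) ^ CARD('d) *\<^sub>R C t) \<partial>M)"
  proof (rule Bochner_Integration.integral_cong[OF refl])
    fix s assume s: "s \<in> space M"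
    have "(\<integral>l. k t (s, l) \<partial>lborel) = (\<integral>l. C s * (indicator \<Lambda> l *\<^sub>R character (t - s) l) \<partial>lborel)"
      by (intro Bochner_Integration.integral_cong refl) (simp add: k_def)
    also have "\<dots> = C s * (if t - s = 0 then (2 * pi) ^ CARD('d) else 0)"
      unfolding integral_mult_right_zero
      using space_diff[OF t s] M by (subst integral_character_period[OF _ \<Lambda>]) auto
    finally show "(\<integral>l. k t (s, l) \<partial>lborel) = indicator {t} s *\<^sub>R ((2 * pi) ^ CARD('d) *\<^sub>R C t)"
      by (auto simp: scaleR_conv_of_real mult.commute split: split_indicator)
  qed
  also have "\<dots> = (2 * pi) ^ CARD('d) *\<^sub>R C t"
  proof -
    have "(\<integral>s. indicator {t} s *\<^sub>R ((2 * pi) ^ CARD('d) *\<^sub>R C t) \<partial>M) = measure M {t} *\<^sub>R ((2 * pi) ^ CARD('d) *\<^sub>R C t)"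
      using tl M by (subst integral_scaleR_left) (auto simp: integrable_indicator_iff emeasure_count_space)
    also have "measure M {t} = 1" using tl M by (simp add: measure_count_space)
    finally show "(\<integral>s. indicator {t} s *\<^sub>R ((2 * pi) ^ CARD('d) *\<^sub>R C t) \<partial>M) = (2 * pi) ^ CARD('d) *\<^sub>R C t" by simp
  qed
  finally show "(LINT l:\<Lambda>|lborel. character t l * complex_of_real (h l)) = (2 * pi) ^ CARD('d) *\<^sub>R C t" .
qed

abbreviation (input) spectral_domain :: "(real ^ 'd) set \<Rightarrow> bool" where
  "spectral_domain \<Lambda> \<equiv> (M = lborel \<and> \<Lambda> = UNIV) \<or>
    (M = count_space int_lattice \<and> \<Lambda> = {l. \<forall>i. 0 \<le> vec_nth l i \<and> vec_nth l i \<le> 2 * pi})"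

lemma fourier_inversion:
  fixes C :: "real ^ 'd \<Rightarrow> complex" and \<Lambda> :: "(real ^ 'd) set"
  assumes M\<Lambda>: "spectral_domain \<Lambda>"
    and C: "integrable M C" and bound: "\<And>t. cmod (C t) \<le> c" and cont: "M = lborel \<Longrightarrow> continuous_on UNIV C"
    and pos: "\<And>l. (\<integral>t. C t * character (- t) l \<partial>M) \<in> \<real>\<^sub>\<ge>\<^sub>0"
  defines "h \<equiv> \<lambda>l. Re (\<integral>t. C t * character (- t) l \<partial>M)"
  shows "set_integrable lborel \<Lambda> h"
    "t \<in> space M \<Longrightarrow> (LINT l:\<Lambda>|lborel. character t l * complex_of_real (h l)) = (2 * pi) ^ CARD('d) *\<^sub>R C t"
proof -
  have "set_integrable lborel \<Lambda> h \<and>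
    (t \<in> space M \<longrightarrow> (LINT l:\<Lambda>|lborel. character t l * complex_of_real (h l)) = (2 * pi) ^ CARD('d) *\<^sub>R C t)"
    using M\<Lambda>
  proof (elim disjE conjE)
    assume M: "M = lborel" and \<Lambda>: "\<Lambda> = UNIV"
    show ?thesis
      using fourier_inversion_lborel[OF C[unfolded M] bound cont[OF M] pos[unfolded M]]
      unfolding h_def M \<Lambda> by (simp add: set_integrable_def set_lebesgue_integral_def)
  next
    assume M: "M = count_space int_lattice" and \<Lambda>: "\<Lambda> = {l. \<forall>i. 0 \<le> vec_nth l i \<and> vec_nth l i \<le> 2 * pi}"
    show ?thesis
      using fourier_inversion_lattice[OF M \<Lambda> C pos] unfolding h_def by blast
  qed
  then show "set_integrable lborel \<Lambda> h"
    "t \<in> space M \<Longrightarrow> (LINT l:\<Lambda>|lborel. character t l * complex_of_real (h l)) = (2 * pi) ^ CARD('d) *\<^sub>R C t"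
    by auto
qed

end

subsection \<open>Autocovariances of factorial polynomials\<close>

text \<open>A weighted form of Cauchy-Schwarz. When one factor is small, the free
  \<open>\<eta>\<close> can be adapted so that both terms are small, without square roots.\<close>

lemma L2_mult:
  assumes f: "f \<in> L2 N" and g: "g \<in> L2 N"
  shows "integrable N (\<lambda>x. f x * g x)"
    "\<eta> > 0 \<Longrightarrow> cmod (\<integral>x. f x * g x \<partial>N) \<le> \<eta> * (\<integral>x. (cmod (f x))\<^sup>2 \<partial>N) + (\<integral>x. (cmod (g x))\<^sup>2 \<partial>N) / \<eta>"
proof -
  have [measurable]: "f \<in> borel_measurable N" "g \<in> borel_measurable N" using f g by (auto simp: L2_def)
  have i: "integrable N (\<lambda>x. (cmod (f x))\<^sup>2)" "integrable N (\<lambda>x. (cmod (g x))\<^sup>2)" using f g by (auto simp: L2_def)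
  have b: "cmod (f x * g x) \<le> \<eta> * (cmod (f x))\<^sup>2 + (cmod (g x))\<^sup>2 / \<eta>" if \<eta>: "\<eta> > 0" for \<eta> x
  proof -
    have "0 \<le> (\<eta> * cmod (f x) - cmod (g x))\<^sup>2 + \<eta> * (cmod (f x) * cmod (g x))" using \<eta> by simp
    then show ?thesis using \<eta> unfolding norm_mult by (simp add: power2_eq_square field_simps)
  qed
  have ib: "integrable N (\<lambda>x. \<eta> * (cmod (f x))\<^sup>2 + (cmod (g x))\<^sup>2 / \<eta>)" for \<eta>
    using i by (intro Bochner_Integration.integrable_add integrable_mult_right integrable_divide_zero) auto
  show fg: "integrable N (\<lambda>x. f x * g x)"
  proof (rule Bochner_Integration.integrable_bound[OF ib[of 1]])
    show "AE x in N. norm (f x * g x) \<le> norm (1 * (cmod (f x))\<^sup>2 + (cmod (g x))\<^sup>2 / 1)"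
      by (intro AE_I2 order_trans[OF b[of 1]]) auto
  qed measurable
  assume \<eta>: "\<eta> > 0"
  have "cmod (\<integral>x. f x * g x \<partial>N) \<le> (\<integral>x. cmod (f x * g x) \<partial>N)" by (rule integral_norm_bound)
  also have "\<dots> \<le> (\<integral>x. \<eta> * (cmod (f x))\<^sup>2 + (cmod (g x))\<^sup>2 / \<eta> \<partial>N)"
    by (rule integral_mono[OF integrable_norm[OF fg] ib b[OF \<eta>]])
  also have "\<dots> = \<eta> * (\<integral>x. (cmod (f x))\<^sup>2 \<partial>N) + (\<integral>x. (cmod (g x))\<^sup>2 \<partial>N) / \<eta>"
    using i by simp
  finally show "cmod (\<integral>x. f x * g x \<partial>N) \<le> \<eta> * (\<integral>x. (cmod (f x))\<^sup>2 \<partial>N) + (\<integral>x. (cmod (g x))\<^sup>2 \<partial>N) / \<eta>" .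
qed

lemma L2_cnj: "f \<in> L2 N \<Longrightarrow> (\<lambda>x. cnj (f x)) \<in> L2 N"
  using measurable_compose[of f N borel cnj borel, OF _ borel_measurable_continuous_onI[OF continuous_on_cnj[OF continuous_on_id]]]
  by (auto simp: L2_def)

lemma L2_scale: "f \<in> L2 N \<Longrightarrow> (\<lambda>x. c * f x) \<in> L2 N"
  by (auto simp: L2_def norm_mult power_mult_distrib)

lemma L2_add:
  assumes f: "f \<in> L2 N" and g: "g \<in> L2 N"
  shows "(\<lambda>x. f x + g x) \<in> L2 N"
    "(\<integral>x. (cmod (f x + g x))\<^sup>2 \<partial>N) \<le> 2 * (\<integral>x. (cmod (f x))\<^sup>2 \<partial>N) + 2 * (\<integral>x. (cmod (g x))\<^sup>2 \<partial>N)"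
proof -
  have [measurable]: "f \<in> borel_measurable N" "g \<in> borel_measurable N" using f g by (auto simp: L2_def)
  have i: "integrable N (\<lambda>x. (cmod (f x))\<^sup>2)" "integrable N (\<lambda>x. (cmod (g x))\<^sup>2)" using f g by (auto simp: L2_def)
  have i2: "integrable N (\<lambda>x. 2 * (cmod (f x))\<^sup>2 + 2 * (cmod (g x))\<^sup>2)" using i by simp
  have le: "(cmod (f x + g x))\<^sup>2 \<le> 2 * (cmod (f x))\<^sup>2 + 2 * (cmod (g x))\<^sup>2" for x
  proof -
    have "(cmod (f x + g x))\<^sup>2 \<le> (cmod (f x) + cmod (g x))\<^sup>2"
      by (intro power_mono norm_triangle_ineq norm_ge_zero)
    also have "\<dots> \<le> 2 * (cmod (f x))\<^sup>2 + 2 * (cmod (g x))\<^sup>2"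
      using zero_le_power2[of "cmod (f x) - cmod (g x)"] by (simp add: power2_eq_square algebra_simps)
    finally show ?thesis .
  qed
  have s: "integrable N (\<lambda>x. (cmod (f x + g x))\<^sup>2)"
    by (rule Bochner_Integration.integrable_bound[OF i2]) (use le in auto)
  then show "(\<lambda>x. f x + g x) \<in> L2 N" by (simp add: L2_def)
  show "(\<integral>x. (cmod (f x + g x))\<^sup>2 \<partial>N) \<le> 2 * (\<integral>x. (cmod (f x))\<^sup>2 \<partial>N) + 2 * (\<integral>x. (cmod (g x))\<^sup>2 \<partial>N)"
    using integral_mono[OF s i2 le] i by simp
qed

lemma L2_diff: "f \<in> L2 N \<Longrightarrow> g \<in> L2 N \<Longrightarrow> (\<lambda>x. f x - g x) \<in> L2 N"
  using L2_add(1)[of f N "\<lambda>x. - 1 * g x"] L2_scale[of g N "- 1"] by simp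

lemma (in prob_space) L2_const: "(\<lambda>x. c) \<in> L2 M"
  by (simp add: L2_def)

lemma (in prob_space) L2_integrable: "f \<in> L2 M \<Longrightarrow> integrable M f"
  using L2_mult(1)[OF _ L2_const[of 1], of f] by simp

context invariant_determinantal_field
begin

lemma mu_emeasure: "B \<in> sets M \<Longrightarrow> mu B = emeasure (density M (\<lambda>x. ennreal (gK x))) B"
  by (simp add: mu_def emeasure_density)

lemma mu_Un_le: "A \<in> sets M \<Longrightarrow> B \<in> sets M \<Longrightarrow> mu (A \<union> B) \<le> mu A + mu B"
  by (simp add: mu_emeasure emeasure_subadditive)

lemma mu_split: "A \<in> sets M \<Longrightarrow> B \<in> sets M \<Longrightarrow> mu A = mu (A \<inter> B) + mu (A - B)"
  using plus_emeasure[of "A \<inter> B" "density M (\<lambda>x. ennreal (gK x))" "A - B"]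
  by (simp add: mu_emeasure Int_Diff_Un Int_Diff_disjoint)

text \<open>Continuity of translations for \<open>mu\<close>: squeeze \<open>A\<close> between a
  compact \<open>C\<close> and an open \<open>U\<close> of nearly the same intensity. A small
  translate of \<open>C\<close> stays in \<open>U\<close>, and by invariance it has the intensity of
  \<open>C\<close>.\<close>

lemma mu_translate_diff:
  assumes M: "M = lborel" and A: "A \<in> bounded_sets M" and e: "e > 0"
  shows "\<exists>d>0. \<forall>t. norm t < d \<longrightarrow> mu ((A - translate t A) \<union> (translate t A - A)) \<le> ennreal e"
proof -
  obtain r where r: "A \<subseteq> ball 0 r"
    using A bounded_subset_ballD[of A 0] by (auto simp: bounded_sets_def)
  \<comment> \<open>Restricted to a ball around \<open>A\<close> the intensity is a finite measure,
    to which inner and outer regularity apply.\<close>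
  let ?N = "density M (\<lambda>x. ennreal (gK x) * indicator (ball 0 r) x)"
  have sM: "sets M = sets borel" "space M = UNIV" using M by auto
  have [measurable]: "ball 0 r \<in> sets M" using sM by simp
  have dm: "(\<lambda>x. ennreal (gK x) * indicator (ball 0 r) x) \<in> borel_measurable M" by measurable
  have N: "emeasure ?N B = mu (B \<inter> ball 0 r)" if "B \<in> sets borel" for B
    using that sM dm by (subst emeasure_density) (auto simp: mu_def intro!: nn_integral_cong split: split_indicator)
  have fin: "mu B < \<infinity>" if "B \<in> sets borel" "B \<subseteq> ball 0 r" for B
    using that M bounded_subset[OF bounded_ball] by (intro mu_finite) (auto simp: bounded_sets_def)
  have Ab: "A \<in> sets borel" using A M by (simp add: bounded_sets_def)
  have reg: "sets ?N = sets borel" "emeasure ?N (space ?N) \<noteq> \<infinity>"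
    using N[of UNIV] fin[of "ball 0 r"] sM by auto
  have NA: "emeasure ?N A = mu A" using N[OF Ab] r by (simp add: Int_absorb2)
  obtain C where C: "C \<subseteq> A" "compact C" "mu A < mu C + ennreal (e / 4)"
  proof -
    have "\<exists>C\<in>{C. C \<subseteq> A \<and> compact C}. emeasure ?N A < emeasure ?N C + ennreal (e / 4)"
      by (rule SUP_approx_ennreal[OF _ _ inner_regular[OF reg Ab]]) (use e fin[OF Ab r] NA in \<open>auto simp: ennreal_zero_less_divide\<close>)
    then obtain C where C: "C \<subseteq> A" "compact C" "emeasure ?N A < emeasure ?N C + ennreal (e / 4)" by auto
    moreover have "emeasure ?N C = mu C"
      using N[of C] C r by (simp add: borel_compact Int_absorb2 order_trans[OF C(1)])
    ultimately show thesis using that NA by simp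
  qed
  obtain U where U: "A \<subseteq> U" "open U" "U \<subseteq> ball 0 r" "mu U < mu A + ennreal (e / 4)"
  proof -
    have "\<exists>U\<in>{U. A \<subseteq> U \<and> open U}. emeasure ?N U < emeasure ?N A + ennreal (e / 4)"
      by (rule INF_approx_ennreal[OF _ outer_regular[OF reg Ab]]) (use e fin[OF Ab r] NA in \<open>auto simp: ennreal_zero_less_divide\<close>)
    then obtain U where U: "A \<subseteq> U" "open U" "emeasure ?N U < emeasure ?N A + ennreal (e / 4)" by auto
    then show thesis using that[of "U \<inter> ball 0 r"] N[of U] NA r by auto
  qed
  obtain d where d: "d > 0" "(\<Union>x\<in>C. ball x d) \<subseteq> U"
    using compact_subset_open_imp_ball_epsilon_subset[of C U] C U by auto
  have "mu ((A - translate t A) \<union> (translate t A - A)) \<le> ennreal e" if t: "norm t < d" for t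
  proof -
    have tM: "t \<in> space M" using M by simp
    have tr: "translate t B \<in> sets M" if "B \<in> bounded_sets M" for B
      using bounded_sets_translate[OF that tM] by (simp add: bounded_sets_def)
    have Cb: "C \<in> bounded_sets M" using C M by (simp add: bounded_sets_def borel_compact compact_imp_bounded)
    have As: "A \<in> sets M" and Us: "U \<in> sets M" using Ab U M by auto
    have CU: "translate t C \<subseteq> U"
      using d(2) t by (force simp: dist_norm)
    have "mu U = mu C + mu (U - translate t C)"
      using mu_split[OF Us tr[OF Cb]] mu_translate[OF Cb tM] CU by (simp add: Int_absorb1)
    moreover have "mu U \<le> mu C + ennreal (e / 2)"
    proof -
      have "mu U \<le> mu C + ennreal (e / 4) + ennreal (e / 4)"
        using U(4) C(3) by (meson add_right_mono less_imp_le order_trans)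
      also have "\<dots> = mu C + ennreal (e / 2)" using e by (simp add: add.assoc flip: ennreal_plus)
      finally show ?thesis .
    qed
    ultimately have "mu (U - translate t C) \<le> ennreal (e / 2)"
      using mu_finite[OF Cb] by (auto simp: ennreal_add_left_cancel_le)
    moreover have "mu (A - translate t A) \<le> mu (U - translate t C)"
      using U(1) C(1) by (intro mu_mono) auto
    ultimately have 1: "mu (A - translate t A) \<le> ennreal (e / 2)" by (rule order_trans[rotated])
    \<comment> \<open>\<open>A\<close> and its translate have equal finite intensity, so the two
      halves of the symmetric difference do as well, and one bound serves both.\<close>
    have "mu (A \<inter> translate t A) + mu (A - translate t A) = mu (A \<inter> translate t A) + mu (translate t A - A)"
      using mu_split[OF As tr[OF A]] mu_split[OF tr[OF A] As] mu_translate[OF A tM] by (simp add: Int_commute)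
    moreover have "mu (A \<inter> translate t A) < \<infinity>"
      using le_less_trans[OF mu_mono[of "A \<inter> translate t A" A] mu_finite[OF A]] by simp
    ultimately have "mu (translate t A - A) = mu (A - translate t A)"
      by (auto simp: ennreal_add_left_cancel)
    with 1 have "mu (A - translate t A) + mu (translate t A - A) \<le> ennreal (e / 2) + ennreal (e / 2)"
      by (intro add_mono) auto
    then show ?thesis
      using mu_Un_le[of "A - translate t A" "translate t A - A"] As tr[OF A] e
      by (auto simp flip: ennreal_plus intro: order_trans)
  qed
  with d(1) show ?thesis by blast
qed

lemma num_particles_eq_translate:
  assumes \<xi>: "\<xi> \<in> space P" and A: "A \<in> bounded_sets M" "B \<in> bounded_sets M"
    and 0: "num_particles ((A - B) \<union> (B - A)) \<xi> = 0"
  shows "num_particles A \<xi> = num_particles B \<xi>"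
proof -
  have c: "\<xi> \<in> configurations (space M)" using \<xi> by (simp add: space_P)
  have b: "bounded A" "bounded B" using A by (auto simp: bounded_sets_def)
  have bd: "bounded (A - B)" "bounded (B - A)" "bounded (A \<inter> B)" using b by (auto intro: bounded_subset)
  have "num_particles (A - B) \<xi> + num_particles (B - A) \<xi> = 0"
    using num_particles_Un[OF c bd(1,2)] 0 by auto
  moreover have "num_particles ((A \<inter> B) \<union> (A - B)) \<xi> = num_particles (A \<inter> B) \<xi> + num_particles (A - B) \<xi>"
    "num_particles ((A \<inter> B) \<union> (B - A)) \<xi> = num_particles (A \<inter> B) \<xi> + num_particles (B - A) \<xi>"
    by (rule num_particles_Un[OF c bd(3,1)], blast) (rule num_particles_Un[OF c bd(3,2)], blast)
  moreover have "(A \<inter> B) \<union> (A - B) = A" "(A \<inter> B) \<union> (B - A) = B" by auto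
  ultimately show ?thesis by simp
qed

text \<open>A small shift changes the monomial only if some \<open>B i t\<close> contains a
  particle, and the expected number of such particles is small. On that rare event the change is
  controlled by a fourth moment, which invariance makes uniform in \<open>t\<close>.\<close>

lemma shift_continuous_monomial:
  assumes M: "M = lborel" and F: "falling_monomial S L F" and e: "e > 0"
  shows "\<exists>d>0. \<forall>t. norm t < d \<longrightarrow> (\<integral>\<^sup>+\<xi>. ennreal ((cmod (of_nat (F (shift t \<xi>)) - of_nat (F \<xi>)))\<^sup>2) \<partial>P) \<le> ennreal e"
proof -
  obtain m :: nat and A k where A: "\<And>i. i < m \<Longrightarrow> A i \<in> bounded_sets M"
    and F_eq: "F = (\<lambda>\<xi>. \<Prod>i<m. falling (num_particles (A i) \<xi>) (k i))"
    by (rule falling_monomialE[OF F]) (rule that)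
  have Fm [measurable]: "F \<in> measurable P (count_space UNIV)" by (rule falling_monomial_measurable[OF F])
  define q where "q = (\<integral>\<^sup>+\<xi>. ennreal (cmod (of_nat (F \<xi>)) ^ 4) \<partial>P)"
  have "q < \<infinity>" unfolding q_def by (rule falling_poly_Lp[OF falling_poly.monomial[OF F]])
  then obtain q' where q': "q = ennreal q'" "q' \<ge> 0" by (cases q) auto
  \<comment> \<open>The fourth moments of the two terms together cost at most
    \<open>2 ^ 4 * 2 * q' = 32 * q'\<close>; \<open>\<eta>\<close> makes their share at most
    \<open>e / 2\<close>, and \<open>\<delta>\<close> does so for the particles in the symmetric
    differences, weighted by \<open>1 / \<eta>\<close>.\<close>
  define \<eta> where "\<eta> = e / (2 * (32 * q' + 1))"
  have \<eta>: "\<eta> > 0" "\<eta> * (32 * q') \<le> e / 2"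
    using e q'(2) by (auto simp: \<eta>_def field_simps)
  define \<delta> where "\<delta> = e * \<eta> / (2 * (real m + 1))"
  have \<delta>: "\<delta> > 0" using e \<eta> by (simp add: \<delta>_def)
  have \<delta>': "real m * \<delta> / \<eta> \<le> e / 2"
  proof -
    have "real m * \<delta> / \<eta> = e * (real m / (2 * (real m + 1)))" using \<eta> by (simp add: \<delta>_def)
    also have "\<dots> \<le> e * (1 / 2)" using e by (intro mult_left_mono) (auto simp: field_simps)
    finally show ?thesis by simp
  qed
  define B where "B i t = (A i - translate t (A i)) \<union> (translate t (A i) - A i)" for i t
  have "\<exists>d. \<forall>i\<in>{..<m}. d i > 0 \<and> (\<forall>t. norm t < d i \<longrightarrow> mu (B i t) \<le> ennreal \<delta>)"
    using mu_translate_diff[OF M A \<delta>] unfolding B_def by (intro bchoice) auto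
  then obtain d where d: "\<And>i. i < m \<Longrightarrow> d i > 0" "\<And>i t. i < m \<Longrightarrow> norm t < d i \<Longrightarrow> mu (B i t) \<le> ennreal \<delta>" by auto
  define D where "D = Min (insert 1 (d ` {..<m}))"
  have D: "D > 0" "\<And>i. i < m \<Longrightarrow> D \<le> d i" unfolding D_def using d(1) by auto
  have "(\<integral>\<^sup>+\<xi>. ennreal ((cmod (of_nat (F (shift t \<xi>)) - of_nat (F \<xi>)))\<^sup>2) \<partial>P) \<le> ennreal e" if t: "norm t < D" for t
  proof -
    have tM [simp]: "t \<in> space M" using M by simp
    have tr: "translate t (A i) \<in> bounded_sets M" if "i < m" for i by (rule bounded_sets_translate[OF A[OF that] tM])
    have Bb: "B i t \<in> bounded_sets M" if "i < m" for i
      unfolding B_def by (intro bounded_sets_ops A tr that)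
    have sh: "F (shift t \<xi>) = (\<Prod>i<m. falling (num_particles (translate t (A i)) \<xi>) (k i))" for \<xi>
      by (simp add: F_eq num_particles_shift)
    let ?s = "\<lambda>\<xi>. cmod (of_nat (F (shift t \<xi>)) + of_nat (F \<xi>)) ^ 4"
    \<comment> \<open>On the event of a change the number of particles in the symmetric differences
      is at least \<open>1\<close>, so it may be inserted next to \<open>1 / \<eta>\<close> in the
      bound of a square by \<open>\<eta>\<close> times a fourth power plus
      \<open>1 / \<eta>\<close>.\<close>
    have pw: "(cmod (of_nat (F (shift t \<xi>)) - of_nat (F \<xi>)))\<^sup>2 \<le> \<eta> * ?s \<xi> + (\<Sum>i<m. real (num_particles (B i t) \<xi>)) / \<eta>"
      if \<xi>: "\<xi> \<in> space P" for \<xi>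
    proof (cases "\<forall>i<m. num_particles (B i t) \<xi> = 0")
      case True
      have "F (shift t \<xi>) = F \<xi>"
        unfolding sh unfolding F_eq using True
        by (intro prod.cong refl arg_cong2[where f=falling] num_particles_eq_translate[OF \<xi> A tr, symmetric])
          (auto simp: B_def)
      then show ?thesis using \<eta> by (simp add: sum_nonneg)
    next
      case False
      then obtain i where i: "i < m" "num_particles (B i t) \<xi> \<ge> 1" by (auto simp: Suc_le_eq)
      have "1 \<le> real (num_particles (B i t) \<xi>)" using i by simp
      also have "\<dots> \<le> (\<Sum>i<m. real (num_particles (B i t) \<xi>))" by (rule member_le_sum) (use i in auto)
      finally have s1: "1 / \<eta> \<le> (\<Sum>i<m. real (num_particles (B i t) \<xi>)) / \<eta>" using \<eta> by (simp add: divide_right_mono)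
      define x y where "x = real (F (shift t \<xi>))" and "y = real (F \<xi>)"
      have xy: "x \<ge> 0" "y \<ge> 0" by (auto simp: x_def y_def)
      have c: "cmod (of_nat (F (shift t \<xi>)) - of_nat (F \<xi>)) = \<bar>x - y\<bar>"
        "cmod (of_nat (F (shift t \<xi>)) + of_nat (F \<xi>)) = x + y"
        unfolding x_def y_def using norm_of_real[of "real (F (shift t \<xi>)) - real (F \<xi>)", where 'a=complex]
          norm_of_real[of "real (F (shift t \<xi>)) + real (F \<xi>)", where 'a=complex] by simp_all
      have "\<bar>x - y\<bar>\<^sup>2 \<le> (x + y)\<^sup>2" using xy by (intro power_mono) auto
      also have "\<dots> \<le> \<eta> * (x + y) ^ 4 + 1 / \<eta>"
      proof -
        have "0 \<le> (\<eta> * (x + y)\<^sup>2 - 1)\<^sup>2 + \<eta> * (x + y)\<^sup>2" using \<eta> by simp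
        then have "\<eta> * (x + y)\<^sup>2 \<le> \<eta> * (\<eta> * (x + y) ^ 4 + 1 / \<eta>)"
          using \<eta> by (simp add: power2_eq_square power4_eq_xxxx algebra_simps)
        then show ?thesis using \<eta> by simp
      qed
      finally show ?thesis unfolding c using s1 by linarith
    qed
    have "(\<integral>\<^sup>+\<xi>. ennreal ((cmod (of_nat (F (shift t \<xi>)) - of_nat (F \<xi>)))\<^sup>2) \<partial>P) \<le>
      (\<integral>\<^sup>+\<xi>. ennreal \<eta> * ennreal (?s \<xi>) + (\<Sum>i<m. ennreal (1 / \<eta>) * of_nat (num_particles (B i t) \<xi>)) \<partial>P)"
    proof (rule nn_integral_mono)
      fix \<xi> assume "\<xi> \<in> space P"
      have "ennreal \<eta> * ennreal (?s \<xi>) + (\<Sum>i<m. ennreal (1 / \<eta>) * of_nat (num_particles (B i t) \<xi>)) =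
        ennreal (\<eta> * ?s \<xi> + (\<Sum>i<m. 1 / \<eta> * real (num_particles (B i t) \<xi>)))"
      proof -
        have "(\<Sum>i<m. ennreal (1 / \<eta>) * of_nat (num_particles (B i t) \<xi>)) = ennreal (\<Sum>i<m. 1 / \<eta> * real (num_particles (B i t) \<xi>))"
          using \<eta> by (simp only: ennreal_of_nat_eq_real_of_nat ennreal_mult[symmetric] less_imp_le divide_nonneg_nonneg
            zero_le_one of_nat_0_le_iff sum_ennreal mult_nonneg_nonneg)
        moreover have "ennreal \<eta> * ennreal (?s \<xi>) = ennreal (\<eta> * ?s \<xi>)" using \<eta> by (intro ennreal_mult[symmetric]) auto
        moreover have "0 \<le> (\<Sum>i<m. 1 / \<eta> * real (num_particles (B i t) \<xi>))" "0 \<le> \<eta> * ?s \<xi>"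
          using \<eta> by (auto intro!: sum_nonneg)
        ultimately show ?thesis by (simp only: ennreal_plus)
      qed
      then show "ennreal ((cmod (of_nat (F (shift t \<xi>)) - of_nat (F \<xi>)))\<^sup>2) \<le>
        ennreal \<eta> * ennreal (?s \<xi>) + (\<Sum>i<m. ennreal (1 / \<eta>) * of_nat (num_particles (B i t) \<xi>))"
        using pw[OF \<open>\<xi> \<in> space P\<close>] by (simp add: sum_divide_distrib ennreal_leI)
    qed
    also have "\<dots> = ennreal \<eta> * (\<integral>\<^sup>+\<xi>. ennreal (?s \<xi>) \<partial>P) + (\<Sum>i<m. ennreal (1 / \<eta>) * (\<integral>\<^sup>+\<xi>. of_nat (num_particles (B i t) \<xi>) \<partial>P))"
    proof -
      have [measurable]: "(\<lambda>\<xi>. F (shift t \<xi>)) \<in> measurable P (count_space UNIV)"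
        by (rule measurable_compose[OF shift_measurable[OF tM] Fm])
      have [measurable]: "num_particles (B i t) \<in> measurable P (count_space UNIV)" if "i \<in> {..<m}" for i
        using that Bb by (intro num_particles_measurable) auto
      show ?thesis by (subst nn_integral_add, measurable) (simp add: nn_integral_cmult nn_integral_sum)
    qed
    also have "\<dots> \<le> ennreal \<eta> * ennreal (32 * q') + (\<Sum>i<m. ennreal (1 / \<eta>) * ennreal \<delta>)"
    proof (intro add_mono mult_left_mono sum_mono)
      have Fc: "(\<lambda>\<xi>. of_nat (F \<xi>) :: complex) \<in> borel_measurable P" by measurable
      have "(\<integral>\<^sup>+\<xi>. ennreal (?s \<xi>) \<partial>P) \<le> ennreal (2 ^ 4) * ((\<integral>\<^sup>+\<xi>. ennreal (cmod (of_nat (F (shift t \<xi>))) ^ 4) \<partial>P) + q)"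
        unfolding q_def by (rule nn_integral_norm_add_power[OF measurable_compose[OF shift_measurable[OF tM] Fc] Fc])
      also have "(\<integral>\<^sup>+\<xi>. ennreal (cmod (of_nat (F (shift t \<xi>))) ^ 4) \<partial>P) = q"
        unfolding q_def using nn_integral_shift_P[OF tM, of "\<lambda>\<xi>. ennreal (cmod (of_nat (F \<xi>)) ^ 4)"] by simp
      also have "ennreal (2 ^ 4) * (q + q) = ennreal (32 * q')"
        unfolding q'(1) using q'(2) by (simp flip: ennreal_plus ennreal_mult ennreal_numeral)
      finally show "(\<integral>\<^sup>+\<xi>. ennreal (?s \<xi>) \<partial>P) \<le> ennreal (32 * q')" .
    next
      fix i assume "i \<in> {..<m}"
      then show "(\<integral>\<^sup>+\<xi>. of_nat (num_particles (B i t) \<xi>) \<partial>P) \<le> ennreal \<delta>"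
        using nn_expectation_num_particles[OF Bb, of i] d(2)[of i t] D(2)[of i] t by auto
    qed auto
    also have "\<dots> = ennreal (\<eta> * (32 * q') + real m * \<delta> / \<eta>)"
      using \<eta> \<delta> q'(2) by (simp add: ennreal_mult[symmetric] ennreal_of_nat_eq_real_of_nat ennreal_plus[symmetric] del: ennreal_plus)
    also have "\<dots> \<le> ennreal e" using \<eta>(2) \<delta>' by (intro ennreal_leI) linarith
    finally show ?thesis .
  qed
  with D(1) show ?thesis by blast
qed

lemma shift_continuous:
  assumes M: "M = lborel" and f: "falling_poly f" and e: "e > 0"
  shows "\<exists>d>0. \<forall>t. norm t < d \<longrightarrow> (\<integral>\<^sup>+\<xi>. ennreal ((cmod (f (shift t \<xi>) - f \<xi>))\<^sup>2) \<partial>P) \<le> ennreal e"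
  using f e
proof (induction arbitrary: e rule: falling_poly.induct)
  case (monomial S L F)
  then show ?case using shift_continuous_monomial[OF M] by blast
next
  case (add f g)
  obtain d1 where d1: "d1 > 0" "\<And>t. norm t < d1 \<Longrightarrow> (\<integral>\<^sup>+\<xi>. ennreal ((cmod (f (shift t \<xi>) - f \<xi>))\<^sup>2) \<partial>P) \<le> ennreal (e / 8)"
    using add.IH(1)[of "e / 8"] add.prems by auto
  obtain d2 where d2: "d2 > 0" "\<And>t. norm t < d2 \<Longrightarrow> (\<integral>\<^sup>+\<xi>. ennreal ((cmod (g (shift t \<xi>) - g \<xi>))\<^sup>2) \<partial>P) \<le> ennreal (e / 8)"
    using add.IH(2)[of "e / 8"] add.prems by auto
  have [measurable]: "f \<in> borel_measurable P" "g \<in> borel_measurable P" using add.hyps falling_poly_measurable by auto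
  have "(\<integral>\<^sup>+\<xi>. ennreal ((cmod ((f (shift t \<xi>) + g (shift t \<xi>)) - (f \<xi> + g \<xi>)))\<^sup>2) \<partial>P) \<le> ennreal e"
    if t: "norm t < min d1 d2" for t
  proof -
    have [measurable]: "shift t \<in> measurable P P" using M by (intro shift_measurable) auto
    have "(\<integral>\<^sup>+\<xi>. ennreal ((cmod ((f (shift t \<xi>) + g (shift t \<xi>)) - (f \<xi> + g \<xi>)))\<^sup>2) \<partial>P) =
      (\<integral>\<^sup>+\<xi>. ennreal ((cmod ((f (shift t \<xi>) - f \<xi>) + (g (shift t \<xi>) - g \<xi>)))\<^sup>2) \<partial>P)"
      by (simp add: algebra_simps)
    also have "\<dots> \<le> ennreal (2\<^sup>2) * ((\<integral>\<^sup>+\<xi>. ennreal ((cmod (f (shift t \<xi>) - f \<xi>))\<^sup>2) \<partial>P) + (\<integral>\<^sup>+\<xi>. ennreal ((cmod (g (shift t \<xi>) - g \<xi>))\<^sup>2) \<partial>P))"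
      by (rule nn_integral_norm_add_power) measurable
    also have "\<dots> \<le> ennreal (2\<^sup>2) * (ennreal (e / 8) + ennreal (e / 8))"
      using d1(2)[of t] d2(2)[of t] t by (intro mult_left_mono add_mono) auto
    also have "\<dots> = ennreal e" using add.prems by (simp flip: ennreal_plus ennreal_mult ennreal_numeral)
    finally show ?thesis .
  qed
  then show ?case using d1(1) d2(1) by (intro exI[of _ "min d1 d2"]) auto
next
  case (scale f c)
  have e': "e / ((cmod c)\<^sup>2 + 1) > 0" using scale.prems by (simp add: add_nonneg_pos)
  obtain d where d: "d > 0" "\<And>t. norm t < d \<Longrightarrow> (\<integral>\<^sup>+\<xi>. ennreal ((cmod (f (shift t \<xi>) - f \<xi>))\<^sup>2) \<partial>P) \<le> ennreal (e / ((cmod c)\<^sup>2 + 1))"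
    using scale.IH[OF e'] by auto
  have [measurable]: "f \<in> borel_measurable P" using scale.hyps falling_poly_measurable by auto
  have "(\<integral>\<^sup>+\<xi>. ennreal ((cmod (c * f (shift t \<xi>) - c * f \<xi>))\<^sup>2) \<partial>P) \<le> ennreal e" if t: "norm t < d" for t
  proof -
    have [measurable]: "shift t \<in> measurable P P" using M by (intro shift_measurable) auto
    have "(\<integral>\<^sup>+\<xi>. ennreal ((cmod (c * f (shift t \<xi>) - c * f \<xi>))\<^sup>2) \<partial>P) =
      (\<integral>\<^sup>+\<xi>. ennreal ((cmod c)\<^sup>2) * ennreal ((cmod (f (shift t \<xi>) - f \<xi>))\<^sup>2) \<partial>P)"
      by (simp add: norm_mult power_mult_distrib ennreal_mult flip: right_diff_distrib)
    also have "\<dots> = ennreal ((cmod c)\<^sup>2) * (\<integral>\<^sup>+\<xi>. ennreal ((cmod (f (shift t \<xi>) - f \<xi>))\<^sup>2) \<partial>P)"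
      by (rule nn_integral_cmult) measurable
    also have "\<dots> \<le> ennreal ((cmod c)\<^sup>2) * ennreal (e / ((cmod c)\<^sup>2 + 1))"
      using d(2)[OF t] by (rule mult_left_mono) simp
    also have "\<dots> = ennreal ((cmod c)\<^sup>2 * (e / ((cmod c)\<^sup>2 + 1)))" using e' by (intro ennreal_mult[symmetric]) auto
    also have "\<dots> \<le> ennreal e"
    proof (rule ennreal_leI)
      have "(cmod c)\<^sup>2 * e \<le> ((cmod c)\<^sup>2 + 1) * e" using scale.prems by (intro mult_right_mono) auto
      moreover have "(cmod c)\<^sup>2 + 1 > 0" by (simp add: add_nonneg_pos)
      ultimately show "(cmod c)\<^sup>2 * (e / ((cmod c)\<^sup>2 + 1)) \<le> e" by (simp add: pos_divide_le_eq mult.commute)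
    qed
    finally show ?thesis .
  qed
  with d(1) show ?case by blast
qed

lemma falling_poly_L2: "falling_poly f \<Longrightarrow> f \<in> L2 P"
  using falling_poly_Lspace[of f 1] by (simp add: Lspace_def L2_def power2_eq_square)

lemma L2_shift: "f \<in> L2 P \<Longrightarrow> t \<in> space M \<Longrightarrow> (\<lambda>\<xi>. f (shift t \<xi>)) \<in> L2 P"
  unfolding L2_def using integrable_shift_P[of t "\<lambda>\<xi>. (cmod (f \<xi>))\<^sup>2"] by auto

lemma L2_norm_shift:
  "f \<in> L2 P \<Longrightarrow> t \<in> space M \<Longrightarrow> (\<integral>\<xi>. (cmod (f (shift t \<xi>)))\<^sup>2 \<partial>P) = (\<integral>\<xi>. (cmod (f \<xi>))\<^sup>2 \<partial>P)"
  unfolding L2_def by (intro integral_shift_P) auto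

definition cov :: "('d config \<Rightarrow> complex) \<Rightarrow> ('d config \<Rightarrow> complex) \<Rightarrow> real ^ 'd \<Rightarrow> complex" where
  "cov f g t = (\<integral>\<xi>. f \<xi> * cnj (g (shift t \<xi>)) \<partial>P) - (\<integral>\<xi>. f \<xi> \<partial>P) * cnj (\<integral>\<xi>. g \<xi> \<partial>P)"

lemma cov_integrand: "f \<in> L2 P \<Longrightarrow> g \<in> L2 P \<Longrightarrow> t \<in> space M \<Longrightarrow> integrable P (\<lambda>\<xi>. f \<xi> * cnj (g (shift t \<xi>)))"
  by (intro L2_mult(1) L2_cnj L2_shift)

lemma cov_add:
  assumes "f \<in> L2 P" "f' \<in> L2 P" "g \<in> L2 P" "t \<in> space M"
  shows "cov (\<lambda>\<xi>. f \<xi> + f' \<xi>) g t = cov f g t + cov f' g t"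
    "cov g (\<lambda>\<xi>. f \<xi> + f' \<xi>) t = cov g f t + cov g f' t"
  using assms cov_integrand[of f g t] cov_integrand[of f' g t] cov_integrand[of g f t] cov_integrand[of g f' t]
    P.L2_integrable[of f] P.L2_integrable[of f']
  by (simp_all add: cov_def distrib_left distrib_right)

lemma cov_scale:
  "cov (\<lambda>\<xi>. c * f \<xi>) g t = c * cov f g t" "cov g (\<lambda>\<xi>. c * f \<xi>) t = cnj c * cov g f t"
proof -
  have "(\<integral>\<xi>. c * f \<xi> * cnj (g (shift t \<xi>)) \<partial>P) = c * (\<integral>\<xi>. f \<xi> * cnj (g (shift t \<xi>)) \<partial>P)"
    by (simp only: mult.assoc integral_mult_right_zero)
  then show "cov (\<lambda>\<xi>. c * f \<xi>) g t = c * cov f g t" by (simp add: cov_def right_diff_distrib)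
  have "(\<integral>\<xi>. g \<xi> * cnj (c * f (shift t \<xi>)) \<partial>P) = cnj c * (\<integral>\<xi>. g \<xi> * cnj (f (shift t \<xi>)) \<partial>P)"
    by (simp only: complex_cnj_mult mult.left_commute[of "g _"] integral_mult_right_zero)
  then show "cov g (\<lambda>\<xi>. c * f \<xi>) t = cnj c * cov g f t" by (simp add: cov_def right_diff_distrib)
qed

lemma cov_bound:
  assumes f: "f \<in> L2 P" and g: "g \<in> L2 P" and t: "t \<in> space M"
  shows "cmod (cov f g t) \<le> (\<integral>\<xi>. (cmod (f \<xi>))\<^sup>2 \<partial>P) + (\<integral>\<xi>. (cmod (g \<xi>))\<^sup>2 \<partial>P) + cmod ((\<integral>\<xi>. f \<xi> \<partial>P) * cnj (\<integral>\<xi>. g \<xi> \<partial>P))"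
  using L2_mult(2)[OF f L2_cnj[OF L2_shift[OF g t]], of 1] L2_norm_shift[OF g t]
    norm_triangle_ineq4[of "\<integral>\<xi>. f \<xi> * cnj (g (shift t \<xi>)) \<partial>P" "(\<integral>\<xi>. f \<xi> \<partial>P) * cnj (\<integral>\<xi>. g \<xi> \<partial>P)"]
  unfolding cov_def by simp

text \<open>Fourier inversion recovers point values, so in the Euclidean case the autocovariance
  itself has to be continuous, not merely integrable. Measurability in \<open>t\<close> is a
  by-product.\<close>

lemma cov_continuous:
  assumes M: "M = lborel" and f: "f \<in> L2 P" and g: "falling_poly g"
  shows "continuous_on UNIV (cov f g)"
proof (rule continuous_at_imp_continuous_on, intro ballI)
  fix s
  have sp [simp]: "t \<in> space M" for t using M by simp
  note g2 = falling_poly_L2[OF g]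
  define A where "A = (\<integral>\<xi>. (cmod (f \<xi>))\<^sup>2 \<partial>P)"
  have A: "A \<ge> 0" by (simp add: A_def)
  show "isCont (cov f g) s"
    unfolding continuous_at_eps_delta
  proof (intro allI impI)
    fix e :: real assume e: "e > 0"
    define \<eta> where "\<eta> = e / (2 * (A + 1))"
    have \<eta>: "\<eta> > 0" "\<eta> * A \<le> e / 2" using e A by (auto simp: \<eta>_def field_simps)
    obtain d where d: "d > 0" "\<And>t. norm t < d \<Longrightarrow> (\<integral>\<^sup>+\<xi>. ennreal ((cmod (g (shift t \<xi>) - g \<xi>))\<^sup>2) \<partial>P) \<le> ennreal (e * \<eta> / 4)"
      using shift_continuous[OF M g, of "e * \<eta> / 4"] e \<eta> by auto
    have "dist (cov f g t) (cov f g s) < e" if t: "dist t s < d" for t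
    proof -
      define k where "k \<xi> = g (shift (t - s) \<xi>) - g \<xi>" for \<xi>
      have k: "k \<in> L2 P" unfolding k_def by (intro L2_diff L2_shift g2 sp)
      have ks: "k (shift s \<xi>) = g (shift t \<xi>) - g (shift s \<xi>)" for \<xi> by (simp add: k_def shift_shift)
      have "ennreal (\<integral>\<xi>. (cmod (k \<xi>))\<^sup>2 \<partial>P) \<le> ennreal (e * \<eta> / 4)"
        using d(2)[of "t - s"] t k unfolding k_def[symmetric]
        by (subst nn_integral_eq_integral[symmetric]) (auto simp: L2_def dist_norm)
      then have q: "(\<integral>\<xi>. (cmod (k \<xi>))\<^sup>2 \<partial>P) \<le> e * \<eta> / 4" using e \<eta> by (simp add: ennreal_le_iff)
      have "cov f g t - cov f g s = (\<integral>\<xi>. f \<xi> * cnj (k (shift s \<xi>)) \<partial>P)"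
        unfolding cov_def ks using cov_integrand[OF f g2, of t] cov_integrand[OF f g2, of s]
        by (simp add: right_diff_distrib)
      then have "cmod (cov f g t - cov f g s) \<le> \<eta> * A + (\<integral>\<xi>. (cmod (k \<xi>))\<^sup>2 \<partial>P) / \<eta>"
        using L2_mult(2)[OF f L2_cnj[OF L2_shift[OF k, of s]] \<eta>(1)] L2_norm_shift[OF k, of s] by (simp add: A_def)
      also have "\<dots> \<le> e / 2 + (e * \<eta> / 4) / \<eta>" using \<eta> q by (intro add_mono divide_right_mono) auto
      also have "\<dots> < e" using \<eta> e by simp
      finally show ?thesis by (simp add: dist_norm)
    qed
    with d(1) show "\<exists>d>0. \<forall>t. dist t s < d \<longrightarrow> dist (cov f g t) (cov f g s) < e" by blast
  qed
qed

lemma cov_measurable: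
  assumes f: "f \<in> L2 P" and g: "falling_poly g"
  shows "cov f g \<in> borel_measurable M"
proof (rule M_cases')
  assume M: "M = lborel"
  have "cov f g \<in> borel_measurable borel"
    by (intro borel_measurable_continuous_onI cov_continuous[OF M f g])
  moreover have "sets M = sets borel" using M by simp
  ultimately show ?thesis by (simp cong: measurable_cong_sets)
next
  assume M: "M = count_space int_lattice"
  then have "sets M = Pow int_lattice" "space M = int_lattice" by simp_all
  then show ?thesis by (intro measurableI) auto
qed

text \<open>Once the supports are disjoint, the covariance is at most a constant times
  \<open>W S (translate t S')\<close>, which is integrable in \<open>t\<close>. The other
  \<open>t\<close> form a bounded set, on which a uniform bound suffices.\<close>

lemma cov_integrable_monomial:
  assumes F: "falling_monomial S L F" and G: "falling_monomial S' L' G"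
  shows "integrable M (cov (\<lambda>\<xi>. of_nat (F \<xi>)) (\<lambda>\<xi>. of_nat (G \<xi>)))"
proof (rule integrableI_bounded)
  let ?c = "cov (\<lambda>\<xi>. of_nat (F \<xi>)) (\<lambda>\<xi>. of_nat (G \<xi>))"
  note Fp = falling_poly.monomial[OF F] and Gp = falling_poly.monomial[OF G]
  show m [measurable]: "?c \<in> borel_measurable M" by (rule cov_measurable[OF falling_poly_L2[OF Fp] Gp])
  have S: "S \<in> bounded_sets M" "S' \<in> bounded_sets M"
    using falling_monomial_support(1)[OF F] falling_monomial_support(1)[OF G] by auto
  obtain R where R: "\<And>t. R \<le> norm (t - 0) \<Longrightarrow> translate 0 S \<inter> translate t S' = {}"
    using translate_disjoint[OF S] by blast
  obtain B where B: "\<And>t. t \<in> space M \<Longrightarrow> cmod (?c t) \<le> B"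
    using cov_bound[OF falling_poly_L2[OF Fp] falling_poly_L2[OF Gp]] by blast
  \<comment> \<open>Outside \<open>V\<close> the support \<open>S\<close> is disjoint from the
    translate of \<open>S'\<close>; inside, no decoupling is available.\<close>
  define V where "V = ball 0 R \<inter> space M"
  have Vs [measurable]: "V \<in> sets M" unfolding V_def by (rule sets_M_borel) simp
  have V: "emeasure M V < \<infinity>"
    using Vs by (intro emeasure_bounded_sets) (auto simp: bounded_sets_def V_def intro: bounded_subset[OF bounded_ball])
  let ?n = "length L + length L'"
  define C where "C = fact ?n * of_nat (length L * length L') * (1 + (mu S + mu S')) ^ ?n"
  have "C < \<top>" unfolding C_def using mu_finite[OF S(1)] mu_finite[OF S(2)]
    by (simp add: ennreal_mult_less_top of_nat_less_top power_less_top_ennreal flip: ennreal_fact)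
  \<comment> \<open>\<open>c\<close> is taken strictly above a possibly vanishing \<open>C\<close>,
    so that it can be divided out.\<close>
  then obtain c where c: "C \<le> ennreal c" "c > 0"
    by (cases C) (auto intro!: that[of "enn2real C + 1"] ennreal_leI simp: add_nonneg_pos)
  have far: "ennreal (cmod (?c t)) \<le> ennreal c * W S (translate t S')" if t: "t \<in> space M" "t \<notin> V" for t
  proof -
    have disj: "S \<inter> translate t S' = {}" using R[of t] t by (auto simp: V_def)
    note Gt = falling_monomial_shift[OF G t(1)]
    have "?c t = of_real (expect (\<lambda>\<xi>. F \<xi> * G (shift t \<xi>)) - expect F * expect G)"
    proof -
      have r: "(\<integral>\<xi>. of_nat (H \<xi>) \<partial>P) = complex_of_real (expect H)" for H :: "'d config \<Rightarrow> nat"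
        unfolding expect_def integral_complex_of_real[symmetric] by simp
      show ?thesis unfolding cov_def using r[of F] r[of G] r[of "\<lambda>\<xi>. F \<xi> * G (shift t \<xi>)"] by simp
    qed
    then have "ennreal (cmod (?c t)) = ennreal \<bar>expect (\<lambda>\<xi>. F \<xi> * G (shift t \<xi>)) - expect F * expect (\<lambda>\<xi>. G (shift t \<xi>))\<bar>"
      using expect_shift[OF G t(1)] by (simp only: norm_of_real)
    also have "\<dots> \<le> fact ?n * of_nat (length L * length L') * (1 + mu (S \<union> translate t S')) ^ ?n * W S (translate t S')"
      using covariance_bound[OF F Gt disj] by simp
    also have "\<dots> \<le> C * W S (translate t S')"
    proof -
      have "mu (S \<union> translate t S') \<le> mu S + mu S'"
        using mu_Un_le[of S "translate t S'"] S bounded_sets_translate[OF S(2) t(1)] mu_translate[OF S(2) t(1)]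
        by (simp add: bounded_sets_def)
      then show ?thesis unfolding C_def by (intro mult_mono power_mono add_mono) auto
    qed
    also have "\<dots> \<le> ennreal c * W S (translate t S')" by (intro mult_right_mono c) auto
    finally show ?thesis .
  qed
  have "(\<integral>\<^sup>+t. ennreal (cmod (?c t)) \<partial>M) \<le>
    (\<integral>\<^sup>+t. ennreal B * indicator V t + ennreal (cmod (?c t)) * indicator (space M - V) t \<partial>M)"
    using B by (intro nn_integral_mono) (auto simp: V_def ennreal_leI split: split_indicator)
  also have "\<dots> = ennreal B * emeasure M V + (\<integral>\<^sup>+t. ennreal (cmod (?c t)) * indicator (space M - V) t \<partial>M)"
    by (subst nn_integral_add) (auto simp: nn_integral_cmult_indicator)
  also have "\<dots> < \<infinity>"
  proof -
    have "(\<integral>\<^sup>+t. ennreal (cmod (?c t)) * indicator (space M - V) t \<partial>M) =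
      (\<integral>\<^sup>+t. ennreal c * (ennreal (cmod (?c t) / c) * indicator (space M - V) t) \<partial>M)"
      using c(2) by (intro nn_integral_cong) (simp add: mult.assoc[symmetric] ennreal_mult[symmetric])
    also have "\<dots> = ennreal c * (\<integral>\<^sup>+t. ennreal (cmod (?c t) / c) * indicator (space M - V) t \<partial>M)"
      by (rule nn_integral_cmult) measurable
    also have "\<dots> \<le> ennreal c * (\<integral>\<^sup>+t. W S (translate t S') \<partial>M)"
    proof (intro mult_left_mono nn_integral_mono)
      fix t assume t: "t \<in> space M"
      show "ennreal (cmod (?c t) / c) * indicator (space M - V) t \<le> W S (translate t S')"
      proof (cases "t \<in> V")
        case False
        have "ennreal c * ennreal (cmod (?c t) / c) \<le> ennreal c * W S (translate t S')"
          using far[OF t False] c(2) by (simp add: ennreal_mult[symmetric])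
        then have "ennreal (cmod (?c t) / c) \<le> W S (translate t S')"
          using c(2) by (simp add: ennreal_mult_le_mult_iff)
        then show ?thesis using t False by simp
      qed simp
    qed simp
    also have "\<dots> < \<infinity>" using nn_integral_W_translate[OF S] by (simp add: ennreal_mult_less_top)
    finally show ?thesis using V by (simp add: ennreal_mult_less_top)
  qed
  finally show "(\<integral>\<^sup>+t. ennreal (norm (?c t)) \<partial>M) < \<infinity>" .
qed

lemma cov_integrable:
  assumes f: "falling_poly f" and g: "falling_poly g"
  shows "integrable M (cov f g)"
  using f
proof (induction rule: falling_poly.induct)
  case (monomial S L F)
  note F = falling_poly_L2[OF falling_poly.monomial[OF monomial]]
  show ?case using g
  proof (induction rule: falling_poly.induct)
    case (monomial S' L' G)
    then show ?case using cov_integrable_monomial \<open>falling_monomial S L F\<close> by blast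
  next
    case (add g g')
    have "integrable M (\<lambda>t. cov (\<lambda>\<xi>. of_nat (F \<xi>)) g t + cov (\<lambda>\<xi>. of_nat (F \<xi>)) g' t)"
      using add.IH by (rule Bochner_Integration.integrable_add)
    then show ?case
      using cov_add(2)[OF falling_poly_L2[OF add.hyps(1)] falling_poly_L2[OF add.hyps(2)] F]
      by (subst Bochner_Integration.integrable_cong[OF refl]) auto
  next
    case (scale g c)
    then show ?case by (simp add: cov_scale)
  qed
next
  case (add f f')
  have "integrable M (\<lambda>t. cov f g t + cov f' g t)"
    using add.IH by (rule Bochner_Integration.integrable_add)
  then show ?case
    using cov_add(1)[OF falling_poly_L2[OF add.hyps(1)] falling_poly_L2[OF add.hyps(2)] falling_poly_L2[OF g]]
    by (subst Bochner_Integration.integrable_cong[OF refl]) auto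
next
  case (scale f c)
  then show ?case by (simp add: cov_scale)
qed

subsection \<open>Spectral densities\<close>

lemma transform_integrand:
  assumes f: "falling_poly f" and g: "falling_poly g"
  shows "integrable M (\<lambda>t. cov f g t * character (- t) l)"
proof -
  have cm: "(\<lambda>t. character (- t) l) \<in> borel_measurable M"
    unfolding character_def using id_measurable by measurable
  show ?thesis
    by (rule Bochner_Integration.integrable_bound[OF cov_integrable[OF f g]])
      (auto simp: norm_mult intro!: borel_measurable_times cm borel_measurable_integrable[OF cov_integrable[OF f g]])
qed

text \<open>The double sum over times is the squared \<open>L2\<close> norm of the combination of
  the shifted observables with coefficients \<open>character (t i) l\<close>, so the integrand is
  positive definite and its integral non-negative.\<close>

lemma cov_positive:
  assumes f: "falling_poly f" and f0: "(\<integral>\<xi>. f \<xi> \<partial>P) = 0"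
  shows "(\<integral>t. cov f f t * character (- t) l \<partial>M) \<in> \<real>\<^sub>\<ge>\<^sub>0"
proof -
  note f2 = falling_poly_L2[OF f]
  \<comment> \<open>Set to \<open>0\<close> outside the space because the averaging lemma asks for a
    bound at all arguments, while \<open>cov\<close> is bounded only at admissible times.\<close>
  define D where "D t = (if t \<in> space M then cov f f t * character (- t) l else 0)" for t
  obtain B where B: "\<And>t. t \<in> space M \<Longrightarrow> cmod (cov f f t) \<le> B" using cov_bound[OF f2 f2] by blast
  have Dc: "D t = cov f f t * character (- t) l" if "t \<in> space M" for t using that by (simp add: D_def)
  have "(\<integral>t. D t \<partial>M) \<in> \<real>\<^sub>\<ge>\<^sub>0"
  proof (rule positive_definite_integral)
    show "integrable M D" using transform_integrand[OF f f] Dc by (subst Bochner_Integration.integrable_cong[OF refl]) auto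
    show "cmod (D t) \<le> max B 0" for t using B[of t] by (auto simp: D_def norm_mult)
    fix N :: nat and t :: "nat \<Rightarrow> real ^ 'd" assume t: "\<And>i. i < N \<Longrightarrow> t i \<in> space M"
    define \<phi> where "\<phi> i \<xi> = character (t i) l * f (shift (t i) \<xi>)" for i \<xi>
    have \<phi>: "\<phi> i \<in> L2 P" if "i < N" for i unfolding \<phi>_def by (intro L2_scale L2_shift f2 t that)
    have int: "integrable P (\<lambda>\<xi>. \<phi> i \<xi> * cnj (\<phi> j \<xi>))" if "i < N" "j < N" for i j
      by (intro L2_mult(1) L2_cnj \<phi> that)
    have D: "D (t j - t i) = (\<integral>\<xi>. \<phi> i \<xi> * cnj (\<phi> j \<xi>) \<partial>P)" if ij: "i < N" "j < N" for i j
    proof -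
      have s: "t j - t i \<in> space M" by (rule space_diff[OF t[OF ij(2)] t[OF ij(1)]])
      have "(\<integral>\<xi>. f \<xi> * cnj (f (shift (t j - t i) \<xi>)) \<partial>P) =
        (\<integral>\<xi>. f (shift (t i) \<xi>) * cnj (f (shift (t j - t i) (shift (t i) \<xi>))) \<partial>P)"
        by (rule integral_shift_P[symmetric, OF t[OF ij(1)]])
          (rule borel_measurable_integrable[OF cov_integrand[OF f2 f2 s]])
      then have c: "cov f f (t j - t i) = (\<integral>\<xi>. f (shift (t i) \<xi>) * cnj (f (shift (t j) \<xi>)) \<partial>P)"
        by (simp add: cov_def f0 shift_shift)
      have ch: "character (- (t j - t i)) l = character (t i) l * cnj (character (t j) l)"
        by (simp add: cnj_character flip: character_add)
      have "(\<integral>\<xi>. \<phi> i \<xi> * cnj (\<phi> j \<xi>) \<partial>P) =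
        (\<integral>\<xi>. (character (t i) l * cnj (character (t j) l)) * (f (shift (t i) \<xi>) * cnj (f (shift (t j) \<xi>))) \<partial>P)"
        by (intro Bochner_Integration.integral_cong refl) (simp add: \<phi>_def)
      also have "\<dots> = D (t j - t i)"
        unfolding integral_mult_right_zero Dc[OF s] c ch by simp
      finally show ?thesis by simp
    qed
    have "(\<Sum>i<N. \<Sum>j<N. D (t j - t i)) = (\<Sum>i<N. \<Sum>j<N. \<integral>\<xi>. \<phi> i \<xi> * cnj (\<phi> j \<xi>) \<partial>P)"
      by (intro sum.cong refl D) auto
    also have "\<dots> = (\<integral>\<xi>. (\<Sum>i<N. \<Sum>j<N. \<phi> i \<xi> * cnj (\<phi> j \<xi>)) \<partial>P)"
    proof -
      have "(\<Sum>j<N. \<integral>\<xi>. \<phi> i \<xi> * cnj (\<phi> j \<xi>) \<partial>P) = (\<integral>\<xi>. (\<Sum>j<N. \<phi> i \<xi> * cnj (\<phi> j \<xi>)) \<partial>P)" if "i < N" for i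
        by (rule Bochner_Integration.integral_sum[symmetric]) (use int that in auto)
      moreover have "(\<integral>\<xi>. (\<Sum>i<N. \<Sum>j<N. \<phi> i \<xi> * cnj (\<phi> j \<xi>)) \<partial>P) = (\<Sum>i<N. \<integral>\<xi>. (\<Sum>j<N. \<phi> i \<xi> * cnj (\<phi> j \<xi>)) \<partial>P)"
        by (intro Bochner_Integration.integral_sum Bochner_Integration.integrable_sum) (use int in auto)
      ultimately show ?thesis by simp
    qed
    also have "\<dots> = (\<integral>\<xi>. complex_of_real ((cmod (\<Sum>i<N. \<phi> i \<xi>))\<^sup>2) \<partial>P)"
      by (simp only: complex_norm_square cnj_sum sum_product)
    also have "\<dots> = complex_of_real (\<integral>\<xi>. (cmod (\<Sum>i<N. \<phi> i \<xi>))\<^sup>2 \<partial>P)"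
      by (rule integral_complex_of_real)
    finally show "(\<Sum>i<N. \<Sum>j<N. D (t j - t i)) \<in> \<real>\<^sub>\<ge>\<^sub>0" by (simp only: nonneg_Reals_of_real_iff) simp
  qed
  also have "(\<integral>t. D t \<partial>M) = (\<integral>t. cov f f t * character (- t) l \<partial>M)"
    by (rule Bochner_Integration.integral_cong[OF refl Dc])
  finally show ?thesis .
qed

text \<open>The normalising constant of Fourier inversion is divided out here. For
  \<open>f = g\<close> of mean zero the integral is already real; mixed pairs serve polarisation
  with real coefficients, for which the real part is enough.\<close>

definition transform :: "('d config \<Rightarrow> complex) \<Rightarrow> ('d config \<Rightarrow> complex) \<Rightarrow> real ^ 'd \<Rightarrow> real" where
  "transform f g l = Re (\<integral>t. cov f g t * character (- t) l \<partial>M) / (2 * pi) ^ CARD('d)"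

lemma transform_add:
  assumes f: "falling_poly f" "falling_poly f'" and g: "falling_poly g"
  shows "transform (\<lambda>\<xi>. f \<xi> + f' \<xi>) g l = transform f g l + transform f' g l"
    "transform g (\<lambda>\<xi>. f \<xi> + f' \<xi>) l = transform g f l + transform g f' l"
proof -
  note L2 = falling_poly_L2[OF f(1)] falling_poly_L2[OF f(2)] falling_poly_L2[OF g]
  have "(\<integral>t. cov (\<lambda>\<xi>. f \<xi> + f' \<xi>) g t * character (- t) l \<partial>M) =
      (\<integral>t. cov f g t * character (- t) l + cov f' g t * character (- t) l \<partial>M)"
    "(\<integral>t. cov g (\<lambda>\<xi>. f \<xi> + f' \<xi>) t * character (- t) l \<partial>M) =
      (\<integral>t. cov g f t * character (- t) l + cov g f' t * character (- t) l \<partial>M)"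
    by (auto intro!: Bochner_Integration.integral_cong simp: cov_add[OF L2] distrib_right)
  then show "transform (\<lambda>\<xi>. f \<xi> + f' \<xi>) g l = transform f g l + transform f' g l"
    "transform g (\<lambda>\<xi>. f \<xi> + f' \<xi>) l = transform g f l + transform g f' l"
    unfolding transform_def using transform_integrand f g by (simp_all add: add_divide_distrib)
qed

lemma transform_scale:
  "transform (\<lambda>\<xi>. complex_of_real c * f \<xi>) g l = c * transform f g l"
  "transform g (\<lambda>\<xi>. complex_of_real c * f \<xi>) l = c * transform g f l"
  by (simp_all add: transform_def cov_scale mult.assoc)

lemma transform_lincomb:
  assumes f: "falling_poly f" and g: "falling_poly g"
  shows "transform (\<lambda>\<xi>. complex_of_real a * f \<xi> + complex_of_real b * g \<xi>) (\<lambda>\<xi>. complex_of_real a * f \<xi> + complex_of_real b * g \<xi>) l =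
    a\<^sup>2 * transform f f l + a * b * (transform f g l + transform g f l) + b\<^sup>2 * transform g g l"
proof -
  note p = falling_poly.scale[OF f, of "complex_of_real a"] falling_poly.scale[OF g, of "complex_of_real b"]
  show ?thesis
    unfolding transform_add(1)[OF p falling_poly.add[OF p]] transform_add(2)[OF p p(1)] transform_add(2)[OF p p(2)] transform_scale
    by (simp add: power2_eq_square algebra_simps)
qed

text \<open>At each frequency the transform is a non-negative quadratic form under real
  combinations, and the difference of two of its values is a polarised value at \<open>f - g\<close>
  and \<open>f + g\<close>. The pointwise bound, once integrated, gives the continuity from
  \<open>L2\<close> to \<open>L1\<close>.\<close>

lemma transform_diff_le:
  assumes f: "falling_poly f" "(\<integral>\<xi>. f \<xi> \<partial>P) = 0" and g: "falling_poly g" "(\<integral>\<xi>. g \<xi> \<partial>P) = 0" and \<eta>: "\<eta> > 0"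
  shows "\<bar>transform f f l - transform g g l\<bar> \<le>
    transform (\<lambda>\<xi>. f \<xi> - g \<xi>) (\<lambda>\<xi>. f \<xi> - g \<xi>) l / \<eta> + \<eta> * transform (\<lambda>\<xi>. f \<xi> + g \<xi>) (\<lambda>\<xi>. f \<xi> + g \<xi>) l"
proof -
  note fi = P.L2_integrable[OF falling_poly_L2[OF f(1)]] and gi = P.L2_integrable[OF falling_poly_L2[OF g(1)]]
  let ?X = "transform f g l + transform g f l"
  have pos: "0 \<le> a\<^sup>2 * transform f f l + a * b * ?X + b\<^sup>2 * transform g g l" for a b
  proof -
    have "(\<integral>\<xi>. complex_of_real a * f \<xi> + complex_of_real b * g \<xi> \<partial>P) = 0" using f(2) g(2) fi gi by simp
    from cov_positive[OF falling_poly.add[OF falling_poly.scale[OF f(1)] falling_poly.scale[OF g(1)]] this, of l]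
    have "0 \<le> transform (\<lambda>\<xi>. complex_of_real a * f \<xi> + complex_of_real b * g \<xi>) (\<lambda>\<xi>. complex_of_real a * f \<xi> + complex_of_real b * g \<xi>) l"
      unfolding transform_def complex_nonneg_Reals_iff by simp
    then show ?thesis by (simp only: transform_lincomb[OF f(1) g(1)])
  qed
  have d: "transform (\<lambda>\<xi>. f \<xi> - g \<xi>) (\<lambda>\<xi>. f \<xi> - g \<xi>) l = transform f f l - ?X + transform g g l"
    using transform_lincomb[OF f(1) g(1), of 1 "- 1" l] by simp
  have s: "transform (\<lambda>\<xi>. f \<xi> + g \<xi>) (\<lambda>\<xi>. f \<xi> + g \<xi>) l = transform f f l + ?X + transform g g l"
    using transform_lincomb[OF f(1) g(1), of 1 1 l] by simp
  have nn: "0 \<le> transform f f l - ?X + transform g g l" "0 \<le> transform f f l + ?X + transform g g l"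
    using pos[of 1 "- 1"] pos[of 1 1] by simp_all
  define A B where "A = transform f f l - ?X + transform g g l" and "B = transform f f l + ?X + transform g g l"
  have AB: "0 \<le> A + \<eta>\<^sup>2 * B" using nn \<eta> unfolding A_def[symmetric] B_def[symmetric] by simp
  \<comment> \<open>The two coefficient pairs are those of \<open>(f - g) + \<eta> (f + g)\<close>
    and \<open>(f - g) - \<eta> (f + g)\<close>; the sign that is needed depends on which of the two
    values is larger.\<close>
  have "2 * \<eta> * \<bar>transform f f l - transform g g l\<bar> \<le> A + \<eta>\<^sup>2 * B"
    unfolding A_def B_def using pos[of "1 + \<eta>" "\<eta> - 1"] pos[of "1 - \<eta>" "- \<eta> - 1"]
    by (simp add: abs_if power2_eq_square algebra_simps)
  then have "\<eta> * \<bar>transform f f l - transform g g l\<bar> \<le> A + \<eta>\<^sup>2 * B" using AB by linarith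
  also have "\<dots> = \<eta> * (A / \<eta> + \<eta> * B)" using \<eta> by (simp add: distrib_left power2_eq_square)
  finally have "\<bar>transform f f l - transform g g l\<bar> \<le> A / \<eta> + \<eta> * B" using \<eta> by (simp only: mult_le_cancel_left_pos)
  then show ?thesis unfolding d s A_def B_def .
qed

text \<open>The total mass is the inversion formula at \<open>t = 0\<close>; it converts
  \<open>L1\<close> norms of densities into \<open>L2\<close> norms of observables.\<close>

lemma spectral_density_poly:
  fixes \<Lambda> :: "(real ^ 'd) set"
  assumes M\<Lambda>: "spectral_domain \<Lambda>"
    and f: "falling_poly f" "(\<integral>\<xi>. f \<xi> \<partial>P) = 0"
  shows "0 \<le> transform f f l" "set_integrable lborel \<Lambda> (transform f f)"
    "t \<in> space M \<Longrightarrow> (LINT l:\<Lambda>|lborel. character t l * complex_of_real (transform f f l)) = cov f f t"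
    "(LINT l:\<Lambda>|lborel. transform f f l) = (\<integral>\<xi>. (cmod (f \<xi>))\<^sup>2 \<partial>P)"
proof -
  note f2 = falling_poly_L2[OF f(1)]
  define C where "C t = (if t \<in> space M then cov f f t else 0)" for t
  have CC: "C t = cov f f t" if "t \<in> space M" for t using that by (simp add: C_def)
  obtain B where B: "\<And>t. t \<in> space M \<Longrightarrow> cmod (cov f f t) \<le> B" using cov_bound[OF f2 f2] by blast
  have CT: "(\<integral>t. C t * character (- t) l \<partial>M) = (\<integral>t. cov f f t * character (- t) l \<partial>M)" for l
    by (intro Bochner_Integration.integral_cong refl) (simp add: CC)
  have Ci: "integrable M C"
    using cov_integrable[OF f(1) f(1)] CC by (subst Bochner_Integration.integrable_cong[OF refl]) auto
  have Cb: "cmod (C t) \<le> max B 0" for t using B[of t] by (auto simp: C_def)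
  have Cc: "continuous_on UNIV C" if M: "M = lborel"
  proof -
    have "C = cov f f" using M by (auto simp: C_def)
    then show ?thesis using cov_continuous[OF M f2 f(1)] by simp
  qed
  have pos: "(\<integral>t. C t * character (- t) l \<partial>M) \<in> \<real>\<^sub>\<ge>\<^sub>0" for l
    unfolding CT by (rule cov_positive[OF f])
  have inv: "set_integrable lborel \<Lambda> (\<lambda>l. Re (\<integral>t. cov f f t * character (- t) l \<partial>M))"
    using fourier_inversion(1)[OF M\<Lambda> Ci Cb Cc pos] unfolding CT by simp
  show "0 \<le> transform f f l"
    using cov_positive[OF f, of l] unfolding transform_def complex_nonneg_Reals_iff by simp
  show T: "set_integrable lborel \<Lambda> (transform f f)"
    unfolding transform_def by (rule set_integrable_divide) (use inv in simp)
  show eq: "(LINT l:\<Lambda>|lborel. character t l * complex_of_real (transform f f l)) = cov f f t" if t: "t \<in> space M" for t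
  proof -
    define c where "c = (2 * pi) ^ CARD('d)"
    have c: "c > 0" by (simp add: c_def)
    have "(LINT l:\<Lambda>|lborel. character t l * complex_of_real (transform f f l)) =
      (LINT l:\<Lambda>|lborel. complex_of_real (1 / c) * (character t l * complex_of_real (Re (\<integral>t. cov f f t * character (- t) l \<partial>M))))"
      unfolding transform_def c_def[symmetric] using c
      unfolding set_lebesgue_integral_def by (intro Bochner_Integration.integral_cong) auto
    also have "\<dots> = complex_of_real (1 / c) * (c *\<^sub>R C t)"
    proof -
      have "(LINT l:\<Lambda>|lborel. character t l * complex_of_real (Re (\<integral>t. cov f f t * character (- t) l \<partial>M))) = c *\<^sub>R C t"
        using fourier_inversion(2)[OF M\<Lambda> Ci Cb Cc pos t] unfolding c_def CT .
      then show ?thesis by (simp only: set_integral_mult_right)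
    qed
    also have "\<dots> = cov f f t" using c CC[OF t] by (simp add: scaleR_conv_of_real)
    finally show ?thesis .
  qed
  have "complex_of_real (LINT l:\<Lambda>|lborel. transform f f l) = cov f f 0"
    unfolding eq[OF space_closed(1), symmetric] set_integral_complex_of_real[symmetric] by simp
  also have "\<dots> = (\<integral>\<xi>. complex_of_real ((cmod (f \<xi>))\<^sup>2) \<partial>P)"
    using f(2) by (simp add: cov_def complex_norm_square del: of_real_power)
  also have "\<dots> = complex_of_real (\<integral>\<xi>. (cmod (f \<xi>))\<^sup>2 \<partial>P)" by (rule integral_complex_of_real)
  finally show "(LINT l:\<Lambda>|lborel. transform f f l) = (\<integral>\<xi>. (cmod (f \<xi>))\<^sup>2 \<partial>P)" by (simp only: of_real_eq_iff)
qed

abbreviation (input) L2_normsq :: "('d config \<Rightarrow> complex) \<Rightarrow> real" where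
  "L2_normsq f \<equiv> \<integral>\<xi>. (cmod (f \<xi>))\<^sup>2 \<partial>P"

lemma L2_normsq_diff:
  assumes f: "f \<in> L2 P" and g: "g \<in> L2 P"
  shows "L2_normsq (\<lambda>\<xi>. f \<xi> - g \<xi>) \<le> 2 * L2_normsq f + 2 * L2_normsq g"
  using L2_add(2)[OF f L2_scale[OF g, of "- 1"]] by simp

lemma L2_normsq_centered:
  assumes f: "f \<in> L2 P"
  shows "L2_normsq (\<lambda>\<xi>. f \<xi> - (\<integral>\<xi>. f \<xi> \<partial>P)) \<le> L2_normsq f"
proof -
  define m where "m = (\<integral>\<xi>. f \<xi> \<partial>P)"
  have i: "integrable P f" "integrable P (\<lambda>\<xi>. (cmod (f \<xi>))\<^sup>2)" using P.L2_integrable[OF f] f by (auto simp: L2_def)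
  have eq: "(cmod (z - m))\<^sup>2 = (cmod z)\<^sup>2 - 2 * Re (z * cnj m) + (cmod m)\<^sup>2" for z
    unfolding cmod_power2 by (simp add: power2_eq_square algebra_simps)
  have "(\<integral>\<xi>. Re (f \<xi> * cnj m) \<partial>P) = Re (m * cnj m)" using i by (simp add: m_def)
  also have "\<dots> = (cmod m)\<^sup>2" by (simp flip: complex_norm_square)
  finally have "L2_normsq (\<lambda>\<xi>. f \<xi> - m) = L2_normsq f - (cmod m)\<^sup>2"
    unfolding eq using i by (simp add: P.prob_space)
  then show ?thesis unfolding m_def[symmetric] by simp
qed

text \<open>Subtracting the mean does not increase the \<open>L2\<close> norm, so approximants can
  be centred; only centred ones are known to have a non-negative transform.\<close>

lemma centered_falling_poly_dense:
  assumes f: "f \<in> L2 P" "(\<integral>\<xi>. f \<xi> \<partial>P) = 0" and \<epsilon>: "\<epsilon> > 0"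
  shows "\<exists>g. falling_poly g \<and> (\<integral>\<xi>. g \<xi> \<partial>P) = 0 \<and> L2_normsq (\<lambda>\<xi>. f \<xi> - g \<xi>) < \<epsilon>"
proof -
  have "f \<in> borel_measurable P" "(\<integral>\<^sup>+\<xi>. ennreal ((cmod (f \<xi>))\<^sup>2) \<partial>P) < \<infinity>"
    using f(1) by (auto simp: L2_def integrable_iff_bounded)
  from falling_poly_dense[OF zero_less_numeral this \<epsilon>]
  obtain g where g: "falling_poly g" "(\<integral>\<^sup>+\<xi>. ennreal ((cmod (f \<xi> - g \<xi>))\<^sup>2) \<partial>P) < ennreal \<epsilon>" by blast
  note g2 = falling_poly_L2[OF g(1)] and gi = P.L2_integrable[OF falling_poly_L2[OF g(1)]]
  have d: "(\<lambda>\<xi>. f \<xi> - g \<xi>) \<in> L2 P" by (rule L2_diff[OF f(1) g2])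
  have fi: "integrable P f" by (rule P.L2_integrable[OF f(1)])
  let ?g = "\<lambda>\<xi>. g \<xi> - (\<integral>\<xi>. g \<xi> \<partial>P)"
  have "L2_normsq (\<lambda>\<xi>. f \<xi> - ?g \<xi>) \<le> L2_normsq (\<lambda>\<xi>. f \<xi> - g \<xi>)"
    using L2_normsq_centered[OF d] f(2) fi gi by (simp add: algebra_simps)
  also have "\<dots> < \<epsilon>"
    using g(2) d \<epsilon> by (subst (asm) nn_integral_eq_integral) (auto simp: L2_def ennreal_less_iff)
  finally have "L2_normsq (\<lambda>\<xi>. f \<xi> - ?g \<xi>) < \<epsilon>" .
  moreover have "falling_poly ?g" by (intro falling_poly_diff g falling_poly_const)
  moreover have "(\<integral>\<xi>. ?g \<xi> \<partial>P) = 0" using gi by (simp add: P.prob_space)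
  ultimately show ?thesis by blast
qed

lemma cov_le:
  assumes f: "f \<in> L2 P" and g: "g \<in> L2 P" and z: "(\<integral>\<xi>. f \<xi> \<partial>P) = 0" and t: "t \<in> space M" and \<eta>: "\<eta> > 0"
  shows "cmod (cov f g t) \<le> \<eta> * L2_normsq f + L2_normsq g / \<eta>"
  using L2_mult(2)[OF f L2_cnj[OF L2_shift[OF g t]] \<eta>] L2_norm_shift[OF g t] z by (simp add: cov_def)

lemma quarter_power: "(1 / 4 :: real) ^ n = (1 / 2) ^ n * (1 / 2) ^ n"
  by (simp flip: power_mult_distrib)

text \<open>The geometric rate makes the \<open>L1\<close> distances of successive densities
  summable. Hence they converge almost everywhere, and the first density plus all increments in
  absolute value is a common integrable bound.\<close>

lemma spectral_density_tendsto:
  fixes \<Lambda> :: "(real ^ 'd) set"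
  assumes M\<Lambda>: "spectral_domain \<Lambda>"
    and f: "f \<in> L2 P" "(\<integral>\<xi>. f \<xi> \<partial>P) = 0"
    and g: "\<And>n. falling_poly (g n)" "\<And>n. (\<integral>\<xi>. g n \<xi> \<partial>P) = 0"
    and fg: "\<And>n. L2_normsq (\<lambda>\<xi>. f \<xi> - g n \<xi>) \<le> (1 / 4) ^ n"
  obtains w h :: "real ^ 'd \<Rightarrow> real" where "integrable lborel w"
    "AE l in lborel. (\<lambda>n. indicator \<Lambda> l * transform (g n) (g n) l) \<longlonglongrightarrow> h l"
    "\<And>n. AE l in lborel. \<bar>indicator \<Lambda> l * transform (g n) (g n) l\<bar> \<le> w l"
proof -
  note g2 = falling_poly_L2[OF g(1)]
  have gi: "integrable P (g n)" for n by (rule P.L2_integrable[OF g2])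
  have d: "(\<lambda>\<xi>. f \<xi> - g n \<xi>) \<in> L2 P" for n by (rule L2_diff[OF f(1) g2])
  define B where "B = 2 * L2_normsq f + 2"
  have Ng: "L2_normsq (g n) \<le> B" for n
  proof -
    have "L2_normsq (g n) = L2_normsq (\<lambda>\<xi>. f \<xi> - (f \<xi> - g n \<xi>))" by simp
    also have "\<dots> \<le> 2 * L2_normsq f + 2 * L2_normsq (\<lambda>\<xi>. f \<xi> - g n \<xi>)" by (rule L2_normsq_diff[OF f(1) d])
    finally show ?thesis using fg[of n] power_le_one[of "1 / 4 :: real" n] by (simp add: B_def)
  qed
  have sum: "L2_normsq (\<lambda>\<xi>. g (Suc n) \<xi> + g n \<xi>) \<le> 4 * B" for n
    using L2_add(2)[OF g2[of "Suc n"] g2[of n]] Ng[of n] Ng[of "Suc n"] by simp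
  have diff: "L2_normsq (\<lambda>\<xi>. g (Suc n) \<xi> - g n \<xi>) \<le> 4 * (1 / 4) ^ n" for n
  proof -
    have "L2_normsq (\<lambda>\<xi>. g (Suc n) \<xi> - g n \<xi>) = L2_normsq (\<lambda>\<xi>. (f \<xi> - g n \<xi>) - (f \<xi> - g (Suc n) \<xi>))" by simp
    also have "\<dots> \<le> 2 * L2_normsq (\<lambda>\<xi>. f \<xi> - g n \<xi>) + 2 * L2_normsq (\<lambda>\<xi>. f \<xi> - g (Suc n) \<xi>)"
      by (rule L2_normsq_diff[OF d d])
    also have "\<dots> \<le> 2 * (1 / 4) ^ n + 2 * (1 / 4) ^ Suc n"
      using fg[of n] fg[of "Suc n"] by linarith
    also have "\<dots> \<le> 4 * (1 / 4) ^ n" by simp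
    finally show ?thesis .
  qed
  define h where "h n l = indicator \<Lambda> l * transform (g n) (g n) l" for n l
  have hi [measurable]: "integrable lborel (h n)" for n
    using spectral_density_poly(2)[OF M\<Lambda> g, of n] by (simp add: h_def[abs_def] set_integrable_def)
  define v where "v n l = h (Suc n) l - h n l" for n l
  have vi: "integrable lborel (v n)" for n unfolding v_def by (intro Bochner_Integration.integrable_diff hi)
  have v: "(\<integral>l. \<bar>v n l\<bar> \<partial>lborel) \<le> (4 + 4 * B) * (1 / 2) ^ n" for n
  proof -
    \<comment> \<open>The geometric mean between the rate \<open>(1 / 4) ^ n\<close> of the
      differences and the bounded norms of the sums; both terms become of order
      \<open>(1 / 2) ^ n\<close>.\<close>
    define \<eta> :: real where "\<eta> = (1 / 2) ^ n"
    have \<eta>: "\<eta> > 0" by (simp add: \<eta>_def)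
    let ?d = "\<lambda>\<xi>. g (Suc n) \<xi> - g n \<xi>" and ?s = "\<lambda>\<xi>. g (Suc n) \<xi> + g n \<xi>"
    have p: "falling_poly ?d" "falling_poly ?s" using g(1) by (auto intro: falling_poly_diff falling_poly.add)
    have z: "(\<integral>\<xi>. ?d \<xi> \<partial>P) = 0" "(\<integral>\<xi>. ?s \<xi> \<partial>P) = 0" using gi g(2) by auto
    note D = spectral_density_poly[OF M\<Lambda> p(1) z(1)] and S = spectral_density_poly[OF M\<Lambda> p(2) z(2)]
    have "(\<integral>l. \<bar>v n l\<bar> \<partial>lborel) \<le> (\<integral>l. (indicator \<Lambda> l *\<^sub>R transform ?d ?d l) / \<eta> + \<eta> * (indicator \<Lambda> l *\<^sub>R transform ?s ?s l) \<partial>lborel)"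
    proof (rule integral_mono)
      show "integrable lborel (\<lambda>l. (indicator \<Lambda> l *\<^sub>R transform ?d ?d l) / \<eta> + \<eta> * (indicator \<Lambda> l *\<^sub>R transform ?s ?s l))"
        using D(2) S(2) unfolding set_integrable_def
        by (intro Bochner_Integration.integrable_add integrable_mult_right integrable_divide_zero) auto
      show "\<bar>v n l\<bar> \<le> (indicator \<Lambda> l *\<^sub>R transform ?d ?d l) / \<eta> + \<eta> * (indicator \<Lambda> l *\<^sub>R transform ?s ?s l)" for l
        using transform_diff_le[OF g(1) g(2) g(1) g(2) \<eta>, of "Suc n" l n]
        by (auto simp: v_def h_def split: split_indicator)
    qed (use vi in simp)
    also have "\<dots> = L2_normsq ?d / \<eta> + \<eta> * L2_normsq ?s"
      using D(2) S(2) unfolding D(4)[symmetric] S(4)[symmetric] set_integrable_def set_lebesgue_integral_def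
      by (subst Bochner_Integration.integral_add) auto
    also have "\<dots> \<le> (4 * (1 / 4) ^ n) / \<eta> + \<eta> * (4 * B)"
      using \<eta> diff[of n] sum[of n] by (intro add_mono divide_right_mono mult_left_mono) auto
    also have "(4 * (1 / 4) ^ n) / \<eta> = 4 * (1 / 2) ^ n"
      unfolding \<eta>_def quarter_power by simp
    finally show ?thesis by (simp add: \<eta>_def algebra_simps)
  qed
  have vs: "summable (\<lambda>n. \<integral>l. \<bar>v n l\<bar> \<partial>lborel)"
    by (rule summable_comparison_test'[where N=0 and g="\<lambda>n. (4 + 4 * B) * (1 / 2) ^ n"]) (use v in \<open>auto intro!: summable_mult summable_geometric\<close>)
  have AE: "AE l in lborel. summable (\<lambda>n. \<bar>v n l\<bar>)"
  proof -
    have [measurable]: "v n \<in> borel_measurable lborel" for n using vi by auto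
    have "(\<integral>\<^sup>+l. (\<Sum>n. ennreal \<bar>v n l\<bar>) \<partial>lborel) = (\<Sum>n. ennreal (\<integral>l. \<bar>v n l\<bar> \<partial>lborel))"
      using vi by (subst nn_integral_suminf) (auto simp: nn_integral_eq_integral)
    also have "\<dots> \<noteq> \<infinity>" using vs by (subst suminf_ennreal2) auto
    finally have "AE l in lborel. (\<Sum>n. ennreal \<bar>v n l\<bar>) \<noteq> \<infinity>" by (intro nn_integral_PInf_AE) auto
    then show ?thesis by eventually_elim (auto intro: summable_suminf_not_top)
  qed
  have tele: "h n l = h 0 l + (\<Sum>i<n. v i l)" for n l
    by (induction n) (simp_all add: v_def)
  have lim: "AE l in lborel. (\<lambda>n. h n l) \<longlonglongrightarrow> h 0 l + (\<Sum>n. v n l)"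
    using AE
  proof eventually_elim
    case (elim l)
    have "(\<lambda>n. h 0 l + (\<Sum>i<n. v i l)) \<longlonglongrightarrow> h 0 l + (\<Sum>n. v n l)"
      by (rule tendsto_add[OF tendsto_const summable_LIMSEQ[OF summable_rabs_cancel[OF elim]]])
    moreover have "(\<lambda>n. h n l) = (\<lambda>n. h 0 l + (\<Sum>i<n. v i l))" by (rule ext) (rule tele)
    ultimately show ?case by (simp only:)
  qed
  have dom: "AE l in lborel. \<bar>h n l\<bar> \<le> \<bar>h 0 l\<bar> + (\<Sum>n. \<bar>v n l\<bar>)" for n
    using AE
  proof eventually_elim
    case (elim l)
    have "\<bar>h n l\<bar> \<le> \<bar>h 0 l\<bar> + (\<Sum>i<n. \<bar>v i l\<bar>)"
      unfolding tele[of n] using sum_abs[of "\<lambda>i. v i l" "{..<n}"] by linarith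
    also have "(\<Sum>i<n. \<bar>v i l\<bar>) \<le> (\<Sum>n. \<bar>v n l\<bar>)" by (rule sum_le_suminf[OF elim]) auto
    finally show ?case by simp
  qed
  show thesis
  proof (rule that)
    show "integrable lborel (\<lambda>l. \<bar>h 0 l\<bar> + (\<Sum>n. \<bar>v n l\<bar>))"
      using AE vs by (intro Bochner_Integration.integrable_add integrable_suminf integrable_abs hi vi) auto
    show "AE l in lborel. (\<lambda>n. indicator \<Lambda> l * transform (g n) (g n) l) \<longlonglongrightarrow> h 0 l + (\<Sum>n. v n l)"
      using lim by (simp only: h_def[symmetric])
    show "AE l in lborel. \<bar>indicator \<Lambda> l * transform (g n) (g n) l\<bar> \<le> \<bar>h 0 l\<bar> + (\<Sum>n. \<bar>v n l\<bar>)" for n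
      using dom[of n] by (simp only: h_def[symmetric])
  qed
qed

text \<open>Densities of centred polynomial approximants converge under an integrable bound while
  their autocovariances converge at each \<open>t\<close>, so the spectral identity passes to the
  limit.\<close>

theorem spectrum:
  fixes \<Lambda> :: "(real ^ 'd) set"
  assumes M\<Lambda>: "spectral_domain \<Lambda>"
  shows "absolutely_continuous_spectrum M \<Lambda> P"
  unfolding absolutely_continuous_spectrum_def
proof (intro ballI impI)
  fix f assume f: "f \<in> L2 P" "(\<integral>\<xi>. f \<xi> \<partial>P) = 0"
  have "\<exists>g. \<forall>n::nat. falling_poly (g n) \<and> (\<integral>\<xi>. g n \<xi> \<partial>P) = 0 \<and> L2_normsq (\<lambda>\<xi>. f \<xi> - g n \<xi>) < (1 / 4) ^ n"
    using centered_falling_poly_dense[OF f] by (intro choice allI) simp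
  then obtain g where g: "\<And>n::nat. falling_poly (g n)" "\<And>n. (\<integral>\<xi>. g n \<xi> \<partial>P) = 0"
    "\<And>n. L2_normsq (\<lambda>\<xi>. f \<xi> - g n \<xi>) \<le> (1 / 4) ^ n" by (auto intro: less_imp_le)
  note g2 = falling_poly_L2[OF g(1)]
  obtain w h where wh: "integrable lborel w"
    "AE l in lborel. (\<lambda>n. indicator \<Lambda> l * transform (g n) (g n) l) \<longlonglongrightarrow> h l"
    "\<And>n. AE l in lborel. \<bar>indicator \<Lambda> l * transform (g n) (g n) l\<bar> \<le> w l"
    using spectral_density_tendsto[OF M\<Lambda> f g] by blast
  define s where "s n l = indicator \<Lambda> l * transform (g n) (g n) l" for n l
  have si: "integrable lborel (s n)" for n
    using spectral_density_poly(2)[OF M\<Lambda> g(1,2), of n] by (simp add: s_def[abs_def] set_integrable_def)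
  have s0: "s n l \<ge> 0" for n l
    using spectral_density_poly(1)[OF M\<Lambda> g(1,2), of n l] by (simp add: s_def)
  note wh = wh[folded s_def]
  \<comment> \<open>Written with \<open>lim\<close> and \<open>max\<close> to be measurable and
    non-negative everywhere; where the limit fails to exist, a null set, the value is immaterial.
    Outside \<open>\<Lambda>\<close> all terms vanish, hence so does \<open>H\<close>.\<close>
  define H where "H l = max 0 (lim (\<lambda>n. s n l))" for l
  have Hlim: "AE l in lborel. (\<lambda>n. s n l) \<longlonglongrightarrow> H l"
    using wh(2)
  proof eventually_elim
    case (elim l)
    have "0 \<le> h l" by (rule LIMSEQ_le_const[OF elim]) (use s0 in auto)
    then show ?case using elim by (simp add: H_def limI)
  qed
  have H0: "0 \<le> H l" for l by (simp add: H_def)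
  have Hout: "indicator \<Lambda> l * H l = H l" for l
    by (cases "l \<in> \<Lambda>") (simp_all add: H_def s_def)
  have [measurable]: "s n \<in> borel_measurable lborel" for n using si by auto
  have Hm [measurable]: "H \<in> borel_measurable lborel" unfolding H_def by (intro borel_measurable_max borel_measurable_lim_metric) auto
  have Hi: "integrable lborel H"
    by (rule integrable_dominated_convergence[OF Hm _ wh(1) Hlim]) (use wh(3) in auto)
  have "(\<integral>\<xi>. f \<xi> * cnj (f (shift t \<xi>)) \<partial>P) = (LINT l:\<Lambda>|lborel. exp (\<i> * complex_of_real (inner t l)) * complex_of_real (H l))"
    if t: "t \<in> space M" for t
  proof -
    have cm [measurable]: "(\<lambda>l. character t l) \<in> borel_measurable lborel"
      unfolding character_def using borel_measurable_continuous_onI[of "\<lambda>l. exp (\<i> * complex_of_real (inner t l))"]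
      by (auto intro!: continuous_intros)
    have "(\<lambda>n. \<integral>l. character t l * complex_of_real (s n l) \<partial>lborel) \<longlonglongrightarrow> (\<integral>l. character t l * complex_of_real (H l) \<partial>lborel)"
    proof (rule integral_dominated_convergence[OF _ _ wh(1)])
      show "AE l in lborel. (\<lambda>n. character t l * complex_of_real (s n l)) \<longlonglongrightarrow> character t l * complex_of_real (H l)"
        using Hlim by eventually_elim (intro tendsto_intros)
      show "AE l in lborel. norm (character t l * complex_of_real (s n l)) \<le> w l" for n
        using wh(3)[of n] by eventually_elim (simp add: norm_mult)
    qed measurable
    moreover have "(\<integral>l. character t l * complex_of_real (s n l) \<partial>lborel) = cov (g n) (g n) t" for n
      unfolding spectral_density_poly(3)[OF M\<Lambda> g(1,2) t, symmetric] set_lebesgue_integral_def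
      by (intro Bochner_Integration.integral_cong refl) (simp add: s_def scaleR_conv_of_real)
    moreover have "(\<lambda>n. cov (g n) (g n) t) \<longlonglongrightarrow> cov f f t"
    proof -
      \<comment> \<open>A numerical constant that hides the kernel here: with
        \<open>\<eta> = (1 / 2) ^ n\<close> the bound is \<open>\<eta>\<close> times the squared
        norm of \<open>f\<close>, plus \<open>2 * \<eta>\<close>, plus \<open>\<eta>\<close> times
        twice that squared norm plus two.\<close>
      define K where "K = 3 * L2_normsq f + 4"
      have bnd: "cmod (cov (g n) (g n) t - cov f f t) \<le> K * (1 / 2) ^ n" for n
      proof -
        define u where "u \<xi> = - 1 * (f \<xi> - g n \<xi>)" for \<xi>
        define \<eta> :: real where "\<eta> = (1 / 2) ^ n"
        have \<eta>: "\<eta> > 0" "\<eta> \<le> 1" "(1 / 4) ^ n / \<eta> = \<eta>"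
          unfolding \<eta>_def quarter_power by (auto simp: power_le_one)
        have u: "u \<in> L2 P" unfolding u_def by (intro L2_scale L2_diff f g2)
        have Nu: "L2_normsq u \<le> (1 / 4) ^ n" using g(3)[of n] by (simp add: u_def norm_minus_commute)
        have uz: "(\<integral>\<xi>. u \<xi> \<partial>P) = 0"
          using f(2) g(2)[of n] P.L2_integrable[OF f(1)] P.L2_integrable[OF g2[of n]] by (simp add: u_def)
        have gx: "f \<xi> + u \<xi> = g n \<xi>" for \<xi> by (simp add: u_def)
        have gf: "g n = (\<lambda>\<xi>. f \<xi> + u \<xi>)" by (auto simp: u_def)
        have N: "L2_normsq (g n) \<le> 2 * L2_normsq f + 2"
          using L2_add(2)[OF f(1) u] Nu power_le_one[of "1 / 4 :: real" n] unfolding gx by simp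
        have "cov (g n) (g n) t - cov f f t = cov f u t + cov u (g n) t"
          using cov_add(1)[OF f(1) u g2[of n] t] cov_add(2)[OF f(1) u f(1) t] by (simp add: gf[symmetric])
        also have "cmod \<dots> \<le> (\<eta> * L2_normsq f + L2_normsq u / \<eta>) + (1 / \<eta> * L2_normsq u + L2_normsq (g n) / (1 / \<eta>))"
          using cov_le[OF f(1) u f(2) t \<eta>(1)] cov_le[OF u g2[of n] uz t, of "1 / \<eta>"] \<eta>(1)
          by (intro order_trans[OF norm_triangle_ineq] add_mono) auto
        also have "\<dots> = \<eta> * L2_normsq f + 2 * (L2_normsq u / \<eta>) + \<eta> * L2_normsq (g n)" by simp
        also have "\<dots> \<le> \<eta> * L2_normsq f + 2 * ((1 / 4) ^ n / \<eta>) + \<eta> * (2 * L2_normsq f + 2)"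
          using Nu N \<eta> by (intro add_mono mult_left_mono divide_right_mono) auto
        also have "\<dots> = K * (1 / 2) ^ n" unfolding \<eta>(3) by (simp add: K_def \<eta>_def algebra_simps)
        finally show ?thesis .
      qed
      have lim0: "(\<lambda>n. K * (1 / 2) ^ n) \<longlonglongrightarrow> 0" by (intro tendsto_mult_right_zero LIMSEQ_realpow_zero) auto
      have "(\<lambda>n. cov (g n) (g n) t - cov f f t) \<longlonglongrightarrow> 0"
        by (rule Lim_null_comparison[OF always_eventually[OF allI[OF bnd]] lim0])
      then show ?thesis by (rule LIM_zero_cancel)
    qed
    ultimately have "(\<integral>l. character t l * complex_of_real (H l) \<partial>lborel) = cov f f t"
      by (simp only:) (rule LIMSEQ_unique)
    moreover have "indicator \<Lambda> l *\<^sub>R (character t l * complex_of_real (H l)) = character t l * complex_of_real (H l)" for l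
      by (subst Hout[of l, symmetric], subst (2) Hout[of l, symmetric]) (auto split: split_indicator)
    ultimately show ?thesis
      using f(2) by (simp add: cov_def set_lebesgue_integral_def flip: character_def)
  qed
  moreover have "set_integrable lborel \<Lambda> H" using Hi by (simp add: set_integrable_def Hout)
  ultimately show "\<exists>h :: real ^ 'd \<Rightarrow> real. (\<forall>l\<in>\<Lambda>. 0 \<le> h l) \<and> set_integrable lborel \<Lambda> h \<and>
      (\<forall>t \<in> space M. (\<integral>\<xi>. f \<xi> * cnj (f (shift t \<xi>)) \<partial>P) =
        (LINT l:\<Lambda>|lborel. exp (\<i> * complex_of_real (inner t l)) * complex_of_real (h l)))"
    using H0 by blast
qed

end

theorem theorem7:
  fixes M :: "(real ^ 'd) measure" and \<Lambda> :: "(real ^ 'd) set"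
    and P :: "(real ^ 'd \<Rightarrow> nat) measure" and K :: "real ^ 'd \<Rightarrow> real ^ 'd \<Rightarrow> complex"
  assumes one_particle_space:
      "(M = lborel \<and> \<Lambda> = UNIV) \<or>
       (M = count_space int_lattice \<and> \<Lambda> = {l. \<forall>i. 0 \<le> vec_nth l i \<and> vec_nth l i \<le> 2 * pi})"
    and determinantal: "determinantal_field M P K"
    and invariant: "translation_invariant M P"
  shows "ergodic_field M P \<and>
         (\<forall>r\<ge>1. mixing_of_multiplicity M P r) \<and>
         absolutely_continuous_spectrum M \<Lambda> P"
proof -
  interpret invariant_determinantal_field M P K
    by unfold_locales (use assms in auto)
  show ?thesis using ergodic mixing spectrum[OF one_particle_space] by blast
qed

end
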